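(* Let $k=\mathbb C$ and fix integers $d,L\ge 1$. There exists $r=r(d,L)$ such that for every finite-dimensional complex vector space $V$, every homogeneous complete intersection $X\subset V$ of degree $d$, codimension $L$ and rank $>r$ is admissible (that is, every weakly linear function $f:X\to \mathbb C$ is the restriction to $X$ of a linear function on $V$).
   Context: Here $k=\mathbb C$. Rank: for a non-zero polynomial $P$ on $V$ of degree $\ge 2$, the rank $r(P)$ is the minimal $r$ such that $P=\sum_{i=1}^r l_iR_i$ with $l_i,R_i$ polynomials over $k$ of positive degrees and $\deg l_i+\deg R_i\le \deg P$. The rank of a finite family $\{P_i\}$ is the minimal rank of a nontrivial linear combination (coefficients in $k$, not all zero) of the $P_i$; it is considered only when all these combinations are non-zero of degree $\ge 2$. Homogeneous complete intersection of codimension $L$: an irreducible algebraic subvariety $X$ of $V$ of codimension $L$, whose ideal is generated by $L$ homogeneous polynomials $P_1,\dots,P_L$. Its rank is the rank of the family $\{P_1,\dots,P_L\}$. Its degree is the degree of the associated projective variety $\bar X\subset\mathbb P(V)$, i.e. the number of points of the intersection of $\bar X$ with a generic linear subspace of $\mathbb P(V)$ of complementary dimension. Weakly linear: an (arbitrary) function $f:X\to \mathbb C$ is weakly linear if its restriction to any two-dimensional linear subspace $W$ of $V$ contained in $X$ is linear. Admissible: $X$ is admissible if any weakly linear function $f:X\to \mathbb C$ is linear, i.e. is the restriction of a linear function on $V$. *)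

theory Defs
  imports
    Complex_Main
    "HOL-Library.Poly_Mapping"
    "HOL-Library.Function_Algebras"
    "HOL-Library.Extended_Nat"
begin

text \<open>
  The dimension has to be quantified inside the theorem, so an n-dimensional complex vector space
  is represented by the sequences that vanish from index n on.
\<close>

definition cscale :: "complex \<Rightarrow> (nat \<Rightarrow> complex) \<Rightarrow> nat \<Rightarrow> complex" where
  "cscale c x = (\<lambda>i. c * x i)"

global_interpretation cvec: vector_space cscale
  by unfold_locales (auto simp: cscale_def fun_eq_iff algebra_simps)

definition coord_space :: "nat \<Rightarrow> (nat \<Rightarrow> complex) set" where
  "coord_space n = {x. \<forall>i\<ge>n. x i = 0}"

definition linear_on :: "(nat \<Rightarrow> complex) set \<Rightarrow> ((nat \<Rightarrow> complex) \<Rightarrow> complex) \<Rightarrow> bool" where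
  "linear_on W f \<longleftrightarrow>
     (\<forall>x\<in>W. \<forall>y\<in>W. f (x + y) = f x + f y) \<and> (\<forall>c. \<forall>x\<in>W. f (cscale c x) = c * f x)"

text \<open>
  A monomial is a finitely supported exponent function; the ring structure on finitely supported
  maps from monomials to coefficients is the convolution product of the library.
\<close>

type_synonym 'v cpoly = "('v \<Rightarrow>\<^sub>0 nat) \<Rightarrow>\<^sub>0 complex"

definition cpolys :: "'v set \<Rightarrow> 'v cpoly set" where
  "cpolys A = {p. \<forall>m\<in>Poly_Mapping.keys p. Poly_Mapping.keys m \<subseteq> A}"

definition const :: "complex \<Rightarrow> 'v cpoly" where
  "const c = Poly_Mapping.single 0 c"

definition peval :: "('v \<Rightarrow> complex) \<Rightarrow> 'v cpoly \<Rightarrow> complex" where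
  "peval x p = (\<Sum>m\<in>Poly_Mapping.keys p.
     Poly_Mapping.lookup p m * (\<Prod>i\<in>Poly_Mapping.keys m. x i ^ Poly_Mapping.lookup m i))"

definition mon_deg :: "('v \<Rightarrow>\<^sub>0 nat) \<Rightarrow> nat" where
  "mon_deg m = (\<Sum>i\<in>Poly_Mapping.keys m. Poly_Mapping.lookup m i)"

text \<open>The zero polynomial gets degree 0.\<close>

definition total_deg :: "'v cpoly \<Rightarrow> nat" where
  "total_deg p = Max (insert 0 (mon_deg ` Poly_Mapping.keys p))"

definition homogeneous :: "'v cpoly \<Rightarrow> bool" where
  "homogeneous p \<longleftrightarrow> (\<exists>e. \<forall>m\<in>Poly_Mapping.keys p. mon_deg m = e)"

text \<open>
  Every polynomial of degree at least 2 has such a decomposition, so the infimum in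
  \<open>enat\<close> is then a finite minimum.
\<close>

definition poly_rank :: "nat \<Rightarrow> nat cpoly \<Rightarrow> enat" where
  "poly_rank n p = Inf {enat r | r. \<exists>l R.
     (\<forall>i<r. l i \<in> cpolys {..<n} \<and> R i \<in> cpolys {..<n} \<and>
        total_deg (l i) > 0 \<and> total_deg (R i) > 0 \<and>
        total_deg (l i) + total_deg (R i) \<le> total_deg p) \<and>
     p = (\<Sum>i<r. l i * R i)}"

definition nontrivial_combinations :: "nat \<Rightarrow> (nat \<Rightarrow> nat cpoly) \<Rightarrow> nat cpoly set" where
  "nontrivial_combinations L P = {\<Sum>i<L. const (c i) * P i | c. \<exists>i<L. c i \<noteq> 0}"

definition family_has_rank :: "nat \<Rightarrow> (nat \<Rightarrow> nat cpoly) \<Rightarrow> bool" where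
  "family_has_rank L P \<longleftrightarrow> (\<forall>Q\<in>nontrivial_combinations L P. Q \<noteq> 0 \<and> total_deg Q \<ge> 2)"

text \<open>Meaningful only under \<^const>\<open>family_has_rank\<close>.\<close>

definition family_rank :: "nat \<Rightarrow> nat \<Rightarrow> (nat \<Rightarrow> nat cpoly) \<Rightarrow> enat" where
  "family_rank n L P = Inf (poly_rank n ` nontrivial_combinations L P)"

definition zariski_closed :: "nat \<Rightarrow> (nat \<Rightarrow> complex) set \<Rightarrow> bool" where
  "zariski_closed n X \<longleftrightarrow>
     (\<exists>S\<subseteq>cpolys {..<n}. X = {x\<in>coord_space n. \<forall>p\<in>S. peval x p = 0})"

definition irreducible_closed :: "nat \<Rightarrow> (nat \<Rightarrow> complex) set \<Rightarrow> bool" where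
  "irreducible_closed n X \<longleftrightarrow> zariski_closed n X \<and> X \<noteq> {} \<and>
     (\<forall>A B. zariski_closed n A \<and> zariski_closed n B \<and> X = A \<union> B \<longrightarrow> X = A \<or> X = B)"

definition zariski_dim :: "nat \<Rightarrow> (nat \<Rightarrow> complex) set \<Rightarrow> enat" where
  "zariski_dim n X = Sup {enat k | k. \<exists>Z.
     (\<forall>i\<le>k. irreducible_closed n (Z i) \<and> Z i \<subseteq> X) \<and> (\<forall>i<k. Z i \<subset> Z (Suc i))}"

definition vanishing_ideal :: "nat \<Rightarrow> (nat \<Rightarrow> complex) set \<Rightarrow> nat cpoly set" where
  "vanishing_ideal n X = {p\<in>cpolys {..<n}. \<forall>x\<in>X. peval x p = 0}"

definition generated_ideal :: "nat \<Rightarrow> nat \<Rightarrow> (nat \<Rightarrow> nat cpoly) \<Rightarrow> nat cpoly set" where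
  "generated_ideal n L P = {\<Sum>i<L. Q i * P i | Q. \<forall>i<L. Q i \<in> cpolys {..<n}}"

text \<open>
  The generators are kept as an argument because the rank is that of the family of generators.
\<close>

definition homogeneous_complete_intersection ::
    "nat \<Rightarrow> nat \<Rightarrow> (nat \<Rightarrow> nat cpoly) \<Rightarrow> (nat \<Rightarrow> complex) set \<Rightarrow> bool" where
  "homogeneous_complete_intersection n L P X \<longleftrightarrow>
     irreducible_closed n X \<and>
     zariski_dim n X + enat L = enat n \<and>
     (\<forall>i<L. P i \<in> cpolys {..<n} \<and> homogeneous (P i)) \<and>
     vanishing_ideal n X = generated_ideal n L P"

text \<open>
  A generic m-dimensional subspace is the span of an m-tuple of vectors outside a proper
  hypersurface in the space of all m-tuples; the variable (j, i) of G stands for the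
  i-th coordinate of the j-th vector. A nonempty open set of such tuples maps onto a nonempty
  open set of the Grassmannian, and open sets of the Grassmannian pull back to open sets.
  If m exceeds n, nothing holds generically.
\<close>

definition generic_subspace :: "nat \<Rightarrow> nat \<Rightarrow> ((nat \<Rightarrow> complex) set \<Rightarrow> bool) \<Rightarrow> bool" where
  "generic_subspace n m Q \<longleftrightarrow>
     (\<exists>G\<in>cpolys ({..<m} \<times> {..<n}). G \<noteq> 0 \<and>
        (\<forall>v. (\<forall>j<m. v j \<in> coord_space n) \<and> peval (\<lambda>(j, i). v j i) G \<noteq> 0 \<longrightarrow>
           cvec.dim (cvec.span (v ` {..<m})) = m \<and> Q (cvec.span (v ` {..<m}))))"

text \<open>
  The points of the projectivization of a cone are the lines through 0 it contains.
\<close>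

definition projective_points :: "(nat \<Rightarrow> complex) set \<Rightarrow> (nat \<Rightarrow> complex) set set" where
  "projective_points Y = {l. cvec.subspace l \<and> cvec.dim l = 1 \<and> l \<subseteq> Y}"

text \<open>
  For a cone X of codimension L, a projective subspace of complementary dimension has dimension L,
  so it comes from a linear subspace of dimension L + 1.
\<close>

definition projective_degree :: "nat \<Rightarrow> nat \<Rightarrow> (nat \<Rightarrow> complex) set \<Rightarrow> nat \<Rightarrow> bool" where
  "projective_degree n L X d \<longleftrightarrow>
     generic_subspace n (L + 1)
       (\<lambda>W. finite (projective_points (X \<inter> W)) \<and> card (projective_points (X \<inter> W)) = d)"

text \<open>
  Functions on X are total functions of which only the values on X matter.
\<close>

definition weakly_linear :: "(nat \<Rightarrow> complex) set \<Rightarrow> ((nat \<Rightarrow> complex) \<Rightarrow> complex) \<Rightarrow> bool" where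
  "weakly_linear X f \<longleftrightarrow>
     (\<forall>W. cvec.subspace W \<and> cvec.dim W = 2 \<and> W \<subseteq> X \<longrightarrow> linear_on W f)"

definition admissible :: "nat \<Rightarrow> (nat \<Rightarrow> complex) set \<Rightarrow> bool" where
  "admissible n X \<longleftrightarrow>
     (\<forall>f. weakly_linear X f \<longrightarrow>
        (\<exists>g. linear_on (coord_space n) g \<and> (\<forall>x\<in>X. f x = g x)))"

end

theory Submission
  imports Defs "Jordan_Normal_Form.Char_Poly" "HOL-Analysis.Continuum_Not_Denumerable"
    "HOL-Computational_Algebra.Fundamental_Theorem_Algebra" "HOL-Computational_Algebra.Field_as_Ring"
    "HOL-Computational_Algebra.Polynomial_Factorial"
begin

text \<open>
  Let X be the set of common zeros of the forms \<open>P j\<close>. A family of forms of high rank restricts, along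
  a suitable linear map, to forms without common zeros in few variables: otherwise a resultant (here a Macaulay
  determinant) would vanish along all such maps, and the first nonvanishing term of its Taylor expansion would exhibit
  a combination of low rank. Hence such a family takes arbitrary values, and even values prescribed by polynomials of
  lower degree. In particular every vector is a sum of three points of X; and if points \<open>x i\<close> of X have
  sum 0, then there are \<open>y i\<close> and \<open>z i\<close>, chosen after replacing the auxiliary forms by a
  family of high rank, such that all the linear relations between values of f that yield
  \<open>\<Sum> f (x i) = 0\<close> take place inside linear subspaces of X. So f extends to a linear function.

  The rank needed depends on the degrees of the \<open>P j\<close>, which are at most the degree d of X: project X
  finitely onto a space of dimension n - L. Each remaining coordinate satisfies on X a monic relation whose degree is at
  most the number of points of a generic fibre. If some \<open>P j\<close> had degree greater than d, these relations
  would be consequences of the other equations in the directions of the fibres, where the latter have a nontrivial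
  common zero.
\<close>

section \<open>Polynomial functions\<close>

text \<open>The bound may depend on \<open>d\<close> and \<open>L\<close> only, never on
  \<open>n\<close>, and this shapes the constructions. Systems of equations are solved after
  restriction to as many variables as there are equations, so the rank they cost is a count of words
  that does not see \<open>n\<close>. The auxiliary forms are the Taylor coefficients of the
  \<open>P j\<close> at the points \<open>x i\<close>: the plane through \<open>x i\<close> and
  \<open>y i\<close> lies in X once \<open>y i\<close> is in X and kills the coefficients of
  intermediate order. Nothing is known about the rank of these forms; hence the regularisation,
  whose bound has to depend on their degrees alone. With S for the sum over i, and S x = 0, the
  additivity relations obtained inside subspaces of X are f(S y) = S f(x) + S f(y), f(S z) = S f(z),
  S f(y + z) = S f(y) + S f(z) = f(S y + S z) and f(S y + S z) = f(S y) + f(S z); together they give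
  S f(x) = 0. The rank hypothesis does not limit the degrees of the equations, so these are bounded
  separately, by counting the values of a single coordinate on a generic fibre.\<close>

type_synonym cvec = "nat \<Rightarrow> complex"

text \<open>Polynomials are treated as functions rather than coefficient maps, so that substitution is composition.\<close>

inductive hom_form :: "nat \<Rightarrow> nat \<Rightarrow> (cvec \<Rightarrow> complex) \<Rightarrow> bool" for n where
  hom_form_const: "hom_form n 0 (\<lambda>x. c)"
| hom_form_zero: "hom_form n e (\<lambda>x. 0)"
| hom_form_add: "hom_form n e F \<Longrightarrow> hom_form n e G \<Longrightarrow> hom_form n e (\<lambda>x. F x + G x)"
| hom_form_var: "i < n \<Longrightarrow> hom_form n e F \<Longrightarrow> hom_form n (Suc e) (\<lambda>x. x i * F x)"

lemma hom_form_mult: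
  assumes "hom_form n a F" "hom_form n b G"
  shows "hom_form n (a + b) (\<lambda>x. F x * G x)"
  using assms
proof (induction rule: hom_form.induct)
  case (hom_form_const c)
  from hom_form_const show ?case
  proof (induction rule: hom_form.induct)
    case (hom_form_add e F G)
    then show ?case using hom_form.hom_form_add[of n "0+e" "\<lambda>x. c * F x" "\<lambda>x. c * G x"] by (simp add: algebra_simps)
  next
    case (hom_form_var i e F)
    then show ?case using hom_form.hom_form_var[of i n "0+e" "\<lambda>x. c * F x"] by (simp add: algebra_simps)
  qed (auto intro: hom_form.intros)
next
  case (hom_form_add e F H)
  then show ?case using hom_form.hom_form_add[of n "e+b" "\<lambda>x. F x * G x" "\<lambda>x. H x * G x"] by (simp add: algebra_simps)
next
  case (hom_form_var i e F)
  then show ?case using hom_form.hom_form_var[of i n "e+b" "\<lambda>x. F x * G x"] by (simp add: algebra_simps)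
qed (auto intro: hom_form.intros)

lemma hom_form_cmult: "hom_form n e F \<Longrightarrow> hom_form n e (\<lambda>x. c * F x)"
  using hom_form_mult[OF hom_form_const, of n e F c] by simp

lemma hom_form_cmult2: "hom_form n e F \<Longrightarrow> hom_form n e (\<lambda>x. F x * c)"
  using hom_form_cmult[of n e F c] by (simp add: mult.commute)

lemma hom_form_uminus: "hom_form n e F \<Longrightarrow> hom_form n e (\<lambda>x. - F x)"
  using hom_form_cmult[of n e F "-1"] by simp

lemma hom_form_diff: "hom_form n e F \<Longrightarrow> hom_form n e G \<Longrightarrow> hom_form n e (\<lambda>x. F x - G x)"
  using hom_form_add[of n e F "\<lambda>x. - G x"] hom_form_uminus[of n e G] by simp

lemma hom_form_sum: "(\<And>i. i \<in> I \<Longrightarrow> hom_form n e (F i)) \<Longrightarrow> hom_form n e (\<lambda>x. \<Sum>i\<in>I. F i x)"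
  by (induction I rule: infinite_finite_induct) (auto intro: hom_form_zero hom_form_add)

lemma hom_form_coord: "i < n \<Longrightarrow> hom_form n 1 (\<lambda>x. x i)"
  using hom_form_var[OF _ hom_form_const, of i n 1] by simp

lemma hom_form_power: "hom_form n e F \<Longrightarrow> hom_form n (k * e) (\<lambda>x. F x ^ k)"
proof (induction k)
  case 0 show ?case using hom_form_const[of n 1] by simp
next
  case (Suc k) then show ?case using hom_form_mult[of n e F "k*e"] by simp
qed

lemma hom_form_prod: "(\<And>i. i \<in> I \<Longrightarrow> hom_form n (e i) (F i)) \<Longrightarrow> finite I \<Longrightarrow> hom_form n (\<Sum>i\<in>I. e i) (\<lambda>x. \<Prod>i\<in>I. F i x)"
proof (induction I rule: infinite_finite_induct)
  case empty show ?case using hom_form_const[of n 1] by simp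
next
  case (insert i I)
  then show ?case using hom_form_mult[of n "e i" "F i" "\<Sum>i\<in>I. e i" "\<lambda>x. \<Prod>i\<in>I. F i x"] by simp
qed auto

lemma hom_form_comp:
  assumes "hom_form n e F" "\<And>i. i < n \<Longrightarrow> hom_form m k (l i)"
  shows "hom_form m (e * k) (\<lambda>x. F (\<lambda>i. l i x))"
  using assms
proof (induction rule: hom_form.induct)
  case (hom_form_var i e F)
  then show ?case using hom_form_mult[of m k "l i" "e*k" "\<lambda>x. F (\<lambda>i. l i x)"] by simp
qed (auto intro: hom_form.intros)

lemma hom_form_comp1:
  assumes "hom_form n e F" "\<And>i. i < n \<Longrightarrow> hom_form m 1 (l i)"
  shows "hom_form m e (\<lambda>x. F (\<lambda>i. l i x))"
  using hom_form_comp[of n e F m 1 l] assms by simp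

lemma hom_form_cong: "hom_form n e F \<Longrightarrow> (\<And>i. i < n \<Longrightarrow> x i = y i) \<Longrightarrow> F x = F y"
  by (induction rule: hom_form.induct) auto

lemma hom_form_scale: "hom_form n e F \<Longrightarrow> F (\<lambda>i. c * x i) = c ^ e * F x"
  by (induction rule: hom_form.induct) (auto simp: algebra_simps)

lemma hom_form_zero_at: "hom_form n e F \<Longrightarrow> 0 < e \<Longrightarrow> F (\<lambda>i. 0) = 0"
  by (induction rule: hom_form.induct) auto

lemma hom_form_0_const: assumes "hom_form n e F" "e = 0" shows "\<exists>c. F = (\<lambda>x. c)"
  using assms by (induction rule: hom_form.induct) auto

text \<open>Taylor expansion at a fixed point \<open>u\<close>: each factor of a monomial
  contributes either its constant \<open>u j\<close> or its linear part \<open>t * v j\<close>. The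
  \<open>H k\<close> are 0 beyond \<open>e\<close>, so that sums may be extended to any common
  bound.\<close>

lemma hom_form_shift:
  assumes "hom_form n e F"
  shows "\<exists>H. (\<forall>k. hom_form n k (H k)) \<and> (\<forall>k>e. H k = (\<lambda>v. 0)) \<and> H e = F \<and>
    (\<forall>t v. F (\<lambda>i. u i + t * v i) = (\<Sum>k\<le>e. t ^ k * H k v))"
  using assms
proof (induction rule: hom_form.induct)
  case (hom_form_const c)
  show ?case
    by (rule exI[of _ "\<lambda>k v. if k = 0 then c else 0"]) (auto intro: hom_form.intros)
next
  case (hom_form_zero e)
  show ?case by (rule exI[of _ "\<lambda>k v. 0"]) (auto intro: hom_form.intros)
next
  case (hom_form_add e F G)
  then obtain H1 H2 where 1: "\<forall>k. hom_form n k (H1 k)" "\<forall>k>e. H1 k = (\<lambda>v. 0)" "H1 e = F"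
    "\<forall>t v. F (\<lambda>i. u i + t * v i) = (\<Sum>k\<le>e. t ^ k * H1 k v)"
    and 2: "\<forall>k. hom_form n k (H2 k)" "\<forall>k>e. H2 k = (\<lambda>v. 0)" "H2 e = G"
    "\<forall>t v. G (\<lambda>i. u i + t * v i) = (\<Sum>k\<le>e. t ^ k * H2 k v)" by blast
  show ?case
    by (rule exI[of _ "\<lambda>k v. H1 k v + H2 k v"])
      (use 1 2 in \<open>auto intro: hom_form.intros simp: sum.distrib algebra_simps\<close>)
next
  case (hom_form_var j e F)
  then obtain H where 1: "\<And>k. hom_form n k (H k)" "\<And>k. k>e \<Longrightarrow> H k = (\<lambda>v. 0)" "H e = F"
    "\<And>t v. F (\<lambda>i. u i + t * v i) = (\<Sum>k\<le>e. t ^ k * H k v)" by blast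
  define K where "K k v = u j * H k v + (case k of 0 \<Rightarrow> 0 | Suc k' \<Rightarrow> v j * H k' v)" for k v
  have "hom_form n k (K k)" for k
    unfolding K_def using 1(1) hom_form_var(1)
    by (cases k) (auto intro!: hom_form.hom_form_add hom_form_cmult hom_form.hom_form_var hom_form_zero)
  moreover have "K k = (\<lambda>v. 0)" if "k > Suc e" for k
    using that 1(2) by (cases k) (auto simp: K_def fun_eq_iff)
  moreover have "K (Suc e) = (\<lambda>x. x j * F x)" using 1(2)[of "Suc e"] 1(3) by (auto simp: K_def fun_eq_iff)
  moreover have "(u j + t * v j) * F (\<lambda>i. u i + t * v i) = (\<Sum>k\<le>Suc e. t ^ k * K k v)" for t v
  proof -
    have "(\<Sum>k\<le>Suc e. t ^ k * K k v) = (\<Sum>k\<le>Suc e. t ^ k * (u j * H k v)) +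
       (\<Sum>k\<le>Suc e. t ^ k * (case k of 0 \<Rightarrow> 0 | Suc k' \<Rightarrow> v j * H k' v))"
      by (simp only: K_def distrib_left sum.distrib)
    also have "(\<Sum>k\<le>Suc e. t ^ k * (u j * H k v)) = u j * (\<Sum>k\<le>e. t ^ k * H k v)"
      using 1(2)[of "Suc e"] by (simp add: sum_distrib_left algebra_simps)
    also have "(\<Sum>k\<le>Suc e. t ^ k * (case k of 0 \<Rightarrow> 0 | Suc k' \<Rightarrow> v j * H k' v)) =
        t * v j * (\<Sum>k\<le>e. t ^ k * H k v)"
      by (subst sum.atMost_Suc_shift) (simp add: sum_distrib_left algebra_simps)
    finally show ?thesis by (simp add: 1(4) algebra_simps)
  qed
  ultimately show ?case by (intro exI[of _ K]) auto
qed

section \<open>Polynomial functions of bounded degree\<close>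

inductive deg_le :: "nat \<Rightarrow> nat \<Rightarrow> (cvec \<Rightarrow> complex) \<Rightarrow> bool" for n where
  deg_le_const: "deg_le n t (\<lambda>x. c)"
| deg_le_add: "deg_le n t F \<Longrightarrow> deg_le n t G \<Longrightarrow> deg_le n t (\<lambda>x. F x + G x)"
| deg_le_var: "i < n \<Longrightarrow> deg_le n t F \<Longrightarrow> deg_le n (Suc t) (\<lambda>x. x i * F x)"

lemma deg_le_mono: "deg_le n t F \<Longrightarrow> t \<le> s \<Longrightarrow> deg_le n s F"
proof (induction arbitrary: s rule: deg_le.induct)
  case (deg_le_var i t F)
  then show ?case using deg_le.deg_le_var[of i n "s-1" F] by (cases s) auto
qed (auto intro: deg_le.intros)

lemma deg_le_mono_n: "deg_le n e F \<Longrightarrow> n \<le> m \<Longrightarrow> deg_le m e F"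
  by (induction rule: deg_le.induct) (auto intro: deg_le.intros)

lemma deg_le_mult:
  assumes "deg_le n a F" "deg_le n b G"
  shows "deg_le n (a + b) (\<lambda>x. F x * G x)"
  using assms
proof (induction rule: deg_le.induct)
  case (deg_le_const t c)
  have "deg_le n b (\<lambda>x. c * G x)" using deg_le_const
  proof (induction rule: deg_le.induct)
    case (deg_le_add e F G)
    then show ?case using deg_le.deg_le_add[of n "e" "\<lambda>x. c * F x" "\<lambda>x. c * G x"] by (simp add: algebra_simps)
  next
    case (deg_le_var i e F)
    then show ?case using deg_le.deg_le_var[of i n "e" "\<lambda>x. c * F x"] by (simp add: algebra_simps)
  qed (auto intro: deg_le.intros)
  then show ?case by (rule deg_le_mono) simp
next
  case (deg_le_add e F H)
  then show ?case using deg_le.deg_le_add[of n "e+b" "\<lambda>x. F x * G x" "\<lambda>x. H x * G x"] by (simp add: algebra_simps)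
next
  case (deg_le_var i e F)
  then show ?case using deg_le.deg_le_var[of i n "e+b" "\<lambda>x. F x * G x"] by (simp add: algebra_simps)
qed

lemma deg_le_cmult: "deg_le n e F \<Longrightarrow> deg_le n e (\<lambda>x. c * F x)"
  using deg_le_mult[OF deg_le_const[of n 0], of e F c] by simp

lemma deg_le_cmult2: "deg_le n e F \<Longrightarrow> deg_le n e (\<lambda>x. F x * c)"
  using deg_le_cmult[of n e F c] by (simp add: mult.commute)

lemma deg_le_uminus: "deg_le n e F \<Longrightarrow> deg_le n e (\<lambda>x. - F x)"
  using deg_le_cmult[of n e F "-1"] by simp

lemma deg_le_diff: "deg_le n e F \<Longrightarrow> deg_le n e G \<Longrightarrow> deg_le n e (\<lambda>x. F x - G x)"
  using deg_le_add[of n e F "\<lambda>x. - G x"] deg_le_uminus[of n e G] by simp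

lemma deg_le_sum: "(\<And>i. i \<in> I \<Longrightarrow> deg_le n e (F i)) \<Longrightarrow> deg_le n e (\<lambda>x. \<Sum>i\<in>I. F i x)"
  by (induction I rule: infinite_finite_induct) (auto intro: deg_le_const deg_le_add)

lemma deg_le_coord: "i < n \<Longrightarrow> deg_le n (Suc 0) (\<lambda>x. x i)"
  using deg_le_var[OF _ deg_le_const, of i n 0 1] by simp

lemma deg_le_power: "deg_le n e F \<Longrightarrow> deg_le n (k * e) (\<lambda>x. F x ^ k)"
proof (induction k)
  case 0 show ?case using deg_le_const[of n 0 1] by simp
next
  case (Suc k) then show ?case using deg_le_mult[of n e F "k*e"] by simp
qed

lemma deg_le_prod: "(\<And>i. i \<in> I \<Longrightarrow> deg_le n (e i) (F i)) \<Longrightarrow> finite I \<Longrightarrow> deg_le n (\<Sum>i\<in>I. e i) (\<lambda>x. \<Prod>i\<in>I. F i x)"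
proof (induction I rule: infinite_finite_induct)
  case empty show ?case using deg_le_const[of n 0 1] by simp
next
  case (insert i I)
  then show ?case using deg_le_mult[of n "e i" "F i" "\<Sum>i\<in>I. e i" "\<lambda>x. \<Prod>i\<in>I. F i x"] by simp
qed auto

lemma deg_le_comp:
  assumes "deg_le n e F" "\<And>i. i < n \<Longrightarrow> deg_le m k (l i)"
  shows "deg_le m (e * k) (\<lambda>x. F (\<lambda>i. l i x))"
  using assms
proof (induction rule: deg_le.induct)
  case (deg_le_var i e F)
  then show ?case using deg_le_mult[of m k "l i" "e*k" "\<lambda>x. F (\<lambda>i. l i x)"] by simp
qed (auto intro: deg_le.intros)

lemma deg_le_comp1:
  assumes "deg_le n e F" "\<And>i. i < n \<Longrightarrow> deg_le m (Suc 0) (l i)"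
  shows "deg_le m e (\<lambda>x. F (\<lambda>i. l i x))"
  using deg_le_comp[of n e F m 1 l] assms by simp

lemma deg_le_cong: "deg_le n e F \<Longrightarrow> (\<And>i. i < n \<Longrightarrow> x i = y i) \<Longrightarrow> F x = F y"
  by (induction rule: deg_le.induct) auto

lemma hom_form_imp_deg_le: "hom_form n e F \<Longrightarrow> deg_le n e F"
  by (induction rule: hom_form.induct) (auto intro: deg_le.intros)

lemma deg_le_hom_form_components:
  assumes "deg_le n t F"
  shows "\<exists>H. (\<forall>k. hom_form n k (H k)) \<and> (\<forall>k>t. H k = (\<lambda>x. 0)) \<and> F = (\<lambda>x. \<Sum>k\<le>t. H k x)"
  using assms
proof (induction rule: deg_le.induct)
  case (deg_le_const t c)
  show ?case
    by (rule exI[of _ "\<lambda>k v. if k = 0 then c else 0"]) (auto intro: hom_form.intros)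
next
  case (deg_le_add t F G)
  then obtain H1 H2 where 1: "\<forall>k. hom_form n k (H1 k)" "\<forall>k>t. H1 k = (\<lambda>x. 0)" "F = (\<lambda>x. \<Sum>k\<le>t. H1 k x)"
    and 2: "\<forall>k. hom_form n k (H2 k)" "\<forall>k>t. H2 k = (\<lambda>x. 0)" "G = (\<lambda>x. \<Sum>k\<le>t. H2 k x)" by blast
  show ?case
    by (rule exI[of _ "\<lambda>k v. H1 k v + H2 k v"])
      (use 1 2 in \<open>auto intro: hom_form.intros simp: sum.distrib\<close>)
next
  case (deg_le_var i t F)
  then obtain H where 1: "\<forall>k. hom_form n k (H k)" "\<forall>k>t. H k = (\<lambda>x. 0)" "F = (\<lambda>x. \<Sum>k\<le>t. H k x)" by blast
  define K where "K k = (case k of 0 \<Rightarrow> (\<lambda>x. 0) | Suc k' \<Rightarrow> (\<lambda>x. x i * H k' x))" for k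
  have "hom_form n k (K k)" for k
    unfolding K_def using 1(1) deg_le_var(1) by (cases k) (auto intro: hom_form.intros)
  moreover have "K k = (\<lambda>x. 0)" if "k > Suc t" for k
    using that 1(2) by (cases k) (auto simp: K_def fun_eq_iff)
  moreover have "x i * F x = (\<Sum>k\<le>Suc t. K k x)" for x
    by (subst sum.atMost_Suc_shift) (simp add: 1(3) K_def sum_distrib_left)
  ultimately show ?case by (intro exI[of _ K]) auto
qed

lemma poly_fun_zero:
  fixes c :: "nat \<Rightarrow> complex"
  assumes "infinite {t. (\<Sum>k\<le>m. c k * t ^ k) = 0}" "k \<le> m"
  shows "c k = 0"
proof -
  have "\<not> (\<exists>k\<le>m. c k \<noteq> 0)"
    using polyfun_finite_roots[of c m] assms(1) by simp
  thus ?thesis using assms(2) by auto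
qed

lemma poly_fun_zero_all:
  fixes c :: "nat \<Rightarrow> complex"
  assumes "\<And>t. (\<Sum>k\<le>m. t ^ k * c k) = 0" "k \<le> m"
  shows "c k = 0"
  by (rule poly_fun_zero[of c m k]) (use assms infinite_UNIV_char_0 in \<open>auto simp: mult.commute\<close>)

lemma deg_le_line:
  assumes "deg_le n t F"
  shows "\<exists>p::complex poly. \<forall>s. F (\<lambda>i. u i + s * v i) = poly p s"
  using assms
proof (induction rule: deg_le.induct)
  case (deg_le_const t c)
  show ?case by (rule exI[of _ "[:c:]"]) simp
next
  case (deg_le_add t F G)
  then obtain p q where "\<forall>s. F (\<lambda>i. u i + s * v i) = poly p s" "\<forall>s. G (\<lambda>i. u i + s * v i) = poly q s" by blast
  then show ?case by (intro exI[of _ "p+q"]) simp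
next
  case (deg_le_var i t F)
  then obtain p where "\<forall>s. F (\<lambda>i. u i + s * v i) = poly p s" by blast
  then show ?case by (intro exI[of _ "[:u i, v i:] * p"]) (simp add: algebra_simps)
qed

text \<open>On the line from \<open>a\<close> to \<open>b\<close> both functions become nonzero
  polynomials in one variable.\<close>

lemma deg_le_no_zero_divisors:
  assumes "deg_le n t F" "deg_le n s G" "F a \<noteq> 0" "G b \<noteq> 0"
  shows "\<exists>x. F x \<noteq> 0 \<and> G x \<noteq> 0"
proof -
  obtain p q where p: "\<And>s. F (\<lambda>i. a i + s * (b i - a i)) = poly p s"
    and q: "\<And>s. G (\<lambda>i. a i + s * (b i - a i)) = poly q s"
    using deg_le_line[OF assms(1)] deg_le_line[OF assms(2)] by metis
  have "p \<noteq> 0" using p[of 0] assms(3) by auto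
  moreover have "q \<noteq> 0" using q[of 1] assms(4) by auto
  ultimately have "p * q \<noteq> 0" by simp
  then obtain s where "poly (p*q) s \<noteq> 0" using poly_all_0_iff_0 by blast
  thus ?thesis using p q by (metis mult_eq_0_iff poly_mult)
qed

section \<open>Monomials and the extraction of coefficients\<close>

definition mon_fun :: "'v set \<Rightarrow> ('v \<Rightarrow> nat) \<Rightarrow> ('v \<Rightarrow> complex) \<Rightarrow> complex" where
  "mon_fun S \<gamma> x = (\<Prod>i\<in>S. x i ^ \<gamma> i)"

definition unity_root :: "nat \<Rightarrow> complex" where
  "unity_root q = cis (2 * pi / real q)"

text \<open>By orthogonality of characters, coefficients are weighted averages of the values at
  points whose coordinates are q-th roots of unity, as long as all exponents are below q.\<close>

definition root_pt :: "'v set \<Rightarrow> nat \<Rightarrow> ('v \<Rightarrow> nat) \<Rightarrow> 'v \<Rightarrow> complex" where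
  "root_pt S q k = (\<lambda>i. if i \<in> S then unity_root q ^ k i else 0)"

definition root_weight :: "'v set \<Rightarrow> nat \<Rightarrow> ('v \<Rightarrow> nat) \<Rightarrow> ('v \<Rightarrow> nat) \<Rightarrow> complex" where
  "root_weight S q \<gamma> k = (\<Prod>i\<in>S. inverse (unity_root q) ^ (k i * \<gamma> i)) / of_nat q ^ card S"

definition grid :: "'v set \<Rightarrow> nat \<Rightarrow> ('v \<Rightarrow> nat) set" where
  "grid S q = PiE S (\<lambda>_. {..<q})"

definition mono_coeff :: "'v set \<Rightarrow> nat \<Rightarrow> ('v \<Rightarrow> nat) \<Rightarrow> (('v \<Rightarrow> complex) \<Rightarrow> complex) \<Rightarrow> complex" where
  "mono_coeff S q \<gamma> h = (\<Sum>k\<in>grid S q. root_weight S q \<gamma> k * h (root_pt S q k))"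

lemma finite_grid [simp]: "finite S \<Longrightarrow> finite (grid S q)"
  unfolding grid_def by (rule finite_PiE) auto

lemma unity_root_sum:
  assumes "q > 0" "a < q" "b < q"
  shows "(\<Sum>k<q. (unity_root q ^ a * inverse (unity_root q) ^ b) ^ k) = (if a = b then of_nat q else 0)"
proof -
  let ?w = "unity_root q" and ?z = "unity_root q ^ a * inverse (unity_root q) ^ b"
  have nz: "?w \<noteq> 0" by (simp add: unity_root_def)
  have wq: "?w ^ q = 1"
    using assms(1) by (simp add: unity_root_def DeMoivre)
  have pw: "?w ^ k = cis (2 * pi * real k / real q)" for k
    by (simp add: unity_root_def DeMoivre algebra_simps)
  have inj: "inj_on (\<lambda>k. ?w ^ k) {..<q}"
    using bij_betw_roots_unity[OF assms(1)] unfolding pw bij_betw_def by blast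
  show ?thesis
  proof (cases "a = b")
    case True
    hence "?z = 1" using nz by (simp add: power_inverse)
    thus ?thesis using True by simp
  next
    case False
    have "?w ^ a \<noteq> ?w ^ b" using inj assms False by (auto simp: inj_on_def)
    hence z1: "?z \<noteq> 1" using nz by (simp add: power_inverse field_simps)
    have "?z ^ q = (?w ^ q) ^ a * inverse (?w ^ q) ^ b"
      by (simp add: power_mult_distrib power_mult[symmetric] mult.commute power_inverse)
    hence "?z ^ q = 1" by (simp add: wq)
    thus ?thesis using one_diff_power_eq[of ?z q] z1 False by simp
  qed
qed

lemma mono_coeff_mon_fun:
  assumes S: "finite S" and q: "q > 0" "\<And>i. i \<in> S \<Longrightarrow> \<gamma> i < q" "\<And>i. i \<in> S \<Longrightarrow> \<delta> i < q"
  shows "mono_coeff S q \<gamma> (mon_fun S \<delta>) = (if \<forall>i\<in>S. \<gamma> i = \<delta> i then 1 else 0)"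
proof -
  let ?w = "unity_root q"
  have "mono_coeff S q \<gamma> (mon_fun S \<delta>) = (\<Sum>k\<in>grid S q. (\<Prod>i\<in>S. inverse ?w ^ (k i * \<gamma> i)) *
      (\<Prod>i\<in>S. (?w ^ k i) ^ \<delta> i)) / of_nat q ^ card S"
    by (simp add: mono_coeff_def root_weight_def mon_fun_def root_pt_def sum_divide_distrib cong: prod.cong)
  also have "(\<Sum>k\<in>grid S q. (\<Prod>i\<in>S. inverse ?w ^ (k i * \<gamma> i)) * (\<Prod>i\<in>S. (?w ^ k i) ^ \<delta> i))
      = (\<Sum>k\<in>grid S q. \<Prod>i\<in>S. (?w ^ \<delta> i * inverse ?w ^ \<gamma> i) ^ k i)"
    by (intro sum.cong refl) (simp add: prod.distrib[symmetric] power_mult_distrib power_mult[symmetric] mult.commute)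
  also have "\<dots> = (\<Prod>i\<in>S. \<Sum>k<q. (?w ^ \<delta> i * inverse ?w ^ \<gamma> i) ^ k)"
    unfolding grid_def by (rule prod_sum_PiE[symmetric]) (use S in auto)
  also have "\<dots> = (\<Prod>i\<in>S. if \<delta> i = \<gamma> i then of_nat q else 0)"
    by (intro prod.cong refl unity_root_sum) (use q in auto)
  also have "\<dots> = (if \<forall>i\<in>S. \<gamma> i = \<delta> i then of_nat q ^ card S else 0)"
  proof (cases "\<forall>i\<in>S. \<gamma> i = \<delta> i")
    case False
    then obtain i where "i \<in> S" "\<gamma> i \<noteq> \<delta> i" by blast
    hence "(\<Prod>i\<in>S. if \<delta> i = \<gamma> i then of_nat q else (0::complex)) = 0"
      by (intro prod_zero[OF S] bexI[of _ i]) auto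
    thus ?thesis by (simp only: False if_False)
  qed simp
  finally show ?thesis using q by simp
qed

lemma mono_coeff_add: "mono_coeff S q \<gamma> (\<lambda>x. F x + G x) = mono_coeff S q \<gamma> F + mono_coeff S q \<gamma> G"
  by (simp add: mono_coeff_def sum.distrib algebra_simps)

lemma mono_coeff_cmult: "mono_coeff S q \<gamma> (\<lambda>x. c * F x) = c * mono_coeff S q \<gamma> F"
  by (simp add: mono_coeff_def sum_distrib_left algebra_simps)

lemma mono_coeff_zero [simp]: "mono_coeff S q \<gamma> (\<lambda>x. 0) = 0"
  by (simp add: mono_coeff_def)

lemma mono_coeff_sum: "mono_coeff S q \<gamma> (\<lambda>x. \<Sum>i\<in>I. F i x) = (\<Sum>i\<in>I. mono_coeff S q \<gamma> (F i))"
  by (induction I rule: infinite_finite_induct) (auto simp: mono_coeff_add)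

text \<open>\<open>ext\<close> identifies exponent functions that agree on \<open>S\<close>, because
  \<open>mono_coeff\<close> sees only their values there.\<close>

lemma mono_coeff_expansion:
  assumes "finite S" "finite \<Gamma>" "\<gamma> \<in> \<Gamma>" "\<And>\<delta> i. \<delta> \<in> \<Gamma> \<Longrightarrow> i \<in> S \<Longrightarrow> \<delta> i < q" "q > 0"
    and ext: "\<And>\<delta>. \<delta> \<in> \<Gamma> \<Longrightarrow> (\<forall>i\<in>S. \<gamma> i = \<delta> i) \<Longrightarrow> \<gamma> = \<delta>"
  shows "mono_coeff S q \<gamma> (\<lambda>x. \<Sum>\<delta>\<in>\<Gamma>. c \<delta> * mon_fun S \<delta> x) = c \<gamma>"
proof -
  have "mono_coeff S q \<gamma> (\<lambda>x. \<Sum>\<delta>\<in>\<Gamma>. c \<delta> * mon_fun S \<delta> x) = (\<Sum>\<delta>\<in>\<Gamma>. c \<delta> * mono_coeff S q \<gamma> (mon_fun S \<delta>))"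
    by (simp add: mono_coeff_sum mono_coeff_cmult)
  also have "\<dots> = (\<Sum>\<delta>\<in>\<Gamma>. if \<delta> = \<gamma> then c \<delta> else 0)"
    using assms by (intro sum.cong refl) (auto simp: mono_coeff_mon_fun)
  also have "\<dots> = c \<gamma>" using assms by simp
  finally show ?thesis .
qed

lemma mon_fun_independent:
  assumes S: "finite S" and G: "finite \<Gamma>" "\<gamma> \<in> \<Gamma>"
    and ext: "\<And>\<delta>. \<delta> \<in> \<Gamma> \<Longrightarrow> (\<forall>i\<in>S. \<gamma> i = \<delta> i) \<Longrightarrow> \<gamma> = \<delta>"
    and z: "\<And>x. (\<Sum>\<delta>\<in>\<Gamma>. c \<delta> * mon_fun S \<delta> x) = 0"
  shows "c \<gamma> = 0"
proof -
  define q where "q = Suc (Max ((\<lambda>(\<delta>,i). \<delta> i) ` (\<Gamma> \<times> S) \<union> {0}))"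
  have "\<delta> i < q" if "\<delta> \<in> \<Gamma>" "i \<in> S" for \<delta> i
    unfolding q_def less_Suc_eq_le by (rule Max_ge) (use that S G in \<open>auto intro!: finite_imageI\<close>)
  moreover have "q > 0" by (simp add: q_def)
  ultimately show ?thesis
    using mono_coeff_expansion[OF S G(1) G(2), of q c] ext z by simp
qed

definition exponents :: "nat \<Rightarrow> nat \<Rightarrow> (nat \<Rightarrow> nat) set" where
  "exponents n e = {\<gamma>. (\<forall>i\<ge>n. \<gamma> i = 0) \<and> (\<Sum>i<n. \<gamma> i) = e}"

lemma exponents_le: "\<gamma> \<in> exponents n e \<Longrightarrow> \<gamma> i \<le> e"
  unfolding exponents_def using member_le_sum[of i "{..<n}" \<gamma>] by (cases "i < n") auto

lemma finite_exponents [simp]: "finite (exponents n e)"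
proof (rule finite_subset)
  show "exponents n e \<subseteq> {f. \<forall>i. (i \<in> {..<n} \<longrightarrow> f i \<in> {..e}) \<and> (i \<notin> {..<n} \<longrightarrow> f i = 0)}"
    using exponents_le[of _ n e] by (auto simp: exponents_def)
qed (rule finite_set_of_finite_funs; simp)

lemma exponents_ext: "\<gamma> \<in> exponents n e \<Longrightarrow> \<delta> \<in> exponents n e' \<Longrightarrow> (\<forall>i\<in>{..<n}. \<gamma> i = \<delta> i) \<Longrightarrow> \<gamma> = \<delta>"
  unfolding exponents_def by (rule ext, rename_tac i, case_tac "i < n") auto

lemma hom_form_mon_fun: assumes "\<gamma> \<in> exponents n e" shows "hom_form n e (mon_fun {..<n} \<gamma>)"
proof -
  have "hom_form n (\<Sum>i<n. \<gamma> i * 1) (\<lambda>x. \<Prod>i<n. x i ^ \<gamma> i)"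
  proof (rule hom_form_prod)
    show "hom_form n (\<gamma> i * 1) (\<lambda>x. x i ^ \<gamma> i)" if "i \<in> {..<n}" for i
      using that by (intro hom_form_power hom_form_coord) auto
  qed simp
  thus ?thesis using assms by (simp add: exponents_def mon_fun_def[abs_def])
qed

lemma mon_fun_upd:
  assumes "i < (n::nat)"
  shows "mon_fun {..<n} (\<gamma>(i := Suc (\<gamma> i))) x = x i * mon_fun {..<n} \<gamma> x"
proof -
  have "mon_fun {..<n} (\<gamma>(i := Suc (\<gamma> i))) x = x i ^ Suc (\<gamma> i) * (\<Prod>j\<in>{..<n}-{i}. x j ^ \<gamma> j)"
    unfolding mon_fun_def using assms by (subst prod.remove[of _ i]) auto
  also have "\<dots> = x i * mon_fun {..<n} \<gamma> x"
    unfolding mon_fun_def using assms by (subst prod.remove[of "{..<n}" i "\<lambda>i. x i ^ \<gamma> i"]) auto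
  finally show ?thesis .
qed

lemma exponents_upd: "i < n \<Longrightarrow> \<gamma> \<in> exponents n e \<Longrightarrow> \<gamma>(i := Suc (\<gamma> i)) \<in> exponents n (Suc e)"
  unfolding exponents_def by (auto simp: sum.remove[of "{..<n}" i])

lemma hom_form_expand_ex:
  assumes "hom_form n e F"
  shows "\<exists>c. \<forall>x. F x = (\<Sum>\<gamma>\<in>exponents n e. c \<gamma> * mon_fun {..<n} \<gamma> x)"
  using assms
proof (induction rule: hom_form.induct)
  case (hom_form_const c)
  have "exponents n 0 = {\<lambda>_. 0}" by (auto simp: exponents_def fun_eq_iff) (metis lessThan_iff not_less)
  then show ?case by (intro exI[of _ "\<lambda>_. c"]) (simp add: mon_fun_def)
next
  case (hom_form_zero e)
  show ?case by (rule exI[of _ "\<lambda>_. 0"]) simp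
next
  case (hom_form_add e F G)
  then obtain c d where "\<forall>x. F x = (\<Sum>\<gamma>\<in>exponents n e. c \<gamma> * mon_fun {..<n} \<gamma> x)"
    "\<forall>x. G x = (\<Sum>\<gamma>\<in>exponents n e. d \<gamma> * mon_fun {..<n} \<gamma> x)" by blast
  then show ?case by (intro exI[of _ "\<lambda>\<gamma>. c \<gamma> + d \<gamma>"]) (simp add: sum.distrib algebra_simps)
next
  case (hom_form_var i e F)
  then obtain c where c: "\<And>x. F x = (\<Sum>\<gamma>\<in>exponents n e. c \<gamma> * mon_fun {..<n} \<gamma> x)" by blast
  let ?u = "\<lambda>\<gamma>. \<gamma>(i := Suc (\<gamma> i))"
  have inj: "inj_on ?u (exponents n e)"
  proof (rule inj_onI, rule ext)
    fix f g j assume "?u f = ?u g"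
    from fun_cong[OF this, of j] show "f j = g j" by (auto split: if_splits)
  qed
  define d where "d \<delta> = (if \<delta> \<in> ?u ` exponents n e then c (the_inv_into (exponents n e) ?u \<delta>) else 0)" for \<delta>
  have "x i * F x = (\<Sum>\<delta>\<in>exponents n (Suc e). d \<delta> * mon_fun {..<n} \<delta> x)" for x
  proof -
    have "(\<Sum>\<delta>\<in>exponents n (Suc e). d \<delta> * mon_fun {..<n} \<delta> x) = (\<Sum>\<delta>\<in>?u ` exponents n e. d \<delta> * mon_fun {..<n} \<delta> x)"
      by (rule sum.mono_neutral_right) (use exponents_upd hom_form_var(1) in \<open>auto simp: d_def\<close>)
    also have "\<dots> = (\<Sum>\<gamma>\<in>exponents n e. c \<gamma> * mon_fun {..<n} (?u \<gamma>) x)"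
      by (subst sum.reindex[OF inj]) (auto simp: d_def the_inv_into_f_f[OF inj] intro!: sum.cong)
    also have "\<dots> = x i * F x"
      by (simp add: mon_fun_upd[OF hom_form_var(1)] c sum_distrib_left algebra_simps)
    finally show ?thesis by simp
  qed
  then show ?case by blast
qed

text \<open>The coefficients are linear combinations of values of F at fixed points, with weights
  that do not depend on F. A polynomial expression in the coefficients is therefore one in these
  values, which is how a resultant becomes a function of point values.\<close>

lemma hom_form_expand:
  assumes "hom_form n e F" "e < q"
  shows "F x = (\<Sum>\<gamma>\<in>exponents n e. mono_coeff {..<n} q \<gamma> F * mon_fun {..<n} \<gamma> x)"
proof -
  obtain c where c: "\<And>x. F x = (\<Sum>\<gamma>\<in>exponents n e. c \<gamma> * mon_fun {..<n} \<gamma> x)"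
    using hom_form_expand_ex[OF assms(1)] by blast
  have "mono_coeff {..<n} q \<gamma> F = c \<gamma>" if \<gamma>: "\<gamma> \<in> exponents n e" for \<gamma>
  proof -
    have "mono_coeff {..<n} q \<gamma> (\<lambda>x. \<Sum>\<gamma>\<in>exponents n e. c \<gamma> * mon_fun {..<n} \<gamma> x) = c \<gamma>"
    proof (rule mono_coeff_expansion)
      show "\<delta> i < q" if "\<delta> \<in> exponents n e" for \<delta> i
        using exponents_le[OF that, of i] assms(2) by simp
      show "\<gamma> = \<delta>" if "\<delta> \<in> exponents n e" "\<forall>i\<in>{..<n}. \<gamma> i = \<delta> i" for \<delta>
        using exponents_ext[OF \<gamma> that] .
    qed (use \<gamma> assms(2) in auto)
    moreover have "F = (\<lambda>x. \<Sum>\<gamma>\<in>exponents n e. c \<gamma> * mon_fun {..<n} \<gamma> x)" using c by blast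
    ultimately show ?thesis by simp
  qed
  thus ?thesis using c by simp
qed

global_interpretation fv: vector_space "\<lambda>(c::complex) (F::'a \<Rightarrow> complex) x. c * F x"
  by unfold_locales (auto simp: fun_eq_iff algebra_simps)

lemma sum_fun_apply: "(\<Sum>i\<in>I. F i) x = (\<Sum>i\<in>I. (F i x :: complex))"
  by (induction I rule: infinite_finite_induct) auto

text \<open>The span of the \<open>h b\<close> has dimension at most \<open>card B\<close>. The
  family \<open>g\<close> may have repetitions, which disappear in the set \<open>g\<close> followed
  by \<open>K\<close>; they give a relation directly and are treated first.\<close>

lemma lin_dep:
  fixes g :: "'k \<Rightarrow> 'a \<Rightarrow> complex" and h :: "'b \<Rightarrow> 'a \<Rightarrow> complex"
  assumes "finite K" "finite B" "card B < card K"
    and "\<And>k. k \<in> K \<Longrightarrow> \<exists>c. \<forall>x. g k x = (\<Sum>b\<in>B. c b * h b x)"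
  shows "\<exists>a. (\<exists>k\<in>K. a k \<noteq> 0) \<and> (\<forall>x. (\<Sum>k\<in>K. a k * g k x) = 0)"
proof (cases "inj_on g K")
  case False
  then obtain k l where kl: "k \<in> K" "l \<in> K" "k \<noteq> l" "g k = g l" by (auto simp: inj_on_def)
  define a where "a i = (if i = k then 1 else if i = l then -1 else (0::complex))" for i
  have "(\<Sum>i\<in>K. a i * g i x) = 0" for x
  proof -
    have "(\<Sum>i\<in>K. a i * g i x) = (\<Sum>i\<in>{k,l}. a i * g i x)"
      by (rule sum.mono_neutral_right) (use assms kl in \<open>auto simp: a_def\<close>)
    thus ?thesis using kl by (simp add: a_def)
  qed
  moreover have "a k \<noteq> 0" by (simp add: a_def)
  ultimately show ?thesis using kl by blast
next
  case True
  have sp: "g ` K \<subseteq> fv.span (h ` B)"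
  proof clarify
    fix k assume "k \<in> K"
    then obtain c where c: "\<And>x. g k x = (\<Sum>b\<in>B. c b * h b x)" using assms(4) by blast
    have "g k = (\<Sum>b\<in>B. (\<lambda>x. c b * h b x))" by (rule ext) (simp add: c sum_fun_apply)
    also have "\<dots> \<in> fv.span (h ` B)"
      by (rule fv.span_sum) (intro fv.span_scale fv.span_base; simp)
    finally show "g k \<in> fv.span (h ` B)" .
  qed
  have "fv.dependent (g ` K)"
  proof (rule ccontr)
    assume "fv.independent (g ` K)"
    from fv.independent_span_bound[OF _ this sp] assms have "card (g ` K) \<le> card (h ` B)" by simp
    thus False using card_image[OF True] card_image_le[OF assms(2), of h] assms(3) by simp
  qed
  then obtain u v where uv: "v \<in> g ` K" "u v \<noteq> 0" "(\<Sum>v\<in>g ` K. (\<lambda>x. u v * v x)) = 0"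
    using fv.dependent_finite[of "g ` K"] assms(1) by auto
  have "(\<Sum>k\<in>K. u (g k) * g k x) = 0" for x
    using fun_cong[OF uv(3), of x] by (simp add: sum_fun_apply sum.reindex[OF True])
  thus ?thesis using uv(1,2) by (intro exI[of _ "\<lambda>k. u (g k)"]) auto
qed

section \<open>From coefficient maps to polynomial functions and back\<close>

lemma peval_superset:
  assumes "finite S" "\<And>m. m \<in> Poly_Mapping.keys p \<Longrightarrow> Poly_Mapping.keys m \<subseteq> S"
    "finite M" "Poly_Mapping.keys p \<subseteq> M"
  shows "peval x p = (\<Sum>m\<in>M. Poly_Mapping.lookup p m * (\<Prod>i\<in>S. x i ^ Poly_Mapping.lookup m i))"
proof -
  have "peval x p = (\<Sum>m\<in>Poly_Mapping.keys p. Poly_Mapping.lookup p m * (\<Prod>i\<in>S. x i ^ Poly_Mapping.lookup m i))"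
    unfolding peval_def
  proof (intro sum.cong refl, goal_cases)
    case (1 m)
    have "(\<Prod>i\<in>Poly_Mapping.keys m. x i ^ Poly_Mapping.lookup m i) = (\<Prod>i\<in>S. x i ^ Poly_Mapping.lookup m i)"
      by (rule prod.mono_neutral_left) (use assms 1 in \<open>auto simp: in_keys_iff\<close>)
    thus ?case by simp
  qed
  also have "\<dots> = (\<Sum>m\<in>M. Poly_Mapping.lookup p m * (\<Prod>i\<in>S. x i ^ Poly_Mapping.lookup m i))"
    by (rule sum.mono_neutral_left) (use assms in \<open>auto simp: in_keys_iff\<close>)
  finally show ?thesis .
qed

definition mvars :: "'v cpoly \<Rightarrow> 'v set" where
  "mvars p = (\<Union>m\<in>Poly_Mapping.keys p. Poly_Mapping.keys m)"

lemma finite_mvars [simp]: "finite (mvars p)"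
  by (simp add: mvars_def)

lemma peval_mvars:
  assumes "finite S" "mvars p \<subseteq> S" "finite M" "Poly_Mapping.keys p \<subseteq> M"
  shows "peval x p = (\<Sum>m\<in>M. Poly_Mapping.lookup p m * (\<Prod>i\<in>S. x i ^ Poly_Mapping.lookup m i))"
  by (rule peval_superset) (use assms in \<open>auto simp: mvars_def\<close>)

lemma peval_zero [simp]: "peval x 0 = 0" by (simp add: peval_def)

lemma peval_add [simp]: "peval x (p + q) = peval x p + peval x q"
proof -
  let ?M = "Poly_Mapping.keys p \<union> Poly_Mapping.keys q \<union> Poly_Mapping.keys (p + q)"
  let ?S = "mvars p \<union> mvars q \<union> mvars (p + q)"
  have "peval x r = (\<Sum>m\<in>?M. Poly_Mapping.lookup r m * (\<Prod>i\<in>?S. x i ^ Poly_Mapping.lookup m i))"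
    if "r \<in> {p, q, p+q}" for r
    by (rule peval_mvars) (use that in auto)
  thus ?thesis by (simp add: lookup_add algebra_simps sum.distrib)
qed

lemma peval_sum [simp]: "peval x (\<Sum>i\<in>I. p i) = (\<Sum>i\<in>I. peval x (p i))"
  by (induction I rule: infinite_finite_induct) auto

lemma peval_single: "peval x (Poly_Mapping.single m c) = c * (\<Prod>i\<in>Poly_Mapping.keys m. x i ^ Poly_Mapping.lookup m i)"
  by (simp add: peval_def)

lemma monom_prod_add:
  "(\<Prod>i\<in>Poly_Mapping.keys (m + m'). x i ^ Poly_Mapping.lookup (m + m') i) =
   (\<Prod>i\<in>Poly_Mapping.keys m. x i ^ Poly_Mapping.lookup m i) * (\<Prod>i\<in>Poly_Mapping.keys m'. (x i :: complex) ^ Poly_Mapping.lookup m' i)"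
proof -
  let ?S = "Poly_Mapping.keys m \<union> Poly_Mapping.keys m' \<union> Poly_Mapping.keys (m + m')"
  have *: "(\<Prod>i\<in>Poly_Mapping.keys k. x i ^ Poly_Mapping.lookup k i) = (\<Prod>i\<in>?S. x i ^ Poly_Mapping.lookup k i)"
    if "k = m \<or> k = m' \<or> k = m+m'" for k
    by (rule prod.mono_neutral_left) (use that in \<open>auto simp: in_keys_iff\<close>)
  show ?thesis unfolding *[OF disjI1[OF refl]] *[OF disjI2[OF disjI1[OF refl]]] *[OF disjI2[OF disjI2[OF refl]]]
    by (simp add: lookup_add power_add prod.distrib)
qed

lemma peval_single_mult: "peval x (Poly_Mapping.single m c * Poly_Mapping.single m' c') =
  peval x (Poly_Mapping.single m c) * peval x (Poly_Mapping.single m' c')"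
  by (simp add: mult_single peval_single monom_prod_add)

lemma poly_mapping_sum_singles: "p = (\<Sum>m\<in>Poly_Mapping.keys p. Poly_Mapping.single m (Poly_Mapping.lookup p m))"
  by (rule poly_mapping_eqI) (auto simp: lookup_sum lookup_single when_def in_keys_iff)

lemma peval_mult [simp]: "peval x (p * q) = peval x p * peval x (q :: 'v cpoly)"
proof -
  have "peval x (p * q) = peval x ((\<Sum>m\<in>Poly_Mapping.keys p. Poly_Mapping.single m (Poly_Mapping.lookup p m)) *
    (\<Sum>m\<in>Poly_Mapping.keys q. Poly_Mapping.single m (Poly_Mapping.lookup q m)))"
    by (simp flip: poly_mapping_sum_singles)
  also have "\<dots> = peval x (\<Sum>m\<in>Poly_Mapping.keys p. Poly_Mapping.single m (Poly_Mapping.lookup p m)) *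
     peval x (\<Sum>m\<in>Poly_Mapping.keys q. Poly_Mapping.single m (Poly_Mapping.lookup q m))"
    by (simp only: sum_product peval_sum peval_single_mult)
  also have "\<dots> = peval x p * peval x q"
    by (simp flip: poly_mapping_sum_singles)
  finally show ?thesis .
qed

lemma peval_const [simp]: "peval x (const c) = c"
  by (simp add: const_def peval_single)

text \<open>Distinct monomials are linearly independent as functions. Formal polynomials are thus
  determined by their values, which links the definitions to polynomial functions.\<close>

lemma peval_nonzero:
  fixes p :: "'v cpoly"
  assumes "p \<noteq> 0"
  shows "\<exists>x. peval x p \<noteq> 0"
proof (rule ccontr)
  assume no: "\<not> ?thesis"
  obtain m where m: "m \<in> Poly_Mapping.keys p" using assms by fastforce
  \<comment> \<open>Independence is stated for exponent functions, so the coefficients of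
    \<open>p\<close> are carried over along the injection
    \<open>Poly_Mapping.lookup\<close>.\<close>
  have "(\<lambda>g. Poly_Mapping.lookup p (the_inv_into UNIV Poly_Mapping.lookup g)) (Poly_Mapping.lookup m) = 0"
  proof (rule mon_fun_independent[of "mvars p" "Poly_Mapping.lookup ` Poly_Mapping.keys p"])
    show "Poly_Mapping.lookup m \<in> Poly_Mapping.lookup ` Poly_Mapping.keys p" using m by simp
  next
    fix \<delta> assume d: "\<delta> \<in> Poly_Mapping.lookup ` Poly_Mapping.keys p" "\<forall>i\<in>mvars p. Poly_Mapping.lookup m i = \<delta> i"
    then obtain m' where m': "m' \<in> Poly_Mapping.keys p" "\<delta> = Poly_Mapping.lookup m'" by blast
    show "Poly_Mapping.lookup m = \<delta>"
    proof
      fix i show "Poly_Mapping.lookup m i = \<delta> i"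
      proof (cases "i \<in> mvars p")
        case False
        thus ?thesis using m m' by (auto simp: mvars_def in_keys_iff)
      qed (use d in auto)
    qed
  next
    fix x
    have inj: "inj (Poly_Mapping.lookup :: ('v \<Rightarrow>\<^sub>0 nat) \<Rightarrow> _)" by (rule injI) (simp add: lookup_inject)
    have "(\<Sum>\<delta>\<in>Poly_Mapping.lookup ` Poly_Mapping.keys p. Poly_Mapping.lookup p (the_inv_into UNIV Poly_Mapping.lookup \<delta>) * mon_fun (mvars p) \<delta> x) = peval x p"
      by (subst sum.reindex) (use inj in \<open>auto intro: inj_on_subset simp: the_inv_into_f_f mon_fun_def
         peval_mvars[of "mvars p" p "Poly_Mapping.keys p" x]\<close>)
    thus "(\<Sum>\<delta>\<in>Poly_Mapping.lookup ` Poly_Mapping.keys p. Poly_Mapping.lookup p (the_inv_into UNIV Poly_Mapping.lookup \<delta>) * mon_fun (mvars p) \<delta> x) = 0"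
      using no by simp
  qed auto
  hence "Poly_Mapping.lookup p m = 0"
    by (simp add: the_inv_into_f_f lookup_inject inj_def)
  thus False using m by (simp add: in_keys_iff)
qed

lemma peval_uminus [simp]: "peval x (- p) = - peval x p"
  using peval_add[of x p "-p"] by (simp add: eq_neg_iff_add_eq_0 add.commute del: peval_add)

lemma peval_diff [simp]: "peval x (p - q) = peval x p - peval x q"
  using peval_add[of x p "-q"] by simp

lemma peval_inject: "(\<And>x. peval x p = peval x q) \<Longrightarrow> p = q"
  using peval_nonzero[of "p - q"] by auto

lemma exponents_keys:
  fixes m :: "nat \<Rightarrow>\<^sub>0 nat"
  assumes "Poly_Mapping.keys m \<subseteq> {..<n}"
  shows "Poly_Mapping.lookup m \<in> exponents n (mon_deg m)"
proof -
  have "(\<Sum>i<n. Poly_Mapping.lookup m i) = mon_deg m"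
    unfolding mon_deg_def by (rule sum.mono_neutral_right) (use assms in \<open>auto simp: in_keys_iff\<close>)
  moreover have "Poly_Mapping.lookup m i = 0" if "i \<ge> n" for i
    using assms that by (meson in_keys_iff lessThan_iff linorder_not_less subsetD)
  ultimately show ?thesis by (auto simp: exponents_def)
qed

lemma peval_monos:
  assumes "p \<in> cpolys {..<(n::nat)}"
  shows "peval x p = (\<Sum>m\<in>Poly_Mapping.keys p. Poly_Mapping.lookup p m * mon_fun {..<n} (Poly_Mapping.lookup m) x)"
  unfolding mon_fun_def by (rule peval_mvars) (use assms in \<open>auto simp: mvars_def cpolys_def\<close>)

lemma cpolys_hom_form:
  assumes "p \<in> cpolys {..<n}" "\<And>m. m \<in> Poly_Mapping.keys p \<Longrightarrow> mon_deg m = e"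
  shows "hom_form n e (\<lambda>x. peval x p)"
  unfolding peval_monos[OF assms(1)]
  by (intro hom_form_sum hom_form_cmult hom_form_mon_fun) (use assms exponents_keys[of _ n] in \<open>force simp: cpolys_def\<close>)

lemma cpolys_deg_le:
  assumes "p \<in> cpolys {..<n}"
  shows "\<exists>t. deg_le n t (\<lambda>x. peval x p)"
proof -
  define t where "t = (\<Sum>m\<in>Poly_Mapping.keys p. mon_deg m)"
  have "deg_le n t (\<lambda>x. Poly_Mapping.lookup p m * mon_fun {..<n} (Poly_Mapping.lookup m) x)" if m: "m \<in> Poly_Mapping.keys p" for m
  proof (intro deg_le_cmult deg_le_mono[OF hom_form_imp_deg_le[OF hom_form_mon_fun]])
    show "Poly_Mapping.lookup m \<in> exponents n (mon_deg m)"
      using assms m by (intro exponents_keys) (auto simp: cpolys_def)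
    show "mon_deg m \<le> t" unfolding t_def using m by (intro member_le_sum) auto
  qed
  thus ?thesis unfolding peval_monos[OF assms] by (intro exI[of _ t] deg_le_sum)
qed

lemma cpolys_zero: "0 \<in> cpolys A" by (simp add: cpolys_def)
lemma cpolys_add: "p \<in> cpolys A \<Longrightarrow> q \<in> cpolys A \<Longrightarrow> p + q \<in> cpolys A"
  unfolding cpolys_def using keys_add[of p q] by blast
lemma cpolys_sum: "(\<And>i. i \<in> I \<Longrightarrow> p i \<in> cpolys A) \<Longrightarrow> (\<Sum>i\<in>I. p i) \<in> cpolys A"
  by (induction I rule: infinite_finite_induct) (auto intro: cpolys_zero cpolys_add)

lemma hom_form_cpolys:
  assumes "hom_form n e F"
  shows "\<exists>p\<in>cpolys {..<n}. (\<forall>m\<in>Poly_Mapping.keys p. mon_deg m = e) \<and> (\<forall>x. peval x p = F x)"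
  using assms
proof (induction rule: hom_form.induct)
  case (hom_form_const c)
  show ?case by (rule bexI[of _ "const c"]) (auto simp: cpolys_def const_def mon_deg_def peval_single)
next
  case (hom_form_zero e)
  show ?case by (rule bexI[of _ 0]) (auto simp: cpolys_def)
next
  case (hom_form_add e F G)
  then obtain p q where "p\<in>cpolys {..<n}" "\<forall>m\<in>Poly_Mapping.keys p. mon_deg m = e" "\<forall>x. peval x p = F x"
    "q\<in>cpolys {..<n}" "\<forall>m\<in>Poly_Mapping.keys q. mon_deg m = e" "\<forall>x. peval x q = G x" by blast
  then show ?case using keys_add[of p q]
    by (intro bexI[of _ "p+q"] cpolys_add) auto
next
  case (hom_form_var i e F)
  then obtain p where p: "p\<in>cpolys {..<n}" "\<forall>m\<in>Poly_Mapping.keys p. mon_deg m = e" "\<forall>x. peval x p = F x" by blast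
  let ?s = "Poly_Mapping.single (Poly_Mapping.single i (1::nat)) (1::complex)"
  have k: "\<exists>m'\<in>Poly_Mapping.keys p. m = Poly_Mapping.single i 1 + m'" if "m \<in> Poly_Mapping.keys (?s * p)" for m
    using subsetD[OF keys_mult that] by auto
  have md: "mon_deg (Poly_Mapping.single i 1 + m') = Suc (mon_deg m') \<and> Poly_Mapping.keys (Poly_Mapping.single i 1 + m') \<subseteq> insert i (Poly_Mapping.keys m')" for m'
  proof -
    have kk: "Poly_Mapping.keys (Poly_Mapping.single i 1 + m') = insert i (Poly_Mapping.keys m')"
      by (auto simp: in_keys_iff lookup_add lookup_single when_def split: if_splits)
    have "mon_deg (Poly_Mapping.single i 1 + m') = (\<Sum>j\<in>insert i (Poly_Mapping.keys m'). Poly_Mapping.lookup m' j + (if i = j then 1 else 0))"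
      unfolding mon_deg_def kk by (intro sum.cong refl) (auto simp: lookup_add lookup_single when_def)
    also have "\<dots> = (\<Sum>j\<in>insert i (Poly_Mapping.keys m'). Poly_Mapping.lookup m' j) + 1"
      by (subst sum.distrib) (simp add: sum.delta)
    also have "(\<Sum>j\<in>insert i (Poly_Mapping.keys m'). Poly_Mapping.lookup m' j) = mon_deg m'"
      unfolding mon_deg_def by (rule sum.mono_neutral_right) (auto simp: in_keys_iff)
    finally show ?thesis using kk by simp
  qed
  show ?case
  proof (rule bexI[of _ "?s * p"], intro conjI ballI allI)
    show "mon_deg m = Suc e" if "m \<in> Poly_Mapping.keys (?s * p)" for m
      using k[OF that] md p by auto
    show "peval x (?s * p) = x i * F x" for x
      using p by (simp add: peval_single)
    show "?s * p \<in> cpolys {..<n}"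
      using k md p hom_form_var(1) unfolding cpolys_def by fastforce
  qed
qed

lemma deg_le_cpolys:
  assumes "deg_le n t F"
  shows "\<exists>p\<in>cpolys {..<n}. \<forall>x. peval x p = F x"
proof -
  obtain H where H: "\<And>k. hom_form n k (H k)" "F = (\<lambda>x. \<Sum>k\<le>t. H k x)" using deg_le_hom_form_components[OF assms] by blast
  have "\<forall>k. \<exists>p. p\<in>cpolys {..<n} \<and> (\<forall>x. peval x p = H k x)" using hom_form_cpolys[OF H(1)] by blast
  then obtain p where p: "\<And>k. p k \<in> cpolys {..<n}" "\<And>k x. peval x (p k) = H k x" by metis
  show ?thesis using p H by (intro bexI[of _ "\<Sum>k\<le>t. p k"]) (auto intro: cpolys_sum)
qed

definition poly_fn :: "nat \<Rightarrow> (cvec \<Rightarrow> complex) \<Rightarrow> bool" where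
  "poly_fn n F \<longleftrightarrow> (\<exists>t. deg_le n t F)"

lemma poly_fn_const: "poly_fn n (\<lambda>x. c)" unfolding poly_fn_def by (blast intro: deg_le_const)
lemma poly_fn_coord: "i < n \<Longrightarrow> poly_fn n (\<lambda>x. x i)" unfolding poly_fn_def by (blast intro: deg_le_coord)
lemma poly_fn_add: assumes "poly_fn n F" "poly_fn n G" shows "poly_fn n (\<lambda>x. F x + G x)"
proof -
  obtain t s where "deg_le n t F" "deg_le n s G" using assms by (auto simp: poly_fn_def)
  hence "deg_le n (max t s) (\<lambda>x. F x + G x)" by (intro deg_le_add) (auto intro: deg_le_mono)
  thus ?thesis by (auto simp: poly_fn_def)
qed
lemma poly_fn_mult: "poly_fn n F \<Longrightarrow> poly_fn n G \<Longrightarrow> poly_fn n (\<lambda>x. F x * G x)"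
  unfolding poly_fn_def by (blast intro: deg_le_mult)
lemma poly_fn_uminus: "poly_fn n F \<Longrightarrow> poly_fn n (\<lambda>x. - F x)"
  unfolding poly_fn_def by (blast intro: deg_le_uminus)
lemma poly_fn_diff: "poly_fn n F \<Longrightarrow> poly_fn n G \<Longrightarrow> poly_fn n (\<lambda>x. F x - G x)"
  using poly_fn_add[of n F "\<lambda>x. - G x"] poly_fn_uminus by simp
lemma poly_fn_sum: "(\<And>i. i \<in> I \<Longrightarrow> poly_fn n (F i)) \<Longrightarrow> poly_fn n (\<lambda>x. \<Sum>i\<in>I. F i x)"
  by (induction I rule: infinite_finite_induct) (auto intro: poly_fn_const poly_fn_add)
lemma poly_fn_prod: "(\<And>i. i \<in> I \<Longrightarrow> poly_fn n (F i)) \<Longrightarrow> poly_fn n (\<lambda>x. \<Prod>i\<in>I. F i x)"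
  by (induction I rule: infinite_finite_induct) (auto intro: poly_fn_const poly_fn_mult)
lemma poly_fn_power: "poly_fn n F \<Longrightarrow> poly_fn n (\<lambda>x. F x ^ k)"
  unfolding poly_fn_def by (blast intro: deg_le_power)
lemma poly_fn_hom_form: "hom_form n e F \<Longrightarrow> poly_fn n F" unfolding poly_fn_def by (blast intro: hom_form_imp_deg_le)
lemma poly_fn_poly: "poly_fn n F \<Longrightarrow> poly_fn n (\<lambda>x. poly p (F x))"
  by (induction p) (auto intro: poly_fn_const poly_fn_add poly_fn_mult)

section \<open>The Nullstellensatz and common zeros of forms\<close>

definition fn_ideal :: "nat \<Rightarrow> (cvec \<Rightarrow> complex) set \<Rightarrow> bool" where
  "fn_ideal n J \<longleftrightarrow> (\<lambda>x. 0) \<in> J \<and> (\<forall>F\<in>J. \<forall>G\<in>J. (\<lambda>x. F x + G x) \<in> J) \<and>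
     (\<forall>F\<in>J. \<forall>a. poly_fn n a \<longrightarrow> (\<lambda>x. a x * F x) \<in> J)"

definition ideal_adjoin :: "nat \<Rightarrow> (cvec \<Rightarrow> complex) set \<Rightarrow> (cvec \<Rightarrow> complex) \<Rightarrow> (cvec \<Rightarrow> complex) set" where
  "ideal_adjoin n J g = {\<lambda>x. F x + a x * g x | F a. F \<in> J \<and> poly_fn n a}"

lemma fn_ideal_add: "fn_ideal n J \<Longrightarrow> F \<in> J \<Longrightarrow> G \<in> J \<Longrightarrow> (\<lambda>x. F x + G x) \<in> J" by (auto simp: fn_ideal_def)
lemma fn_ideal_mult: "fn_ideal n J \<Longrightarrow> F \<in> J \<Longrightarrow> poly_fn n a \<Longrightarrow> (\<lambda>x. a x * F x) \<in> J" by (auto simp: fn_ideal_def)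
lemma fn_ideal_mult2: "fn_ideal n J \<Longrightarrow> F \<in> J \<Longrightarrow> poly_fn n a \<Longrightarrow> (\<lambda>x. F x * a x) \<in> J"
  using fn_ideal_mult[of n J F a] by (simp add: mult.commute)
lemma fn_ideal_zero: "fn_ideal n J \<Longrightarrow> (\<lambda>x. 0) \<in> J" by (auto simp: fn_ideal_def)
lemma fn_ideal_sum: "fn_ideal n J \<Longrightarrow> (\<And>i. i \<in> I \<Longrightarrow> F i \<in> J) \<Longrightarrow> (\<lambda>x. \<Sum>i\<in>I. F i x) \<in> J"
  by (induction I rule: infinite_finite_induct) (auto intro: fn_ideal_add fn_ideal_zero)

lemma fn_ideal_ideal_adjoin:
  assumes J: "fn_ideal n J"
  shows "fn_ideal n (ideal_adjoin n J g)"
  unfolding fn_ideal_def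
proof (intro conjI ballI allI impI)
  show "(\<lambda>x. 0) \<in> ideal_adjoin n J g"
    unfolding ideal_adjoin_def using fn_ideal_zero[OF J] poly_fn_const[of n 0]
    by (intro CollectI exI[of _ "\<lambda>x. 0"]) auto
next
  fix F G assume "F \<in> ideal_adjoin n J g" "G \<in> ideal_adjoin n J g"
  then obtain F' a G' b where 1: "F = (\<lambda>x. F' x + a x * g x)" "F' \<in> J" "poly_fn n a"
    "G = (\<lambda>x. G' x + b x * g x)" "G' \<in> J" "poly_fn n b" by (auto simp: ideal_adjoin_def)
  show "(\<lambda>x. F x + G x) \<in> ideal_adjoin n J g" unfolding ideal_adjoin_def
    by (intro CollectI exI[of _ "\<lambda>x. F' x + G' x"] exI[of _ "\<lambda>x. a x + b x"])
      (use 1 J in \<open>auto simp: algebra_simps intro: fn_ideal_add poly_fn_add\<close>)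
next
  fix F b assume "F \<in> ideal_adjoin n J g" "poly_fn n b"
  then obtain F' a where 1: "F = (\<lambda>x. F' x + a x * g x)" "F' \<in> J" "poly_fn n a" by (auto simp: ideal_adjoin_def)
  show "(\<lambda>x. b x * F x) \<in> ideal_adjoin n J g" unfolding ideal_adjoin_def
    by (intro CollectI exI[of _ "\<lambda>x. b x * F' x"] exI[of _ "\<lambda>x. b x * a x"])
      (use 1 fn_ideal_mult[OF J 1(2) \<open>poly_fn n b\<close>] poly_fn_mult[OF \<open>poly_fn n b\<close> 1(3)] in \<open>auto simp: distrib_left mult.assoc\<close>)
qed

lemma ideal_adjoin_sup: "F \<in> J \<Longrightarrow> F \<in> ideal_adjoin n J g"
  unfolding ideal_adjoin_def using poly_fn_const[of n 0] by (intro CollectI exI[of _ F] exI[of _ "\<lambda>x. 0"]) auto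

lemma ideal_adjoin_mem: "fn_ideal n J \<Longrightarrow> g \<in> ideal_adjoin n J g"
  unfolding ideal_adjoin_def using poly_fn_const[of n 1] fn_ideal_zero[of n J]
  by (intro CollectI exI[of _ "\<lambda>x. 0"] exI[of _ "\<lambda>x. 1"]) auto

text \<open>If every \<open>x i - \<rho>\<close> is invertible modulo \<open>J\<close>, then so is
  every nonzero polynomial in \<open>x i\<close>, since it splits into linear factors; the induction
  removes one factor at a time.\<close>

lemma fn_ideal_poly_cancel:
  assumes J: "fn_ideal n J" and inv: "\<And>\<rho>. \<exists>a. poly_fn n a \<and> (\<lambda>x. a x * (x i - \<rho>) - 1) \<in> J"
    and i: "i < n"
  shows "(p::complex poly) \<noteq> 0 \<Longrightarrow> (\<lambda>x. poly p (x i)) \<in> J \<Longrightarrow> (\<lambda>x. 1) \<in> J"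
proof (induction "degree p" arbitrary: p)
  case 0
  then obtain c where "p = [:c:]" by (metis degree_eq_zeroE)
  hence "c \<noteq> 0" "(\<lambda>x. c) \<in> J" using 0 by auto
  with fn_ideal_mult[OF J this(2) poly_fn_const[of n "inverse c"]] show ?case by simp
next
  case (Suc k)
  obtain \<sigma> where "poly p \<sigma> = 0"
    using fundamental_theorem_of_algebra[of p] Suc.hyps(2) by (metis constant_degree nat.distinct(1))
  then obtain q where q: "p = [:-\<sigma>, 1:] * q" unfolding poly_eq_0_iff_dvd by (rule dvdE)
  have q0: "q \<noteq> 0" using q Suc.prems by auto
  have "degree p = Suc (degree q)" unfolding q using q0 by (subst degree_mult_eq) auto
  hence dq: "k = degree q" using Suc.hyps by simp
  obtain a where a: "poly_fn n a" "(\<lambda>x. a x * (x i - \<sigma>) - 1) \<in> J" using inv by blast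
  have PFq: "poly_fn n (\<lambda>x. poly q (x i))" by (intro poly_fn_poly poly_fn_coord i)
  have 1: "(\<lambda>x. a x * poly p (x i)) \<in> J" by (rule fn_ideal_mult[OF J Suc.prems(2) a(1)])
  have 2: "(\<lambda>x. (-1) * ((a x * (x i - \<sigma>) - 1) * poly q (x i))) \<in> J"
    by (rule fn_ideal_mult[OF J fn_ideal_mult2[OF J a(2) PFq] poly_fn_const])
  have "(\<lambda>x. a x * poly p (x i) + (-1) * ((a x * (x i - \<sigma>) - 1) * poly q (x i))) = (\<lambda>x. poly q (x i))"
    by (rule ext) (simp add: q algebra_simps)
  hence "(\<lambda>x. poly q (x i)) \<in> J" using fn_ideal_add[OF J 1 2] by simp
  with Suc.hyps(1)[OF dq q0] show ?case .
qed

lemma deg_le_expand: "deg_le n t F \<Longrightarrow> \<exists>c. \<forall>x. F x = (\<Sum>\<gamma>\<in>(\<Union>e\<le>t. exponents n e). c \<gamma> * mon_fun {..<n} \<gamma> x)"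
proof -
  assume "deg_le n t F"
  then obtain H where H: "\<And>k. hom_form n k (H k)" "F = (\<lambda>x. \<Sum>k\<le>t. H k x)" using deg_le_hom_form_components by blast
  have "\<forall>k. \<exists>c. \<forall>x. H k x = (\<Sum>\<gamma>\<in>exponents n k. c \<gamma> * mon_fun {..<n} \<gamma> x)" using hom_form_expand_ex[OF H(1)] by blast
  then obtain c where c: "\<And>k x. H k x = (\<Sum>\<gamma>\<in>exponents n k. c k \<gamma> * mon_fun {..<n} \<gamma> x)" by metis
  have disj: "\<forall>e\<in>{..t}. \<forall>e'\<in>{..t}. e \<noteq> e' \<longrightarrow> exponents n e \<inter> exponents n e' = {}" by (auto simp: exponents_def)
  have fin: "\<forall>e\<in>{..t}. finite (exponents n e)" by simp
  have "F x = (\<Sum>\<gamma>\<in>(\<Union>e\<le>t. exponents n e). c (\<Sum>i<n. \<gamma> i) \<gamma> * mon_fun {..<n} \<gamma> x)" for x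
    unfolding H(2) c sum.UNION_disjoint[OF finite_atMost fin disj]
    by (intro sum.cong refl) (auto simp: exponents_def)
  thus ?thesis by (intro exI[of _ "\<lambda>\<gamma>. c (\<Sum>i<n. \<gamma> i) \<gamma>"]) blast
qed

text \<open>Over an uncountable field a proper ideal stays proper after adding x_i - r for some r:
  otherwise uncountably many inverses of x_i - r live in a space of countable dimension.\<close>

lemma fn_ideal_extend:
  assumes J: "fn_ideal n J" and proper: "(\<lambda>x. 1) \<notin> J" and i: "i < n"
  shows "\<exists>\<rho>. (\<lambda>x. 1) \<notin> ideal_adjoin n J (\<lambda>x. x i - \<rho>)"
proof (rule ccontr)
  assume "\<not> ?thesis"
  hence all: "(\<lambda>x. 1) \<in> ideal_adjoin n J (\<lambda>x. x i - \<rho>)" for \<rho> by blast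
  have "\<exists>a. poly_fn n a \<and> (\<lambda>x. a x * (x i - \<rho>) - 1) \<in> J" for \<rho>
  proof -
    obtain F a where F: "F \<in> J" "poly_fn n a" "(\<lambda>x. 1) = (\<lambda>x. F x + a x * (x i - \<rho>))"
      using all[of \<rho>] by (auto simp: ideal_adjoin_def)
    have "(\<lambda>x. a x * (x i - \<rho>) - 1) = (\<lambda>x. (-1) * F x)"
    proof
      fix x show "a x * (x i - \<rho>) - 1 = (-1) * F x" using fun_cong[OF F(3), of x] by (simp add: algebra_simps)
    qed
    thus ?thesis using fn_ideal_mult[OF J F(1) poly_fn_const[of n "-1"]] F(2) by auto
  qed
  then obtain a where a: "\<And>\<rho>. poly_fn n (a \<rho>)" "\<And>\<rho>. (\<lambda>x. a \<rho> x * (x i - \<rho>) - 1) \<in> J" by metis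
  \<comment> \<open>The uncountably many \<open>\<rho>\<close> cannot be spread over countably many
    degree bounds with only finitely many for each.\<close>
  obtain t where t: "infinite {\<rho>. deg_le n t (a \<rho>)}"
  proof -
    have "UNIV = (\<Union>t. {\<rho>. deg_le n t (a \<rho>)})" using a(1) by (auto simp: poly_fn_def)
    hence "\<not> (\<forall>t. countable {\<rho>. deg_le n t (a \<rho>)})"
      using uncountable_UNIV_complex by (metis countable_UN countableI_type)
    thus ?thesis using that countable_finite by blast
  qed
  define B where "B = (\<Union>e\<le>t. exponents n e)"
  have fB: "finite B" by (simp add: B_def)
  \<comment> \<open>One element more than there are monomials of degree at most \<open>t\<close>, so
    that the inverses attached to \<open>K\<close> are linearly dependent.\<close>
  obtain K where K: "K \<subseteq> {\<rho>. deg_le n t (a \<rho>)}" "finite K" "card K = Suc (card B)"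
    using infinite_arbitrarily_large[OF t] by blast
  have "\<exists>c. (\<exists>k\<in>K. c k \<noteq> 0) \<and> (\<forall>x. (\<Sum>k\<in>K. c k * a k x) = 0)"
  proof (rule lin_dep[OF K(2) fB])
    show "\<exists>c. \<forall>x. a k x = (\<Sum>b\<in>B. c b * mon_fun {..<n} b x)" if "k \<in> K" for k
      unfolding B_def by (rule deg_le_expand) (use that K(1) in blast)
  qed (use K(3) in simp)
  then obtain c where c: "\<exists>k\<in>K. c k \<noteq> 0" "\<And>x. (\<Sum>k\<in>K. c k * a k x) = 0" by blast
  \<comment> \<open>The relation between the inverses of the \<open>x i - k\<close>, with
    denominators cleared. At a point \<open>k\<close> of \<open>K\<close> only the term of
    \<open>k\<close> survives, so \<open>q\<close> is not 0.\<close>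
  define q where "q = (\<Sum>k\<in>K. Polynomial.smult (c k) (\<Prod>l\<in>K-{k}. [:-l, 1:]))"
  have "(\<lambda>x. \<Sum>k\<in>K. (- c k * (\<Prod>l\<in>K-{k}. (x i - l))) * (a k x * (x i - k) - 1)) \<in> J"
    by (intro fn_ideal_sum[OF J] fn_ideal_mult[OF J a(2)] poly_fn_mult poly_fn_const poly_fn_prod poly_fn_diff poly_fn_coord i)
  moreover have "(\<Sum>k\<in>K. (- c k * (\<Prod>l\<in>K-{k}. (x i - l))) * (a k x * (x i - k) - 1)) = poly q (x i)" for x
  proof -
    have "(\<Sum>k\<in>K. (- c k * (\<Prod>l\<in>K-{k}. (x i - l))) * (a k x * (x i - k) - 1)) =
      (\<Sum>k\<in>K. c k * (\<Prod>l\<in>K-{k}. (x i - l)) - (\<Prod>l\<in>K. (x i - l)) * (c k * a k x))"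
      by (intro sum.cong refl) (simp add: prod.remove[OF K(2)] algebra_simps)
    also have "\<dots> = (\<Sum>k\<in>K. c k * (\<Prod>l\<in>K-{k}. (x i - l)))"
      by (simp add: sum_subtractf sum_distrib_left[symmetric] c(2))
    also have "\<dots> = poly q (x i)" by (simp add: q_def poly_sum poly_prod algebra_simps)
    finally show ?thesis .
  qed
  ultimately have "(\<lambda>x. poly q (x i)) \<in> J" by simp
  moreover have "q \<noteq> 0"
  proof
    assume q0: "q = 0"
    obtain k where k: "k \<in> K" "c k \<noteq> 0" using c by blast
    have "poly q k = (\<Sum>m\<in>K. if m = k then c k * (\<Prod>l\<in>K-{k}. (k - l)) else 0)"
      unfolding q_def poly_sum
    proof (intro sum.cong refl)
      fix m assume "m \<in> K"
      show "poly (Polynomial.smult (c m) (\<Prod>l\<in>K - {m}. [:- l, 1:])) k = (if m = k then c k * (\<Prod>l\<in>K-{k}. (k - l)) else 0)"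
      proof (cases "m = k")
        case False
        have "(\<Prod>l\<in>K-{m}. poly [:- l, 1:] k) = 0"
          by (rule prod_zero) (use K(2) k False in \<open>auto intro!: bexI[of _ k]\<close>)
        thus ?thesis using False by (simp add: poly_prod)
      qed (simp add: poly_prod)
    qed
    also have "\<dots> = c k * (\<Prod>l\<in>K-{k}. (k - l))" using K(2) k by simp
    finally show False using q0 k K(2) by simp
  qed
  ultimately have "(\<lambda>x. 1) \<in> J"
    using fn_ideal_poly_cancel[OF J _ i, of q] a by blast
  thus False using proper by simp
qed

text \<open>Adjoining a suitable \<open>x k - \<rho> k\<close> for each coordinate in turn keeps the
  ideal proper. Modulo the final ideal every polynomial function equals its value at
  \<open>\<rho>\<close>, so a member of \<open>J\<close> that did not vanish at
  \<open>\<rho>\<close> would be a unit.\<close>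

lemma weak_nullstellensatz_fn_ideal:
  assumes J: "fn_ideal n J" and proper: "(\<lambda>x. 1) \<notin> J" and J_poly_fn: "\<And>F. F \<in> J \<Longrightarrow> poly_fn n F"
  shows "\<exists>\<rho>. \<forall>F\<in>J. F \<rho> = 0"
proof -
  have "\<exists>\<rho> J'. fn_ideal n J' \<and> J \<subseteq> J' \<and> (\<lambda>x. 1) \<notin> J' \<and> (\<forall>i<k. (\<lambda>x. x i - \<rho> i) \<in> J')" if "k \<le> n" for k
    using that
  proof (induction k)
    case 0 show ?case using J proper by blast
  next
    case (Suc k)
    then obtain \<rho> J' where *: "fn_ideal n J'" "J \<subseteq> J'" "(\<lambda>x. 1) \<notin> J'" "\<forall>i<k. (\<lambda>x. x i - \<rho> i) \<in> J'" by auto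
    obtain r where r: "(\<lambda>x. 1) \<notin> ideal_adjoin n J' (\<lambda>x. x k - r)"
      using fn_ideal_extend[OF *(1,3), of k] Suc.prems by auto
    show ?case
      by (rule exI[of _ "\<rho>(k := r)"], rule exI[of _ "ideal_adjoin n J' (\<lambda>x. x k - r)"])
        (use * r fn_ideal_ideal_adjoin[OF *(1)] ideal_adjoin_mem[OF *(1), of "\<lambda>x. x k - r"] in \<open>auto intro: ideal_adjoin_sup simp: less_Suc_eq\<close>)
  qed
  then obtain \<rho> J' where *: "fn_ideal n J'" "J \<subseteq> J'" "(\<lambda>x. 1) \<notin> J'" "\<And>i. i < n \<Longrightarrow> (\<lambda>x. x i - \<rho> i) \<in> J'" by blast
  have ev: "(\<lambda>x. F x - F \<rho>) \<in> J'" if "deg_le n t F" for F t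
    using that
  proof (induction rule: deg_le.induct)
    case (deg_le_const t c) show ?case using fn_ideal_zero[OF *(1)] by simp
  next
    case (deg_le_add t F G)
    from fn_ideal_add[OF *(1) deg_le_add.IH] show ?case by (simp add: algebra_simps)
  next
    case (deg_le_var i t F)
    from fn_ideal_add[OF *(1) fn_ideal_mult[OF *(1) deg_le_var.IH poly_fn_coord[OF deg_le_var.hyps(1)]]
        fn_ideal_mult[OF *(1) *(4)[OF deg_le_var.hyps(1)] poly_fn_const[of n "F \<rho>"]]]
    show ?case by (simp add: algebra_simps)
  qed
  have "F \<rho> = 0" if F: "F \<in> J" for F
  proof (rule ccontr)
    assume nz: "F \<rho> \<noteq> 0"
    obtain t where "deg_le n t F" using J_poly_fn[OF F] by (auto simp: poly_fn_def)
    from ev[OF this] have 1: "(\<lambda>x. F x - F \<rho>) \<in> J'" .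
    have 2: "F \<in> J'" using F *(2) by blast
    from fn_ideal_mult[OF *(1) fn_ideal_add[OF *(1) 2 fn_ideal_mult[OF *(1) 1 poly_fn_const[of n "-1"]]] poly_fn_const[of n "inverse (F \<rho>)"]]
    have "(\<lambda>x. 1) \<in> J'" using nz by simp
    thus False using *(3) by simp
  qed
  thus ?thesis by blast
qed

lemma weak_nullstellensatz:
  assumes fin: "finite I" and "\<And>i. i \<in> I \<Longrightarrow> poly_fn n (f i)" "\<And>x. \<exists>i\<in>I. f i x \<noteq> 0"
  shows "\<exists>a. (\<forall>i\<in>I. poly_fn n (a i)) \<and> (\<forall>x. (\<Sum>i\<in>I. a i x * f i x) = 1)"
proof (rule ccontr)
  assume no: "\<not> ?thesis"
  define J where "J = {(\<lambda>x. \<Sum>i\<in>I. a i x * f i x) | a. \<forall>i\<in>I. poly_fn n (a i)}"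
  have "fn_ideal n J" unfolding fn_ideal_def
  proof (intro conjI ballI allI impI)
    show "(\<lambda>x. 0) \<in> J" unfolding J_def
      by (intro CollectI exI[of _ "\<lambda>i x. 0"]) (auto intro: poly_fn_const)
  next
    fix F G assume "F \<in> J" "G \<in> J"
    then obtain a b where 1: "F = (\<lambda>x. \<Sum>i\<in>I. a i x * f i x)" "\<forall>i\<in>I. poly_fn n (a i)"
      "G = (\<lambda>x. \<Sum>i\<in>I. b i x * f i x)" "\<forall>i\<in>I. poly_fn n (b i)" by (auto simp: J_def)
    show "(\<lambda>x. F x + G x) \<in> J" unfolding J_def
      by (intro CollectI exI[of _ "\<lambda>i x. a i x + b i x"]) (use 1 in \<open>auto intro: poly_fn_add simp: sum.distrib algebra_simps\<close>)
  next
    fix F b assume "F \<in> J" "poly_fn n b"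
    then obtain a where 1: "F = (\<lambda>x. \<Sum>i\<in>I. a i x * f i x)" "\<forall>i\<in>I. poly_fn n (a i)" by (auto simp: J_def)
    show "(\<lambda>x. b x * F x) \<in> J" unfolding J_def
      by (intro CollectI exI[of _ "\<lambda>i x. b x * a i x"])
        (use 1 \<open>poly_fn n b\<close> in \<open>auto intro: poly_fn_mult simp: sum_distrib_left algebra_simps\<close>)
  qed
  moreover have "(\<lambda>x. 1) \<notin> J"
  proof
    assume "(\<lambda>x. 1) \<in> J"
    then obtain a where a: "(\<lambda>x. 1) = (\<lambda>x. \<Sum>i\<in>I. a i x * f i x)" "\<forall>i\<in>I. poly_fn n (a i)" by (auto simp: J_def)
    show False using no a(2) fun_cong[OF a(1)] by (auto intro!: exI[of _ a])
  qed
  moreover have "poly_fn n F" if "F \<in> J" for F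
    using that assms(2) by (auto simp: J_def intro!: poly_fn_sum poly_fn_mult)
  ultimately obtain \<rho> where \<rho>: "\<And>F. F \<in> J \<Longrightarrow> F \<rho> = 0"
    using weak_nullstellensatz_fn_ideal[of n J] by blast
  obtain i where i: "i \<in> I" "f i \<rho> \<noteq> 0" using assms(3) by blast
  have "(\<lambda>x. \<Sum>j\<in>I. (if j = i then 1 else 0) * f j x) \<in> J" unfolding J_def
    by (intro CollectI exI[of _ "\<lambda>j x. if j = i then 1 else 0"]) (auto intro: poly_fn_const)
  from \<rho>[OF this] have "(\<Sum>j\<in>I. (if j = i then 1 else 0) * f j \<rho>) = 0" .
  moreover have "(\<Sum>j\<in>I. (if j = i then 1 else 0) * f j \<rho>) = (\<Sum>j\<in>I. if j = i then f i \<rho> else 0)"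
    by (rule sum.cong) auto
  ultimately have "(\<Sum>j\<in>I. if j = i then f i \<rho> else 0) = 0" by (simp only:)
  thus False using i fin by simp
qed

text \<open>Homogenising a Bezout identity on the chart x_j = 1.\<close>

lemma graded_nullstellensatz_coord:
  assumes I: "finite I" and f: "\<And>i. i \<in> I \<Longrightarrow> hom_form n (e i) (f i)"
    and triv: "\<And>x. (\<forall>i\<in>I. f i x = 0) \<Longrightarrow> x j = 0" and j: "j < n"
  shows "\<exists>M>0. \<forall>M'\<ge>M. \<exists>a. (\<forall>i\<in>I. e i \<le> M' \<and> hom_form n (M' - e i) (a i)) \<and> (\<forall>x. x j ^ M' = (\<Sum>i\<in>I. a i x * f i x))"
proof -
  \<comment> \<open>The added equation \<open>x j = 1\<close> contradicts the others, whose common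
    zeros have \<open>x j = 0\<close>.\<close>
  define g where "g k = (case k of None \<Rightarrow> (\<lambda>x. x j - 1) | Some i \<Rightarrow> f i)" for k
  have "\<exists>a. (\<forall>k\<in>insert None (Some ` I). poly_fn n (a k)) \<and> (\<forall>x. (\<Sum>k\<in>insert None (Some ` I). a k x * g k x) = 1)"
  proof (rule weak_nullstellensatz)
    show "poly_fn n (g k)" if "k \<in> insert None (Some ` I)" for k
      using that f poly_fn_diff[OF poly_fn_coord[OF j] poly_fn_const[of n 1]] by (auto simp: g_def intro: poly_fn_hom_form[OF f])
    show "\<exists>k\<in>insert None (Some ` I). g k x \<noteq> 0" for x
      using triv[of x] by (cases "\<forall>i\<in>I. f i x = 0") (auto simp: g_def)
  qed (use I in auto)
  then obtain a where a: "\<And>i. i \<in> I \<Longrightarrow> poly_fn n (a (Some i))"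
    "\<And>x. a None x * (x j - 1) + (\<Sum>i\<in>I. a (Some i) x * f i x) = 1"
    using I by (auto simp: g_def sum.reindex)
  have "\<forall>i\<in>I. \<exists>t. deg_le n t (a (Some i))" using a(1) by (auto simp: poly_fn_def)
  then obtain t where t: "\<And>i. i \<in> I \<Longrightarrow> deg_le n (t i) (a (Some i))" by metis
  define T where "T = (\<Sum>i\<in>I. t i)"
  have "deg_le n T (a (Some i))" if "i \<in> I" for i
    by (rule deg_le_mono[OF t[OF that]]) (use that I in \<open>auto simp: T_def intro: member_le_sum\<close>)
  hence "\<forall>i\<in>I. \<exists>H. (\<forall>k. hom_form n k (H k)) \<and> a (Some i) = (\<lambda>x. \<Sum>k\<le>T. H k x)"
    using deg_le_hom_form_components by blast
  then obtain A where A: "\<And>i k. i \<in> I \<Longrightarrow> hom_form n k (A i k)" "\<And>i x. i \<in> I \<Longrightarrow> a (Some i) x = (\<Sum>k\<le>T. A i k x)"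
    by metis
  \<comment> \<open>Large enough to make all exponents \<open>M' - e i - k\<close> positive, which
    settles the identity where \<open>x j = 0\<close>; elsewhere the point is rescaled to
    \<open>x j = 1\<close>.\<close>
  define M where "M = Suc (T + (\<Sum>i\<in>I. e i))"
  show ?thesis
  proof (intro exI[of _ M] conjI allI impI)
    fix M' assume M': "M \<le> M'"
    have eM: "e i + k < M'" if "i \<in> I" "k \<le> T" for i k
      using that I M' member_le_sum[of i I e] by (auto simp: M_def)
    define a' where "a' i x = (\<Sum>k\<le>T. x j ^ (M' - e i - k) * A i k x)" for i x
    have 1: "e i \<le> M' \<and> hom_form n (M' - e i) (a' i)" if i: "i \<in> I" for i
    proof
      show "e i \<le> M'" using eM[OF i, of 0] by simp
      show "hom_form n (M' - e i) (a' i)" unfolding a'_def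
      proof (rule hom_form_sum)
        fix k assume "k \<in> {..T}"
        have "hom_form n ((M' - e i - k) * 1 + k) (\<lambda>x. x j ^ (M' - e i - k) * A i k x)"
          by (intro hom_form_mult hom_form_power hom_form_coord j A i)
        thus "hom_form n (M' - e i) (\<lambda>x. x j ^ (M' - e i - k) * A i k x)"
          using eM[OF i, of k] \<open>k \<in> {..T}\<close> by simp
      qed
    qed
    have 2: "x j ^ M' = (\<Sum>i\<in>I. a' i x * f i x)" for x
    proof (cases "x j = 0")
      case True
      have "a' i x = 0" if i: "i \<in> I" for i
        unfolding a'_def
      proof (intro sum.neutral ballI)
        fix k assume "k \<in> {..T}"
        hence "M' - e i - k > 0" using eM[OF i, of k] by simp
        thus "x j ^ (M' - e i - k) * A i k x = 0" using True by simp
      qed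
      moreover have "M' > 0" using M' by (simp add: M_def)
      ultimately show ?thesis using True by (simp add: power_0_left)
    next
      case False
      let ?c = "inverse (x j)"
      have "1 = (\<Sum>i\<in>I. a (Some i) (\<lambda>l. ?c * x l) * f i (\<lambda>l. ?c * x l))"
        using a(2)[of "\<lambda>l. ?c * x l"] False by simp
      also have "\<dots> = (\<Sum>i\<in>I. (\<Sum>k\<le>T. ?c ^ k * A i k x) * (?c ^ e i * f i x))"
        by (intro sum.cong refl) (simp add: A(2) hom_form_scale[OF A(1)] hom_form_scale[OF f])
      finally have "x j ^ M' = x j ^ M' * (\<Sum>i\<in>I. (\<Sum>k\<le>T. ?c ^ k * A i k x) * (?c ^ e i * f i x))" by simp
      also have "\<dots> = (\<Sum>i\<in>I. \<Sum>k\<le>T. (x j ^ M' * ?c ^ k * ?c ^ e i) * A i k x * f i x)"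
        by (simp add: sum_distrib_left sum_distrib_right mult_ac)
      also have "\<dots> = (\<Sum>i\<in>I. \<Sum>k\<le>T. x j ^ (M' - e i - k) * A i k x * f i x)"
      proof (intro sum.cong refl)
        fix i k assume ik: "i \<in> I" "k \<in> {..T}"
        have "x j ^ M' = x j ^ (M' - e i - k) * (x j ^ k * x j ^ e i)"
          using eM[of i k] ik by (simp add: power_add[symmetric])
        hence "x j ^ M' * ?c ^ k * ?c ^ e i = x j ^ (M' - e i - k)"
          using False by (simp add: power_inverse field_simps)
        thus "x j ^ M' * ?c ^ k * ?c ^ e i * A i k x * f i x = x j ^ (M' - e i - k) * A i k x * f i x" by simp
      qed
      also have "\<dots> = (\<Sum>i\<in>I. a' i x * f i x)" by (simp add: a'_def sum_distrib_right)
      finally show ?thesis .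
    qed
    show "\<exists>a. (\<forall>i\<in>I. e i \<le> M' \<and> hom_form n (M' - e i) (a i)) \<and> (\<forall>x. x j ^ M' = (\<Sum>i\<in>I. a i x * f i x))"
      using 1 2 by (intro exI[of _ a']) blast
  qed (simp add: M_def)
qed

text \<open>Each coordinate admits all large exponents, so a common one exists.\<close>

lemma graded_nullstellensatz:
  assumes I: "finite I" and f: "\<And>i. i \<in> I \<Longrightarrow> hom_form n (e i) (f i)"
    and triv: "\<And>x j. (\<forall>i\<in>I. f i x = 0) \<Longrightarrow> j < n \<Longrightarrow> x j = 0"
  shows "\<exists>M>0. \<forall>j<n. \<exists>a. (\<forall>i\<in>I. e i \<le> M \<and> hom_form n (M - e i) (a i)) \<and> (\<forall>x. x j ^ M = (\<Sum>i\<in>I. a i x * f i x))"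
proof -
  define R where "R j M' \<longleftrightarrow> (\<exists>a. (\<forall>i\<in>I. e i \<le> M' \<and> hom_form n (M' - e i) (a i)) \<and> (\<forall>x. x j ^ M' = (\<Sum>i\<in>I. a i x * f i x)))" for j M'
  have "\<forall>j. \<exists>M>0. j < n \<longrightarrow> (\<forall>M'\<ge>M. R j M')"
  proof
    fix j
    show "\<exists>M>0. j < n \<longrightarrow> (\<forall>M'\<ge>M. R j M')"
    proof (cases "j < n")
      case True
      have "\<exists>M>0. \<forall>M'\<ge>M. R j M'"
        unfolding R_def using True by (intro graded_nullstellensatz_coord I) (auto intro: f triv)
      thus ?thesis by blast
    qed blast
  qed
  then obtain M where M: "\<And>j. M j > (0::nat)" "\<And>j M'. j < n \<Longrightarrow> M' \<ge> M j \<Longrightarrow> R j M'"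
    by metis
  show ?thesis
  proof (intro exI[of _ "Suc (\<Sum>j<n. M j)"] conjI allI impI)
    fix j assume j: "j < n"
    hence "M j \<le> (\<Sum>j<n. M j)" by (intro member_le_sum) auto
    thus "\<exists>a. (\<forall>i\<in>I. e i \<le> Suc (\<Sum>j<n. M j) \<and> hom_form n (Suc (\<Sum>j<n. M j) - e i) (a i)) \<and> (\<forall>x. x j ^ Suc (\<Sum>j<n. M j) = (\<Sum>i\<in>I. a i x * f i x))"
      unfolding R_def[symmetric] by (intro M j) simp
  qed simp
qed

section \<open>Common zeros by counting polynomials of bounded degree\<close>

lemma mon_fun_family_independent:
  fixes n :: nat
  assumes "finite \<Gamma>" "\<And>\<gamma> i. \<gamma> \<in> \<Gamma> \<Longrightarrow> i \<ge> n \<Longrightarrow> \<gamma> i = 0"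
  shows "fv.independent (mon_fun {..<n} ` \<Gamma>)" "inj_on (mon_fun {..<n}) \<Gamma>"
proof -
  have ext: "\<gamma> = \<delta>" if "\<gamma> \<in> \<Gamma>" "\<delta> \<in> \<Gamma>" "\<forall>i\<in>{..<n}. \<gamma> i = \<delta> i" for \<gamma> \<delta>
  proof
    fix i show "\<gamma> i = \<delta> i"
      using that(3) assms(2)[OF that(1), of i] assms(2)[OF that(2), of i] by (cases "i < n") simp_all
  qed
  show inj: "inj_on (mon_fun {..<n}) \<Gamma>"
  proof (rule inj_onI, rule ccontr)
    fix \<gamma> \<delta> assume *: "\<gamma> \<in> \<Gamma>" "\<delta> \<in> \<Gamma>" "mon_fun {..<n} \<gamma> = mon_fun {..<n} \<delta>" "\<gamma> \<noteq> \<delta>"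
    have "(if \<gamma> = \<gamma> then 1 else -1 :: complex) = 0"
    proof (rule mon_fun_independent[of "{..<n}" "{\<gamma>,\<delta>}" \<gamma> "\<lambda>k. if k = \<gamma> then 1 else -1"])
      show "(\<Sum>k\<in>{\<gamma>,\<delta>}. (if k = \<gamma> then 1 else -1) * mon_fun {..<n} k x) = 0" for x
        using * by auto
    qed (use * ext in auto)
    thus False by simp
  qed
  show "fv.independent (mon_fun {..<n} ` \<Gamma>)"
  proof (subst fv.dependent_finite)
    show "\<not> (\<exists>u. (\<exists>v\<in>mon_fun {..<n} ` \<Gamma>. u v \<noteq> 0) \<and> (\<Sum>v\<in>mon_fun {..<n} ` \<Gamma>. (\<lambda>x. u v * v x)) = 0)"
    proof (intro notI, elim exE conjE bexE)
      fix u v assume u: "v \<in> mon_fun {..<n} ` \<Gamma>" "u v \<noteq> 0" "(\<Sum>v\<in>mon_fun {..<n} ` \<Gamma>. (\<lambda>x. u v * v x)) = 0"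
      obtain \<gamma> where \<gamma>: "\<gamma> \<in> \<Gamma>" "v = mon_fun {..<n} \<gamma>" using u(1) by blast
      have "u (mon_fun {..<n} \<gamma>) = 0"
      proof (rule mon_fun_independent[of "{..<n}" \<Gamma> \<gamma> "\<lambda>\<delta>. u (mon_fun {..<n} \<delta>)"])
        show "(\<Sum>\<delta>\<in>\<Gamma>. u (mon_fun {..<n} \<delta>) * mon_fun {..<n} \<delta> x) = 0" for x
          using fun_cong[OF u(3), of x] by (simp add: sum_fun_apply sum.reindex[OF inj])
      qed (use assms(1) \<gamma> ext in auto)
      thus False using u(2) \<gamma>(2) by simp
    qed
  qed (use assms(1) in simp)
qed

definition weight_support :: "nat \<Rightarrow> (nat \<Rightarrow> nat) set" where
  "weight_support s = {\<alpha>. \<forall>i\<ge>s. \<alpha> i = 0}"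

definition weight :: "nat \<Rightarrow> (nat \<Rightarrow> nat) \<Rightarrow> (nat \<Rightarrow> nat) \<Rightarrow> nat" where
  "weight s e \<alpha> = (\<Sum>i<s. \<alpha> i * e i)"

lemma weight_upd: "i < s \<Longrightarrow> weight s e (\<alpha>(i := Suc (\<alpha> i))) = weight s e \<alpha> + e i"
  unfolding weight_def by (simp add: sum.remove[of "{..<s}" i] algebra_simps)

text \<open>Indexes the products of a monomial f^\<alpha>, whose degree is
  \<open>weight s e \<alpha>\<close>, with a function \<open>h b\<close> that is allowed in the
  remaining degree.\<close>

definition weight_index :: "nat \<Rightarrow> (nat \<Rightarrow> nat) \<Rightarrow> (nat \<Rightarrow> 'b set) \<Rightarrow> nat \<Rightarrow> ((nat \<Rightarrow> nat) \<times> 'b) set" where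
  "weight_index s e B t = {(\<alpha>, b). \<alpha> \<in> weight_support s \<and> weight s e \<alpha> \<le> t \<and> b \<in> B (t - weight s e \<alpha>)}"

text \<open>The coefficients \<open>a i\<close> that \<open>step\<close> produces have smaller
  degree, because \<open>e i > 0\<close>; hence \<open>step\<close> can be applied to them again
  until only remainders in the span of \<open>h\<close> are left.\<close>

lemma filtered_span:
  fixes h :: "'b \<Rightarrow> cvec \<Rightarrow> complex"
  assumes e: "\<And>i. i < s \<Longrightarrow> e i > 0"
    and step: "\<And>t F. deg_le n t F \<Longrightarrow> \<exists>b a. b \<in> fv.span (h ` B t) \<and>
      (\<forall>i<s. a i = (\<lambda>x. 0) \<or> e i \<le> t \<and> deg_le n (t - e i) (a i)) \<and> (\<forall>x. F x = b x + (\<Sum>i<s. a i x * f i x))"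
    and F: "deg_le n t F"
  shows "F \<in> fv.span ((\<lambda>(\<alpha>, b) x. mon_fun {..<s} \<alpha> (\<lambda>i. f i x) * h b x) ` weight_index s e B t)"
  using F
proof (induction t arbitrary: F rule: less_induct)
  case (less t)
  let ?g = "\<lambda>(\<alpha>, b) x. mon_fun {..<s} \<alpha> (\<lambda>i. f i x) * h b x"
  obtain b a where ba: "b \<in> fv.span (h ` B t)" "\<forall>i<s. a i = (\<lambda>x. 0) \<or> e i \<le> t \<and> deg_le n (t - e i) (a i)"
    "\<And>x. F x = b x + (\<Sum>i<s. a i x * f i x)" using step[OF less.prems] by blast
  have "h ` B t \<subseteq> ?g ` weight_index s e B t"
  proof clarify
    fix c assume "c \<in> B t"
    hence "((\<lambda>_. 0), c) \<in> weight_index s e B t" by (auto simp: weight_index_def weight_support_def weight_def)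
    moreover have "h c = ?g ((\<lambda>_. 0), c)" by (simp add: mon_fun_def)
    ultimately show "h c \<in> ?g ` weight_index s e B t" by blast
  qed
  hence 1: "b \<in> fv.span (?g ` weight_index s e B t)" using ba(1) fv.span_mono by blast
  have 2: "(\<lambda>x. a i x * f i x) \<in> fv.span (?g ` weight_index s e B t)" if i: "i < s" for i
  proof (cases "a i = (\<lambda>x. 0)")
    case True
    thus ?thesis using fv.span_zero by (simp add: zero_fun_def)
  next
    case False
    hence ai: "e i \<le> t" "deg_le n (t - e i) (a i)" using ba(2) i by auto
    have "t - e i < t" using ai(1) e[OF i] by simp
    from less.IH[OF this ai(2)] have "a i \<in> fv.span (?g ` weight_index s e B (t - e i))" .
    thus ?thesis
    proof (induction rule: fv.span_induct_alt)
      case base show ?case using fv.span_zero by (simp add: zero_fun_def)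
    next
      case (step c v w)
      obtain \<alpha> b where v: "v = ?g (\<alpha>, b)" "(\<alpha>, b) \<in> weight_index s e B (t - e i)" using step(1) by auto
      have "(\<alpha>(i := Suc (\<alpha> i)), b) \<in> weight_index s e B t"
        using v(2) ai(1) i weight_upd[OF i, of e \<alpha>] by (auto simp: weight_index_def weight_support_def algebra_simps)
      moreover have "(\<lambda>x. v x * f i x) = ?g (\<alpha>(i := Suc (\<alpha> i)), b)"
        by (auto simp: v mon_fun_upd[OF i] algebra_simps)
      ultimately have "(\<lambda>x. v x * f i x) \<in> ?g ` weight_index s e B t"
        by (intro image_eqI)
      hence "(\<lambda>x. v x * f i x) \<in> fv.span (?g ` weight_index s e B t)" by (rule fv.span_base)
      from fv.span_add[OF fv.span_scale[OF this, of c] step(2)]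
      show ?case by (simp add: plus_fun_def algebra_simps)
    qed
  qed
  have "F = b + (\<Sum>i<s. (\<lambda>x. a i x * f i x))" by (rule ext) (simp add: ba(3) sum_fun_apply)
  also have "\<dots> \<in> fv.span (?g ` weight_index s e B t)"
    by (intro fv.span_add 1 fv.span_sum 2) auto
  finally show ?case .
qed

definition box :: "nat \<Rightarrow> nat \<Rightarrow> (nat \<Rightarrow> nat) set" where
  "box n M = {\<gamma>. (\<forall>j\<ge>n. \<gamma> j = 0) \<and> (\<forall>j<n. \<gamma> j < M)}"

lemma bij_box: "bij_betw (\<lambda>g i. if i < n then g i else 0) (PiE {..<n} (\<lambda>_. {..<M})) (box n M)"
proof (rule bij_betw_byWitness[where f' = "\<lambda>g. restrict g {..<n}"])
  show "\<forall>g\<in>PiE {..<n} (\<lambda>_. {..<M}). restrict (\<lambda>i. if i < n then g i else 0) {..<n} = g"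
    by (auto simp: PiE_def extensional_def restrict_def)
  show "\<forall>g\<in>box n M. (\<lambda>i. if i < n then restrict g {..<n} i else 0) = g"
    by (auto simp: box_def)
  show "(\<lambda>g i. if i < n then g i else 0) ` PiE {..<n} (\<lambda>_. {..<M}) \<subseteq> box n M"
    by (auto simp: box_def PiE_def Pi_def)
  show "(\<lambda>g. restrict g {..<n}) ` box n M \<subseteq> PiE {..<n} (\<lambda>_. {..<M})"
    by (auto simp: box_def PiE_def extensional_def)
qed

lemma finite_box [simp]: "finite (box n M)" and card_box: "card (box n M) = M ^ n"
proof -
  show "finite (box n M)" using bij_betw_finite[OF bij_box[of n M]] finite_PiE[of "{..<n}" "\<lambda>_. {..<M}"] by simp
  show "card (box n M) = M ^ n" using bij_betw_same_card[OF bij_box[of n M]] by (simp add: card_PiE)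
qed

lemma deg_le_span_monos:
  assumes "deg_le n t F"
  shows "F \<in> fv.span (mon_fun {..<n} ` (\<Union>e\<le>t. exponents n e))"
proof -
  obtain c where c: "\<And>x. F x = (\<Sum>\<gamma>\<in>(\<Union>e\<le>t. exponents n e). c \<gamma> * mon_fun {..<n} \<gamma> x)"
    using deg_le_expand[OF assms] by blast
  have "F = (\<Sum>\<gamma>\<in>(\<Union>e\<le>t. exponents n e). (\<lambda>x. c \<gamma> * mon_fun {..<n} \<gamma> x))"
    by (rule ext) (simp add: c sum_fun_apply)
  also have "\<dots> \<in> fv.span (mon_fun {..<n} ` (\<Union>e\<le>t. exponents n e))"
    by (intro fv.span_sum fv.span_scale fv.span_base) blast
  finally show ?thesis .
qed

text \<open>Without such a zero, some powers \<open>x j ^ M\<close> lie in the ideal of the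
  \<open>f i\<close>, and all polynomials are spanned by monomials in the \<open>f i\<close> times
  finitely many fixed monomials. Up to degree \<open>T\<close> there are at most a constant times
  T^s such products, too few for the polynomials in s + 1 variables, whose number grows like
  T^(s+1).\<close>

theorem forms_common_zero:
  assumes f: "\<And>i. i < s \<Longrightarrow> hom_form (Suc s) (e i) (f i)" and e: "\<And>i. i < s \<Longrightarrow> e i > 0"
  shows "\<exists>x. (\<exists>j\<le>s. x j \<noteq> 0) \<and> (\<forall>i<s. f i x = 0)"
proof (rule ccontr)
  assume no: "\<not> ?thesis"
  let ?n = "Suc s"
  have "\<exists>M>0. \<forall>j<?n. \<exists>a. (\<forall>i\<in>{..<s}. e i \<le> M \<and> hom_form ?n (M - e i) (a i)) \<and> (\<forall>x. x j ^ M = (\<Sum>i\<in>{..<s}. a i x * f i x))"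
    by (rule graded_nullstellensatz) (use f no in \<open>auto simp: less_Suc_eq_le\<close>)
  then obtain M where M: "M > 0" "\<And>j. j < ?n \<Longrightarrow> \<exists>a. (\<forall>i<s. e i \<le> M \<and> hom_form ?n (M - e i) (a i)) \<and> (\<forall>x. x j ^ M = (\<Sum>i<s. a i x * f i x))"
    unfolding Ball_def lessThan_iff by blast
  define B where "B t = box ?n M" for t :: nat
  let ?h = "mon_fun {..<?n}"
  let ?rep = "\<lambda>t F. \<exists>b a. b \<in> fv.span (?h ` B t) \<and>
      (\<forall>i<s. a i = (\<lambda>x. 0) \<or> e i \<le> t \<and> deg_le ?n (t - e i) (a i)) \<and> (\<forall>x. F x = b x + (\<Sum>i<s. a i x * f i x))"
  \<comment> \<open>A monomial outside the box contains some \<open>x j ^ M\<close>, which is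
    replaced by its expression in the \<open>f i\<close>.\<close>
  have rep_mono: "?rep t (?h \<gamma>)" if \<gamma>: "\<gamma> \<in> exponents ?n k" "k \<le> t" for \<gamma> k t
  proof (cases "\<forall>j<?n. \<gamma> j < M")
    case True
    hence "\<gamma> \<in> B t" using \<gamma> by (auto simp: B_def box_def exponents_def)
    thus ?thesis by (intro exI[of _ "?h \<gamma>"] exI[of _ "\<lambda>i x. 0"]) (auto intro: fv.span_base)
  next
    case False
    then obtain j where j: "j < ?n" "\<gamma> j \<ge> M" by (auto simp: not_less)
    define \<gamma>' where "\<gamma>' = \<gamma>(j := \<gamma> j - M)"
    have sg: "(\<Sum>i<?n. \<gamma> i) = \<gamma> j + (\<Sum>i\<in>{..<?n}-{j}. \<gamma> i)" using j by (subst sum.remove[of _ j]) auto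
    have "(\<Sum>i<?n. \<gamma>' i) = \<gamma> j - M + (\<Sum>i\<in>{..<?n}-{j}. \<gamma> i)"
      using j by (subst sum.remove[of _ j]) (auto simp: \<gamma>'_def)
    hence g': "\<gamma>' \<in> exponents ?n (k - M)" and kM: "M \<le> k"
      using \<gamma>(1) j sg unfolding exponents_def by (auto simp: \<gamma>'_def)
    have hg: "?h \<gamma> x = x j ^ M * ?h \<gamma>' x" for x
    proof -
      have "?h \<gamma> x = x j ^ \<gamma> j * (\<Prod>i\<in>{..<?n}-{j}. x i ^ \<gamma> i)" unfolding mon_fun_def using j by (subst prod.remove[of _ j]) auto
      moreover have "?h \<gamma>' x = x j ^ (\<gamma> j - M) * (\<Prod>i\<in>{..<?n}-{j}. x i ^ \<gamma> i)"
        unfolding mon_fun_def using j by (subst prod.remove[of _ j]) (auto simp: \<gamma>'_def)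
      ultimately show ?thesis using j(2) by (simp add: power_add[symmetric] mult.assoc[symmetric])
    qed
    obtain a where a: "\<And>i. i < s \<Longrightarrow> e i \<le> M \<and> hom_form ?n (M - e i) (a i)" "\<And>x. x j ^ M = (\<Sum>i<s. a i x * f i x)"
      using M(2)[OF j(1)] by blast
    have "e i \<le> t \<and> deg_le ?n (t - e i) (\<lambda>x. a i x * ?h \<gamma>' x)" if i: "i < s" for i
    proof
      show "e i \<le> t" using a(1)[OF i] kM \<gamma>(2) by simp
      have "deg_le ?n (M - e i + (k - M)) (\<lambda>x. a i x * ?h \<gamma>' x)"
        using a(1)[OF i] hom_form_mon_fun[OF g'] by (intro deg_le_mult hom_form_imp_deg_le) auto
      thus "deg_le ?n (t - e i) (\<lambda>x. a i x * ?h \<gamma>' x)"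
        by (rule deg_le_mono) (use a(1)[OF i] kM \<gamma>(2) in simp)
    qed
    thus ?thesis
      by (intro exI[of _ "\<lambda>x. 0"] exI[of _ "\<lambda>i x. a i x * ?h \<gamma>' x"])
        (use fv.span_zero in \<open>auto simp: hg a(2) sum_distrib_right sum_distrib_left mult_ac zero_fun_def\<close>)
  qed
  have rep: "?rep t F" if "deg_le ?n t F" for t F
    using deg_le_span_monos[OF that]
  proof (induction rule: fv.span_induct_alt)
    case base
    show ?case by (intro exI[of _ "\<lambda>x. 0"] exI[of _ "\<lambda>i x. 0"]) (use fv.span_zero in \<open>auto simp: zero_fun_def\<close>)
  next
    case (step c v w)
    obtain b1 a1 where 1: "b1 \<in> fv.span (?h ` B t)" "\<forall>i<s. a1 i = (\<lambda>x. 0) \<or> e i \<le> t \<and> deg_le ?n (t - e i) (a1 i)"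
      "\<And>x. v x = b1 x + (\<Sum>i<s. a1 i x * f i x)" using step(1) rep_mono by blast
    obtain b2 a2 where 2: "b2 \<in> fv.span (?h ` B t)" "\<forall>i<s. a2 i = (\<lambda>x. 0) \<or> e i \<le> t \<and> deg_le ?n (t - e i) (a2 i)"
      "\<And>x. w x = b2 x + (\<Sum>i<s. a2 i x * f i x)" using step(2) by blast
    have "(\<lambda>x. c * a1 i x + a2 i x) = (\<lambda>x. 0) \<or> e i \<le> t \<and> deg_le ?n (t - e i) (\<lambda>x. c * a1 i x + a2 i x)" if i: "i < s" for i
    proof -
      consider "a1 i = (\<lambda>x. 0) \<and> a2 i = (\<lambda>x. 0)" | "e i \<le> t \<and> deg_le ?n (t - e i) (a1 i) \<and> deg_le ?n (t - e i) (a2 i)"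
        using 1(2)[rule_format, OF i] 2(2)[rule_format, OF i] deg_le_const[of ?n "t - e i" 0] by (elim disjE) simp_all
      thus ?thesis by cases (auto intro: deg_le_add deg_le_cmult)
    qed
    moreover have "(\<lambda>x. c * b1 x + b2 x) \<in> fv.span (?h ` B t)"
      using fv.span_add[OF fv.span_scale[OF 1(1), of c] 2(1)] by (simp add: plus_fun_def)
    ultimately show ?case
      by (intro exI[of _ "\<lambda>x. c * b1 x + b2 x"] exI[of _ "\<lambda>i x. c * a1 i x + a2 i x"])
        (auto simp: 1(3) 2(3) algebra_simps sum.distrib sum_distrib_left)
  qed
  \<comment> \<open>\<open>T\<close> bounds the degree of the monomials with exponents at most
    \<open>K\<close>, and \<open>K\<close> is chosen to turn the comparison of dimensions into
    \<open>Suc K * Suc K ^ s \<le> K * Suc K ^ s\<close>.\<close>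
  define K where "K = Suc s ^ s * M ^ Suc s"
  define T where "T = Suc s * K"
  let ?g = "\<lambda>(\<alpha>, b) x. mon_fun {..<s} \<alpha> (\<lambda>i. f i x) * ?h b x"
  have sub: "weight_index s e B T \<subseteq> box s (Suc T) \<times> box ?n M"
  proof
    fix p assume "p \<in> weight_index s e B T"
    then obtain \<alpha> b where p: "p = (\<alpha>, b)" "\<alpha> \<in> weight_support s" "weight s e \<alpha> \<le> T" "b \<in> box ?n M" by (auto simp: weight_index_def B_def)
    have "\<alpha> i \<le> T" if "i < s" for i
    proof -
      have "\<alpha> i \<le> \<alpha> i * e i" using e[OF that] by simp
      also have "\<dots> \<le> weight s e \<alpha>" unfolding weight_def using that by (intro member_le_sum) auto
      finally show ?thesis using p(3) by simp
    qed
    thus "p \<in> box s (Suc T) \<times> box ?n M" using p by (auto simp: box_def weight_support_def less_Suc_eq_le)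
  qed
  have fin: "finite (weight_index s e B T)" by (rule finite_subset[OF sub]) simp
  have sp: "mon_fun {..<?n} ` box ?n (Suc K) \<subseteq> fv.span (?g ` weight_index s e B T)"
  proof clarify
    fix \<gamma> assume g: "\<gamma> \<in> box ?n (Suc K)"
    have "(\<Sum>i<?n. \<gamma> i) \<le> (\<Sum>i<?n. K)" by (intro sum_mono) (use g in \<open>auto simp: box_def less_Suc_eq_le\<close>)
    hence le: "(\<Sum>i<?n. \<gamma> i) \<le> T" by (simp add: T_def)
    have "\<gamma> \<in> exponents ?n (\<Sum>i<?n. \<gamma> i)" using g by (auto simp: exponents_def box_def)
    hence "deg_le ?n T (mon_fun {..<?n} \<gamma>)" by (rule deg_le_mono[OF hom_form_imp_deg_le[OF hom_form_mon_fun] le])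
    from filtered_span[OF e rep this] show "mon_fun {..<?n} \<gamma> \<in> fv.span (?g ` weight_index s e B T)" .
  qed
  have cb: "card (mon_fun {..<?n} ` box ?n (Suc K)) = Suc K ^ ?n"
  proof (subst card_image)
    show "inj_on (mon_fun {..<?n}) (box ?n (Suc K))"
      by (rule mon_fun_family_independent(2)[OF finite_box]) (auto simp: box_def)
  qed (rule card_box)
  have ind: "fv.independent (mon_fun {..<?n} ` box ?n (Suc K))"
    by (rule mon_fun_family_independent(1)[OF finite_box]) (simp add: box_def)
  have "card (mon_fun {..<?n} ` box ?n (Suc K)) \<le> card (?g ` weight_index s e B T)"
    using fv.independent_span_bound[OF finite_imageI[OF fin] ind sp] by (rule conjunct2)
  also have "\<dots> \<le> card (weight_index s e B T)" by (rule card_image_le[OF fin])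
  also have "\<dots> \<le> card (box s (Suc T) \<times> box ?n M)" by (rule card_mono[OF _ sub]) simp
  also have "\<dots> = Suc T ^ s * M ^ ?n" by (simp add: card_cartesian_product card_box)
  finally have X: "Suc K ^ ?n \<le> Suc T ^ s * M ^ ?n"
    unfolding cb .
  have "Suc T ^ s \<le> (Suc s * Suc K) ^ s" by (intro power_mono) (auto simp: T_def)
  from order_trans[OF X mult_le_mono1[OF this]]
  have "Suc K ^ ?n \<le> (Suc s * Suc K) ^ s * M ^ ?n" .
  also have "\<dots> = K * Suc K ^ s"
    unfolding K_def power_mult_distrib by (simp only: mult_ac)
  finally have "Suc K * Suc K ^ s \<le> K * Suc K ^ s" by (simp only: power_Suc)
  thus False by simp
qed

section \<open>Families of forms of high rank\<close>

definition lin :: "nat \<Rightarrow> cvec \<Rightarrow> cvec \<Rightarrow> complex" where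
  "lin s \<alpha> x = (\<Sum>b<s. \<alpha> b * x b)"

lemma lin_unit: "i < s \<Longrightarrow> lin s (\<lambda>b. if b = i then 1 else 0) x = x i"
  unfolding lin_def by (simp add: if_distrib[of "\<lambda>c. c * _"] cong: if_cong)

text \<open>The e-th powers of linear forms span the forms of degree e; this is the dual formulation.\<close>

lemma power_span_dual:
  fixes \<Lambda> :: "(cvec \<Rightarrow> complex) \<Rightarrow> complex"
  assumes add: "\<And>F G. \<Lambda> (\<lambda>x. F x + G x) = \<Lambda> F + \<Lambda> G" and cm: "\<And>c F. \<Lambda> (\<lambda>x. c * F x) = c * \<Lambda> F"
    and pow: "\<And>\<alpha>. \<Lambda> (\<lambda>x. lin s \<alpha> x ^ e) = 0" and h: "hom_form s e h"
  shows "\<Lambda> h = 0"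
proof -
  have z: "\<Lambda> (\<lambda>x. 0) = 0" using cm[of 0 "\<lambda>x. 0"] by simp
  have sm: "\<Lambda> (\<lambda>x. \<Sum>i\<in>I. F i x) = (\<Sum>i\<in>I. \<Lambda> (F i))" for I :: "nat set" and F
    by (induction I rule: infinite_finite_induct) (auto simp: z add)
  \<comment> \<open>Polarisation: starting from powers of one linear form, the factors in
    \<open>bs\<close> are split off one at a time.\<close>
  have 1: "\<Lambda> (\<lambda>x. lin s \<alpha> x ^ (e - length bs) * (\<Prod>\<beta>\<leftarrow>bs. lin s \<beta> x)) = 0" if "length bs \<le> e" for \<alpha> bs
    using that
  proof (induction bs arbitrary: \<alpha>)
    case Nil thus ?case using pow by simp
  next
    case (Cons \<beta> bs)
    define k where "k = e - length bs"
    have k: "k > 0" "e - length (\<beta> # bs) = k - 1" using Cons.prems by (auto simp: k_def)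
    let ?P = "\<lambda>x. \<Prod>\<beta>\<leftarrow>bs. lin s \<beta> x"
    let ?c = "\<lambda>j. of_nat (k choose j) * \<Lambda> (\<lambda>x. lin s \<beta> x ^ j * lin s \<alpha> x ^ (k - j) * ?P x)"
    have "(\<Sum>j\<le>k. t ^ j * ?c j) = 0" for t
    proof -
      have "0 = \<Lambda> (\<lambda>x. lin s (\<lambda>b. t * \<beta> b + \<alpha> b) x ^ k * ?P x)"
        using Cons unfolding k_def by simp
      also have "(\<lambda>x. lin s (\<lambda>b. t * \<beta> b + \<alpha> b) x ^ k * ?P x) =
        (\<lambda>x. \<Sum>j\<le>k. (t ^ j * of_nat (k choose j)) * (lin s \<beta> x ^ j * lin s \<alpha> x ^ (k - j) * ?P x))"
      proof
        fix x
        have "lin s (\<lambda>b. t * \<beta> b + \<alpha> b) x = t * lin s \<beta> x + lin s \<alpha> x"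
          by (simp add: lin_def sum.distrib sum_distrib_left algebra_simps)
        thus "lin s (\<lambda>b. t * \<beta> b + \<alpha> b) x ^ k * ?P x =
          (\<Sum>j\<le>k. (t ^ j * of_nat (k choose j)) * (lin s \<beta> x ^ j * lin s \<alpha> x ^ (k - j) * ?P x))"
          by (simp add: binomial_ring sum_distrib_left power_mult_distrib mult_ac)
      qed
      also have "\<Lambda> \<dots> = (\<Sum>j\<le>k. t ^ j * ?c j)"
        by (simp only: sm cm mult.assoc)
      finally show ?thesis by simp
    qed
    \<comment> \<open>The coefficient of \<open>t\<close> consists of the terms with exactly one
      factor \<open>lin s \<beta>\<close>; it carries the nonzero number \<open>k\<close>.\<close>
    from poly_fun_zero_all[OF this, of 1] k(1)
    have "\<Lambda> (\<lambda>x. lin s \<beta> x * lin s \<alpha> x ^ (k - 1) * ?P x) = 0" by simp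
    thus ?case unfolding k(2) by (simp add: mult_ac)
  qed
  have "\<Lambda> (\<lambda>x. h x * (\<Prod>\<beta>\<leftarrow>bs. lin s \<beta> x)) = 0" if "hom_form s j h" "length bs + j = e" for j h bs
    using that
  proof (induction arbitrary: bs rule: hom_form.induct)
    case (hom_form_const c)
    thus ?case using 1[of bs] by (simp add: cm)
  next
    case (hom_form_zero e) thus ?case by (simp add: z)
  next
    case (hom_form_add e F G) thus ?case by (simp add: add distrib_right)
  next
    case (hom_form_var i j F)
    from hom_form_var.IH[of "(\<lambda>b. if b = i then 1 else 0) # bs"] hom_form_var show ?case
      by (simp add: lin_unit mult_ac)
  qed
  from this[of e h "[]"] h show ?thesis by simp
qed

text \<open>A letter \<open>(a, \<iota>)\<close> stands for the coefficient of order
  \<open>a\<close> in component \<open>\<iota>\<close> of a path, a word for the product of its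
  letters. In \<open>words k m j\<close> the number \<open>j\<close> is the total order and
  \<open>m\<close> a lower bound for the number of factors.\<close>

definition prodl :: "(nat \<Rightarrow> nat \<Rightarrow> cvec \<Rightarrow> complex) \<Rightarrow> (nat \<times> nat) list \<Rightarrow> cvec \<Rightarrow> complex" where
  "prodl \<kappa> w v = (\<Prod>(a,\<iota>)\<leftarrow>w. \<kappa> a \<iota> v)"

definition words :: "nat \<Rightarrow> nat \<Rightarrow> nat \<Rightarrow> (nat \<times> nat) list set" where
  "words k m j = {w. set w \<subseteq> {1..} \<times> {..<k} \<and> sum_list (map fst w) = j \<and> m \<le> length w}"

definition word_span :: "nat \<Rightarrow> (nat \<Rightarrow> nat \<Rightarrow> cvec \<Rightarrow> complex) \<Rightarrow> nat \<Rightarrow> nat \<Rightarrow> (cvec \<Rightarrow> complex) set" where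
  "word_span k \<kappa> m j = fv.span (prodl \<kappa> ` words k m j)"

lemma word_span_zero: "(\<lambda>v. 0) \<in> word_span k \<kappa> m j"
  unfolding word_span_def using fv.span_zero by (simp add: zero_fun_def)
lemma word_span_add: "F \<in> word_span k \<kappa> m j \<Longrightarrow> G \<in> word_span k \<kappa> m j \<Longrightarrow> (\<lambda>v. F v + G v) \<in> word_span k \<kappa> m j"
  unfolding word_span_def using fv.span_add[of F _ G] by (simp add: plus_fun_def)
lemma word_span_cmult: "F \<in> word_span k \<kappa> m j \<Longrightarrow> (\<lambda>v. c * F v) \<in> word_span k \<kappa> m j"
  unfolding word_span_def by (rule fv.span_scale)
lemma word_span_sum: "(\<And>i. i \<in> I \<Longrightarrow> F i \<in> word_span k \<kappa> m j) \<Longrightarrow> (\<lambda>v. \<Sum>i\<in>I. F i v) \<in> word_span k \<kappa> m j"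
  by (induction I rule: infinite_finite_induct) (auto intro: word_span_zero word_span_add)
lemma word_span_anti: "F \<in> word_span k \<kappa> m j \<Longrightarrow> m' \<le> m \<Longrightarrow> F \<in> word_span k \<kappa> m' j"
  unfolding word_span_def by (erule subsetD[OF fv.span_mono, rotated]) (auto simp: words_def)
lemma word_span_mult: assumes "F \<in> word_span k \<kappa> m j" "G \<in> word_span k \<kappa> m' j'"
  shows "(\<lambda>v. F v * G v) \<in> word_span k \<kappa> (m + m') (j + j')"
  using assms(1) unfolding word_span_def
proof (induction rule: fv.span_induct_alt)
  case base show ?case using word_span_zero[of k \<kappa> "m+m'" "j+j'"] by (simp add: word_span_def)
next
  case (step c F1 F2)
  then obtain w where w: "w \<in> words k m j" "F1 = prodl \<kappa> w" by blast
  have "(\<lambda>v. F1 v * G v) \<in> word_span k \<kappa> (m + m') (j + j')"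
    using assms(2) unfolding word_span_def
  proof (induction rule: fv.span_induct_alt)
    case base show ?case using word_span_zero[of k \<kappa> "m+m'" "j+j'"] by (simp add: word_span_def)
  next
    case (step c G1 G2)
    then obtain w' where w': "w' \<in> words k m' j'" "G1 = prodl \<kappa> w'" by blast
    have "w @ w' \<in> words k (m+m') (j+j')" using w w' by (auto simp: words_def)
    moreover have "(\<lambda>v. F1 v * G1 v) = prodl \<kappa> (w @ w')" by (simp add: w w' prodl_def fun_eq_iff)
    ultimately have "(\<lambda>v. F1 v * G1 v) \<in> word_span k \<kappa> (m+m') (j+j')"
      unfolding word_span_def by (auto intro: fv.span_base)
    from word_span_add[OF word_span_cmult[OF this, of c] step(2)[folded word_span_def]]
    show ?case unfolding word_span_def by (simp add: plus_fun_def algebra_simps)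
  qed
  from word_span_add[OF word_span_cmult[OF this, of c] step(2)[folded word_span_def]]
  show ?case unfolding word_span_def by (simp add: plus_fun_def algebra_simps)
qed
lemma word_span_var: "a \<ge> 1 \<Longrightarrow> \<iota> < k \<Longrightarrow> \<kappa> a \<iota> \<in> word_span k \<kappa> 1 a"
  unfolding word_span_def by (rule fv.span_base, rule image_eqI[of _ _ "[(a,\<iota>)]"]) (auto simp: prodl_def words_def)
text \<open>Two factors of order at least 1 have total order at least 2. Hence in order 1 the Taylor
  expansion along a path is exactly the derivative.\<close>

lemma word_span_21: assumes "F \<in> word_span k \<kappa> 2 1" shows "F = (\<lambda>v. 0)"
proof -
  have "words k 2 1 = {}"
  proof -
    have False if w: "w \<in> words k 2 1" for w
    proof -
      obtain a b w' where "w = a # b # w'"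
        using w by (cases w; cases "tl w") (auto simp: words_def)
      thus False using w by (cases a; cases b) (auto simp: words_def)
    qed
    thus ?thesis by blast
  qed
  thus ?thesis using assms by (simp add: word_span_def zero_fun_def)
qed

lemma deg_le_0_const: "deg_le k N G \<Longrightarrow> N = 0 \<Longrightarrow> \<exists>c. G = (\<lambda>x. c)"
  by (induction rule: deg_le.induct) auto

text \<open>Taylor expansion along a path: the coefficient of t^j is the derivative applied to the j-th
  coefficient of the path, up to products of at least two path coefficients of total order j.\<close>

lemma deg_le_taylor:
  assumes "deg_le k N G"
  shows "\<exists>DG. (\<forall>\<iota>. deg_le k (N - 1) (DG \<iota>)) \<and>
    (\<forall>\<kappa> \<kappa>0 D. (\<forall>\<iota> v. \<kappa> 0 \<iota> v = \<kappa>0 \<iota>) \<longrightarrow> (\<forall>j>D. \<forall>\<iota>. \<kappa> j \<iota> = (\<lambda>v. 0)) \<longrightarrow>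
      (\<exists>g. (\<forall>t v. G (\<lambda>\<iota>. \<Sum>j\<le>D. t ^ j * \<kappa> j \<iota> v) = (\<Sum>j\<le>N*D. t ^ j * g j v)) \<and>
         (\<forall>v. g 0 v = G \<kappa>0) \<and> (\<forall>j>N*D. \<forall>v. g j v = 0) \<and>
         (\<forall>j\<ge>1. g j \<in> word_span k \<kappa> 1 j \<and> (\<lambda>v. g j v - (\<Sum>\<iota><k. DG \<iota> \<kappa>0 * \<kappa> j \<iota> v)) \<in> word_span k \<kappa> 2 j)))"
  using assms
proof (induction rule: deg_le.induct)
  case (deg_le_const N c)
  have *: "\<exists>g. (\<forall>t v. c = (\<Sum>j\<le>N*D. t ^ j * g j v)) \<and>
         (\<forall>v. g 0 v = c) \<and> (\<forall>j>N*D. \<forall>v. g j v = 0) \<and>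
         (\<forall>j\<ge>1. g j \<in> word_span k \<kappa> 1 j \<and> (\<lambda>v. g j v - (\<Sum>\<iota><k. 0 * \<kappa> j \<iota> v)) \<in> word_span k \<kappa> 2 j)" for \<kappa> D
  proof (rule exI[of _ "\<lambda>j v. if j = 0 then c else 0"], intro conjI allI impI)
    show "c = (\<Sum>j\<le>N * D. t ^ j * (if j = 0 then c else 0))" for t
      by (simp add: if_distrib[of "\<lambda>z. _ * z"] cong: if_cong)
  qed (auto intro: word_span_zero)
  show ?case
    by (rule exI[of _ "\<lambda>\<iota> \<kappa>. 0"], intro conjI allI impI deg_le.deg_le_const) (use * in blast)
next
  case (deg_le_add N F G)
  obtain DF where DF: "\<And>\<iota>. deg_le k (N - 1) (DF \<iota>)"
    "\<And>(\<kappa> :: nat \<Rightarrow> nat \<Rightarrow> cvec \<Rightarrow> complex) \<kappa>0 D. (\<forall>\<iota> v. \<kappa> 0 \<iota> v = \<kappa>0 \<iota>) \<Longrightarrow> (\<forall>j>D. \<forall>\<iota>. \<kappa> j \<iota> = (\<lambda>v. 0)) \<Longrightarrow>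
      (\<exists>g. (\<forall>t v. F (\<lambda>\<iota>. \<Sum>j\<le>D. t ^ j * \<kappa> j \<iota> v) = (\<Sum>j\<le>N*D. t ^ j * g j v)) \<and>
         (\<forall>v. g 0 v = F \<kappa>0) \<and> (\<forall>j>N*D. \<forall>v. g j v = 0) \<and>
         (\<forall>j\<ge>1. g j \<in> word_span k \<kappa> 1 j \<and> (\<lambda>v. g j v - (\<Sum>\<iota><k. DF \<iota> \<kappa>0 * \<kappa> j \<iota> v)) \<in> word_span k \<kappa> 2 j))"
    using deg_le_add.IH(1) by blast
  obtain DG where DG: "\<And>\<iota>. deg_le k (N - 1) (DG \<iota>)"
    "\<And>(\<kappa> :: nat \<Rightarrow> nat \<Rightarrow> cvec \<Rightarrow> complex) \<kappa>0 D. (\<forall>\<iota> v. \<kappa> 0 \<iota> v = \<kappa>0 \<iota>) \<Longrightarrow> (\<forall>j>D. \<forall>\<iota>. \<kappa> j \<iota> = (\<lambda>v. 0)) \<Longrightarrow>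
      (\<exists>g. (\<forall>t v. G (\<lambda>\<iota>. \<Sum>j\<le>D. t ^ j * \<kappa> j \<iota> v) = (\<Sum>j\<le>N*D. t ^ j * g j v)) \<and>
         (\<forall>v. g 0 v = G \<kappa>0) \<and> (\<forall>j>N*D. \<forall>v. g j v = 0) \<and>
         (\<forall>j\<ge>1. g j \<in> word_span k \<kappa> 1 j \<and> (\<lambda>v. g j v - (\<Sum>\<iota><k. DG \<iota> \<kappa>0 * \<kappa> j \<iota> v)) \<in> word_span k \<kappa> 2 j))"
    using deg_le_add.IH(2) by blast
  show ?case
  proof (rule exI[of _ "\<lambda>\<iota> \<kappa>. DF \<iota> \<kappa> + DG \<iota> \<kappa>"], intro conjI allI impI)
    show "deg_le k (N - 1) (\<lambda>\<kappa>. DF \<iota> \<kappa> + DG \<iota> \<kappa>)" for \<iota> using DF(1) DG(1) by (rule deg_le.deg_le_add)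
  next
    fix \<kappa> :: "nat \<Rightarrow> nat \<Rightarrow> cvec \<Rightarrow> complex" and \<kappa>0 D
    assume a: "\<forall>\<iota> v. \<kappa> 0 \<iota> v = \<kappa>0 \<iota>" "\<forall>j>D. \<forall>\<iota>. \<kappa> j \<iota> = (\<lambda>v. 0)"
    obtain f where f: "\<And>t v. F (\<lambda>\<iota>. \<Sum>j\<le>D. t ^ j * \<kappa> j \<iota> v) = (\<Sum>j\<le>N*D. t ^ j * f j v)"
         "\<And>v. f 0 v = F \<kappa>0" "\<And>j v. j>N*D \<Longrightarrow> f j v = 0"
         "\<And>j. j\<ge>1 \<Longrightarrow> f j \<in> word_span k \<kappa> 1 j \<and> (\<lambda>v. f j v - (\<Sum>\<iota><k. DF \<iota> \<kappa>0 * \<kappa> j \<iota> v)) \<in> word_span k \<kappa> 2 j"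
      using DF(2)[OF a] by blast
    obtain g where g: "\<And>t v. G (\<lambda>\<iota>. \<Sum>j\<le>D. t ^ j * \<kappa> j \<iota> v) = (\<Sum>j\<le>N*D. t ^ j * g j v)"
         "\<And>v. g 0 v = G \<kappa>0" "\<And>j v. j>N*D \<Longrightarrow> g j v = 0"
         "\<And>j. j\<ge>1 \<Longrightarrow> g j \<in> word_span k \<kappa> 1 j \<and> (\<lambda>v. g j v - (\<Sum>\<iota><k. DG \<iota> \<kappa>0 * \<kappa> j \<iota> v)) \<in> word_span k \<kappa> 2 j"
      using DG(2)[OF a] by blast
    have 4: "(\<lambda>v. f j v + g j v) \<in> word_span k \<kappa> 1 j"
      "(\<lambda>v. f j v + g j v - (\<Sum>\<iota><k. (DF \<iota> \<kappa>0 + DG \<iota> \<kappa>0) * \<kappa> j \<iota> v)) \<in> word_span k \<kappa> 2 j" if "j \<ge> 1" for j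
    proof -
      show "(\<lambda>v. f j v + g j v) \<in> word_span k \<kappa> 1 j"
        by (rule word_span_add[OF conjunct1[OF f(4)[OF that]] conjunct1[OF g(4)[OF that]]])
      have "(\<lambda>v. (f j v - (\<Sum>\<iota><k. DF \<iota> \<kappa>0 * \<kappa> j \<iota> v)) + (g j v - (\<Sum>\<iota><k. DG \<iota> \<kappa>0 * \<kappa> j \<iota> v))) \<in> word_span k \<kappa> 2 j"
        by (rule word_span_add[OF conjunct2[OF f(4)[OF that]] conjunct2[OF g(4)[OF that]]])
      thus "(\<lambda>v. f j v + g j v - (\<Sum>\<iota><k. (DF \<iota> \<kappa>0 + DG \<iota> \<kappa>0) * \<kappa> j \<iota> v)) \<in> word_span k \<kappa> 2 j"
        by (simp add: sum.distrib algebra_simps)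
    qed
    show "\<exists>h. (\<forall>t v. F (\<lambda>\<iota>. \<Sum>j\<le>D. t ^ j * \<kappa> j \<iota> v) + G (\<lambda>\<iota>. \<Sum>j\<le>D. t ^ j * \<kappa> j \<iota> v) = (\<Sum>j\<le>N*D. t ^ j * h j v)) \<and>
         (\<forall>v. h 0 v = F \<kappa>0 + G \<kappa>0) \<and> (\<forall>j>N*D. \<forall>v. h j v = 0) \<and>
         (\<forall>j\<ge>1. h j \<in> word_span k \<kappa> 1 j \<and> (\<lambda>v. h j v - (\<Sum>\<iota><k. (DF \<iota> \<kappa>0 + DG \<iota> \<kappa>0) * \<kappa> j \<iota> v)) \<in> word_span k \<kappa> 2 j)"
      by (rule exI[of _ "\<lambda>j v. f j v + g j v"]) (use f g 4 in \<open>auto simp: sum.distrib algebra_simps\<close>)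
  qed
next
  case (deg_le_var i N F)
  obtain DF where DF: "\<And>\<iota>. deg_le k (N - 1) (DF \<iota>)"
    "\<And>(\<kappa> :: nat \<Rightarrow> nat \<Rightarrow> cvec \<Rightarrow> complex) \<kappa>0 D. (\<forall>\<iota> v. \<kappa> 0 \<iota> v = \<kappa>0 \<iota>) \<Longrightarrow> (\<forall>j>D. \<forall>\<iota>. \<kappa> j \<iota> = (\<lambda>v. 0)) \<Longrightarrow>
      (\<exists>g. (\<forall>t v. F (\<lambda>\<iota>. \<Sum>j\<le>D. t ^ j * \<kappa> j \<iota> v) = (\<Sum>j\<le>N*D. t ^ j * g j v)) \<and>
         (\<forall>v. g 0 v = F \<kappa>0) \<and> (\<forall>j>N*D. \<forall>v. g j v = 0) \<and>
         (\<forall>j\<ge>1. g j \<in> word_span k \<kappa> 1 j \<and> (\<lambda>v. g j v - (\<Sum>\<iota><k. DF \<iota> \<kappa>0 * \<kappa> j \<iota> v)) \<in> word_span k \<kappa> 2 j))"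
    using deg_le_var.IH by blast
  \<comment> \<open>Product rule. For \<open>N = 0\<close> the truncated \<open>N - 1\<close> is no
    smaller than \<open>N\<close>, so the second term would exceed the degree bound; it is left out,
    as F is then constant along every path.\<close>
  define DG where "DG \<iota> \<kappa> = (if \<iota> = i then F \<kappa> else 0) + (if N = 0 then 0 else \<kappa> i * DF \<iota> \<kappa>)" for \<iota> and \<kappa> :: cvec
  show ?case
  proof (rule exI[of _ DG], intro conjI allI impI)
    show "deg_le k (Suc N - 1) (DG \<iota>)" for \<iota>
    proof -
      have 1: "deg_le k N (\<lambda>\<kappa>. if N = 0 then 0 else \<kappa> i * DF \<iota> \<kappa>)"
        using deg_le.deg_le_var[OF deg_le_var.hyps(1) DF(1), of \<iota>] by (cases N) (auto intro: deg_le.deg_le_const)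
      have 2: "deg_le k N (\<lambda>\<kappa>. if \<iota> = i then F \<kappa> else 0)"
        using deg_le_var.hyps(2) by (cases "\<iota> = i") (auto intro: deg_le.deg_le_const)
      show ?thesis using deg_le.deg_le_add[OF 2 1] by (simp add: DG_def[abs_def])
    qed
  next
    fix \<kappa> :: "nat \<Rightarrow> nat \<Rightarrow> cvec \<Rightarrow> complex" and \<kappa>0 D
    assume a: "\<forall>\<iota> v. \<kappa> 0 \<iota> v = \<kappa>0 \<iota>" "\<forall>j>D. \<forall>\<iota>. \<kappa> j \<iota> = (\<lambda>v. 0)"
    obtain f where f: "\<And>t v. F (\<lambda>\<iota>. \<Sum>j\<le>D. t ^ j * \<kappa> j \<iota> v) = (\<Sum>j\<le>N*D. t ^ j * f j v)"
         "\<And>v. f 0 v = F \<kappa>0" "\<And>j v. j>N*D \<Longrightarrow> f j v = 0"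
         "\<And>j. j\<ge>1 \<Longrightarrow> f j \<in> word_span k \<kappa> 1 j"
         "\<And>j. j\<ge>1 \<Longrightarrow> (\<lambda>v. f j v - (\<Sum>\<iota><k. DF \<iota> \<kappa>0 * \<kappa> j \<iota> v)) \<in> word_span k \<kappa> 2 j"
      using DF(2)[OF a] by blast
    define g where "g j v = (\<Sum>a\<le>j. \<kappa> a i v * f (j - a) v)" for j v
    have 1: "(\<Sum>j\<le>D. t ^ j * \<kappa> j i v) * F (\<lambda>\<iota>. \<Sum>j\<le>D. t ^ j * \<kappa> j \<iota> v) = (\<Sum>j\<le>Suc N*D. t ^ j * g j v)" for t v
      unfolding f(1) g_def using polynomial_product[of D "\<lambda>j. \<kappa> j i v" "N*D" "\<lambda>j. f j v" t] a(2) f(3)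
      by (simp add: mult.commute[of "t ^ _"] add.commute)
    have 2: "g 0 v = \<kappa>0 i * F \<kappa>0" for v by (simp add: g_def a(1) f(2))
    have 3: "g j v = 0" if "j > Suc N * D" for j v
      unfolding g_def
    proof (rule sum.neutral, rule ballI)
      fix b assume "b \<in> {..j}"
      show "\<kappa> b i v * f (j - b) v = 0"
      proof (cases "b > D")
        case False
        hence "j - b > N * D" using that by simp
        thus ?thesis by (simp add: f(3))
      qed (use a(2) in simp)
    qed
    have mid: "(\<lambda>v. \<Sum>b\<in>{1..<j}. \<kappa> b i v * f (j - b) v) \<in> word_span k \<kappa> 2 j" for j
    proof (rule word_span_sum)
      fix b assume b: "b \<in> {1..<j}"
      have "(\<lambda>v. \<kappa> b i v * f (j - b) v) \<in> word_span k \<kappa> (1+1) (b + (j - b))"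
        by (intro word_span_mult word_span_var f(4)) (use b deg_le_var.hyps(1) in auto)
      thus "(\<lambda>v. \<kappa> b i v * f (j - b) v) \<in> word_span k \<kappa> 2 j" using b by (simp add: numeral_2_eq_2)
    qed
    have ge: "g j v = \<kappa>0 i * f j v + \<kappa> j i v * F \<kappa>0 + (\<Sum>b\<in>{1..<j}. \<kappa> b i v * f (j - b) v)" if "j \<ge> 1" for j v
    proof -
      have "{..j} = insert 0 (insert j {1..<j})" using that by auto
      thus ?thesis unfolding g_def using that by (simp add: a(1) f(2))
    qed
    have 4: "g j \<in> word_span k \<kappa> 1 j" if "j \<ge> 1" for j
    proof -
      have "(\<lambda>v. \<kappa>0 i * f j v + F \<kappa>0 * \<kappa> j i v + (\<Sum>b\<in>{1..<j}. \<kappa> b i v * f (j - b) v)) \<in> word_span k \<kappa> 1 j"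
        by (intro word_span_add word_span_cmult f(4) that word_span_var deg_le_var.hyps(1) word_span_anti[OF mid]) auto
      also have "(\<lambda>v. \<kappa>0 i * f j v + F \<kappa>0 * \<kappa> j i v + (\<Sum>b\<in>{1..<j}. \<kappa> b i v * f (j - b) v)) = g j"
        by (rule ext) (simp add: ge[OF that] mult_ac)
      finally show ?thesis .
    qed
    have 5: "(\<lambda>v. g j v - (\<Sum>\<iota><k. DG \<iota> \<kappa>0 * \<kappa> j \<iota> v)) \<in> word_span k \<kappa> 2 j" if j: "j \<ge> 1" for j
    proof -
      have s1: "(\<Sum>\<iota><k. (if \<iota> = i then F \<kappa>0 else 0) * \<kappa> j \<iota> v) = F \<kappa>0 * \<kappa> j i v" for v
        using deg_le_var.hyps(1) by (simp add: if_distrib[of "\<lambda>c. c * _"] cong: if_cong)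
      have s2: "(\<lambda>v. \<kappa>0 i * f j v - (\<Sum>\<iota><k. (if N = 0 then 0 else \<kappa>0 i * DF \<iota> \<kappa>0) * \<kappa> j \<iota> v)) \<in> word_span k \<kappa> 2 j"
      proof (cases "N = 0")
        case True
        hence "f j v = 0" for v using f(3)[of j v] j by simp
        thus ?thesis using True by (simp add: word_span_zero)
      next
        case False
        from word_span_cmult[OF f(5)[OF j], of "\<kappa>0 i"] False show ?thesis
          by (simp add: right_diff_distrib sum_distrib_left mult_ac)
      qed
      have "(\<lambda>v. (\<kappa>0 i * f j v - (\<Sum>\<iota><k. (if N = 0 then 0 else \<kappa>0 i * DF \<iota> \<kappa>0) * \<kappa> j \<iota> v)) +
         (\<Sum>b\<in>{1..<j}. \<kappa> b i v * f (j - b) v)) \<in> word_span k \<kappa> 2 j"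
        by (intro word_span_add s2 mid)
      also have "(\<lambda>v. (\<kappa>0 i * f j v - (\<Sum>\<iota><k. (if N = 0 then 0 else \<kappa>0 i * DF \<iota> \<kappa>0) * \<kappa> j \<iota> v)) +
         (\<Sum>b\<in>{1..<j}. \<kappa> b i v * f (j - b) v)) = (\<lambda>v. g j v - (\<Sum>\<iota><k. DG \<iota> \<kappa>0 * \<kappa> j \<iota> v))"
        unfolding ge[OF j] DG_def distrib_right sum.distrib s1 by (simp add: algebra_simps)
      finally show ?thesis .
    qed
    show "\<exists>g. (\<forall>t v. (\<Sum>j\<le>D. t ^ j * \<kappa> j i v) * F (\<lambda>\<iota>. \<Sum>j\<le>D. t ^ j * \<kappa> j \<iota> v) = (\<Sum>j\<le>Suc N*D. t ^ j * g j v)) \<and>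
         (\<forall>v. g 0 v = \<kappa>0 i * F \<kappa>0) \<and> (\<forall>j>Suc N*D. \<forall>v. g j v = 0) \<and>
         (\<forall>j\<ge>1. g j \<in> word_span k \<kappa> 1 j \<and> (\<lambda>v. g j v - (\<Sum>\<iota><k. DG \<iota> \<kappa>0 * \<kappa> j \<iota> v)) \<in> word_span k \<kappa> 2 j)"
      by (rule exI[of _ g]) (use 1 2 3 4 5 in blast)
  qed
qed

section \<open>Low and high rank\<close>

text \<open>The homogeneous version of the rank condition; the degrees of the two factors may vary
  with the summand. The value \<open>r = 0\<close> covers the zero form.\<close>

definition lowrank :: "nat \<Rightarrow> nat \<Rightarrow> nat \<Rightarrow> (cvec \<Rightarrow> complex) \<Rightarrow> bool" where
  "lowrank n E B F \<longleftrightarrow> (\<exists>r\<le>B. \<exists>A G. (\<forall>l<r. \<exists>a b. a > 0 \<and> b > 0 \<and> a + b = E \<and> hom_form n a (A l) \<and> hom_form n b (G l)) \<and>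
     (\<forall>x. F x = (\<Sum>l<(r::nat). A l x * G l x)))"

text \<open>Only members of equal degree are combined, as in Schmidt's rank of a system of forms, so
  that every combination is again a form.\<close>

definition high_rank :: "nat \<Rightarrow> 'i set \<Rightarrow> ('i \<Rightarrow> nat) \<Rightarrow> ('i \<Rightarrow> cvec \<Rightarrow> complex) \<Rightarrow> nat \<Rightarrow> bool" where
  "high_rank n I e F B \<longleftrightarrow> (\<forall>E c. (\<exists>i\<in>I. e i = E \<and> c i \<noteq> 0) \<longrightarrow>
     \<not> lowrank n E B (\<lambda>x. \<Sum>i\<in>{i\<in>I. e i = E}. c i * F i x))"

lemma lowrank_mono: "lowrank n E B F \<Longrightarrow> B \<le> B' \<Longrightarrow> lowrank n E B' F"
  unfolding lowrank_def
  by (erule exE, erule conjE, rule exI, rule conjI, erule order_trans, assumption, assumption)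

lemma high_rank_mono: "high_rank n I e F B' \<Longrightarrow> B \<le> B' \<Longrightarrow> high_rank n I e F B"
  unfolding high_rank_def using lowrank_mono by blast

lemma lowrank_finite:
  assumes "finite W" "card W \<le> B"
    "\<And>w. w \<in> W \<Longrightarrow> \<exists>a b. a > 0 \<and> b > 0 \<and> a + b = E \<and> hom_form n a (A w) \<and> hom_form n b (G w)"
    "\<And>x. F x = (\<Sum>w\<in>W. A w x * G w x)"
  shows "lowrank n E B F"
proof -
  obtain h where h: "bij_betw h {..<card W} W"
    using ex_bij_betw_nat_finite[OF assms(1)] by (auto simp: atLeast0LessThan)
  show ?thesis unfolding lowrank_def
  proof (rule exI[of _ "card W"], rule conjI[OF assms(2)], rule exI[of _ "\<lambda>l. A (h l)"], rule exI[of _ "\<lambda>l. G (h l)"],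
      intro conjI allI impI)
    fix l assume "l < card W"
    hence "h l \<in> W" using h by (auto simp: bij_betw_def)
    thus "\<exists>a b. a > 0 \<and> b > 0 \<and> a + b = E \<and> hom_form n a (A (h l)) \<and> hom_form n b (G (h l))" by (rule assms(3))
  next
    fix x show "F x = (\<Sum>l<card W. A (h l) x * G (h l) x)"
      using sum.reindex_bij_betw[OF h, of "\<lambda>w. A w x * G w x"] assms(4)[of x] by simp
  qed
qed

text \<open>A bound, free of \<open>n\<close>, for the number of words of total order at most
  \<open>D\<close> in \<open>k\<close> components, and therefore for the rank of a combination of
  products of path coefficients.\<close>

definition word_bound :: "nat \<Rightarrow> nat \<Rightarrow> nat" where
  "word_bound D k = card {w. set w \<subseteq> {..D} \<times> {..<k} \<and> length w \<le> D}"

lemma words_sub: "words k m j \<subseteq> {w. set w \<subseteq> {..j} \<times> {..<k} \<and> length w \<le> j}"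
proof
  fix w assume w: "w \<in> words k m j"
  have len: "length w \<le> sum_list (map fst w)" if "set w \<subseteq> {1..} \<times> {..<k}" for w :: "(nat\<times>nat) list"
    using that by (induction w) auto
  have el: "fst p \<le> sum_list (map fst w)" if "p \<in> set w" for p and w :: "(nat\<times>nat) list"
    using that by (intro member_le_sum_list) auto
  show "w \<in> {w. set w \<subseteq> {..j} \<times> {..<k} \<and> length w \<le> j}"
    using w len[of w] el[of _ w] by (fastforce simp: words_def)
qed

lemma word_bound_words: assumes "j \<le> D" shows "finite (words k m j)" "card (words k m j) \<le> word_bound D k"
proof -
  have fin: "finite {w. set w \<subseteq> {..D} \<times> {..<k} \<and> length w \<le> D}"
    by (rule finite_lists_length_le) simp
  have sub: "words k m j \<subseteq> {w. set w \<subseteq> {..D} \<times> {..<k} \<and> length w \<le> D}"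
  proof
    fix w assume "w \<in> words k m j"
    hence "set w \<subseteq> {..j} \<times> {..<k}" "length w \<le> j" using words_sub by blast+
    moreover have "{..j} \<times> {..<k} \<subseteq> {..D} \<times> {..<k}" using assms by auto
    ultimately show "w \<in> {w. set w \<subseteq> {..D} \<times> {..<k} \<and> length w \<le> D}" using assms by auto
  qed
  show "finite (words k m j)" by (rule finite_subset[OF sub fin])
  show "card (words k m j) \<le> word_bound D k" unfolding word_bound_def by (rule card_mono[OF fin sub])
qed

text \<open>A word with at least two letters splits into its first letter and the rest, both of
  positive degree; so there are at most as many products as words.\<close>

lemma word_span_lowrank:
  assumes \<kappa>: "\<And>j \<iota>. \<iota> < k \<Longrightarrow> hom_form n j (\<kappa> j \<iota>)" and F: "F \<in> word_span k \<kappa> 2 E" and E: "E \<le> D"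
  shows "lowrank n E (word_bound D k) F"
proof -
  let ?W = "words k 2 E"
  have fin: "finite ?W" and card: "card ?W \<le> word_bound D k" using word_bound_words[OF E] by auto
  have "\<exists>c. F = (\<lambda>x. \<Sum>w\<in>?W. c w * prodl \<kappa> w x)"
    using F unfolding word_span_def
  proof (induction rule: fv.span_induct_alt)
    case base show ?case by (rule exI[of _ "\<lambda>_. 0"]) (simp add: zero_fun_def)
  next
    case (step c G H)
    then obtain w d where w: "w \<in> ?W" "G = prodl \<kappa> w" and d: "H = (\<lambda>x. \<Sum>w\<in>?W. d w * prodl \<kappa> w x)" by blast
    show ?case
    proof (rule exI[of _ "\<lambda>u. (if u = w then c else 0) + d u"], rule ext)
      fix x
      have "(\<Sum>u\<in>?W. (if u = w then c else 0) * prodl \<kappa> u x) = (\<Sum>u\<in>?W. if u = w then c * prodl \<kappa> w x else 0)"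
        by (rule sum.cong) auto
      thus "((\<lambda>x. c * G x) + H) x = (\<Sum>u\<in>?W. ((if u = w then c else 0) + d u) * prodl \<kappa> u x)"
        using w fin by (simp add: d distrib_right sum.distrib)
    qed
  qed
  then obtain c where c: "\<And>x. F x = (\<Sum>w\<in>?W. c w * prodl \<kappa> w x)" by blast
  have hp: "hom_form n (sum_list (map fst w)) (prodl \<kappa> w)" if "set w \<subseteq> {1..} \<times> {..<k}" for w
    using that
  proof (induction w)
    case Nil show ?case using hom_form_const[of n 1] by (simp add: prodl_def[abs_def])
  next
    case (Cons p w)
    obtain a \<iota> where p: "p = (a, \<iota>)" "\<iota> < k" using Cons.prems by (cases p) auto
    have "hom_form n (a + sum_list (map fst w)) (\<lambda>x. \<kappa> a \<iota> x * prodl \<kappa> w x)"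
      using Cons p by (intro hom_form_mult \<kappa>) auto
    thus ?case by (simp add: p prodl_def[abs_def])
  qed
  show ?thesis
  proof (rule lowrank_finite[OF fin card, of E n "\<lambda>w x. c w * prodl \<kappa> [hd w] x" "\<lambda>w. prodl \<kappa> (tl w)"])
    fix w assume w: "w \<in> ?W"
    then obtain p q w' where w': "w = p # q # w'" by (cases w; cases "tl w") (auto simp: words_def)
    have s: "set w \<subseteq> {1..} \<times> {..<k}" "sum_list (map fst w) = E" using w by (auto simp: words_def)
    have 1: "hom_form n (fst p) (\<lambda>x. c w * prodl \<kappa> [hd w] x)" using hp[of "[p]"] s w' by (intro hom_form_cmult) auto
    have 2: "hom_form n (sum_list (map fst (q # w'))) (prodl \<kappa> (tl w))" using hp[of "q # w'"] s w' by auto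
    show "\<exists>a b. 0 < a \<and> 0 < b \<and> a + b = E \<and> hom_form n a (\<lambda>x. c w * prodl \<kappa> [hd w] x) \<and> hom_form n b (prodl \<kappa> (tl w))"
      using 1 2 s w' by (intro exI[of _ "fst p"] exI[of _ "sum_list (map fst (q # w'))"]) auto
  next
    fix x
    show "F x = (\<Sum>w\<in>?W. c w * prodl \<kappa> [hd w] x * prodl \<kappa> (tl w) x)"
      unfolding c
    proof (intro sum.cong refl)
      fix w assume "w \<in> ?W"
      then obtain p w' where "w = p # w'" by (cases w) (auto simp: words_def)
      thus "c w * prodl \<kappa> w x = c w * prodl \<kappa> [hd w] x * prodl \<kappa> (tl w) x" by (simp add: prodl_def)
    qed
  qed
qed

section \<open>Restrictions of a family of high rank\<close>

text \<open>A tuple of s functions is encoded by its values at m points: position i * m + j holds the value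
  of the i-th function at the j-th point.\<close>

definition point_values :: "nat \<Rightarrow> nat \<Rightarrow> (nat \<Rightarrow> cvec) \<Rightarrow> (nat \<Rightarrow> cvec \<Rightarrow> complex) \<Rightarrow> cvec" where
  "point_values s m pt f = (\<lambda>\<iota>. if \<iota> < s * m then f (\<iota> div m) (pt (\<iota> mod m)) else 0)"

text \<open>The pullback of \<open>F i\<close> under the linear map that sends the b-th standard
  vector to \<open>\<phi> b\<close>.\<close>

definition subst_lin :: "nat \<Rightarrow> (nat \<Rightarrow> cvec) \<Rightarrow> (nat \<Rightarrow> cvec \<Rightarrow> complex) \<Rightarrow> nat \<Rightarrow> cvec \<Rightarrow> complex" where
  "subst_lin s \<phi> F i x = F i (\<lambda>l. \<Sum>b<s. x b * \<phi> b l)"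

lemma sum_lessThan_add: "(\<Sum>\<iota><a + b. h \<iota>) = (\<Sum>\<iota><a. h \<iota>) + (\<Sum>j<b. h (a + j :: nat))" for h :: "nat \<Rightarrow> complex"
  by (induction b) (auto simp: add.assoc)

lemma sum_div_mod: "(\<Sum>\<iota><s*m. h \<iota>) = (\<Sum>i<s. \<Sum>j<m. h (i * m + j :: nat))" for h :: "nat \<Rightarrow> complex"
proof (induction s)
  case (Suc s)
  have "(\<Sum>\<iota><Suc s*m. h \<iota>) = (\<Sum>\<iota><s*m + m. h \<iota>)" by (simp add: add.commute)
  also have "\<dots> = (\<Sum>\<iota><s*m. h \<iota>) + (\<Sum>j<m. h (s * m + j))"
    by (rule sum_lessThan_add)
  finally show ?case using Suc by simp
qed simp

lemma point_values_ij: "i < s \<Longrightarrow> j < m \<Longrightarrow> point_values s m pt f (i * m + j) = f i (pt j)"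
proof -
  assume ij: "i < s" "j < m"
  have "i * m + j < i * m + m" using ij by simp
  also have "\<dots> = Suc i * m" by simp
  also have "\<dots> \<le> s * m" using ij by (intro mult_le_mono1) simp
  finally show ?thesis using ij by (simp add: point_values_def)
qed

lemma hom_form_subst_lin: "hom_form n e (F i) \<Longrightarrow> hom_form s e (subst_lin s \<phi> F i)"
  unfolding subst_lin_def[abs_def] by (rule hom_form_comp1[of n e "F i" s "\<lambda>l x. \<Sum>b<s. x b * \<phi> b l"]) (auto intro!: hom_form_sum hom_form_cmult2 hom_form_coord[simplified])

lemma sum_pow_swap:
  fixes t :: complex
  shows "(\<Sum>j<m. a j * (\<Sum>k\<le>D. t ^ k * b j k)) = (\<Sum>k\<le>D. t ^ k * (\<Sum>j<m. a j * b j k))"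
proof -
  have "(\<Sum>j<m. a j * (\<Sum>k\<le>D. t ^ k * b j k)) = (\<Sum>j<m. \<Sum>k\<le>D. t ^ k * (a j * b j k))"
    by (simp add: sum_distrib_left mult_ac)
  also have "\<dots> = (\<Sum>k\<le>D. \<Sum>j<m. t ^ k * (a j * b j k))" by (rule sum.swap)
  finally show ?thesis by (simp add: sum_distrib_left)
qed

text \<open>With \<open>DG\<close> the gradient of a function of point values, this is its
  derivative at \<open>\<kappa>\<close> when the i-th form is varied in the direction of the
  \<open>e i\<close>-th power of \<open>lin s \<alpha>\<close>.\<close>

definition polar_deriv :: "nat \<Rightarrow> nat \<Rightarrow> (nat \<Rightarrow> nat) \<Rightarrow> (nat \<Rightarrow> cvec) \<Rightarrow> (nat \<Rightarrow> cvec \<Rightarrow> complex) \<Rightarrow> nat \<Rightarrow> cvec \<Rightarrow> cvec \<Rightarrow> complex" where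
  "polar_deriv s m e pt DG i \<alpha> \<kappa> = (\<Sum>j<m. lin s \<alpha> (pt j) ^ e i * DG (i * m + j) \<kappa>)"

text \<open>Powers of linear forms span, so a derivative that vanishes in their directions vanishes
  in the direction of every form of degree \<open>e i\<close>.\<close>

lemma polar_deriv_dual:
  assumes "\<And>\<alpha>. polar_deriv s m e pt DG i \<alpha> \<kappa> = 0" "hom_form s (e i) h"
  shows "(\<Sum>j<m. DG (i * m + j) \<kappa> * h (pt j)) = 0"
  using assms
  by (intro power_span_dual[of "\<lambda>h. \<Sum>j<m. DG (i * m + j) \<kappa> * h (pt j)" s "e i" h])
    (auto simp: polar_deriv_def sum.distrib algebra_simps sum_distrib_left)

text \<open>The hypothesis says that the derivative vanishes at every \<open>t0\<close>; in
  characteristic 0 the polynomial is then constant.\<close>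

lemma poly_deriv_zero_const:
  fixes p :: "complex poly"
  assumes "\<And>t0. \<exists>g M. g 1 = 0 \<and> (\<forall>t. poly p (t0 + t) = (\<Sum>j\<le>M. t ^ j * g j))"
  shows "poly p a = poly p b"
proof -
  have "poly (pderiv p) t0 = 0" for t0
  proof -
    obtain g M where g: "g 1 = 0" "\<And>t. poly p (t0 + t) = (\<Sum>j\<le>M. t ^ j * g j)" using assms by blast
    define q where "q = (\<Sum>j\<le>M. monom (g j) j)"
    have "pcompose p [:t0, 1:] = q"
      by (rule poly_eq_poly_eq_iff[THEN iffD1], rule ext)
        (simp add: poly_pcompose g(2) q_def poly_sum poly_monom mult.commute)
    hence "poly (pderiv (pcompose p [:t0, 1:])) 0 = poly (pderiv q) 0" by simp
    hence "poly (pderiv p) t0 = coeff q 1"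
      by (simp add: pderiv_pcompose poly_pcompose poly_0_coeff_0 coeff_pderiv pderiv_pCons)
    also have "\<dots> = 0" unfolding q_def coeff_sum by (rule sum.neutral) (use g(1) in auto)
    finally show ?thesis .
  qed
  hence "pderiv p = 0" using poly_all_0_iff_0 by blast
  hence "degree p = 0" by (simp add: pderiv_eq_0_iff)
  then obtain c where "p = [:c:]" by (metis degree_eq_zeroE)
  thus ?thesis by simp
qed

text \<open>As far as \<open>m\<close> values of each form can tell, the restrictions of a family of
  high rank are Zariski dense among the tuples of forms in \<open>s\<close> variables. The induction
  is on the degree of \<open>G\<close>: a derivative of \<open>G\<close> that is nonzero at some
  forms is, by induction, nonzero at a restriction along some \<open>\<phi>0\<close>, and moving
  away from \<open>\<phi>0\<close> along maps of rank one shows that \<open>G\<close> cannot vanish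
  on all restrictions.\<close>

theorem universality:
  fixes pt :: "nat \<Rightarrow> cvec"
  assumes e: "\<And>i. i < s \<Longrightarrow> 0 < e i \<and> e i \<le> D"
    and F: "\<And>i. i < s \<Longrightarrow> hom_form n (e i) (F i)"
    and high_rank: "high_rank n {..<s} e F (word_bound D (s * m))"
  shows "deg_le (s * m) N G \<Longrightarrow> \<forall>i<s. hom_form s (e i) (f0 i) \<Longrightarrow> G (point_values s m pt f0) \<noteq> 0 \<Longrightarrow>
    \<exists>\<phi>. G (point_values s m pt (subst_lin s \<phi> F)) \<noteq> 0"
proof (induction N arbitrary: G f0)
  case 0
  then obtain c where "G = (\<lambda>x. c)" using deg_le_0_const by blast
  thus ?case using 0 by simp
next
  case (Suc N)
  let ?k = "s * m"
  let ?V = "point_values s m pt"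
  obtain DG where DG: "\<And>\<iota>. deg_le ?k N (DG \<iota>)"
    "\<And>(\<kappa> :: nat \<Rightarrow> nat \<Rightarrow> cvec \<Rightarrow> complex) \<kappa>0 D. (\<forall>\<iota> v. \<kappa> 0 \<iota> v = \<kappa>0 \<iota>) \<Longrightarrow> (\<forall>j>D. \<forall>\<iota>. \<kappa> j \<iota> = (\<lambda>v. 0)) \<Longrightarrow>
      (\<exists>g. (\<forall>t v. G (\<lambda>\<iota>. \<Sum>j\<le>D. t ^ j * \<kappa> j \<iota> v) = (\<Sum>j\<le>Suc N*D. t ^ j * g j v)) \<and>
         (\<forall>v. g 0 v = G \<kappa>0) \<and> (\<forall>j>Suc N*D. \<forall>v. g j v = 0) \<and>
         (\<forall>j\<ge>1. g j \<in> word_span ?k \<kappa> 1 j \<and> (\<lambda>v. g j v - (\<Sum>\<iota><?k. DG \<iota> \<kappa>0 * \<kappa> j \<iota> v)) \<in> word_span ?k \<kappa> 2 j))"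
    using deg_le_taylor[OF Suc.prems(1)] by (simp only: diff_Suc_1) blast
  let ?form = "\<lambda>f. \<forall>i<s. hom_form s (e i) (f i)"
  let ?polar_deriv = "polar_deriv s m e pt DG"
  show ?case
  proof (cases "\<forall>i<s. \<forall>\<alpha> f. ?form f \<longrightarrow> ?polar_deriv i \<alpha> (?V f) = 0")
    \<comment> \<open>All derivatives of \<open>G\<close> in the directions of forms vanish, so
      \<open>G\<close> is constant on tuples of forms; its value is found at the zero tuple.\<close>
    case True
    have dz: "(\<Sum>\<iota><?k. DG \<iota> (?V f) * ?V g \<iota>) = 0" if "?form f" "?form g" for f g
      unfolding sum_div_mod
    proof (rule sum.neutral, rule ballI)
      fix i assume "i \<in> {..<s}"
      hence i: "i < s" by simp
      have "(\<Sum>j<m. DG (i * m + j) (?V f) * ?V g (i * m + j)) = (\<Sum>j<m. DG (i * m + j) (?V f) * g i (pt j))"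
        by (intro sum.cong refl) (simp add: point_values_ij i)
      also have "\<dots> = 0" by (rule polar_deriv_dual) (use True that i in auto)
      finally show "(\<Sum>j<m. DG (i * m + j) (?V f) * ?V g (i * m + j)) = 0" .
    qed
    have const: "G (?V f) = G (\<lambda>\<iota>. 0)" if f: "?form f" for f
    proof -
      obtain p where p: "\<And>t. G (\<lambda>\<iota>. 0 + t * ?V f \<iota>) = poly p t"
        using deg_le_line[OF Suc.prems(1), of "\<lambda>_. 0" "?V f"] by blast
      have "poly p 1 = poly p 0"
      proof (rule poly_deriv_zero_const)
        fix t0
        let ?ft = "\<lambda>i x. t0 * f i x"
        have fft: "?form ?ft" using f by (auto intro: hom_form_cmult)
        have vft: "?V ?ft \<iota> = t0 * ?V f \<iota>" for \<iota> by (simp add: point_values_def)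
        define \<kappa> :: "nat \<Rightarrow> nat \<Rightarrow> cvec \<Rightarrow> complex" where
          "\<kappa> j \<iota> v = (if j = 0 then ?V ?ft \<iota> else if j = 1 then ?V f \<iota> else 0)" for j \<iota> v
        have a1: "\<forall>\<iota> v. \<kappa> 0 \<iota> v = ?V ?ft \<iota>" by (simp add: \<kappa>_def)
        have a2: "\<forall>j>1. \<forall>\<iota>. \<kappa> j \<iota> = (\<lambda>v. 0)" by (auto simp: \<kappa>_def)
        obtain g where g: "\<And>t v. G (\<lambda>\<iota>. \<Sum>j\<le>1. t ^ j * \<kappa> j \<iota> v) = (\<Sum>j\<le>Suc N*1. t ^ j * g j v)"
          "(\<lambda>v. g 1 v - (\<Sum>\<iota><?k. DG \<iota> (?V ?ft) * \<kappa> 1 \<iota> v)) \<in> word_span ?k \<kappa> 2 1"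
          using DG(2)[OF a1 a2] by blast
        have "(\<Sum>\<iota><?k. DG \<iota> (?V ?ft) * \<kappa> 1 \<iota> v) = 0" for v
          using dz[OF fft f] by (simp add: \<kappa>_def)
        hence g1: "g 1 = (\<lambda>v. 0)" using word_span_21[OF g(2)] by (simp add: fun_eq_iff)
        have "poly p (t0 + t) = (\<Sum>j\<le>Suc N. t ^ j * g j (\<lambda>_. 0))" for t
          using g(1)[of t "\<lambda>_. 0"] p[of "t0 + t"] by (simp add: \<kappa>_def vft algebra_simps)
        thus "\<exists>g M. g 1 = 0 \<and> (\<forall>t. poly p (t0 + t) = (\<Sum>j\<le>M. t ^ j * g j))"
          using g1 by (intro exI[of _ "\<lambda>j. g j (\<lambda>_. 0)"] exI[of _ "Suc N"]) auto
      qed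
      thus ?thesis using p[of 1] p[of 0] by simp
    qed
    have "?form (subst_lin s \<phi> F)" for \<phi> using F hom_form_subst_lin by blast
    hence "G (?V (subst_lin s \<phi> F)) \<noteq> 0" for \<phi>
      using const[of f0] const[of "subst_lin s \<phi> F"] Suc.prems(2,3) by simp
    thus ?thesis by blast
  next
    case False
    define Es where "Es = {e i | i \<alpha> f. i < s \<and> ?form f \<and> ?polar_deriv i \<alpha> (?V f) \<noteq> 0}"
    have fEs: "finite Es" "Es \<noteq> {}"
    proof -
      have "Es \<subseteq> e ` {..<s}" by (auto simp: Es_def)
      thus "finite Es" by (rule finite_subset) simp
      show "Es \<noteq> {}" using False unfolding Es_def by blast
    qed
    \<comment> \<open>\<open>E\<close> is the largest degree in which a derivative survives. In
      order \<open>E\<close>, components of larger degree will contribute nothing for lack of a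
      derivative, and those of smaller degree because their expansion ends earlier.\<close>
    define E where "E = Max Es"
    have "E \<in> Es" unfolding E_def using fEs by simp
    then obtain i0 \<alpha> f where i0: "i0 < s" "e i0 = E" "?form f" "?polar_deriv i0 \<alpha> (?V f) \<noteq> 0"
      unfolding Es_def by blast
    have big: "?polar_deriv i \<beta> (?V h) = 0" if "i < s" "e i > E" "?form h" for i \<beta> h
    proof (rule ccontr)
      assume "?polar_deriv i \<beta> (?V h) \<noteq> 0"
      hence "e i \<in> Es" unfolding Es_def using that by blast
      hence "e i \<le> E" unfolding E_def using fEs by simp
      thus False using that by simp
    qed
    have pdDD: "deg_le ?k N (?polar_deriv i0 \<alpha>)" unfolding polar_deriv_def[abs_def]
      by (intro deg_le_sum deg_le_cmult DG(1))
    obtain \<phi>0 where \<phi>0: "?polar_deriv i0 \<alpha> (?V (subst_lin s \<phi>0 F)) \<noteq> 0"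
      using Suc.IH[OF pdDD i0(3,4)] by blast
    let ?f0 = "subst_lin s \<phi>0 F"
    have form0: "?form ?f0" using F hom_form_subst_lin by blast
    show ?thesis
    proof (rule ccontr)
      assume "\<not> ?thesis"
      hence vanish: "\<And>\<phi>. G (?V (subst_lin s \<phi> F)) = 0" by blast
      have E: "0 < E" "E \<le> D" using e[OF i0(1)] i0(2) by auto
      define R where "R i x H \<longleftrightarrow> (i < s \<longrightarrow> (\<forall>k. hom_form n k (H k)) \<and> (\<forall>k>e i. H k = (\<lambda>v. 0)) \<and> H (e i) = F i \<and>
          (\<forall>t v. F i (\<lambda>l. (\<Sum>b<s. x b * \<phi>0 b l) + t * v l) = (\<Sum>k\<le>e i. t ^ k * H k v)))" for i x H
      have "\<exists>H. R i x H" for i x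
      proof (cases "i < s")
        case True
        from hom_form_shift[OF F[OF True], of "\<lambda>l. \<Sum>b<s. x b * \<phi>0 b l"] True show ?thesis
          unfolding R_def by (simp only: simp_thms)
      qed (simp add: R_def)
      then obtain H where HH: "\<And>i x. R i x (H i x)" by metis
      have H: "\<And>i x k. i < s \<Longrightarrow> hom_form n k (H i x k)" "\<And>i x k. i < s \<Longrightarrow> k > e i \<Longrightarrow> H i x k = (\<lambda>v. 0)"
        "\<And>i x. i < s \<Longrightarrow> H i x (e i) = F i"
        "\<And>i x t v. i < s \<Longrightarrow> F i (\<lambda>l. (\<Sum>b<s. x b * \<phi>0 b l) + t * v l) = (\<Sum>k\<le>e i. t ^ k * H i x k v)"
        using HH unfolding R_def by blast+
      define \<kappa> :: "nat \<Rightarrow> nat \<Rightarrow> cvec \<Rightarrow> complex" where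
        "\<kappa> k \<iota> v = (if \<iota> < ?k then lin s \<alpha> (pt (\<iota> mod m)) ^ k * H (\<iota> div m) (pt (\<iota> mod m)) k v else 0)" for k \<iota> v
      have dm: "\<iota> div m < s" if "\<iota> < ?k" for \<iota>
        using that by (simp add: less_mult_imp_div_less)
      have hom_form\<kappa>: "hom_form n k (\<kappa> k \<iota>)" if "\<iota> < ?k" for k \<iota>
        unfolding \<kappa>_def using that H(1)[OF dm[OF that]] by (auto intro: hom_form_cmult)
      \<comment> \<open>Perturbing \<open>\<phi>0\<close> by a map of rank one with image spanned by
        \<open>v\<close> puts the k-th power of \<open>lin s \<alpha> x\<close> into the coefficient
        of \<open>t ^ k\<close>. In order \<open>E\<close> the gradient then meets precisely the
        direction of \<open>polar_deriv\<close>.\<close>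
      have path: "F i (\<lambda>l. \<Sum>b<s. x b * (\<phi>0 b l + t * \<alpha> b * v l)) = (\<Sum>k\<le>D. t ^ k * (lin s \<alpha> x ^ k * H i x k v))"
        if i: "i < s" for i x t v
      proof -
        have "(\<lambda>l. \<Sum>b<s. x b * (\<phi>0 b l + t * \<alpha> b * v l)) = (\<lambda>l. (\<Sum>b<s. x b * \<phi>0 b l) + (t * lin s \<alpha> x) * v l)"
          by (rule ext) (simp add: lin_def algebra_simps sum.distrib sum_distrib_left sum_distrib_right)
        hence "F i (\<lambda>l. \<Sum>b<s. x b * (\<phi>0 b l + t * \<alpha> b * v l)) = (\<Sum>k\<le>e i. (t * lin s \<alpha> x) ^ k * H i x k v)"
          using H(4)[OF i] by simp
        also have "\<dots> = (\<Sum>k\<le>D. (t * lin s \<alpha> x) ^ k * H i x k v)"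
          by (rule sum.mono_neutral_left) (use e[OF i] H(2)[OF i] in auto)
        finally show ?thesis by (simp add: power_mult_distrib mult.assoc)
      qed
      have a1: "\<forall>\<iota> v. \<kappa> 0 \<iota> v = ?V ?f0 \<iota>"
      proof (intro allI)
        fix \<iota> v
        show "\<kappa> 0 \<iota> v = ?V ?f0 \<iota>"
        proof (cases "\<iota> < ?k")
          case True
          have "(\<Sum>k\<le>D. 0 ^ k * (lin s \<alpha> x ^ k * H i x k v)) = H i x 0 v" for i x
            by (simp add: power_0_left if_distrib[of "\<lambda>c. c * _"] cong: if_cong)
          with path[OF dm[OF True], of "pt (\<iota> mod m)" 0 v] True show ?thesis
            by (simp add: \<kappa>_def point_values_def subst_lin_def)
        qed (simp add: \<kappa>_def point_values_def)
      qed
      have a2: "\<forall>j>D. \<forall>\<iota>. \<kappa> j \<iota> = (\<lambda>v. 0)"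
      proof (intro allI impI)
        fix j \<iota> assume j: "j > D"
        show "\<kappa> j \<iota> = (\<lambda>v. 0)"
        proof (cases "\<iota> < ?k")
          case True
          have "e (\<iota> div m) < j" using e[OF dm[OF True]] j by simp
          from H(2)[OF dm[OF True] this] show ?thesis by (simp add: \<kappa>_def fun_eq_iff)
        qed (simp add: \<kappa>_def fun_eq_iff)
      qed
      obtain g where g: "\<And>t v. G (\<lambda>\<iota>. \<Sum>j\<le>D. t ^ j * \<kappa> j \<iota> v) = (\<Sum>j\<le>Suc N*D. t ^ j * g j v)"
         "\<And>j v. j>Suc N*D \<Longrightarrow> g j v = 0"
         "\<And>j. j\<ge>1 \<Longrightarrow> (\<lambda>v. g j v - (\<Sum>\<iota><?k. DG \<iota> (?V ?f0) * \<kappa> j \<iota> v)) \<in> word_span ?k \<kappa> 2 j"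
        using DG(2)[OF a1 a2] by blast
      have Gz: "G (\<lambda>\<iota>. \<Sum>j\<le>D. t ^ j * \<kappa> j \<iota> v) = 0" for t v
      proof -
        have "G (\<lambda>\<iota>. \<Sum>j\<le>D. t ^ j * \<kappa> j \<iota> v) = G (?V (subst_lin s (\<lambda>b l. \<phi>0 b l + t * \<alpha> b * v l) F))"
        proof (rule deg_le_cong[OF Suc.prems(1)])
          fix \<iota> assume \<iota>: "\<iota> < ?k"
          show "(\<Sum>j\<le>D. t ^ j * \<kappa> j \<iota> v) = ?V (subst_lin s (\<lambda>b l. \<phi>0 b l + t * \<alpha> b * v l) F) \<iota>"
            using path[OF dm[OF \<iota>], of "pt (\<iota> mod m)" t v] \<iota> by (simp add: \<kappa>_def point_values_def subst_lin_def)
        qed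
        thus ?thesis using vanish by simp
      qed
      have gE: "g E v = 0" for v
      proof (cases "E \<le> Suc N * D")
        case True
        show ?thesis by (rule poly_fun_zero_all[of "\<lambda>j. g j v" "Suc N*D" E]) (use g(1) Gz True in auto)
      qed (use g(2) in auto)
      define c where "c i = ?polar_deriv i \<alpha> (?V ?f0)" for i
      have main: "(\<Sum>\<iota><?k. DG \<iota> (?V ?f0) * \<kappa> E \<iota> v) = (\<Sum>i\<in>{i\<in>{..<s}. e i = E}. c i * F i v)" for v
      proof -
        have "(\<Sum>\<iota><?k. DG \<iota> (?V ?f0) * \<kappa> E \<iota> v) =
          (\<Sum>i<s. \<Sum>j<m. DG (i * m + j) (?V ?f0) * (lin s \<alpha> (pt j) ^ E * H i (pt j) E v))"
          unfolding sum_div_mod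
        proof (intro sum.cong refl)
          fix i j assume ij: "i \<in> {..<s}" "j \<in> {..<m}"
          have "i * m + j < ?k"
          proof -
            have "i * m + j < i * m + m" using ij by simp
            also have "\<dots> = Suc i * m" by simp
            also have "\<dots> \<le> s * m" using ij by (intro mult_le_mono1) simp
            finally show ?thesis .
          qed
          thus "DG (i * m + j) (?V ?f0) * \<kappa> E (i * m + j) v =
            DG (i * m + j) (?V ?f0) * (lin s \<alpha> (pt j) ^ E * H i (pt j) E v)"
            using ij by (simp add: \<kappa>_def)
        qed
        also have "\<dots> = (\<Sum>i<s. if e i = E then c i * F i v else 0)"
        proof (intro sum.cong refl)
          fix i assume "i \<in> {..<s}"
          hence i: "i < s" by simp
          show "(\<Sum>j<m. DG (i * m + j) (?V ?f0) * (lin s \<alpha> (pt j) ^ E * H i (pt j) E v)) =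
            (if e i = E then c i * F i v else 0)"
          proof (cases "e i" E rule: linorder_cases)
            case less
            thus ?thesis using H(2)[OF i less] by simp
          next
            case equal
            hence "H i x E = F i" for x using H(3)[OF i] by simp
            thus ?thesis using equal by (simp add: c_def polar_deriv_def sum_distrib_left mult_ac)
          next
            \<comment> \<open>By the choice of \<open>E\<close> the gradient annihilates all forms
              in component \<open>i\<close>, in particular every point of the path, hence each
              coefficient of the path.\<close>
            case greater
            have "(\<Sum>k\<le>D. t ^ k * (\<Sum>j<m. DG (i * m + j) (?V ?f0) * (lin s \<alpha> (pt j) ^ k * H i (pt j) k v))) = 0" for t
            proof -
              let ?h = "subst_lin s (\<lambda>b l. \<phi>0 b l + t * \<alpha> b * v l) F i"
              have "0 = (\<Sum>j<m. DG (i * m + j) (?V ?f0) * ?h (pt j))"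
                by (rule polar_deriv_dual[symmetric, where e = e and s = s]) (use big[OF i greater form0] hom_form_subst_lin[of n "e i" F i s] F[OF i] in auto)
              also have "\<dots> = (\<Sum>j<m. DG (i * m + j) (?V ?f0) * (\<Sum>k\<le>D. t ^ k * (lin s \<alpha> (pt j) ^ k * H i (pt j) k v)))"
                by (simp add: subst_lin_def path[OF i])
              also have "\<dots> = (\<Sum>k\<le>D. t ^ k * (\<Sum>j<m. DG (i * m + j) (?V ?f0) * (lin s \<alpha> (pt j) ^ k * H i (pt j) k v)))"
                by (rule sum_pow_swap)
              finally show ?thesis by simp
            qed
            hence z: "(\<Sum>j<m. DG (i * m + j) (?V ?f0) * (lin s \<alpha> (pt j) ^ E * H i (pt j) E v)) = 0"
              by (rule poly_fun_zero_all[of "\<lambda>k. \<Sum>j<m. DG (i * m + j) (?V ?f0) * (lin s \<alpha> (pt j) ^ k * H i (pt j) k v)" D E, OF _ E(2)])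
            have ne: "e i \<noteq> E" using greater by simp
            show ?thesis unfolding if_not_P[OF ne] by (rule z)
          qed
        qed
        also have "\<dots> = (\<Sum>i\<in>{i\<in>{..<s}. e i = E}. c i * F i v)"
          by (rule sum.inter_filter[symmetric]) simp
        finally show ?thesis .
      qed
      \<comment> \<open>The coefficient of \<open>t ^ E\<close> is 0, so its linear part, a
        combination of the \<open>F i\<close> of degree \<open>E\<close>, is a combination of
        products with at least two factors. Its coefficient \<open>c i0\<close> is not 0, contrary
        to the high rank.\<close>
      have "(\<lambda>v. -1 * (g E v - (\<Sum>\<iota><?k. DG \<iota> (?V ?f0) * \<kappa> E \<iota> v))) \<in> word_span ?k \<kappa> 2 E"
        by (rule word_span_cmult, rule g(3)) (use E in simp)
      hence "(\<lambda>v. \<Sum>i\<in>{i\<in>{..<s}. e i = E}. c i * F i v) \<in> word_span ?k \<kappa> 2 E"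
        by (simp add: gE main)
      from word_span_lowrank[OF hom_form\<kappa> this E(2)]
      have "lowrank n E (word_bound D ?k) (\<lambda>v. \<Sum>i\<in>{i\<in>{..<s}. e i = E}. c i * F i v)" .
      moreover have "c i0 \<noteq> 0" using \<phi>0 by (simp add: c_def)
      ultimately show False using high_rank i0 unfolding high_rank_def by blast
    qed
  qed
qed

section \<open>Macaulay determinants and the solution of equations\<close>

lemma det_deg_le:
  assumes "\<And>a b. a < M \<Longrightarrow> b < M \<Longrightarrow> deg_le k t (\<lambda>x. E a b x)"
  shows "deg_le k (M * t) (\<lambda>x. det (mat M M (\<lambda>(a,b). E a b x)))"
proof -
  have "deg_le k (M * t) (\<lambda>x. signof p * (\<Prod>i\<in>{0..<M}. E i (p i) x))" if "p permutes {0..<M}" for p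
  proof (rule deg_le_cmult)
    have "deg_le k (\<Sum>i\<in>{0..<M}. t) (\<lambda>x. \<Prod>i\<in>{0..<M}. E i (p i) x)"
      by (rule deg_le_prod) (use assms permutes_in_image[OF that] in auto)
    thus "deg_le k (M * t) (\<lambda>x. \<Prod>i\<in>{0..<M}. E i (p i) x)" by simp
  qed
  hence "deg_le k (M * t) (\<lambda>x. \<Sum>p\<in>{p. p permutes {0..<M}}. signof p * (\<Prod>i\<in>{0..<M}. E i (p i) x))"
    by (intro deg_le_sum) auto
  moreover have "det (mat M M (\<lambda>(a,b). E a b x)) = (\<Sum>p\<in>{p. p permutes {0..<M}}. signof p * (\<Prod>i\<in>{0..<M}. E i (p i) x))" for x
    unfolding det_def
    by (auto intro!: sum.cong prod.cong simp: permutes_in_image)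
  ultimately show ?thesis by simp
qed

lemma deg_le_if: "deg_le n t F \<Longrightarrow> deg_le n t G \<Longrightarrow> deg_le n t (\<lambda>x. if c then F x else G x)"
  by (cases c) simp_all

lemma mon_fun_add: "mon_fun S (\<lambda>i. \<gamma> i + \<delta> i) x = mon_fun S \<gamma> x * mon_fun S \<delta> x"
  by (simp add: mon_fun_def power_add prod.distrib)

text \<open>A Macaulay determinant: it does not vanish at the tuple of pure powers, and its vanishing is forced
  by a nontrivial common zero x, since the vector of monomials at x lies in the kernel.\<close>

lemma macaulay:
  assumes s: "s > 0" and e: "\<And>i. i < s \<Longrightarrow> 0 < e i \<and> e i \<le> D" and q: "q = s * D + 2"
  shows "\<exists>pt N G f0. deg_le (s * q ^ s) N G \<and> (\<forall>i<s. hom_form s (e i) (f0 i)) \<and> G (point_values s (q ^ s) pt f0) \<noteq> 0 \<and>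
    (\<forall>f. (\<forall>i<s. hom_form s (e i) (f i)) \<longrightarrow> G (point_values s (q ^ s) pt f) \<noteq> 0 \<longrightarrow>
      (\<forall>x. (\<forall>i<s. f i x = 0) \<longrightarrow> (\<forall>j<s. x j = 0)))"
proof -
  \<comment> \<open>The least degree in which every monomial is divisible by some
    \<open>x i ^ e i\<close>.\<close>
  define N where "N = Suc (\<Sum>i<s. e i - 1)"
  have eq: "e i < q" if "i < s" for i
  proof -
    have "1 * D \<le> s * D" using s by (intro mult_le_mono1) simp
    thus ?thesis using e[OF that] unfolding q by linarith
  qed
  obtain ms where ms: "set ms = exponents s N" "distinct ms" using finite_distinct_list[OF finite_exponents] by blast
  define M where "M = length ms"
  obtain gs where gs: "set gs = grid {..<s} q" "distinct gs" using finite_distinct_list[OF finite_grid[OF finite_lessThan]] by blast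
  define m where "m = q ^ s"
  have lm: "length gs = m"
    using distinct_card[OF gs(2)] gs(1) by (simp add: m_def grid_def card_PiE)
  define pt where "pt j = root_pt {..<s} q (gs ! j)" for j
  \<comment> \<open>The linear functional on point values that returns the coefficient of the
    monomial \<open>\<delta>\<close> in the i-th form.\<close>
  define cfv where "cfv i \<delta> \<kappa> = (\<Sum>j<m. root_weight {..<s} q \<delta> (gs ! j) * \<kappa> (i * m + j))" for i \<delta> and \<kappa> :: cvec
  have cfv_point_values: "cfv i \<delta> (point_values s m pt f) = mono_coeff {..<s} q \<delta> (f i)" if "i < s" for i \<delta> f
  proof -
    have "cfv i \<delta> (point_values s m pt f) = (\<Sum>j<m. root_weight {..<s} q \<delta> (gs ! j) * f i (root_pt {..<s} q (gs ! j)))"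
      unfolding cfv_def by (intro sum.cong refl) (simp add: point_values_ij that pt_def)
    also have "\<dots> = mono_coeff {..<s} q \<delta> (f i)" unfolding mono_coeff_def
      by (rule sum.reindex_bij_betw) (use bij_betw_nth[OF gs(2), of "{..<m}"] lm gs(1) in auto)
    finally show ?thesis .
  qed
  have ij: "i * m + j < s * m" if "i < s" "j < m" for i j
  proof -
    have "i * m + j < i * m + m" using that by simp
    also have "\<dots> = Suc i * m" by simp
    also have "\<dots> \<le> s * m" using that by (intro mult_le_mono1) simp
    finally show ?thesis .
  qed
  have deg_le_cfv: "deg_le (s * m) 1 (cfv i \<delta>)" if "i < s" for i \<delta>
    unfolding cfv_def[abs_def] using ij[OF that] deg_le_coord by (intro deg_le_sum deg_le_cmult) auto
  have "\<exists>i<s. e i \<le> \<gamma> i" if "\<gamma> \<in> exponents s N" for \<gamma>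
  proof (rule ccontr)
    assume "\<not> ?thesis"
    hence "\<gamma> i \<le> e i - 1" if "i < s" for i using that by (auto simp: not_le)
    hence "(\<Sum>i<s. \<gamma> i) \<le> (\<Sum>i<s. e i - 1)" by (intro sum_mono) auto
    thus False using that by (simp add: exponents_def N_def)
  qed
  then obtain pk where pk: "\<And>\<gamma>. \<gamma> \<in> exponents s N \<Longrightarrow> pk \<gamma> < s \<and> e (pk \<gamma>) \<le> \<gamma> (pk \<gamma>)" by metis
  \<comment> \<open>\<open>sh \<gamma>\<close> is the monomial \<open>\<gamma>\<close> divided by
    the chosen pure power. Row \<open>\<gamma>\<close> of the matrix lists the coefficients of the
    monomial \<open>sh \<gamma>\<close> times the form with index
    \<open>pk \<gamma>\<close>.\<close>
  define sh where "sh \<gamma> = \<gamma>(pk \<gamma> := \<gamma> (pk \<gamma>) - e (pk \<gamma>))" for \<gamma>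
  define ent where "ent \<gamma> \<beta> \<kappa> = (if \<forall>l. sh \<gamma> l \<le> \<beta> l then cfv (pk \<gamma>) (\<lambda>l. \<beta> l - sh \<gamma> l) \<kappa> else 0)" for \<gamma> \<beta> \<kappa>
  define G where "G \<kappa> = det (mat M M (\<lambda>(a,b). ent (ms ! a) (ms ! b) \<kappa>))" for \<kappa>
  define f0 where "f0 i x = x i ^ e i" for i and x :: cvec
  have msM: "ms ! a \<in> exponents s N" if "a < M" for a using that ms(1) nth_mem unfolding M_def by blast
  have 1: "deg_le (s * m) (M * 1) G"
    unfolding G_def[abs_def]
  proof (rule det_deg_le)
    fix a b assume "a < M" "b < M"
    thus "deg_le (s * m) 1 (\<lambda>x. ent (ms ! a) (ms ! b) x)"
      unfolding ent_def by (intro deg_le_if deg_le_const deg_le_cfv) (use pk[OF msM[of a]] in auto)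
  qed
  have 2: "hom_form s (e i) (f0 i)" if "i < s" for i
    using hom_form_power[OF hom_form_coord[OF that], of "e i"] unfolding f0_def by simp
  have f0_mono: "f0 i = mon_fun {..<s} (\<lambda>l. if l = i then e i else 0)" if "i < s" for i
  proof
    fix x
    have "mon_fun {..<s} (\<lambda>l. if l = i then e i else 0) x = (\<Prod>l<s. if l = i then x i ^ e i else 1)"
      unfolding mon_fun_def by (rule prod.cong) auto
    thus "f0 i x = mon_fun {..<s} (\<lambda>l. if l = i then e i else 0) x" using that by (simp add: f0_def)
  qed
  have 3: "G (point_values s m pt f0) \<noteq> 0"
  proof -
    \<comment> \<open>For pure powers the product in row \<open>\<gamma>\<close> is the monomial
      \<open>\<gamma>\<close> itself.\<close>
    have "mat M M (\<lambda>(a,b). ent (ms ! a) (ms ! b) (point_values s m pt f0)) = 1\<^sub>m M"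
    proof (rule eq_matI)
      fix a b assume "a < dim_row (1\<^sub>m M :: complex mat)" "b < dim_col (1\<^sub>m M :: complex mat)"
      hence ab: "a < M" "b < M" by auto
      let ?g = "ms ! a" and ?b = "ms ! b"
      have p: "pk ?g < s" "e (pk ?g) \<le> ?g (pk ?g)" using pk[OF msM[OF ab(1)]] by auto
      have "ent ?g ?b (point_values s m pt f0) = (if a = b then 1 else 0)"
      proof (cases "\<forall>l. sh ?g l \<le> ?b l")
        case False
        have "sh ?g l \<le> ?g l" for l by (simp add: sh_def)
        hence "a \<noteq> b" using False by auto
        thus ?thesis unfolding ent_def if_not_P[OF False] by simp
      next
        case True
        have sb: "(\<Sum>l<s. ?b l) = N" and sg: "(\<Sum>l<s. ?g l) = N" using msM ab by (auto simp: exponents_def)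
        have "(\<Sum>l<s. ?g l) = ?g (pk ?g) + (\<Sum>l\<in>{..<s}-{pk ?g}. ?g l)" using p by (subst sum.remove[of _ "pk ?g"]) auto
        moreover have "(\<Sum>l<s. sh ?g l) = ?g (pk ?g) - e (pk ?g) + (\<Sum>l\<in>{..<s}-{pk ?g}. ?g l)"
          using p by (subst sum.remove[of _ "pk ?g"]) (auto simp: sh_def)
        ultimately have ssh: "(\<Sum>l<s. sh ?g l) + e (pk ?g) = N" using p sg by simp
        have "(\<Sum>l<s. ?b l - sh ?g l) = (\<Sum>l<s. ?b l) - (\<Sum>l<s. sh ?g l)"
          using True by (intro sum_subtractf_nat) auto
        hence sd: "(\<Sum>l<s. ?b l - sh ?g l) = e (pk ?g)" using ssh sb by simp
        have ds: "?b l - sh ?g l < q" if "l < s" for l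
        proof -
          have "?b l - sh ?g l \<le> (\<Sum>l<s. ?b l - sh ?g l)" using that by (intro member_le_sum) auto
          thus ?thesis using sd eq[OF p(1)] by simp
        qed
        have "ent ?g ?b (point_values s m pt f0) = mono_coeff {..<s} q (\<lambda>l. ?b l - sh ?g l) (f0 (pk ?g))"
          using True by (simp add: ent_def cfv_point_values p)
        also have "\<dots> = (if \<forall>l\<in>{..<s}. ?b l - sh ?g l = (if l = pk ?g then e (pk ?g) else 0) then 1 else 0)"
          unfolding f0_mono[OF p(1)] using eq[OF p(1)] ds q by (intro mono_coeff_mon_fun) auto
        also have "(\<forall>l\<in>{..<s}. ?b l - sh ?g l = (if l = pk ?g then e (pk ?g) else 0)) \<longleftrightarrow> a = b"
        proof
          assume *: "\<forall>l\<in>{..<s}. ?b l - sh ?g l = (if l = pk ?g then e (pk ?g) else 0)"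
          have "?g = ?b"
          proof (rule exponents_ext[OF msM[OF ab(1)] msM[OF ab(2)]], rule ballI)
            fix l assume l: "l \<in> {..<s}"
            have "?b l - sh ?g l = (if l = pk ?g then e (pk ?g) else 0)" "sh ?g l \<le> ?b l" using * True l by auto
            thus "?g l = ?b l" using p(2) by (auto simp: sh_def split: if_splits)
          qed
          thus "a = b" using ms(2) ab by (simp add: nth_eq_iff_index_eq M_def)
        next
          assume "a = b"
          thus "\<forall>l\<in>{..<s}. ?b l - sh ?g l = (if l = pk ?g then e (pk ?g) else 0)" using p(2) by (auto simp: sh_def)
        qed
        finally show ?thesis .
      qed
      thus "mat M M (\<lambda>(a,b). ent (ms ! a) (ms ! b) (point_values s m pt f0)) $$ (a, b) = 1\<^sub>m M $$ (a, b)" using ab by simp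
    qed auto
    thus ?thesis by (simp add: G_def)
  qed
  have 4: "x j = 0" if f: "\<forall>i<s. hom_form s (e i) (f i)" and nz: "G (point_values s m pt f) \<noteq> 0" and x: "\<forall>i<s. f i x = 0" and j: "j < s" for f x j
  proof (rule ccontr)
    assume xj: "x j \<noteq> 0"
    let ?A = "mat M M (\<lambda>(a,b). ent (ms ! a) (ms ! b) (point_values s m pt f))"
    let ?u = "vec M (\<lambda>b. mon_fun {..<s} (ms ! b) x)"
    define \<gamma> where "\<gamma> l = (if l = j then N else 0)" for l
    have "\<gamma> \<in> exponents s N" using j by (auto simp: \<gamma>_def exponents_def)
    then obtain b where b: "b < M" "ms ! b = \<gamma>" using ms(1) by (metis M_def in_set_conv_nth)
    have "mon_fun {..<s} \<gamma> x = (\<Prod>l<s. if l = j then x j ^ N else 1)"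
      unfolding mon_fun_def \<gamma>_def by (rule prod.cong) auto
    hence "mon_fun {..<s} \<gamma> x \<noteq> 0" using j xj by simp
    hence u0: "?u \<noteq> 0\<^sub>v M" using b by (metis index_vec index_zero_vec(1))
    have "?A *\<^sub>v ?u = 0\<^sub>v M"
    proof (rule eq_vecI)
      fix a assume "a < dim_vec (0\<^sub>v M :: complex vec)"
      hence a: "a < M" by simp
      let ?g = "ms ! a"
      have g: "?g \<in> exponents s N" by (rule msM[OF a])
      have p: "pk ?g < s" "e (pk ?g) \<le> ?g (pk ?g)" using pk[OF g] by auto
      let ?E = "\<lambda>\<beta>. ent ?g \<beta> (point_values s m pt f) * mon_fun {..<s} \<beta> x"
      have "(?A *\<^sub>v ?u) $ a = (\<Sum>b<M. ?E (ms ! b))"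
        using a by (simp add: scalar_prod_def atLeast0LessThan)
      also have "\<dots> = (\<Sum>\<beta>\<in>exponents s N. ?E \<beta>)"
        by (rule sum.reindex_bij_betw) (use bij_betw_nth[OF ms(2), of "{..<M}"] ms(1) in \<open>auto simp: M_def\<close>)
      also have "\<dots> = (\<Sum>\<beta>\<in>{\<beta>\<in>exponents s N. \<forall>l. sh ?g l \<le> \<beta> l}. ?E \<beta>)"
        by (rule sum.mono_neutral_right) (auto simp: ent_def)
      also have "\<dots> = (\<Sum>\<delta>\<in>exponents s (e (pk ?g)). mono_coeff {..<s} q \<delta> (f (pk ?g)) * mon_fun {..<s} (\<lambda>l. \<delta> l + sh ?g l) x)"
      proof (rule sum.reindex_bij_witness[of _ "\<lambda>\<delta> l. \<delta> l + sh ?g l" "\<lambda>\<beta> l. \<beta> l - sh ?g l"])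
        have "(\<Sum>l<s. ?g l) = ?g (pk ?g) + (\<Sum>l\<in>{..<s}-{pk ?g}. ?g l)" using p by (subst sum.remove[of _ "pk ?g"]) auto
        moreover have "(\<Sum>l<s. sh ?g l) = ?g (pk ?g) - e (pk ?g) + (\<Sum>l\<in>{..<s}-{pk ?g}. ?g l)"
          using p by (subst sum.remove[of _ "pk ?g"]) (auto simp: sh_def)
        ultimately have ssh: "(\<Sum>l<s. sh ?g l) + e (pk ?g) = N" using p g by (simp add: exponents_def)
        have shz: "sh ?g l = 0" if "l \<ge> s" for l using that g p by (auto simp: sh_def exponents_def)
        show "(\<lambda>l. \<beta> l - sh ?g l) \<in> exponents s (e (pk ?g))" if "\<beta> \<in> {\<beta>\<in>exponents s N. \<forall>l. sh ?g l \<le> \<beta> l}" for \<beta>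
        proof -
          have "(\<Sum>l<s. \<beta> l - sh ?g l) = (\<Sum>l<s. \<beta> l) - (\<Sum>l<s. sh ?g l)"
            using that by (intro sum_subtractf_nat) auto
          thus ?thesis using that ssh by (auto simp: exponents_def)
        qed
        show "(\<lambda>l. \<delta> l + sh ?g l) \<in> {\<beta>\<in>exponents s N. \<forall>l. sh ?g l \<le> \<beta> l}" if "\<delta> \<in> exponents s (e (pk ?g))" for \<delta>
          using that ssh shz by (auto simp: exponents_def sum.distrib)
        show "(\<lambda>l. (\<beta> l - sh ?g l) + sh ?g l) = \<beta>" if "\<beta> \<in> {\<beta>\<in>exponents s N. \<forall>l. sh ?g l \<le> \<beta> l}" for \<beta>
          using that by auto
        show "(\<lambda>l. (\<delta> l + sh ?g l) - sh ?g l) = \<delta>" for \<delta> by simp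
        show "mono_coeff {..<s} q (\<lambda>l. \<beta> l - sh ?g l) (f (pk ?g)) * mon_fun {..<s} (\<lambda>l. (\<beta> l - sh ?g l) + sh ?g l) x = ?E \<beta>"
          if "\<beta> \<in> {\<beta>\<in>exponents s N. \<forall>l. sh ?g l \<le> \<beta> l}" for \<beta>
          using that by (simp add: ent_def cfv_point_values p)
      qed
      also have "\<dots> = f (pk ?g) x * mon_fun {..<s} (sh ?g) x"
        using hom_form_expand[of s "e (pk ?g)" "f (pk ?g)" q x] f p(1) eq[OF p(1)]
        by (simp add: mon_fun_add sum_distrib_right mult.assoc)
      also have "\<dots> = 0" using x p(1) by simp
      finally show "(?A *\<^sub>v ?u) $ a = 0\<^sub>v M $ a" using a by simp
    qed simp
    hence "det ?A = 0"
      using det_0_iff_vec_prod_zero_field[of ?A M] u0 by (auto intro!: exI[of _ ?u])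
    thus False using nz by (simp add: G_def)
  qed
  show ?thesis
    unfolding m_def[symmetric]
    by (rule exI[of _ pt], rule exI[of _ "M * 1"], rule exI[of _ G], rule exI[of _ f0]) (use 1 2 3 4 in blast)
qed

text \<open>\<open>word_bound\<close> for the number of point values that the Macaulay determinant
  of \<open>s\<close> forms of degree at most \<open>D\<close> requires.\<close>

definition solvable_bound :: "nat \<Rightarrow> nat \<Rightarrow> nat" where
  "solvable_bound s D = word_bound D (s * (s * D + 2) ^ s)"

text \<open>Along a suitable \<open>\<phi>\<close> the \<open>F i\<close> restrict to forms without
  a nontrivial common zero. Homogenising \<open>F i - T i\<close> there with one more variable gives
  \<open>s\<close> forms in \<open>s + 1\<close> variables. At a common zero the new variable cannot
  be 0, for then only the \<open>F i\<close> would remain; so it can be scaled to 1.\<close>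

theorem solvable:
  assumes e: "\<And>i. i < s \<Longrightarrow> 0 < e i \<and> e i \<le> D"
    and F: "\<And>i. i < s \<Longrightarrow> hom_form n (e i) (F i)"
    and T: "\<And>i. i < s \<Longrightarrow> deg_le n (e i - 1) (T i)"
    and high_rank: "high_rank n {..<s} e F (solvable_bound s D)"
  shows "\<exists>v. \<forall>i<s. F i v = T i v"
proof (cases "s = 0")
  case False
  hence s: "s > 0" by simp
  obtain pt N G f0 where G: "deg_le (s * (s * D + 2) ^ s) N G" "\<forall>i<s. hom_form s (e i) (f0 i)" "G (point_values s ((s * D + 2) ^ s) pt f0) \<noteq> 0"
    "\<forall>f. (\<forall>i<s. hom_form s (e i) (f i)) \<longrightarrow> G (point_values s ((s * D + 2) ^ s) pt f) \<noteq> 0 \<longrightarrow>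
      (\<forall>x. (\<forall>i<s. f i x = 0) \<longrightarrow> (\<forall>j<s. x j = 0))"
    using macaulay[where q = "s * D + 2" and e = e and D = D, OF s e refl] by blast
  obtain \<phi> where \<phi>: "G (point_values s ((s * D + 2) ^ s) pt (subst_lin s \<phi> F)) \<noteq> 0"
    using universality[OF e F high_rank[unfolded solvable_bound_def] G(1-3)] by blast
  have triv: "x j = 0" if "\<forall>i<s. subst_lin s \<phi> F i x = 0" "j < s" for x j
    using G(4) \<phi> that F hom_form_subst_lin by blast
  have "\<forall>i. \<exists>H. i < s \<longrightarrow> (\<forall>k. hom_form n k (H k)) \<and> T i = (\<lambda>x. \<Sum>k\<le>e i - 1. H k x)"
    using deg_le_hom_form_components[OF T] by blast
  then obtain H where H: "\<And>i k. i < s \<Longrightarrow> hom_form n k (H i k)" "\<And>i x. i < s \<Longrightarrow> T i x = (\<Sum>k\<le>e i - 1. H i k x)" by metis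
  define \<psi> where "\<psi> x = (\<lambda>l. \<Sum>b<s. x b * \<phi> b l)" for x :: cvec
  have h\<psi>: "hom_form (Suc s) k (\<lambda>x. K (\<psi> x))" if "hom_form n k K" for k K
    unfolding \<psi>_def by (rule hom_form_comp1[OF that]) (auto intro!: hom_form_sum hom_form_cmult2 hom_form_coord[simplified])
  \<comment> \<open>\<open>x s\<close> is the homogenising variable; its exponents are positive
    because \<open>T i\<close> has degree less than \<open>e i\<close>.\<close>
  define P where "P i x = F i (\<psi> x) - (\<Sum>k\<le>e i - 1. x s ^ (e i - k) * H i k (\<psi> x))" for i x
  have "hom_form (Suc s) (e i) (P i)" if i: "i < s" for i
    unfolding P_def[abs_def]
  proof (intro hom_form_diff h\<psi> F i hom_form_sum)
    fix k assume "k \<in> {..e i - 1}"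
    hence "k \<le> e i" using e[OF i] by auto
    have "hom_form (Suc s) ((e i - k) * 1 + k) (\<lambda>x. x s ^ (e i - k) * H i k (\<psi> x))"
      by (intro hom_form_mult hom_form_power hom_form_coord h\<psi> H i) simp
    thus "hom_form (Suc s) (e i) (\<lambda>x. x s ^ (e i - k) * H i k (\<psi> x))" using \<open>k \<le> e i\<close> by simp
  qed
  then obtain x where x: "\<exists>j\<le>s. x j \<noteq> 0" "\<And>i. i < s \<Longrightarrow> P i x = 0"
    using forms_common_zero[of s e P] e by blast
  have xs: "x s \<noteq> 0"
  proof
    assume xs: "x s = 0"
    have "subst_lin s \<phi> F i x = 0" if "i < s" for i
    proof -
      have "(\<Sum>k\<le>e i - 1. x s ^ (e i - k) * H i k (\<psi> x)) = 0"
      proof (rule sum.neutral, rule ballI)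
        fix k assume "k \<in> {..e i - 1}"
        hence "e i - k > 0" using e[OF that] by auto
        thus "x s ^ (e i - k) * H i k (\<psi> x) = 0" using xs by simp
      qed
      thus ?thesis using x(2)[OF that] by (simp add: P_def subst_lin_def \<psi>_def)
    qed
    hence "x j = 0" if "j \<le> s" for j using triv[of x j] xs that by (cases "j = s") auto
    thus False using x(1) by blast
  qed
  let ?c = "inverse (x s)"
  have "F i (\<lambda>l. ?c * \<psi> x l) = T i (\<lambda>l. ?c * \<psi> x l)" if i: "i < s" for i
  proof -
    have "F i (\<lambda>l. ?c * \<psi> x l) = ?c ^ e i * F i (\<psi> x)" by (rule hom_form_scale[OF F[OF i]])
    also have "F i (\<psi> x) = (\<Sum>k\<le>e i - 1. x s ^ (e i - k) * H i k (\<psi> x))" using x(2)[OF i] by (simp add: P_def)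
    also have "?c ^ e i * \<dots> = (\<Sum>k\<le>e i - 1. ?c ^ k * H i k (\<psi> x))"
      unfolding sum_distrib_left
    proof (intro sum.cong refl)
      fix k assume "k \<in> {..e i - 1}"
      hence "k \<le> e i" using e[OF i] by auto
      hence "?c ^ e i = ?c ^ k * ?c ^ (e i - k)" by (simp add: power_add[symmetric])
      thus "?c ^ e i * (x s ^ (e i - k) * H i k (\<psi> x)) = ?c ^ k * H i k (\<psi> x)"
        using xs by (simp add: power_inverse)
    qed
    also have "\<dots> = T i (\<lambda>l. ?c * \<psi> x l)" by (simp add: H(2)[OF i] hom_form_scale[OF H(1)[OF i]])
    finally show ?thesis .
  qed
  thus ?thesis by blast
qed simp

lemma high_rank_alt: 
  assumes "finite I"
  shows "high_rank n I e F B \<longleftrightarrow> (\<forall>E c. (\<exists>i\<in>I. e i = E \<and> c i \<noteq> 0) \<longrightarrow>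
     \<not> lowrank n E B (\<lambda>x. \<Sum>i\<in>I. if e i = E then c i * F i x else 0))"
  unfolding high_rank_def using assms by (simp add: sum.inter_filter)

lemma high_rank_reindex:
  assumes high_rank: "high_rank n I e F B" and h: "bij_betw h J I" and fin: "finite I"
  shows "high_rank n J (\<lambda>j. e (h j)) (\<lambda>j. F (h j)) B"
proof -
  have finJ: "finite J" using bij_betw_finite[OF h] fin by simp
  have "\<not> lowrank n E B (\<lambda>x. \<Sum>j\<in>J. if e (h j) = E then c j * F (h j) x else 0)"
    if ex: "\<exists>j\<in>J. e (h j) = E \<and> c j \<noteq> 0" for E c
  proof -
    define c' where "c' i = c (the_inv_into J h i)" for i
    have inj: "inj_on h J" using h by (simp add: bij_betw_def)
    have c': "c' (h j) = c j" if "j \<in> J" for j using the_inv_into_f_f[OF inj that] by (simp add: c'_def)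
    obtain j where j: "j \<in> J" "e (h j) = E" "c j \<noteq> 0" using ex by blast
    have "\<exists>i\<in>I. e i = E \<and> c' i \<noteq> 0"
      using j c' h by (intro bexI[of _ "h j"]) (auto simp: bij_betw_def)
    hence *: "\<not> lowrank n E B (\<lambda>x. \<Sum>i\<in>I. if e i = E then c' i * F i x else 0)"
      using high_rank unfolding high_rank_alt[OF fin] by blast
    have "(\<Sum>i\<in>I. if e i = E then c' i * F i x else 0) = (\<Sum>j\<in>J. if e (h j) = E then c j * F (h j) x else 0)" for x
      unfolding sum.reindex_bij_betw[OF h, symmetric] by (intro sum.cong refl) (simp add: c')
    thus ?thesis using * by simp
  qed
  thus ?thesis unfolding high_rank_alt[OF finJ] by blast
qed

theorem solvable_fin:
  assumes I: "finite I" and e: "\<And>i. i \<in> I \<Longrightarrow> 0 < e i \<and> e i \<le> D"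
    and F: "\<And>i. i \<in> I \<Longrightarrow> hom_form n (e i) (F i)"
    and T: "\<And>i. i \<in> I \<Longrightarrow> deg_le n (e i - 1) (T i)"
    and high_rank: "high_rank n I e F (solvable_bound (card I) D)"
  shows "\<exists>v. \<forall>i\<in>I. F i v = T i v"
proof -
  obtain h where h: "bij_betw h {..<card I} I"
    using ex_bij_betw_nat_finite[OF I] by (auto simp: atLeast0LessThan)
  have hI: "h j \<in> I" if "j < card I" for j using h that by (auto simp: bij_betw_def)
  obtain v where v: "\<And>j. j < card I \<Longrightarrow> F (h j) v = T (h j) v"
    using solvable[of "card I" "\<lambda>j. e (h j)" D n "\<lambda>j. F (h j)" "\<lambda>j. T (h j)"] e F T hI high_rank_reindex[OF high_rank h I] by blast
  have "F i v = T i v" if i: "i \<in> I" for i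
  proof -
    obtain j where "j < card I" "i = h j" using h i by (auto simp: bij_betw_def)
    thus ?thesis using v by simp
  qed
  thus ?thesis by blast
qed

lemma word_bound_mono: "k \<le> k' \<Longrightarrow> word_bound D k \<le> word_bound D k'"
  unfolding word_bound_def by (rule card_mono) (auto intro!: finite_lists_length_le)

lemma solvable_bound_mono: assumes "s \<le> s'" shows "solvable_bound s D \<le> solvable_bound s' D"
proof (cases "s = s'")
  case False
  have "(s * D + 2) ^ s \<le> (s' * D + 2) ^ s" using assms by (intro power_mono) auto
  also have "\<dots> \<le> (s' * D + 2) ^ s'" using assms by (intro power_increasing) auto
  finally show ?thesis unfolding solvable_bound_def using assms by (intro word_bound_mono mult_le_mono) auto
qed simp

section \<open>Regularisation of auxiliary forms\<close>

text \<open>The sum type separates the auxiliary forms, which may be traded, from the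
  \<open>P j\<close>, which may not.\<close>

definition joint_fam :: "(nat \<times> (cvec \<Rightarrow> complex)) list \<Rightarrow> nat \<Rightarrow> (nat + nat) set" where
  "joint_fam qs L = {..<length qs} <+> {..<L}"

definition joint_deg :: "(nat \<times> (cvec \<Rightarrow> complex)) list \<Rightarrow> (nat \<Rightarrow> nat) \<Rightarrow> nat + nat \<Rightarrow> nat" where
  "joint_deg qs d = case_sum (\<lambda>i. fst (qs ! i)) d"

definition joint_fun :: "(nat \<times> (cvec \<Rightarrow> complex)) list \<Rightarrow> (nat \<Rightarrow> cvec \<Rightarrow> complex) \<Rightarrow> nat + nat \<Rightarrow> cvec \<Rightarrow> complex" where
  "joint_fun qs P = case_sum (\<lambda>i. snd (qs ! i)) P"

lemma finite_joint_fam [simp]: "finite (joint_fam qs L)" by (simp add: joint_fam_def)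

lemma joint_fam_sum: "(\<Sum>i\<in>joint_fam qs L. h i) = (\<Sum>i<length qs. h (Inl i)) + (\<Sum>j<L. h (Inr j))" for h :: "_ \<Rightarrow> complex"
  unfolding joint_fam_def by (subst sum.Plus) (auto simp: comp_def)

text \<open>Regularisation in the sense of Schmidt: a member of a low-rank combination is traded for the
  factors of a decomposition, which have lower degree; P itself has high rank and is never traded.\<close>

lemma regularize:
  fixes \<rho> :: "nat \<Rightarrow> nat"
  assumes "\<And>e. e \<in># M \<Longrightarrow> e \<le> D"
  shows "\<exists>r. \<forall>n d P qs. mset (map fst qs) = M \<longrightarrow> (\<forall>(e,F)\<in>set qs. 0 < e \<and> hom_form n e F) \<longrightarrow> high_rank n {..<L} d P r \<longrightarrow>
    (\<exists>rs. (\<forall>(e,F)\<in>set rs. 0 < e \<and> e \<le> D \<and> hom_form n e F) \<and> high_rank n (joint_fam rs L) (joint_deg rs d) (joint_fun rs P) (\<rho> (length rs)) \<and>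
      (\<forall>x. (\<forall>(e,F)\<in>set rs. F x = 0) \<and> (\<forall>j<L. P j x = 0) \<longrightarrow> (\<forall>(e,F)\<in>set qs. F x = 0)))"
  using wf_mult[OF wf_less_than] assms
proof (induction M rule: wf_induct_rule)
  case (less M)
  define \<rho>0 where "\<rho>0 = \<rho> (size M)"
  \<comment> \<open>\<open>ext E\<close> reserves \<open>\<rho>0\<close> places for every degree
    from 1 to \<open>E - 1\<close>. Places that a decomposition leaves free are filled with zero
    forms, so that the new multiset of degrees depends on \<open>E\<close> alone and the bound
    \<open>r\<close> on \<open>M\<close> alone.\<close>
  define ext where "ext E = concat (map (\<lambda>a. map (\<lambda>l. (a, l)) [0..<\<rho>0]) [1..<E])" for E :: nat
  define M' where "M' E = M - {#E#} + mset (map fst (ext E))" for E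
  have ext_set: "set (ext E) = {(a, l). 1 \<le> a \<and> a < E \<and> l < \<rho>0}" for E by (auto simp: ext_def)
  have M'1: "(M' E, M) \<in> Multiset.mult less_than" if "E \<in># M" for E
  proof -
    have "(M - {#E#} + mset (map fst (ext E)), M - {#E#} + {#E#}) \<in> Multiset.mult less_than"
      by (rule one_step_implies_mult) (auto simp: ext_set)
    thus ?thesis using that by (simp add: M'_def)
  qed
  have M'2: "e \<le> D" if "E \<in># M" "e \<in># M' E" for E e
  proof -
    have "e \<in># M \<or> e \<in> set (map fst (ext E))"
      using that(2) in_diffD[of e M "{#E#}"] unfolding M'_def union_iff set_mset_mset by blast
    thus ?thesis using less.prems[of e] less.prems[OF that(1)] by (auto simp: ext_set)
  qed
  define S where "S M r \<longleftrightarrow> (\<forall>n d P qs. mset (map fst qs) = M \<longrightarrow> (\<forall>(e,F)\<in>set qs. 0 < e \<and> hom_form n e F) \<longrightarrow> high_rank n {..<L} d P r \<longrightarrow>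
    (\<exists>rs. (\<forall>(e,F)\<in>set rs. 0 < e \<and> e \<le> D \<and> hom_form n e F) \<and> high_rank n (joint_fam rs L) (joint_deg rs d) (joint_fun rs P) (\<rho> (length rs)) \<and>
      (\<forall>x. (\<forall>(e,F)\<in>set rs. F x = 0) \<and> (\<forall>j<L. P j x = 0) \<longrightarrow> (\<forall>(e,F)\<in>set qs. F x = 0))))" for M r
  have "\<exists>r. S (M' E) r" if "E \<in># M" for E
    unfolding S_def by (rule less.IH[OF M'1[OF that]]) (rule M'2[OF that])
  then obtain rr where rr: "\<And>E. E \<in># M \<Longrightarrow> S (M' E) (rr E)" by metis
  \<comment> \<open>Enough to exclude combinations of the \<open>P j\<close> alone, and to apply the
    induction hypothesis whichever degree \<open>E\<close> is traded.\<close>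
  define r where "r = \<rho>0 + (\<Sum>E\<in>set_mset M. rr E)"
  have rr_le: "rr E \<le> r" if "E \<in># M" for E
    using member_le_sum[of E "set_mset M" rr] that by (simp add: r_def)
  have "S M r" unfolding S_def
  proof (intro allI impI)
    fix n d P qs
    assume qs: "mset (map fst qs) = M" "\<forall>(e,F)\<in>set qs. 0 < e \<and> hom_form n e F" and HP: "high_rank n {..<L} d P r"
    let ?concl = "\<lambda>rs. (\<forall>(e,F)\<in>set rs. 0 < e \<and> e \<le> D \<and> hom_form n e F) \<and> high_rank n (joint_fam rs L) (joint_deg rs d) (joint_fun rs P) (\<rho> (length rs)) \<and>
      (\<forall>x. (\<forall>(e,F)\<in>set rs. F x = 0) \<and> (\<forall>j<L. P j x = 0) \<longrightarrow> (\<forall>(e,F)\<in>set qs. F x = 0))"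
    have len: "length qs = size M" using qs(1) by (metis length_map size_mset)
    show "\<exists>rs. ?concl rs"
    proof (cases "high_rank n (joint_fam qs L) (joint_deg qs d) (joint_fun qs P) \<rho>0")
      case True
      have "e \<le> D" if "(e, F) \<in> set qs" for e F
      proof (rule less.prems)
        show "e \<in># M" unfolding qs(1)[symmetric] using that by force
      qed
      thus ?thesis using True qs(2) len by (intro exI[of _ qs]) (auto simp: \<rho>0_def)
    next
      case False
      then obtain E c where c: "\<exists>i\<in>joint_fam qs L. joint_deg qs d i = E \<and> c i \<noteq> 0"
        and lr: "lowrank n E \<rho>0 (\<lambda>x. \<Sum>i\<in>joint_fam qs L. if joint_deg qs d i = E then c i * joint_fun qs P i x else 0)"
        unfolding high_rank_alt[OF finite_joint_fam] by blast
      have lr': "lowrank n E \<rho>0 (\<lambda>x. (\<Sum>i<length qs. if fst (qs ! i) = E then c (Inl i) * snd (qs ! i) x else 0) +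
          (\<Sum>j<L. if d j = E then c (Inr j) * P j x else 0))"
        using lr unfolding joint_fam_sum by (simp add: joint_deg_def joint_fun_def cong: if_cong)
      \<comment> \<open>The \<open>P j\<close> by themselves have high rank, so an auxiliary form
        must take part in the combination.\<close>
      have "\<exists>i<length qs. fst (qs ! i) = E \<and> c (Inl i) \<noteq> 0"
      proof (rule ccontr)
        assume no: "\<not> ?thesis"
        have z: "(\<Sum>i<length qs. if fst (qs ! i) = E then c (Inl i) * snd (qs ! i) x else 0) = 0" for x
          using no by (intro sum.neutral) auto
        obtain j where "j < L" "d j = E" "c (Inr j) \<noteq> 0" using c no by (auto simp: joint_fam_def joint_deg_def)
        hence ex: "\<exists>j\<in>{..<L}. d j = E \<and> c (Inr j) \<noteq> 0" by blast
        have "lowrank n E r (\<lambda>x. \<Sum>j<L. if d j = E then c (Inr j) * P j x else 0)"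
        proof (rule lowrank_mono)
          show "lowrank n E \<rho>0 (\<lambda>x. \<Sum>j<L. if d j = E then c (Inr j) * P j x else 0)"
            using lr' unfolding z add_0 .
        qed (simp add: r_def)
        thus False
          by (rule notE[OF HP[unfolded high_rank_alt[OF finite_lessThan], rule_format, of E "\<lambda>j. c (Inr j)", OF ex]])
      qed
      then obtain i0 where i0: "i0 < length qs" "fst (qs ! i0) = E" "c (Inl i0) \<noteq> 0" by blast
      obtain F0 where F0: "qs ! i0 = (E, F0)" using i0 by (cases "qs ! i0") auto
      have EM: "E \<in># M" unfolding qs(1)[symmetric] using i0 by (auto intro!: image_eqI[of _ _ "qs ! i0"])
      obtain r' A G where rAG: "r' \<le> \<rho>0" "\<And>l. l < r' \<Longrightarrow> \<exists>a b. a > 0 \<and> b > 0 \<and> a + b = E \<and> hom_form n a (A l) \<and> hom_form n b (G l)"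
        "\<And>x. (\<Sum>i<length qs. if fst (qs ! i) = E then c (Inl i) * snd (qs ! i) x else 0) +
          (\<Sum>j<L. if d j = E then c (Inr j) * P j x else 0) = (\<Sum>l<(r'::nat). A l x * G l x)"
        using lr' unfolding lowrank_def by blast
      obtain dg where dg: "\<And>l. l < r' \<Longrightarrow> 0 < dg l \<and> dg l < E \<and> hom_form n (dg l) (A l)"
      proof -
        have "\<forall>l. \<exists>a. l < r' \<longrightarrow> 0 < a \<and> a < E \<and> hom_form n a (A l)"
          using rAG(2) by (metis less_add_same_cancel1)
        thus ?thesis using that by metis
      qed
      define rest where "rest = take i0 qs @ drop (Suc i0) qs"
      have qs_eq: "qs = take i0 qs @ (E, F0) # drop (Suc i0) qs" using id_take_nth_drop[OF i0(1)] F0 by simp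
      define ex where "ex = map (\<lambda>(a,l). (a, if l < r' \<and> dg l = a then A l else (\<lambda>x. 0))) (ext E)"
      define qs' where "qs' = rest @ ex"
      have fex: "map fst ex = map fst (ext E)" by (auto simp: ex_def)
      have "M = mset (map fst rest) + {#E#}"
        unfolding qs(1)[symmetric] rest_def by (subst qs_eq) simp
      hence 1: "mset (map fst qs') = M' E" by (simp add: qs'_def M'_def fex)
      have rest_sub: "set rest \<subseteq> set qs" unfolding rest_def using set_take_subset set_drop_subset by force
      have 2: "\<forall>(e,F)\<in>set qs'. 0 < e \<and> hom_form n e F"
        using qs(2) rest_sub dg by (auto simp: qs'_def ex_def ext_set hom_form_zero)
      have 3: "high_rank n {..<L} d P (rr E)" by (rule high_rank_mono[OF HP rr_le[OF EM]])
      obtain rs where rs: "(\<forall>(e,F)\<in>set rs. 0 < e \<and> e \<le> D \<and> hom_form n e F)" "high_rank n (joint_fam rs L) (joint_deg rs d) (joint_fun rs P) (\<rho> (length rs))"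
        "\<forall>x. (\<forall>(e,F)\<in>set rs. F x = 0) \<and> (\<forall>j<L. P j x = 0) \<longrightarrow> (\<forall>(e,F)\<in>set qs'. F x = 0)"
        using rr[OF EM, unfolded S_def] 1 2 3 by blast
      \<comment> \<open>Where the factors \<open>A l\<close>, the other auxiliary forms and the
        \<open>P j\<close> vanish, the low-rank combination reduces to a nonzero multiple of the
        traded form \<open>F0\<close>.\<close>
      have "\<forall>(e,F)\<in>set qs. F x = 0" if x: "\<forall>(e,F)\<in>set rs. F x = 0" "\<forall>j<L. P j x = 0" for x
      proof -
        have q': "\<forall>(e,F)\<in>set qs'. F x = 0" using rs(3) x by blast
        have A0: "A l x = 0" if "l < r'" for l
        proof -
          have "(dg l, l) \<in> set (ext E)" using dg[OF that] that rAG(1) by (auto simp: ext_set)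
          hence "(dg l, A l) \<in> set qs'" using that by (force simp: qs'_def ex_def)
          thus ?thesis using q' by blast
        qed
        have rest0: "snd (qs ! i) x = 0" if "i < length qs" "i \<noteq> i0" for i
        proof -
          have "qs ! i \<in> set rest"
          proof (cases "i < i0")
            case True
            hence "qs ! i = take i0 qs ! i" "i < length (take i0 qs)" using i0 by auto
            thus ?thesis unfolding rest_def by (metis UnI1 nth_mem set_append)
          next
            case False
            hence "qs ! i = drop (Suc i0) qs ! (i - Suc i0)" "i - Suc i0 < length (drop (Suc i0) qs)" using that by auto
            thus ?thesis unfolding rest_def by (metis UnI2 nth_mem set_append)
          qed
          hence "qs ! i \<in> set qs'" by (simp add: qs'_def)
          thus ?thesis using q' by (cases "qs ! i") auto
        qed
        have "(\<Sum>i<length qs. if fst (qs ! i) = E then c (Inl i) * snd (qs ! i) x else 0) = (\<Sum>i<length qs. if i = i0 then c (Inl i0) * F0 x else 0)"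
          by (intro sum.cong refl) (use rest0 i0 F0 in auto)
        also have "\<dots> = c (Inl i0) * F0 x" using i0 by simp
        finally have s1: "(\<Sum>i<length qs. if fst (qs ! i) = E then c (Inl i) * snd (qs ! i) x else 0) = c (Inl i0) * F0 x" .
        have s2: "(\<Sum>j<L. if d j = E then c (Inr j) * P j x else 0) = 0" using x(2) by (intro sum.neutral) auto
        have s3: "(\<Sum>l<r'. A l x * G l x) = 0" using A0 by (intro sum.neutral) auto
        have "c (Inl i0) * F0 x = 0" using rAG(3)[of x] unfolding s1 s2 s3 by simp
        hence F00: "F0 x = 0" using i0 by simp
        have "snd (qs ! i) x = 0" if "i < length qs" for i
          using rest0[OF that] F00 F0 by (cases "i = i0") auto
        thus ?thesis by (fastforce simp: in_set_conv_nth)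
      qed
      thus ?thesis using rs(1,2) by (intro exI[of _ rs]) blast
    qed
  qed
  thus ?case unfolding S_def by blast
qed

section \<open>Weakly linear functions\<close>

definition block :: "nat \<Rightarrow> nat \<Rightarrow> cvec \<Rightarrow> cvec" where
  "block n a Y = (\<lambda>l. if l < n then Y (a * n + l) else 0)"

text \<open>For all \<open>\<gamma>\<close> together these are the polarisations of F on
  \<open>m\<close> vectors, written as forms in the concatenated vector \<open>Y\<close>.\<close>

definition block_coeff :: "nat \<Rightarrow> nat \<Rightarrow> nat \<Rightarrow> (cvec \<Rightarrow> complex) \<Rightarrow> (nat \<Rightarrow> nat) \<Rightarrow> cvec \<Rightarrow> complex" where
  "block_coeff n m q F \<gamma> Y = mono_coeff {..<m} q \<gamma> (\<lambda>\<sigma>. F (\<lambda>l. \<Sum>a<m. \<sigma> a * block n a Y l))"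

lemma block_index: "a < m \<Longrightarrow> l < n \<Longrightarrow> a * n + l < m * (n::nat)"
proof -
  assume "a < m" "l < n"
  have "a * n + l < a * n + n" using \<open>l < n\<close> by simp
  also have "\<dots> = Suc a * n" by simp
  also have "\<dots> \<le> m * n" using \<open>a < m\<close> by (intro mult_le_mono1) simp
  finally show ?thesis .
qed

lemma hom_form_block: "a < m \<Longrightarrow> hom_form (m * n) 1 (\<lambda>Y. block n a Y l)"
  unfolding block_def by (cases "l < n") (use hom_form_coord[OF block_index, of a m l n] hom_form_zero in auto)

lemma hom_form_lincomb_block: "hom_form n e F \<Longrightarrow> hom_form (m * n) e (\<lambda>Y. F (\<lambda>l. \<Sum>a<m. \<sigma> a * block n a Y l))"
  by (rule hom_form_comp1) (auto intro!: hom_form_sum hom_form_cmult hom_form_block[simplified])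

lemma hom_form_mono_coeff: "(\<And>\<sigma>. hom_form n e (\<lambda>Y. h \<sigma> Y)) \<Longrightarrow> hom_form n e (\<lambda>Y. mono_coeff S q \<gamma> (\<lambda>\<sigma>. h \<sigma> Y))"
  unfolding mono_coeff_def by (intro hom_form_sum hom_form_cmult)

lemma deg_le_mono_coeff: "(\<And>\<sigma>. deg_le n e (\<lambda>Y. h \<sigma> Y)) \<Longrightarrow> deg_le n e (\<lambda>Y. mono_coeff S q \<gamma> (\<lambda>\<sigma>. h \<sigma> Y))"
  unfolding mono_coeff_def by (intro deg_le_sum deg_le_cmult)

lemma hom_form_block_coeff: "hom_form n e F \<Longrightarrow> hom_form (m * n) e (block_coeff n m q F \<gamma>)"
  unfolding block_coeff_def[abs_def] by (intro hom_form_mono_coeff hom_form_lincomb_block)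

lemma block_coeff_expand:
  assumes "hom_form n e F" "e < q"
  shows "F (\<lambda>l. \<Sum>a<m. \<sigma> a * block n a Y l) = (\<Sum>\<gamma>\<in>exponents m e. block_coeff n m q F \<gamma> Y * mon_fun {..<m} \<gamma> \<sigma>)"
  unfolding block_coeff_def
proof (rule hom_form_expand[of m e "\<lambda>\<sigma>. F (\<lambda>l. \<Sum>a<m. \<sigma> a * block n a Y l)", OF _ assms(2)])
  show "hom_form m e (\<lambda>\<sigma>. F (\<lambda>l. \<Sum>a<m. \<sigma> a * block n a Y l))"
    by (rule hom_form_comp1[OF assms(1)]) (auto intro!: hom_form_sum hom_form_cmult2 hom_form_coord[simplified])
qed

lemma lowrank_comp:
  assumes "lowrank m E B F" "\<And>i. i < m \<Longrightarrow> hom_form n 1 (l i)"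
  shows "lowrank n E B (\<lambda>x. F (\<lambda>i. l i x))"
proof -
  obtain r A G where r: "r \<le> B" "\<And>k. k < r \<Longrightarrow> \<exists>a b. a > 0 \<and> b > 0 \<and> a + b = E \<and> hom_form m a (A k) \<and> hom_form m b (G k)"
     "\<And>x. F x = (\<Sum>k<(r::nat). A k x * G k x)" using assms(1) unfolding lowrank_def by blast
  show ?thesis unfolding lowrank_def
  proof (rule exI[of _ r], rule conjI[OF r(1)], rule exI[of _ "\<lambda>k x. A k (\<lambda>i. l i x)"], rule exI[of _ "\<lambda>k x. G k (\<lambda>i. l i x)"],
      intro conjI allI impI)
    fix k assume "k < r"
    then obtain a b where "a > 0" "b > 0" "a + b = E" "hom_form m a (A k)" "hom_form m b (G k)" using r(2) by blast
    thus "\<exists>a b. 0 < a \<and> 0 < b \<and> a + b = E \<and> hom_form n a (\<lambda>x. A k (\<lambda>i. l i x)) \<and> hom_form n b (\<lambda>x. G k (\<lambda>i. l i x))"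
      using hom_form_comp1 assms(2) by blast
  qed (use r(3) in simp)
qed

text \<open>The index (l, i) stands for the l-th form of the list at the i-th of m vectors, the index (j, \<gamma>) for the coefficient
  of the monomial with exponents \<gamma> in the value of the j-th form at a linear combination of the m vectors.\<close>

definition coeff_fam :: "(nat \<times> (cvec \<Rightarrow> complex)) list \<Rightarrow> nat \<Rightarrow> nat \<Rightarrow> (nat \<Rightarrow> nat) \<Rightarrow> nat \<Rightarrow> (nat \<times> nat + nat \<times> (nat \<Rightarrow> nat)) set" where
  "coeff_fam rs N L d m = ({..<length rs} \<times> {..<N}) <+> (SIGMA j:{..<L}. exponents m (d j))"

definition coeff_deg :: "(nat \<times> (cvec \<Rightarrow> complex)) list \<Rightarrow> (nat \<Rightarrow> nat) \<Rightarrow> nat \<times> nat + nat \<times> (nat \<Rightarrow> nat) \<Rightarrow> nat" where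
  "coeff_deg rs d = case_sum (\<lambda>(l,i). fst (rs ! l)) (\<lambda>(j,\<gamma>). d j)"

definition coeff_fun :: "nat \<Rightarrow> nat \<Rightarrow> nat \<Rightarrow> (nat \<times> (cvec \<Rightarrow> complex)) list \<Rightarrow> (nat \<Rightarrow> cvec \<Rightarrow> complex) \<Rightarrow> nat \<times> nat + nat \<times> (nat \<Rightarrow> nat) \<Rightarrow> cvec \<Rightarrow> complex" where
  "coeff_fun n m q rs P = case_sum (\<lambda>(l,i) Y. snd (rs ! l) (block n i Y)) (\<lambda>(j,\<gamma>). block_coeff n m q (P j) \<gamma>)"

lemma finite_coeff_fam [simp]: "finite (coeff_fam rs N L d m)" by (simp add: coeff_fam_def)

text \<open>Restricting the blocks to multiples of one vector shows that the family of all block coefficients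
  inherits the rank of the original family.\<close>

lemma high_rank_coeff_fam:
  assumes high_rank: "high_rank n (joint_fam rs L) (joint_deg rs d) (joint_fun rs P) B" and N: "N \<le> m"
    and rs: "\<forall>(e,F)\<in>set rs. 0 < e \<and> hom_form n e F" and P: "\<And>j. j < L \<Longrightarrow> hom_form n (d j) (P j)"
    and q: "\<And>j. j < L \<Longrightarrow> d j < q"
  shows "high_rank (m * n) (coeff_fam rs N L d m) (coeff_deg rs d) (coeff_fun n m q rs P) B"
  unfolding high_rank_alt[OF finite_coeff_fam]
proof (intro allI impI notI)
  fix E and c :: "nat \<times> nat + nat \<times> (nat \<Rightarrow> nat) \<Rightarrow> complex"
  assume ex: "\<exists>i\<in>coeff_fam rs N L d m. coeff_deg rs d i = E \<and> c i \<noteq> 0"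
  assume lr: "lowrank (m * n) E B (\<lambda>x. \<Sum>i\<in>coeff_fam rs N L d m. if coeff_deg rs d i = E then c i * coeff_fun n m q rs P i x else 0)"
  have rsl: "0 < fst (rs ! l) \<and> hom_form n (fst (rs ! l)) (snd (rs ! l))" if "l < length rs" for l
    using rs nth_mem[OF that] by (cases "rs ! l") auto
  \<comment> \<open>What becomes of the coefficients when block \<open>a\<close> is
    \<open>\<alpha> a\<close> times one common vector: a list form in block \<open>i\<close>
    acquires the factor \<open>\<alpha> i ^ E\<close>, the polarisation of \<open>P j\<close> at
    \<open>\<gamma>\<close> the coefficient at \<open>\<gamma>\<close> of a power of
    \<open>lin m \<alpha>\<close>.\<close>
  define cl where "cl \<alpha> l = (\<Sum>i<N. c (Inl (l,i)) * \<alpha> i ^ E)" for \<alpha> :: cvec and l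
  define cr where "cr \<alpha> j = (\<Sum>\<gamma>\<in>exponents m (d j). c (Inr (j,\<gamma>)) * mono_coeff {..<m} q \<gamma> (\<lambda>x. lin m \<alpha> x ^ d j))" for \<alpha> :: cvec and j
  \<comment> \<open>For a list form a unit vector \<open>\<alpha>\<close> isolates one block. For
    \<open>P j\<close>, if all contributions were 0, the functional with coefficients
    \<open>c (Inr (j, \<gamma>))\<close> would vanish on powers of linear forms, hence on every
    monomial.\<close>
  have "\<exists>\<alpha>. (\<exists>l<length rs. fst (rs ! l) = E \<and> cl \<alpha> l \<noteq> 0) \<or> (\<exists>j<L. d j = E \<and> cr \<alpha> j \<noteq> 0)"
  proof -
    obtain i where i: "i \<in> coeff_fam rs N L d m" "coeff_deg rs d i = E" "c i \<noteq> 0" using ex by blast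
    from i(1) consider l b where "i = Inl (l,b)" "l < length rs" "b < N" | j \<gamma> where "i = Inr (j,\<gamma>)" "j < L" "\<gamma> \<in> exponents m (d j)"
      by (auto simp: coeff_fam_def)
    thus ?thesis
    proof cases
      case 1
      have E0: "E > 0" using rsl[OF 1(2)] i(2) 1 by (auto simp: coeff_deg_def)
      have "cl (\<lambda>b'. if b' = b then 1 else 0) l = (\<Sum>b'<N. if b' = b then c (Inl (l,b)) else 0)"
        unfolding cl_def by (intro sum.cong refl) (use E0 in \<open>auto simp: power_0_left\<close>)
      hence "cl (\<lambda>b'. if b' = b then 1 else 0) l \<noteq> 0" using 1 i(3) by simp
      thus ?thesis using 1 i(2) by (auto simp: coeff_deg_def)
    next
      case 2
      have "\<exists>\<alpha>. cr \<alpha> j \<noteq> 0"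
      proof (rule ccontr)
        assume "\<not> ?thesis"
        hence z: "cr \<alpha> j = 0" for \<alpha> by blast
        let ?\<Lambda> = "\<lambda>h. \<Sum>\<gamma>\<in>exponents m (d j). c (Inr (j,\<gamma>)) * mono_coeff {..<m} q \<gamma> h"
        have "?\<Lambda> (mon_fun {..<m} \<gamma>) = 0"
        proof (rule power_span_dual[of ?\<Lambda> m "d j"])
          show "?\<Lambda> (\<lambda>x. F x + G x) = ?\<Lambda> F + ?\<Lambda> G" for F G
            by (simp add: mono_coeff_add sum.distrib algebra_simps)
          show "?\<Lambda> (\<lambda>x. k * F x) = k * ?\<Lambda> F" for k F
            by (simp add: mono_coeff_cmult sum_distrib_left mult_ac)
        qed (use z 2 hom_form_mon_fun in \<open>auto simp: cr_def\<close>)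
        moreover have "?\<Lambda> (mon_fun {..<m} \<gamma>) = (\<Sum>\<delta>\<in>exponents m (d j). if \<delta> = \<gamma> then c (Inr (j,\<gamma>)) else 0)"
        proof (intro sum.cong refl)
          fix \<delta> assume \<delta>: "\<delta> \<in> exponents m (d j)"
          have "mono_coeff {..<m} q \<delta> (mon_fun {..<m} \<gamma>) = (if \<forall>i\<in>{..<m}. \<delta> i = \<gamma> i then 1 else 0)"
            by (rule mono_coeff_mon_fun) (use q[OF 2(2)] exponents_le[OF \<delta>] exponents_le[OF 2(3)] in \<open>auto intro: le_less_trans\<close>)
          also have "(\<forall>i\<in>{..<m}. \<delta> i = \<gamma> i) \<longleftrightarrow> \<delta> = \<gamma>" using exponents_ext[OF \<delta> 2(3)] by auto
          finally show "c (Inr (j,\<delta>)) * mono_coeff {..<m} q \<delta> (mon_fun {..<m} \<gamma>) = (if \<delta> = \<gamma> then c (Inr (j,\<gamma>)) else 0)" by simp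
        qed
        ultimately show False using 2 i(3) by simp
      qed
      thus ?thesis using 2 i(2) by (auto simp: coeff_deg_def)
    qed
  qed
  then obtain \<alpha> where \<alpha>: "(\<exists>l<length rs. fst (rs ! l) = E \<and> cl \<alpha> l \<noteq> 0) \<or> (\<exists>j<L. d j = E \<and> cr \<alpha> j \<noteq> 0)" by blast
  define Z where "Z w = (\<lambda>k. \<alpha> (k div n) * w (k mod n))" for w :: cvec
  have bZ: "block n a (Z w) l = \<alpha> a * (if l < n then w l else 0)" for a w l
    by (auto simp: block_def Z_def)
  have zext: "F (\<lambda>l. k * (if l < n then w l else 0)) = k ^ e * F w" if "hom_form n e F" for F e k w
  proof -
    have "F (\<lambda>l. k * (if l < n then w l else 0)) = F (\<lambda>l. k * w l)" by (rule hom_form_cong[OF that]) auto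
    thus ?thesis using hom_form_scale[OF that] by simp
  qed
  have rw1: "snd (rs ! l) (block n i (Z w)) = \<alpha> i ^ fst (rs ! l) * snd (rs ! l) w" if "l < length rs" for l i w
    using zext[of "fst (rs!l)" "snd (rs!l)" "\<alpha> i" w] rsl[OF that] by (simp add: bZ[abs_def])
  have rw2: "block_coeff n m q (P j) \<gamma> (Z w) = P j w * mono_coeff {..<m} q \<gamma> (\<lambda>x. lin m \<alpha> x ^ d j)" if "j < L" for j \<gamma> w
  proof -
    have "(\<lambda>l. \<Sum>a<m. \<sigma> a * block n a (Z w) l) = (\<lambda>l. lin m \<alpha> \<sigma> * (if l < n then w l else 0))" for \<sigma>
      by (rule ext) (simp add: bZ lin_def sum_distrib_left mult_ac)
    hence "block_coeff n m q (P j) \<gamma> (Z w) = mono_coeff {..<m} q \<gamma> (\<lambda>\<sigma>. P j w * lin m \<alpha> \<sigma> ^ d j)"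
      unfolding block_coeff_def by (simp add: zext[OF P[OF that]] mult.commute)
    thus ?thesis by (simp add: mono_coeff_cmult)
  qed
  have Zlin: "hom_form n 1 (\<lambda>w. Z w k)" if "k < m * n" for k
  proof -
    have "n > 0" using that by (cases n) auto
    hence "k mod n < n" by simp
    from hom_form_cmult[OF hom_form_coord[OF this], of "\<alpha> (k div n)"] show ?thesis by (simp add: Z_def)
  qed
  have "lowrank n E B (\<lambda>w. \<Sum>i\<in>coeff_fam rs N L d m. if coeff_deg rs d i = E then c i * coeff_fun n m q rs P i (Z w) else 0)"
    using lowrank_comp[OF lr, of n "\<lambda>k w. Z w k"] Zlin by simp
  also have "(\<lambda>w. \<Sum>i\<in>coeff_fam rs N L d m. if coeff_deg rs d i = E then c i * coeff_fun n m q rs P i (Z w) else 0) =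
    (\<lambda>w. \<Sum>i\<in>joint_fam rs L. if joint_deg rs d i = E then (case_sum (cl \<alpha>) (cr \<alpha>) i) * joint_fun rs P i w else 0)"
  proof
    fix w
    have "(\<Sum>i\<in>coeff_fam rs N L d m. if coeff_deg rs d i = E then c i * coeff_fun n m q rs P i (Z w) else 0) =
      (\<Sum>(l,i)\<in>{..<length rs} \<times> {..<N}. if fst (rs ! l) = E then c (Inl (l,i)) * snd (rs ! l) (block n i (Z w)) else 0) +
      (\<Sum>(j,\<gamma>)\<in>(SIGMA j:{..<L}. exponents m (d j)). if d j = E then c (Inr (j,\<gamma>)) * block_coeff n m q (P j) \<gamma> (Z w) else 0)"
      unfolding coeff_fam_def by (subst sum.Plus) (auto simp: coeff_deg_def coeff_fun_def comp_def case_prod_beta cong: if_cong)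
    also have "(\<Sum>(l,i)\<in>{..<length rs} \<times> {..<N}. if fst (rs ! l) = E then c (Inl (l,i)) * snd (rs ! l) (block n i (Z w)) else 0) =
      (\<Sum>l<length rs. \<Sum>i<N. if fst (rs ! l) = E then c (Inl (l,i)) * snd (rs ! l) (block n i (Z w)) else 0)"
      by (rule sum.cartesian_product[symmetric])
    also have "\<dots> = (\<Sum>l<length rs. if fst (rs ! l) = E then cl \<alpha> l * snd (rs ! l) w else 0)"
      by (intro sum.cong refl) (auto simp: rw1 cl_def sum_distrib_left mult_ac)
    also have "(\<Sum>(j,\<gamma>)\<in>(SIGMA j:{..<L}. exponents m (d j)). if d j = E then c (Inr (j,\<gamma>)) * block_coeff n m q (P j) \<gamma> (Z w) else 0) =
      (\<Sum>j<L. \<Sum>\<gamma>\<in>exponents m (d j). if d j = E then c (Inr (j,\<gamma>)) * block_coeff n m q (P j) \<gamma> (Z w) else 0)"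
      by (rule sum.Sigma[symmetric]) auto
    also have "\<dots> = (\<Sum>j<L. if d j = E then cr \<alpha> j * P j w else 0)"
      by (intro sum.cong refl) (auto simp: rw2 cr_def sum_distrib_left mult_ac)
    finally show "(\<Sum>i\<in>coeff_fam rs N L d m. if coeff_deg rs d i = E then c i * coeff_fun n m q rs P i (Z w) else 0) =
      (\<Sum>i\<in>joint_fam rs L. if joint_deg rs d i = E then (case_sum (cl \<alpha>) (cr \<alpha>) i) * joint_fun rs P i w else 0)"
      unfolding joint_fam_sum by (simp add: joint_deg_def joint_fun_def cong: if_cong)
  qed
  finally have "lowrank n E B (\<lambda>w. \<Sum>i\<in>joint_fam rs L. if joint_deg rs d i = E then (case_sum (cl \<alpha>) (cr \<alpha>) i) * joint_fun rs P i w else 0)" .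
  moreover have "\<exists>i\<in>joint_fam rs L. joint_deg rs d i = E \<and> case_sum (cl \<alpha>) (cr \<alpha>) i \<noteq> 0"
    using \<alpha>
  proof (elim disjE exE conjE)
    fix l assume "l < length rs" "fst (rs ! l) = E" "cl \<alpha> l \<noteq> 0"
    thus ?thesis by (intro bexI[of _ "Inl l"]) (auto simp: joint_fam_def joint_deg_def)
  next
    fix j assume "j < L" "d j = E" "cr \<alpha> j \<noteq> 0"
    thus ?thesis by (intro bexI[of _ "Inr j"]) (auto simp: joint_fam_def joint_deg_def)
  qed
  ultimately show False using high_rank unfolding high_rank_alt[OF finite_joint_fam] by blast
qed

definition zero_set :: "nat \<Rightarrow> nat \<Rightarrow> (nat \<Rightarrow> cvec \<Rightarrow> complex) \<Rightarrow> cvec set" where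
  "zero_set n L P = {x\<in>coord_space n. \<forall>j<L. P j x = 0}"

lemma sum_delta_push:
  fixes h :: "'a \<Rightarrow> complex"
  assumes "finite \<Gamma>" "finite \<Delta>" "\<And>\<delta>. \<delta> \<in> \<Delta> \<Longrightarrow> g \<delta> \<in> \<Gamma>"
  shows "(\<Sum>\<gamma>\<in>\<Gamma>. (\<Sum>\<delta>\<in>\<Delta>. if g \<delta> = \<gamma> then l \<delta> else 0) * h \<gamma>) = (\<Sum>\<delta>\<in>\<Delta>. l \<delta> * h (g \<delta>))"
proof -
  have "(\<Sum>\<gamma>\<in>\<Gamma>. (\<Sum>\<delta>\<in>\<Delta>. if g \<delta> = \<gamma> then l \<delta> else 0) * h \<gamma>) =
    (\<Sum>\<gamma>\<in>\<Gamma>. \<Sum>\<delta>\<in>\<Delta>. if g \<delta> = \<gamma> then l \<delta> * h \<gamma> else 0)"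
    unfolding sum_distrib_right by (intro sum.cong refl) auto
  also have "\<dots> = (\<Sum>\<delta>\<in>\<Delta>. \<Sum>\<gamma>\<in>\<Gamma>. if g \<delta> = \<gamma> then l \<delta> * h \<gamma> else 0)" by (rule sum.swap)
  also have "\<dots> = (\<Sum>\<delta>\<in>\<Delta>. l \<delta> * h (g \<delta>))"
    by (intro sum.cong refl) (simp add: assms sum.delta')
  finally show ?thesis .
qed

lemma mon_fun_zero: "finite S \<Longrightarrow> i \<in> S \<Longrightarrow> 0 < \<delta> i \<Longrightarrow> x i = 0 \<Longrightarrow> mon_fun S \<delta> x = 0"
  unfolding mon_fun_def by (rule prod_zero) (auto intro!: bexI[of _ i])

lemma mon_fun_restrict:
  assumes "N \<le> (m::nat)" "\<And>i. i \<ge> N \<Longrightarrow> \<delta> i = 0"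
  shows "mon_fun {..<m} \<delta> x = mon_fun {..<N} \<delta> x"
  unfolding mon_fun_def by (rule prod.mono_neutral_right) (use assms in auto)

text \<open>A factor \<open>s\<close> other than 0 can be taken out by homogeneity;
  \<open>s = 0\<close> leaves multiples of \<open>w\<close>.\<close>

lemma hom_form_two_point:
  assumes "hom_form n e F" "\<And>t. F (\<lambda>l. u l + t * w l) = 0" "F w = 0"
  shows "F (\<lambda>l. s * u l + t * w l) = 0"
proof (cases "s = 0")
  case True thus ?thesis using hom_form_scale[OF assms(1), of t w] assms(3) by simp
next
  case False
  have "(\<lambda>l. s * u l + t * w l) = (\<lambda>l. s * (u l + (t / s) * w l))" using False by (simp add: algebra_simps)
  hence "F (\<lambda>l. s * u l + t * w l) = s ^ e * F (\<lambda>l. u l + (t / s) * w l)"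
    using hom_form_scale[OF assms(1), of s "\<lambda>l. u l + (t / s) * w l"] by simp
  thus ?thesis unfolding assms(2) by simp
qed

text \<open>Exponents of degree at most \<open>D\<close> in \<open>m\<close> variables lie in a box
  with \<open>Suc D ^ m\<close> elements; this is the origin of the argument of
  \<open>solvable_bound\<close> in the rank hypotheses below.\<close>

lemma coeff_fam_card:
  assumes "\<And>j. j < L \<Longrightarrow> d j \<le> D"
  shows "card (coeff_fam rs N L d m) \<le> length rs * N + L * Suc D ^ m"
proof -
  have "card (exponents m (d j)) \<le> Suc D ^ m" if "j < L" for j
  proof -
    have "exponents m (d j) \<subseteq> box m (Suc D)"
      using exponents_le[of _ m "d j"] assms[OF that] by (auto simp: box_def less_Suc_eq_le exponents_def intro: order_trans)
    from card_mono[OF finite_box this] show ?thesis by (simp add: card_box)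
  qed
  hence "(\<Sum>j<L. card (exponents m (d j))) \<le> (\<Sum>j<L. Suc D ^ m)" by (intro sum_mono) auto
  thus ?thesis by (simp add: coeff_fam_def card_Plus card_cartesian_product)
qed

section \<open>The configuration attached to a relation between points\<close>

text \<open>The coefficients of the P_j on the span of the unknown y_i, z_i can be prescribed: those mixed in the y_i cancel
  the lower order terms caused by the x_i, and those with one z_i in place of y_i compensate for this in the y_i + z_i.\<close>

lemma relation_config:
  fixes x :: "nat \<Rightarrow> cvec"
  assumes P: "\<And>j. j < L \<Longrightarrow> hom_form n (d j) (P j)" and d: "\<And>j. j < L \<Longrightarrow> 2 \<le> d j \<and> d j \<le> D"
    and x: "\<And>i j. i < N \<Longrightarrow> j < L \<Longrightarrow> P j (x i) = 0" and x0: "\<And>l. (\<Sum>i<N. x i l) = 0"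
    and rs: "\<forall>(e,F)\<in>set rs. 0 < e \<and> e \<le> D \<and> hom_form n e F"
    and high_rank: "high_rank n (joint_fam rs L) (joint_deg rs d) (joint_fun rs P) (solvable_bound (length rs * N + L * Suc D ^ (N + N)) D)"
    and H: "\<And>i j k. i < N \<Longrightarrow> j < L \<Longrightarrow> hom_form n k (H i j k)" "\<And>i j. i < N \<Longrightarrow> j < L \<Longrightarrow> H i j (d j) = P j"
      "\<And>i j t w. i < N \<Longrightarrow> j < L \<Longrightarrow> P j (\<lambda>l. x i l + t * w l) = (\<Sum>k\<le>d j. t ^ k * H i j k w)"
    and van: "\<And>w i j k. (\<forall>(e,F)\<in>set rs. F w = 0) \<Longrightarrow> (\<forall>j<L. P j w = 0) \<Longrightarrow> i < N \<Longrightarrow> j < L \<Longrightarrow> 0 < k \<Longrightarrow> k < d j \<Longrightarrow> H i j k w = 0"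
  shows "\<exists>y z. (\<forall>i. y i \<in> coord_space n \<and> z i \<in> coord_space n) \<and> (\<forall>j<L.
     (\<forall>i<N. \<forall>s t. P j (\<lambda>l. s * x i l + t * y i l) = 0) \<and>
     (\<forall>s. P j (\<lambda>l. \<Sum>i<N. s i * (x i l + y i l)) = 0) \<and>
     (\<forall>s. P j (\<lambda>l. \<Sum>i<N. s i * z i l) = 0) \<and>
     (\<forall>i<N. \<forall>s t. P j (\<lambda>l. s * y i l + t * z i l) = 0) \<and>
     (\<forall>s. P j (\<lambda>l. \<Sum>i<N. s i * (y i l + z i l)) = 0) \<and>
     (\<forall>s t. P j (\<lambda>l. s * (\<Sum>i<N. y i l) + t * (\<Sum>i<N. z i l)) = 0))"
proof -
  define m where "m = N + N"
  define q where "q = Suc D"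
  have q: "d j < q" if "j < L" for j using d[OF that] by (simp add: q_def)
  \<comment> \<open>The coefficients in \<open>s\<close> of the terms that the \<open>x i\<close>
    add to \<open>P j\<close>. They have degree less than \<open>d j\<close> in \<open>Y\<close>, as
    values prescribed by \<open>solvable_fin\<close> must.\<close>
  define lo where "lo j \<delta> Y = mono_coeff {..<N} q \<delta> (\<lambda>s. P j (\<lambda>l. \<Sum>i<N. s i * (x i l + block n i Y l)) - P j (\<lambda>l. \<Sum>i<N. s i * block n i Y l))" for j \<delta> Y
  \<comment> \<open>Exponents that involve at least two indices. Only such monomials receive nonzero
    coefficients, which keeps every single \<open>y i\<close> in the zero set.\<close>
  define mix where "mix j = {\<delta>\<in>exponents N (d j). \<exists>i i'. i \<noteq> i' \<and> 0 < \<delta> i \<and> 0 < \<delta> i'}" for j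
  \<comment> \<open>In a mixed monomial one variable is selected; \<open>dn\<close> removes one
    occurrence of it, and \<open>sw\<close> puts the variable of the corresponding
    \<open>z i\<close> in its place.\<close>
  define sel where "sel \<delta> = (SOME i. 0 < \<delta> i)" for \<delta> :: "nat \<Rightarrow> nat"
  define dn where "dn \<delta> = \<delta>(sel \<delta> := \<delta> (sel \<delta>) - 1)" for \<delta>
  define sw where "sw \<delta> = (dn \<delta>)(N + sel \<delta> := 1)" for \<delta>
  have mixN: "\<delta> \<in> exponents N (d j)" if "\<delta> \<in> mix j" for \<delta> j using that by (simp add: mix_def)
  have finmix: "finite (mix j)" for j by (simp add: mix_def)
  have sel: "0 < \<delta> (sel \<delta>)" "sel \<delta> < N" "\<exists>i'<N. i' \<noteq> sel \<delta> \<and> 0 < \<delta> i'" if dm: "\<delta> \<in> mix j" for \<delta> j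
  proof -
    obtain i i' where i: "i \<noteq> i'" "0 < \<delta> i" "0 < \<delta> i'" using dm by (auto simp: mix_def)
    show s: "0 < \<delta> (sel \<delta>)" unfolding sel_def by (rule someI[of _ i]) (rule i(2))
    have ltN: "a < N" if "0 < \<delta> a" for a
      using mixN[OF dm] that unfolding exponents_def by (metis (mono_tags, lifting) mem_Collect_eq not_less less_irrefl)
    show "sel \<delta> < N" by (rule ltN[OF s])
    show "\<exists>i'<N. i' \<noteq> sel \<delta> \<and> 0 < \<delta> i'" using i ltN by metis
  qed
  have dn_other: "\<exists>i'<N. i' \<noteq> sel \<delta> \<and> 0 < dn \<delta> i'" if "\<delta> \<in> mix j" for \<delta> j
    using sel(3)[OF that] by (auto simp: dn_def)
  have dn_exponents: "dn \<delta> \<in> exponents N (d j - 1)" if "\<delta> \<in> mix j" for \<delta> j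
  proof -
    note s = sel[OF that]
    have "(\<Sum>i<N. \<delta> i) = \<delta> (sel \<delta>) + (\<Sum>i\<in>{..<N}-{sel \<delta>}. \<delta> i)" using s by (subst sum.remove[of _ "sel \<delta>"]) auto
    moreover have "(\<Sum>i<N. dn \<delta> i) = \<delta> (sel \<delta>) - 1 + (\<Sum>i\<in>{..<N}-{sel \<delta>}. \<delta> i)"
      using s by (subst sum.remove[of _ "sel \<delta>"]) (auto simp: dn_def)
    ultimately show ?thesis using mixN[OF that] s by (auto simp: exponents_def dn_def)
  qed
  have up_dn: "\<delta> = (dn \<delta>)(sel \<delta> := Suc (dn \<delta> (sel \<delta>)))" if "\<delta> \<in> mix j" for \<delta> j
    using sel(1)[OF that] by (auto simp: dn_def)
  have sw_eq: "sw \<delta> = (dn \<delta>)(N + sel \<delta> := Suc (dn \<delta> (N + sel \<delta>)))" if "\<delta> \<in> mix j" for \<delta> j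
    using dn_exponents[OF that] by (auto simp: sw_def exponents_def)
  have dn_m: "dn \<delta> \<in> exponents m (d j - 1)" if "\<delta> \<in> mix j" for \<delta> j
  proof -
    have "(\<Sum>i<m. dn \<delta> i) = (\<Sum>i<N. dn \<delta> i)"
      by (rule sum.mono_neutral_right) (use dn_exponents[OF that] in \<open>auto simp: exponents_def m_def\<close>)
    thus ?thesis using dn_exponents[OF that] by (auto simp: exponents_def m_def)
  qed
  have dpos: "Suc (d j - 1) = d j" if "j < L" for j using d[OF that] by simp
  have sw_m: "sw \<delta> \<in> exponents m (d j)" and \<delta>_m: "\<delta> \<in> exponents m (d j)" if "\<delta> \<in> mix j" "j < L" for \<delta> j
  proof -
    have "(dn \<delta>)(N + sel \<delta> := Suc (dn \<delta> (N + sel \<delta>))) \<in> exponents m (Suc (d j - 1))"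
      by (rule exponents_upd[OF _ dn_m[OF that(1)]]) (use sel(2)[OF that(1)] in \<open>simp add: m_def\<close>)
    thus "sw \<delta> \<in> exponents m (d j)" using sw_eq[OF that(1)] dpos[OF that(2)] by simp
    have "(dn \<delta>)(sel \<delta> := Suc (dn \<delta> (sel \<delta>))) \<in> exponents m (Suc (d j - 1))"
      by (rule exponents_upd[OF _ dn_m[OF that(1)]]) (use sel(2)[OF that(1)] in \<open>simp add: m_def\<close>)
    thus "\<delta> \<in> exponents m (d j)" using up_dn[OF that(1)] dpos[OF that(2)] by simp
  qed
  \<comment> \<open>Prescribes \<open>P j\<close> on the span of the \<open>y i\<close> and
    \<open>z i\<close> as the sum over mixed \<open>\<delta>\<close> of
    \<open>lo j \<delta> Y\<close> times the difference of the monomials \<open>sw \<delta>\<close>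
    and \<open>\<delta>\<close>. The list forms are required to vanish at the
    \<open>y i\<close>.\<close>
  define T where "T i Y = (case i of Inl _ \<Rightarrow> 0 | Inr (j,\<gamma>) \<Rightarrow>
     (\<Sum>\<delta>\<in>mix j. if sw \<delta> = \<gamma> then lo j \<delta> Y else 0) - (\<Sum>\<delta>\<in>mix j. if \<delta> = \<gamma> then lo j \<delta> Y else 0))"
    for i :: "nat \<times> nat + nat \<times> (nat \<Rightarrow> nat)" and Y
  have deg_le_lo: "deg_le (m * n) (d j - 1) (lo j \<delta>)" if j: "j < L" for j \<delta>
    unfolding lo_def[abs_def]
  proof (rule deg_le_mono_coeff)
    fix s :: cvec
    define u where "u l = (\<Sum>i<N. s i * x i l)" for l
    define v where "v Y l = (\<Sum>i<N. s i * block n i Y l)" for Y l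
    obtain K where K: "\<And>k. hom_form n k (K k)" "K (d j) = P j" "\<And>t w. P j (\<lambda>l. u l + t * w l) = (\<Sum>k\<le>d j. t ^ k * K k w)"
      using hom_form_shift[OF P[OF j], of u] by blast
    have "P j (\<lambda>l. \<Sum>i<N. s i * (x i l + block n i Y l)) - P j (\<lambda>l. \<Sum>i<N. s i * block n i Y l) = (\<Sum>k<d j. K k (v Y))" for Y
    proof -
      have "(\<lambda>l. \<Sum>i<N. s i * (x i l + block n i Y l)) = (\<lambda>l. u l + 1 * v Y l)"
        by (simp add: u_def v_def distrib_left sum.distrib)
      moreover have "(\<lambda>l. \<Sum>i<N. s i * block n i Y l) = v Y" by (simp add: v_def[abs_def])
      ultimately show ?thesis using K(3)[of 1 "v Y"] K(2) by (simp add: lessThan_Suc_atMost[symmetric])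
    qed
    moreover have "deg_le (m * n) (d j - 1) (\<lambda>Y. \<Sum>k<d j. K k (v Y))"
    proof (rule deg_le_sum)
      fix k assume "k \<in> {..<d j}"
      hence k: "k \<le> d j - 1" by auto
      have "hom_form (m * n) k (\<lambda>Y. K k (v Y))" unfolding v_def[abs_def]
        by (rule hom_form_comp1[OF K(1)]) (auto intro!: hom_form_sum hom_form_cmult hom_form_block[simplified] simp: m_def)
      from deg_le_mono[OF hom_form_imp_deg_le[OF this] k] show "deg_le (m * n) (d j - 1) (\<lambda>Y. K k (v Y))" .
    qed
    ultimately show "deg_le (m * n) (d j - 1) (\<lambda>Y. P j (\<lambda>l. \<Sum>i<N. s i * (x i l + block n i Y l)) - P j (\<lambda>l. \<Sum>i<N. s i * block n i Y l))"
      by simp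
  qed
  have rsl: "0 < fst (rs ! l) \<and> fst (rs ! l) \<le> D \<and> hom_form n (fst (rs ! l)) (snd (rs ! l))" if "l < length rs" for l
    using rs nth_mem[OF that] by (cases "rs ! l") auto
  have "\<exists>Y. \<forall>i\<in>coeff_fam rs N L d m. coeff_fun n m q rs P i Y = T i Y"
  proof (rule solvable_fin[of _ "coeff_deg rs d" D "m * n"])
    show "finite (coeff_fam rs N L d m)" by simp
    show "0 < coeff_deg rs d i \<and> coeff_deg rs d i \<le> D" if "i \<in> coeff_fam rs N L d m" for i
      using that rsl d by (fastforce simp: coeff_fam_def coeff_deg_def)
    show "hom_form (m * n) (coeff_deg rs d i) (coeff_fun n m q rs P i)" if i: "i \<in> coeff_fam rs N L d m" for i
    proof -
      have "hom_form (m * n) (fst (rs ! l)) (\<lambda>Y. snd (rs ! l) (block n b Y))" if "l < length rs" "b < N" for l b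
      proof -
        have "hom_form (m * n) (fst (rs ! l)) (\<lambda>Y. snd (rs ! l) (\<lambda>k. block n b Y k))"
          by (rule hom_form_comp1) (use rsl[OF that(1)] hom_form_block[of b m n] that in \<open>auto simp: m_def\<close>)
        thus ?thesis by simp
      qed
      thus ?thesis using i hom_form_block_coeff[OF P] by (auto simp: coeff_fam_def coeff_deg_def coeff_fun_def)
    qed
    show "deg_le (m * n) (coeff_deg rs d i - 1) (T i)" if "i \<in> coeff_fam rs N L d m" for i
    proof -
      have "deg_le (m * n) (d j - 1) (\<lambda>Y. (\<Sum>\<delta>\<in>mix j. if sw \<delta> = \<gamma> then lo j \<delta> Y else 0) - (\<Sum>\<delta>\<in>mix j. if \<delta> = \<gamma> then lo j \<delta> Y else 0))"
        if "j < L" for j \<gamma> by (intro deg_le_diff deg_le_sum deg_le_if deg_le_lo deg_le_const that)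
      thus ?thesis using that by (auto simp: T_def[abs_def] coeff_fam_def coeff_deg_def intro: deg_le_const)
    qed
    have "high_rank n (joint_fam rs L) (joint_deg rs d) (joint_fun rs P) (solvable_bound (card (coeff_fam rs N L d m)) D)"
      by (rule high_rank_mono[OF high_rank solvable_bound_mono]) (use coeff_fam_card[of L d D rs N m] d in \<open>simp add: m_def\<close>)
    thus "high_rank (m * n) (coeff_fam rs N L d m) (coeff_deg rs d) (coeff_fun n m q rs P) (solvable_bound (card (coeff_fam rs N L d m)) D)"
      by (rule high_rank_coeff_fam) (use rs P q in \<open>auto simp: m_def\<close>)
  qed
  then obtain Y where Y: "\<And>i. i \<in> coeff_fam rs N L d m \<Longrightarrow> coeff_fun n m q rs P i Y = T i Y" by blast
  define y where "y i = block n i Y" for i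
  define z where "z i = block n (N + i) Y" for i
  have main: "P j (\<lambda>l. \<Sum>i<N. (\<sigma> i * y i l + \<sigma> (N + i) * z i l)) =
      (\<Sum>\<delta>\<in>mix j. lo j \<delta> Y * (mon_fun {..<N} (dn \<delta>) \<sigma> * (\<sigma> (N + sel \<delta>) - \<sigma> (sel \<delta>))))" if j: "j < L" for j \<sigma>
  proof -
    have "P j (\<lambda>l. \<Sum>i<N. (\<sigma> i * y i l + \<sigma> (N + i) * z i l)) = P j (\<lambda>l. \<Sum>a<m. \<sigma> a * block n a Y l)"
      by (simp add: m_def sum_lessThan_add y_def z_def sum.distrib)
    also have "\<dots> = (\<Sum>\<gamma>\<in>exponents m (d j). block_coeff n m q (P j) \<gamma> Y * mon_fun {..<m} \<gamma> \<sigma>)"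
      by (rule block_coeff_expand[OF P[OF j] q[OF j]])
    also have "\<dots> = (\<Sum>\<gamma>\<in>exponents m (d j). T (Inr (j,\<gamma>)) Y * mon_fun {..<m} \<gamma> \<sigma>)"
    proof (intro sum.cong refl)
      fix \<gamma> assume "\<gamma> \<in> exponents m (d j)"
      hence "Inr (j,\<gamma>) \<in> coeff_fam rs N L d m" using j by (auto simp: coeff_fam_def)
      from Y[OF this] show "block_coeff n m q (P j) \<gamma> Y * mon_fun {..<m} \<gamma> \<sigma> = T (Inr (j,\<gamma>)) Y * mon_fun {..<m} \<gamma> \<sigma>"
        by (simp add: coeff_fun_def)
    qed
    also have "\<dots> = (\<Sum>\<gamma>\<in>exponents m (d j). (\<Sum>\<delta>\<in>mix j. if sw \<delta> = \<gamma> then lo j \<delta> Y else 0) * mon_fun {..<m} \<gamma> \<sigma>) -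
        (\<Sum>\<gamma>\<in>exponents m (d j). (\<Sum>\<delta>\<in>mix j. if \<delta> = \<gamma> then lo j \<delta> Y else 0) * mon_fun {..<m} \<gamma> \<sigma>)"
      by (simp add: T_def left_diff_distrib sum_subtractf)
    also have "\<dots> = (\<Sum>\<delta>\<in>mix j. lo j \<delta> Y * mon_fun {..<m} (sw \<delta>) \<sigma>) - (\<Sum>\<delta>\<in>mix j. lo j \<delta> Y * mon_fun {..<m} \<delta> \<sigma>)"
      by (intro arg_cong2[where f = "(-)"] sum_delta_push finmix finite_exponents) (use sw_m \<delta>_m j in auto)
    also have "\<dots> = (\<Sum>\<delta>\<in>mix j. lo j \<delta> Y * (mon_fun {..<m} (sw \<delta>) \<sigma> - mon_fun {..<m} \<delta> \<sigma>))"
      by (simp add: sum_subtractf right_diff_distrib)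
    also have "\<dots> = (\<Sum>\<delta>\<in>mix j. lo j \<delta> Y * (mon_fun {..<N} (dn \<delta>) \<sigma> * (\<sigma> (N + sel \<delta>) - \<sigma> (sel \<delta>))))"
    proof (intro sum.cong refl)
      fix \<delta> assume \<delta>: "\<delta> \<in> mix j"
      have r: "mon_fun {..<m} (dn \<delta>) \<sigma> = mon_fun {..<N} (dn \<delta>) \<sigma>"
        by (rule mon_fun_restrict) (use dn_exponents[OF \<delta>] in \<open>auto simp: m_def exponents_def\<close>)
      have a: "mon_fun {..<m} (sw \<delta>) \<sigma> = \<sigma> (N + sel \<delta>) * mon_fun {..<N} (dn \<delta>) \<sigma>"
        unfolding sw_eq[OF \<delta>] by (subst mon_fun_upd) (use sel(2)[OF \<delta>] r in \<open>auto simp: m_def\<close>)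
      have b: "mon_fun {..<m} \<delta> \<sigma> = \<sigma> (sel \<delta>) * mon_fun {..<N} (dn \<delta>) \<sigma>"
        by (subst up_dn[OF \<delta>], subst mon_fun_upd) (use sel(2)[OF \<delta>] r in \<open>auto simp: m_def\<close>)
      show "lo j \<delta> Y * (mon_fun {..<m} (sw \<delta>) \<sigma> - mon_fun {..<m} \<delta> \<sigma>) =
        lo j \<delta> Y * (mon_fun {..<N} (dn \<delta>) \<sigma> * (\<sigma> (N + sel \<delta>) - \<sigma> (sel \<delta>)))"
        unfolding a b by (simp add: algebra_simps)
    qed
    finally show ?thesis .
  qed
  \<comment> \<open>Each term contains a variable, or a difference of two variables, whose index is
    not \<open>i0\<close>; it is 0 here.\<close>
  have c4: "P j (\<lambda>l. s * y i0 l + t * z i0 l) = 0" if j: "j < L" and i0: "i0 < N" for j i0 s t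
  proof -
    define \<sigma> where "\<sigma> a = (if a = i0 then s else if a = N + i0 then t else 0)" for a
    have "(\<Sum>i<N. (\<sigma> i * y i l + \<sigma> (N + i) * z i l)) = (\<Sum>i<N. if i = i0 then s * y i0 l + t * z i0 l else 0)" for l
      by (intro sum.cong refl) (use i0 in \<open>auto simp: \<sigma>_def\<close>)
    hence "P j (\<lambda>l. s * y i0 l + t * z i0 l) = P j (\<lambda>l. \<Sum>i<N. (\<sigma> i * y i l + \<sigma> (N + i) * z i l))"
      using i0 by simp
    also have "\<dots> = 0" unfolding main[OF j]
    proof (rule sum.neutral, rule ballI)
      fix \<delta> assume \<delta>: "\<delta> \<in> mix j"
      show "lo j \<delta> Y * (mon_fun {..<N} (dn \<delta>) \<sigma> * (\<sigma> (N + sel \<delta>) - \<sigma> (sel \<delta>))) = 0"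
      proof (cases "sel \<delta> = i0")
        case True
        obtain i' where i': "i' < N" "i' \<noteq> sel \<delta>" "0 < dn \<delta> i'" using dn_other[OF \<delta>] by blast
        have "mon_fun {..<N} (dn \<delta>) \<sigma> = 0"
          by (rule mon_fun_zero[of _ i']) (use i' True in \<open>auto simp: \<sigma>_def\<close>)
        thus ?thesis by simp
      qed (use sel(2)[OF \<delta>] i0 in \<open>auto simp: \<sigma>_def\<close>)
    qed
    finally show ?thesis .
  qed
  have Py: "P j (y i) = 0" if "j < L" "i < N" for j i using c4[OF that, of 1 0] by simp
  \<comment> \<open>The forms of the list \<open>rs\<close> vanish at \<open>y i\<close>, and by
    \<open>van\<close> this forces the intermediate Taylor coefficients at \<open>x i\<close> to
    vanish there too.\<close>
  have Qy: "H i j k (y i) = 0" if "i < N" "j < L" "0 < k" "k < d j" for i j k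
  proof (rule van[OF _ _ that])
    show "\<forall>j<L. P j (y i) = 0" using Py that by blast
    have "snd (rs ! l) (y i) = 0" if l: "l < length rs" for l
    proof -
      have "Inl (l,i) \<in> coeff_fam rs N L d m" using l \<open>i < N\<close> by (auto simp: coeff_fam_def)
      from Y[OF this] show ?thesis by (simp add: coeff_fun_def T_def y_def)
    qed
    thus "\<forall>(e,F)\<in>set rs. F (y i) = 0" by (force simp: in_set_conv_nth)
  qed
  have c1: "P j (\<lambda>l. s * x i l + t * y i l) = 0" if j: "j < L" and i: "i < N" for i j s t
  proof (rule hom_form_two_point[OF P[OF j]])
    show "P j (\<lambda>l. x i l + t * y i l) = 0" for t
      unfolding H(3)[OF i j]
    proof (rule sum.neutral, rule ballI)
      fix k assume "k \<in> {..d j}"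
      then consider "k = 0" | "0 < k" "k < d j" | "k = d j" by fastforce
      thus "t ^ k * H i j k (y i) = 0"
      proof cases
        case 1
        have "H i j 0 (y i) = (\<Sum>k\<le>d j. 0 ^ k * H i j k (y i))"
          by (simp add: power_0_left if_distrib[of "\<lambda>c. c * _"] cong: if_cong)
        also have "\<dots> = P j (\<lambda>l. x i l + 0 * y i l)" by (rule H(3)[OF i j, symmetric])
        also have "\<dots> = 0" using x[OF i j] by simp
        finally show ?thesis using 1 by simp
      qed (use Qy[OF i j] H(2)[OF i j] Py[OF j i] in auto)
    qed
  qed (rule Py[OF j i])
  have lo_expand: "P j (\<lambda>l. \<Sum>i<N. s i * (x i l + y i l)) - P j (\<lambda>l. \<Sum>i<N. s i * y i l) =
      (\<Sum>\<delta>\<in>exponents N (d j). lo j \<delta> Y * mon_fun {..<N} \<delta> s)" if j: "j < L" for j s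
    unfolding lo_def y_def
  proof (rule hom_form_expand[of N "d j" "\<lambda>s. P j (\<lambda>l. \<Sum>i<N. s i * (x i l + block n i Y l)) - P j (\<lambda>l. \<Sum>i<N. s i * block n i Y l)", OF _ q[OF j]])
    show "hom_form N (d j) (\<lambda>s. P j (\<lambda>l. \<Sum>i<N. s i * (x i l + block n i Y l)) - P j (\<lambda>l. \<Sum>i<N. s i * block n i Y l))"
      by (intro hom_form_diff hom_form_comp1[OF P[OF j]]) (auto intro!: hom_form_sum hom_form_cmult2 hom_form_coord[simplified])
  qed
  \<comment> \<open>For a single index the added terms vanish, because the plane of
    \<open>x i\<close> and \<open>y i\<close> already lies in the zero set.\<close>
  have lo_single: "lo j \<delta> Y = 0" if j: "j < L" and \<delta>: "\<delta> \<in> exponents N (d j)" "\<delta> \<notin> mix j" for j \<delta>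
  proof -
    have "(\<Sum>i<N. \<delta> i) \<noteq> 0" using \<delta>(1) d[OF j] by (simp add: exponents_def)
    then obtain i where i: "i < N" "0 < \<delta> i" by (auto simp: sum_eq_0_iff)
    have oth: "\<delta> i' = 0" if "i' \<noteq> i" for i' using \<delta> i that by (auto simp: mix_def) (metis less_irrefl)
    define s where "s a = (if a = i then 1 else 0 :: complex)" for a
    have ev: "(\<Sum>a<N. s a * v a) = v i" for v :: cvec
      using i by (simp add: s_def if_distrib[of "\<lambda>c. c * _"] cong: if_cong)
    have "0 = P j (\<lambda>l. \<Sum>a<N. s a * (x a l + y a l)) - P j (\<lambda>l. \<Sum>a<N. s a * y a l)"
      using c1[OF j i(1), of 1 1] Py[OF j i(1)] by (simp add: ev)
    also have "\<dots> = (\<Sum>\<delta>'\<in>exponents N (d j). lo j \<delta>' Y * mon_fun {..<N} \<delta>' s)" by (rule lo_expand[OF j])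
    also have "\<dots> = (\<Sum>\<delta>'\<in>exponents N (d j). if \<delta>' = \<delta> then lo j \<delta> Y else 0)"
    proof (intro sum.cong refl)
      fix \<delta>' assume \<delta>': "\<delta>' \<in> exponents N (d j)"
      show "lo j \<delta>' Y * mon_fun {..<N} \<delta>' s = (if \<delta>' = \<delta> then lo j \<delta> Y else 0)"
      proof (cases "\<delta>' = \<delta>")
        case True
        have "mon_fun {..<N} \<delta> s = 1" unfolding mon_fun_def
          by (rule prod.neutral) (use oth in \<open>auto simp: s_def\<close>)
        thus ?thesis using True by simp
      next
        case False
        have "\<exists>a<N. a \<noteq> i \<and> 0 < \<delta>' a"
        proof (rule ccontr)
          assume no: "\<not> ?thesis"
          have "(\<Sum>a<N. \<delta>' a) = \<delta>' i + (\<Sum>a\<in>{..<N}-{i}. \<delta>' a)" using i by (subst sum.remove[of _ i]) auto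
          moreover have "(\<Sum>a\<in>{..<N}-{i}. \<delta>' a) = 0" using no by (intro sum.neutral) auto
          ultimately have 1: "\<delta>' i = d j" using \<delta>' by (simp add: exponents_def)
          have "(\<Sum>a<N. \<delta> a) = \<delta> i + (\<Sum>a\<in>{..<N}-{i}. \<delta> a)" using i by (subst sum.remove[of _ i]) auto
          moreover have "(\<Sum>a\<in>{..<N}-{i}. \<delta> a) = 0" using oth by (intro sum.neutral) auto
          ultimately have 2: "\<delta> i = d j" using \<delta> by (simp add: exponents_def)
          have "\<delta>' = \<delta>" by (rule exponents_ext[OF \<delta>' \<delta>(1)]) (use 1 2 oth no in force)
          thus False using False by simp
        qed
        then obtain a where a: "a < N" "a \<noteq> i" "0 < \<delta>' a" by blast
        have "mon_fun {..<N} \<delta>' s = 0" by (rule mon_fun_zero[of _ a]) (use a in \<open>auto simp: s_def\<close>)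
        thus ?thesis using False by simp
      qed
    qed
    also have "\<dots> = lo j \<delta> Y" using \<delta> by simp
    finally show ?thesis by simp
  qed
  have lo_mix: "P j (\<lambda>l. \<Sum>i<N. s i * (x i l + y i l)) - P j (\<lambda>l. \<Sum>i<N. s i * y i l) =
      (\<Sum>\<delta>\<in>mix j. lo j \<delta> Y * mon_fun {..<N} \<delta> s)" if j: "j < L" for j s
    unfolding lo_expand[OF j]
    by (rule sum.mono_neutral_right) (use lo_single[OF j] mixN in auto)
  \<comment> \<open>Without the \<open>z i\<close>, the prescribed form is minus the mixed part of
    the terms added by the \<open>x i\<close>, and the two cancel.\<close>
  have c2: "P j (\<lambda>l. \<Sum>i<N. s i * (x i l + y i l)) = 0" if j: "j < L" for j s
  proof -
    define \<sigma> where "\<sigma> a = (if a < N then s a else 0)" for a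
    have "P j (\<lambda>l. \<Sum>i<N. s i * y i l) = P j (\<lambda>l. \<Sum>i<N. (\<sigma> i * y i l + \<sigma> (N + i) * z i l))"
      by (simp add: \<sigma>_def)
    also have "\<dots> = - (\<Sum>\<delta>\<in>mix j. lo j \<delta> Y * mon_fun {..<N} \<delta> s)"
      unfolding main[OF j] sum_negf[symmetric]
    proof (intro sum.cong refl)
      fix \<delta> assume \<delta>: "\<delta> \<in> mix j"
      have "mon_fun {..<N} \<delta> s = s (sel \<delta>) * mon_fun {..<N} (dn \<delta>) s"
        by (subst up_dn[OF \<delta>], subst mon_fun_upd) (use sel(2)[OF \<delta>] in auto)
      moreover have "mon_fun {..<N} (dn \<delta>) \<sigma> = mon_fun {..<N} (dn \<delta>) s"
        unfolding mon_fun_def by (rule prod.cong) (auto simp: \<sigma>_def)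
      ultimately show "lo j \<delta> Y * (mon_fun {..<N} (dn \<delta>) \<sigma> * (\<sigma> (N + sel \<delta>) - \<sigma> (sel \<delta>))) = - (lo j \<delta> Y * mon_fun {..<N} \<delta> s)"
        using sel(2)[OF \<delta>] by (simp add: \<sigma>_def)
    qed
    finally show ?thesis using lo_mix[OF j, of s] by simp
  qed
  \<comment> \<open>After the removal of one occurrence, a mixed monomial still contains a variable
    of some \<open>y i\<close>, here set to 0.\<close>
  have c3: "P j (\<lambda>l. \<Sum>i<N. s i * z i l) = 0" if j: "j < L" for j s
  proof -
    define \<sigma> where "\<sigma> a = (if a < N then 0 else s (a - N))" for a
    have "P j (\<lambda>l. \<Sum>i<N. s i * z i l) = P j (\<lambda>l. \<Sum>i<N. (\<sigma> i * y i l + \<sigma> (N + i) * z i l))"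
      by (simp add: \<sigma>_def)
    also have "\<dots> = 0" unfolding main[OF j]
    proof (rule sum.neutral, rule ballI)
      fix \<delta> assume \<delta>: "\<delta> \<in> mix j"
      obtain i' where i': "i' < N" "i' \<noteq> sel \<delta>" "0 < dn \<delta> i'" using dn_other[OF \<delta>] by blast
      have "mon_fun {..<N} (dn \<delta>) \<sigma> = 0" by (rule mon_fun_zero[of _ i']) (use i' in \<open>auto simp: \<sigma>_def\<close>)
      thus "lo j \<delta> Y * (mon_fun {..<N} (dn \<delta>) \<sigma> * (\<sigma> (N + sel \<delta>) - \<sigma> (sel \<delta>))) = 0" by simp
    qed
    finally show ?thesis .
  qed
  \<comment> \<open>The difference of \<open>sw \<delta>\<close> and \<open>\<delta>\<close>
    vanishes when each \<open>z i\<close> has the same coefficient as \<open>y i\<close>.\<close>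
  have c5: "P j (\<lambda>l. \<Sum>i<N. s i * (y i l + z i l)) = 0" if j: "j < L" for j s
  proof -
    define \<sigma> where "\<sigma> a = (if a < N then s a else s (a - N))" for a
    have "P j (\<lambda>l. \<Sum>i<N. s i * (y i l + z i l)) = P j (\<lambda>l. \<Sum>i<N. (\<sigma> i * y i l + \<sigma> (N + i) * z i l))"
      by (simp add: \<sigma>_def distrib_left)
    also have "\<dots> = 0" unfolding main[OF j]
      by (rule sum.neutral) (use sel(2) in \<open>auto simp: \<sigma>_def\<close>)
    finally show ?thesis .
  qed
  \<comment> \<open>Here the relation between the \<open>x i\<close> enters: at equal coefficients 1
    it makes the added terms, and hence the sum of the \<open>lo j \<delta> Y\<close>, equal to
    0.\<close>
  have c6: "P j (\<lambda>l. s * (\<Sum>i<N. y i l) + t * (\<Sum>i<N. z i l)) = 0" if j: "j < L" for j s t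
  proof -
    have one: "mon_fun {..<N} \<delta> (\<lambda>_. 1) = 1" for \<delta> by (simp add: mon_fun_def)
    have "(\<Sum>\<delta>\<in>mix j. lo j \<delta> Y) = P j (\<lambda>l. \<Sum>i<N. 1 * (x i l + y i l)) - P j (\<lambda>l. \<Sum>i<N. 1 * y i l)"
      unfolding lo_mix[OF j] one by simp
    also have "\<dots> = 0" by (simp add: sum.distrib x0)
    finally have z0: "(\<Sum>\<delta>\<in>mix j. lo j \<delta> Y) = 0" .
    define \<sigma> where "\<sigma> a = (if a < N then s else t)" for a
    have "P j (\<lambda>l. s * (\<Sum>i<N. y i l) + t * (\<Sum>i<N. z i l)) = P j (\<lambda>l. \<Sum>i<N. (\<sigma> i * y i l + \<sigma> (N + i) * z i l))"
      by (simp add: \<sigma>_def sum.distrib sum_distrib_left)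
    also have "\<dots> = (\<Sum>\<delta>\<in>mix j. lo j \<delta> Y * (s ^ (d j - 1) * (t - s)))"
      unfolding main[OF j]
    proof (intro sum.cong refl)
      fix \<delta> assume \<delta>: "\<delta> \<in> mix j"
      have "mon_fun {..<N} (dn \<delta>) \<sigma> = (\<Prod>i<N. s ^ dn \<delta> i)" unfolding mon_fun_def by (rule prod.cong) (auto simp: \<sigma>_def)
      also have "\<dots> = s ^ (d j - 1)" using dn_exponents[OF \<delta>] by (simp add: exponents_def power_sum[symmetric])
      finally show "lo j \<delta> Y * (mon_fun {..<N} (dn \<delta>) \<sigma> * (\<sigma> (N + sel \<delta>) - \<sigma> (sel \<delta>))) = lo j \<delta> Y * (s ^ (d j - 1) * (t - s))"
        using sel(2)[OF \<delta>] by (simp add: \<sigma>_def)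
    qed
    also have "\<dots> = 0" by (simp only: sum_distrib_right[symmetric] z0 mult_zero_left)
    finally show ?thesis .
  qed
  have "y i \<in> coord_space n \<and> z i \<in> coord_space n" for i by (auto simp: y_def z_def block_def coord_space_def)
  thus ?thesis using c1 c2 c3 c4 c5 c6 by (intro exI[of _ y] exI[of _ z]) blast
qed

lemma high_rank_cong:
  fixes I :: "'a set"
  assumes "finite I" "\<And>i. i \<in> I \<Longrightarrow> e i = e' i" "\<And>i. i \<in> I \<Longrightarrow> F i = F' i" "high_rank n I e F B"
  shows "high_rank n I e' F' B"
  unfolding high_rank_alt[OF assms(1)]
proof (intro allI impI)
  fix E and c :: "'a \<Rightarrow> complex" assume "\<exists>i\<in>I. e' i = E \<and> c i \<noteq> 0"
  hence ex: "\<exists>i\<in>I. e i = E \<and> c i \<noteq> 0" using assms(2) by auto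
  have "(\<Sum>i\<in>I. if e i = E then c i * F i x else 0) = (\<Sum>i\<in>I. if e' i = E then c i * F' i x else 0)" for x
    by (intro sum.cong refl) (use assms(2,3) in auto)
  thus "\<not> lowrank n E B (\<lambda>x. \<Sum>i\<in>I. if e' i = E then c i * F' i x else 0)"
    using assms(4)[unfolded high_rank_alt[OF assms(1)], rule_format, OF ex] by simp
qed

lemma high_rank_joint_fam_Nil:
  assumes "high_rank n {..<L} d P B"
  shows "high_rank n (joint_fam [] L) (joint_deg [] d) (joint_fun [] P) B"
proof -
  have bij: "bij_betw (case_sum (\<lambda>_. 0) id) (joint_fam [] L) {..<L}"
    unfolding bij_betw_def joint_fam_def inj_on_def by (auto simp: image_iff) (metis InrI old.sum.simps(6) id_apply lessThan_iff)
  show ?thesis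
    by (rule high_rank_cong[OF _ _ _ high_rank_reindex[OF assms bij finite_lessThan]]) (auto simp: joint_fam_def joint_deg_def joint_fun_def)
qed

lemma hom_form_split_coords:
  assumes "hom_form n (Suc e) F"
  shows "\<exists>G. (\<forall>i. hom_form n e (G i)) \<and> (\<forall>x. F x = (\<Sum>i<n. x i * G i x))"
proof -
  have "\<exists>G. (\<forall>i. hom_form n e (G i)) \<and> (\<forall>x. F x = (\<Sum>i<n. x i * G i x))" if "hom_form n e' F" "e' = Suc e" for e'
    using that
  proof (induction rule: hom_form.induct)
    case (hom_form_zero e') show ?case by (rule exI[of _ "\<lambda>i x. 0"]) (auto intro: hom_form.hom_form_zero)
  next
    case (hom_form_add e' F1 F2)
    then obtain G1 G2 where "\<forall>i. hom_form n e (G1 i)" "\<forall>x. F1 x = (\<Sum>i<n. x i * G1 i x)"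
      "\<forall>i. hom_form n e (G2 i)" "\<forall>x. F2 x = (\<Sum>i<n. x i * G2 i x)" by blast
    thus ?case by (intro exI[of _ "\<lambda>i x. G1 i x + G2 i x"]) (auto intro: hom_form.hom_form_add simp: sum.distrib algebra_simps)
  next
    case (hom_form_var i0 e' F1)
    show ?case
    proof (rule exI[of _ "\<lambda>i. if i = i0 then F1 else (\<lambda>x. 0)"], intro conjI allI)
      show "hom_form n e (if i = i0 then F1 else (\<lambda>x. 0))" for i using hom_form_var by (auto intro: hom_form.hom_form_zero)
      show "x i0 * F1 x = (\<Sum>i<n. x i * (if i = i0 then F1 else (\<lambda>x. 0)) x)" for x
      proof -
        have "(\<Sum>i<n. x i * (if i = i0 then F1 else (\<lambda>x. 0)) x) = (\<Sum>i<n. if i = i0 then x i0 * F1 x else 0)"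
          by (intro sum.cong refl) auto
        thus ?thesis using hom_form_var by simp
      qed
    qed
  qed auto
  thus ?thesis using assms by blast
qed

section \<open>Planes through points, and sums of three points\<close>

text \<open>A form of degree at least 2 is a sum of \<open>n\<close> products with the coordinates.
  High rank thus forces the large dimension on which \<open>plane_exists\<close> relies.\<close>

lemma high_rank_dim:
  fixes L :: nat
  assumes "hom_form n (d 0) (P 0)" "2 \<le> d 0" "0 < L" "high_rank n {..<L} d P B"
  shows "B < n"
proof (rule ccontr)
  assume "\<not> B < n"
  have "hom_form n (Suc (d 0 - 1)) (P 0)" using assms by simp
  then obtain G where G: "\<And>i. hom_form n (d 0 - 1) (G i)" "\<And>x. P 0 x = (\<Sum>i<n. x i * G i x)"
    using hom_form_split_coords by blast
  have "lowrank n (d 0) n (P 0)"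
  proof (rule lowrank_finite[of "{..<n}" n "d 0" n "\<lambda>i x. x i" G])
    fix i assume "i \<in> {..<n}"
    hence "hom_form n 1 (\<lambda>x. x i)" by (intro hom_form_coord) simp
    thus "\<exists>a b. 0 < a \<and> 0 < b \<and> a + b = d 0 \<and> hom_form n a (\<lambda>x. x i) \<and> hom_form n b (G i)"
      using G(1) assms(2) by (intro exI[of _ 1] exI[of _ "d 0 - 1"]) auto
  qed (use G in auto)
  hence "lowrank n (d 0) B (P 0)" by (rule lowrank_mono) (use \<open>\<not> B < n\<close> in simp)
  moreover have "P 0 = (\<lambda>x. \<Sum>j<L. if d j = d 0 then (if j = 0 then 1 else 0) * P j x else 0)"
  proof
    fix x
    have "(\<Sum>j<L. if d j = d 0 then (if j = 0 then 1 else 0) * P j x else 0) = (\<Sum>j<L. if j = 0 then P 0 x else 0)"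
      by (intro sum.cong refl) auto
    also have "\<dots> = P 0 x" using assms(3) by simp
    finally show "P 0 x = (\<Sum>j<L. if d j = d 0 then (if j = 0 then 1 else 0) * P j x else 0)" by (rule sym)
  qed
  ultimately have lr: "lowrank n (d 0) B (\<lambda>x. \<Sum>j<L. if d j = d 0 then (if j = 0 then 1 else 0) * P j x else 0)" by simp
  have ex: "\<exists>j\<in>{..<L}. d j = d 0 \<and> (if j = 0 then 1 else 0 :: complex) \<noteq> 0" using assms(3) by (intro bexI[of _ 0]) auto
  show False
    by (rule notE[OF assms(4)[unfolded high_rank_alt[OF finite_lessThan], rule_format, of "d 0" "\<lambda>j. if j = 0 then 1 else 0", OF ex] lr])
qed

lemma hom_form_shift_family:
  assumes "\<forall>i\<in>I. hom_form n (d i) (P i)"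
  shows "\<exists>H. \<forall>i\<in>I. (\<forall>k. hom_form n k (H i k)) \<and> (\<forall>k>d i. H i k = (\<lambda>v. 0)) \<and> H i (d i) = P i \<and>
     (\<forall>t w. P i (\<lambda>l. u i l + t * w l) = (\<Sum>k\<le>d i. t ^ k * H i k w))"
  by (rule bchoice) (intro ballI hom_form_shift assms[rule_format])

text \<open>The plane lies in the zero set once \<open>w\<close> kills the Taylor coefficients of
  the \<open>P j\<close> at \<open>u\<close> in orders 1 to \<open>d j\<close>. These are at most
  \<open>L * D\<close> forms, and one free coordinate more is available. Coordinate \<open>p\<close>
  is kept at 0, so that a point \<open>u\<close> with \<open>u p\<close> different from 0 is
  independent of \<open>w\<close>.\<close>

lemma plane_exists:
  assumes P: "\<And>j. j < L \<Longrightarrow> hom_form n (d j) (P j)" and d: "\<And>j. j < L \<Longrightarrow> 2 \<le> d j \<and> d j \<le> D"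
    and n: "L * D + 2 \<le> n" and u: "\<And>j. j < L \<Longrightarrow> P j u = 0" and p: "p < n"
  shows "\<exists>w\<in>coord_space n. w \<noteq> 0 \<and> w p = 0 \<and> (\<forall>j<L. \<forall>s t. P j (\<lambda>l. s * u l + t * w l) = 0)"
proof -
  have P': "\<forall>j\<in>{..<L}. hom_form n (d j) (P j)" using P by simp
  obtain H where HH: "\<forall>j\<in>{..<L}. (\<forall>k. hom_form n k (H j k)) \<and> (\<forall>k>d j. H j k = (\<lambda>v. 0)) \<and> H j (d j) = P j \<and>
     (\<forall>t w. P j (\<lambda>l. u l + t * w l) = (\<Sum>k\<le>d j. t ^ k * H j k w))"
    using hom_form_shift_family[of "{..<L}" n d P "\<lambda>_. u", OF P'] by (elim exE)
  have H: "\<And>j k. j < L \<Longrightarrow> hom_form n k (H j k)" "\<And>j. j < L \<Longrightarrow> H j (d j) = P j"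
    "\<And>j t w. j < L \<Longrightarrow> P j (\<lambda>l. u l + t * w l) = (\<Sum>k\<le>d j. t ^ k * H j k w)"
    using HH by (simp_all only: lessThan_iff Ball_def)
  define s where "s = L * D"
  \<comment> \<open>Inserts a 0 at position \<open>p\<close> and after the first
    \<open>s + 1\<close> other coordinates.\<close>
  define wv where "wv x = (\<lambda>l. if l = p \<or> (if l < p then l else l - 1) > s then 0 else x (if l < p then l else l - 1))" for x :: cvec
  have hfw: "hom_form (Suc s) 1 (\<lambda>x. wv x l)" for l
  proof (cases "l = p \<or> (if l < p then l else l - 1) > s")
    case True thus ?thesis unfolding wv_def by (auto intro: hom_form_zero)
  next
    case False
    hence "(if l < p then l else l - 1) < Suc s" by auto
    from hom_form_coord[OF this] show ?thesis using False unfolding wv_def by auto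
  qed
  \<comment> \<open>Equation number \<open>i\<close> encodes the pair of the index
    \<open>i div D\<close> and the order \<open>Suc (i mod D)\<close>.\<close>
  have "\<exists>x. (\<exists>b\<le>s. x b \<noteq> 0) \<and> (\<forall>i<s. H (i div D) (Suc (i mod D)) (wv x) = 0)"
  proof (rule forms_common_zero[of s "\<lambda>i. Suc (i mod D)" "\<lambda>i x. H (i div D) (Suc (i mod D)) (wv x)"])
    fix i assume "i < s"
    hence "i div D < L" unfolding s_def by (simp add: less_mult_imp_div_less)
    have "hom_form (Suc s) (Suc (i mod D)) (\<lambda>x. H (i div D) (Suc (i mod D)) (\<lambda>l. wv x l))"
      by (rule hom_form_comp1[OF H(1)[OF \<open>i div D < L\<close>] hfw])
    thus "hom_form (Suc s) (Suc (i mod D)) (\<lambda>x. H (i div D) (Suc (i mod D)) (wv x))" by simp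
  qed simp
  then obtain x where x: "\<exists>b\<le>s. x b \<noteq> 0" "\<And>i. i < s \<Longrightarrow> H (i div D) (Suc (i mod D)) (wv x) = 0" by blast
  define w where "w = wv x"
  have Hw: "H j k w = 0" if "j < L" "0 < k" "k \<le> d j" for j k
  proof -
    define i where "i = j * D + (k - 1)"
    have kD: "k - 1 < D" using d[OF that(1)] that by auto
    have "i < j * D + D" using kD by (simp add: i_def)
    also have "\<dots> = Suc j * D" by simp
    also have "\<dots> \<le> s" unfolding s_def using that(1) by (intro mult_le_mono1) simp
    finally have "i < s" .
    moreover have "i div D = j" "i mod D = k - 1" using kD by (auto simp: i_def)
    ultimately show ?thesis using x(2)[of i] that(2) by (simp add: w_def)
  qed
  have Pj: "P j (\<lambda>l. a * u l + t * w l) = 0" if j: "j < L" for j a t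
  proof (rule hom_form_two_point[OF P[OF j]])
    show "P j w = 0" using Hw[OF j, of "d j"] d[OF j] H(2)[OF j] by simp
    show "P j (\<lambda>l. u l + t * w l) = 0" for t
    proof -
      have "H j 0 w = (\<Sum>k\<le>d j. 0 ^ k * H j k w)"
        by (simp add: power_0_left if_distrib[of "\<lambda>c. c * _"] cong: if_cong)
      also have "\<dots> = P j (\<lambda>l. u l + 0 * w l)" by (rule H(3)[OF j, symmetric])
      finally have "H j 0 w = 0" using u[OF j] by simp
      hence "H j k w = 0" if "k \<le> d j" for k using Hw[OF j _ that] by (cases "k = 0") auto
      thus ?thesis unfolding H(3)[OF j] by (intro sum.neutral) auto
    qed
  qed
  have "w \<noteq> 0"
  proof
    assume w0: "w = 0"
    obtain b where b: "b \<le> s" "x b \<noteq> 0" using x(1) by blast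
    have "w (if b < p then b else Suc b) = x b" using b by (auto simp: w_def wv_def)
    thus False using b w0 by simp
  qed
  moreover have "w \<in> coord_space n" using n by (auto simp: w_def wv_def coord_space_def s_def)
  moreover have "w p = 0" by (simp add: w_def wv_def)
  ultimately show ?thesis using Pj by blast
qed

text \<open>Two of the points are unknowns, the third is what they leave of \<open>v\<close>. On the
  span of the unknowns all coefficients of the \<open>P j\<close> are prescribed to be 0 except for
  a mixed one, which serves to move the third point into the zero set.\<close>

lemma sum_of_three:
  assumes P: "\<And>j. j < L \<Longrightarrow> hom_form n (d j) (P j)" and d: "\<And>j. j < L \<Longrightarrow> 2 \<le> d j \<and> d j \<le> D"
    and high_rank: "high_rank n {..<L} d P (solvable_bound (L * Suc D ^ 2) D)" and v: "v \<in> coord_space n"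
  shows "\<exists>a\<in>zero_set n L P. \<exists>b\<in>zero_set n L P. \<exists>c\<in>zero_set n L P. v = a + b + c"
proof -
  define q where "q = Suc D"
  have q: "d j < q" if "j < L" for j using d[OF that] by (simp add: q_def)
  define low where "low j Y = P j (\<lambda>l. v l - (block n 0 Y l + block n 1 Y l)) - P j (\<lambda>l. - (block n 0 Y l + block n 1 Y l))" for j Y
  \<comment> \<open>One factor from the first vector and \<open>d j - 1\<close> from the second. As
    \<open>d j\<close> is at least 2, the monomial is mixed, and both vectors are zeros of
    \<open>P j\<close>.\<close>
  define gs where "gs j = (\<lambda>i::nat. if i = 0 then 1 else if i = 1 then d j - 1 else 0)" for j
  \<comment> \<open>The sign compensates for the passage from \<open>a + b\<close> to its negative
    in the form \<open>P j\<close> of degree \<open>d j\<close>.\<close>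
  define T where "T i Y = (case i of Inl _ \<Rightarrow> 0 | Inr (j,\<gamma>) \<Rightarrow> if gs j = \<gamma> then - ((-1) ^ d j * low j Y) else 0)"
    for i :: "nat \<times> nat + nat \<times> (nat \<Rightarrow> nat)" and Y
  have deg_le_low: "deg_le (2 * n) (d j - 1) (low j)" if j: "j < L" for j
  proof -
    obtain K where K: "\<And>k. hom_form n k (K k)" "K (d j) = P j" "\<And>t w. P j (\<lambda>l. v l + t * w l) = (\<Sum>k\<le>d j. t ^ k * K k w)"
      using hom_form_shift[OF P[OF j], of v] by blast
    have "low j = (\<lambda>Y. \<Sum>k<d j. K k (\<lambda>l. - (block n 0 Y l + block n 1 Y l)))"
    proof
      fix Y
      have "(\<lambda>l. v l - (block n 0 Y l + block n 1 Y l)) = (\<lambda>l. v l + 1 * - (block n 0 Y l + block n 1 Y l))" by (rule ext) simp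
      hence "P j (\<lambda>l. v l - (block n 0 Y l + block n 1 Y l)) = (\<Sum>k\<le>d j. 1 ^ k * K k (\<lambda>l. - (block n 0 Y l + block n 1 Y l)))"
        unfolding K(3)[symmetric] by (rule arg_cong)
      thus "low j Y = (\<Sum>k<d j. K k (\<lambda>l. - (block n 0 Y l + block n 1 Y l)))" by (simp add: low_def lessThan_Suc_atMost[symmetric] K(2))
    qed
    moreover have "deg_le (2 * n) (d j - 1) (\<lambda>Y. \<Sum>k<d j. K k (\<lambda>l. - (block n 0 Y l + block n 1 Y l)))"
    proof (rule deg_le_sum)
      fix k assume "k \<in> {..<d j}"
      hence k: "k \<le> d j - 1" by auto
      have "hom_form (2 * n) k (\<lambda>Y. K k (\<lambda>l. - (block n 0 Y l + block n 1 Y l)))"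
        by (rule hom_form_comp1[OF K(1)]) (intro hom_form_uminus hom_form_add hom_form_block, simp_all)
      from deg_le_mono[OF hom_form_imp_deg_le[OF this] k] show "deg_le (2 * n) (d j - 1) (\<lambda>Y. K k (\<lambda>l. - (block n 0 Y l + block n 1 Y l)))" .
    qed
    ultimately show ?thesis by (simp only:)
  qed
  have "\<exists>Y. \<forall>i\<in>coeff_fam [] 0 L d 2. coeff_fun n 2 q [] P i Y = T i Y"
  proof (rule solvable_fin[of _ "coeff_deg [] d" D "2 * n"])
    show "finite (coeff_fam [] 0 L d 2)" by simp
    show "0 < coeff_deg [] d i \<and> coeff_deg [] d i \<le> D" if "i \<in> coeff_fam [] 0 L d 2" for i
      using that d by (fastforce simp: coeff_fam_def coeff_deg_def)
    show "hom_form (2 * n) (coeff_deg [] d i) (coeff_fun n 2 q [] P i)" if i: "i \<in> coeff_fam [] 0 L d 2" for i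
      using i hom_form_block_coeff[OF P] by (auto simp: coeff_fam_def coeff_deg_def coeff_fun_def)
    show "deg_le (2 * n) (coeff_deg [] d i - 1) (T i)" if "i \<in> coeff_fam [] 0 L d 2" for i
    proof -
      have "deg_le (2 * n) (d j - 1) (\<lambda>Y. if gs j = \<gamma> then - ((-1) ^ d j * low j Y) else 0)" if "j < L" for j \<gamma>
        by (intro deg_le_if deg_le_uminus deg_le_cmult deg_le_low deg_le_const that)
      thus ?thesis using that by (auto simp: T_def[abs_def] coeff_fam_def coeff_deg_def intro: deg_le_const)
    qed
    have "high_rank n (joint_fam [] L) (joint_deg [] d) (joint_fun [] P) (solvable_bound (card (coeff_fam [] 0 L d 2)) D)"
      by (rule high_rank_mono[OF high_rank_joint_fam_Nil[OF high_rank] solvable_bound_mono]) (use coeff_fam_card[of L d D "[]" 0 2] d in simp)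
    thus "high_rank (2 * n) (coeff_fam [] 0 L d 2) (coeff_deg [] d) (coeff_fun n 2 q [] P) (solvable_bound (card (coeff_fam [] 0 L d 2)) D)"
      by (rule high_rank_coeff_fam) (use P q in auto)
  qed
  then obtain Y where Y: "\<And>i. i \<in> coeff_fam [] 0 L d 2 \<Longrightarrow> coeff_fun n 2 q [] P i Y = T i Y" by blast
  define a where "a = block n 0 Y"
  define b where "b = block n 1 Y"
  have main: "P j (\<lambda>l. \<sigma> 0 * a l + \<sigma> 1 * b l) = - ((-1) ^ d j * low j Y) * (\<sigma> 0 * \<sigma> 1 ^ (d j - 1))" if j: "j < L" for j and \<sigma> :: cvec
  proof -
    have g: "gs j \<in> exponents 2 (d j)" using d[OF j] by (auto simp: exponents_def gs_def numeral_2_eq_2)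
    have "P j (\<lambda>l. \<sigma> 0 * a l + \<sigma> 1 * b l) = P j (\<lambda>l. \<Sum>c<2. \<sigma> c * block n c Y l)"
      by (simp add: numeral_2_eq_2 a_def b_def)
    also have "\<dots> = (\<Sum>\<gamma>\<in>exponents 2 (d j). block_coeff n 2 q (P j) \<gamma> Y * mon_fun {..<2} \<gamma> \<sigma>)"
      by (rule block_coeff_expand[OF P[OF j] q[OF j]])
    also have "\<dots> = (\<Sum>\<gamma>\<in>exponents 2 (d j). if gs j = \<gamma> then - ((-1) ^ d j * low j Y) * mon_fun {..<2} (gs j) \<sigma> else 0)"
    proof (intro sum.cong refl)
      fix \<gamma> assume "\<gamma> \<in> exponents 2 (d j)"
      hence "Inr (j,\<gamma>) \<in> coeff_fam [] 0 L d 2" using j by (auto simp: coeff_fam_def)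
      from Y[OF this] show "block_coeff n 2 q (P j) \<gamma> Y * mon_fun {..<2} \<gamma> \<sigma> = (if gs j = \<gamma> then - ((-1) ^ d j * low j Y) * mon_fun {..<2} (gs j) \<sigma> else 0)"
        by (auto simp: coeff_fun_def T_def)
    qed
    also have "\<dots> = - ((-1) ^ d j * low j Y) * mon_fun {..<2} (gs j) \<sigma>" using g by simp
    also have "mon_fun {..<2} (gs j) \<sigma> = \<sigma> 0 * \<sigma> 1 ^ (d j - 1)"
      by (simp add: mon_fun_def gs_def numeral_2_eq_2)
    finally show ?thesis .
  qed
  have Pa: "P j a = 0" if "j < L" for j
    using main[OF that, of "\<lambda>i. if i = 0 then 1 else 0"] d[OF that] by simp
  have Pb: "P j b = 0" if "j < L" for j
    using main[OF that, of "\<lambda>i. if i = 0 then 0 else 1"] by simp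
  have Pc: "P j (\<lambda>l. v l - (a l + b l)) = 0" if j: "j < L" for j
  proof -
    have "P j (\<lambda>l. - (a l + b l)) = (-1) ^ d j * P j (\<lambda>l. a l + b l)"
      using hom_form_scale[OF P[OF j], of "-1" "\<lambda>l. a l + b l"] by simp
    also have "P j (\<lambda>l. a l + b l) = - ((-1) ^ d j * low j Y)" using main[OF j, of "\<lambda>_. 1"] by simp
    also have "(-1) ^ d j * - ((-1) ^ d j * low j Y) = - low j Y"
      by (simp add: power_mult_distrib[symmetric] mult.assoc[symmetric])
    finally show ?thesis by (simp add: low_def a_def b_def)
  qed
  have co: "a \<in> coord_space n" "b \<in> coord_space n" "(\<lambda>l. v l - (a l + b l)) \<in> coord_space n"
    using v by (auto simp: coord_space_def a_def b_def block_def)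
  have "v = a + b + (\<lambda>l. v l - (a l + b l))" by (rule ext) simp
  thus ?thesis using Pa Pb Pc co unfolding zero_set_def by blast
qed

section \<open>Extension of weakly linear functions\<close>

lemma weakly_linear_plane:
  assumes wl: "weakly_linear X f" and X: "\<And>s t. (\<lambda>l. s * u l + t * v l) \<in> X"
    and ind: "\<And>s t. (\<lambda>l. s * u l + t * v l) = 0 \<Longrightarrow> s = 0 \<and> t = 0"
  shows "f (u + v) = f u + f v" "f (cscale c u) = c * f u"
proof -
  define W where "W = {(\<lambda>l. s * u l + t * v l) | s t. True}"
  have W: "(\<lambda>l. s * u l + t * v l) \<in> W" for s t unfolding W_def by blast
  have sub: "cvec.subspace W"
    unfolding cvec.subspace_def
  proof (intro conjI ballI allI)
    show "0 \<in> W" using W[of 0 0] by (simp add: zero_fun_def)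
  next
    fix a b assume "a \<in> W" "b \<in> W"
    then obtain s t s' t' where "a = (\<lambda>l. s * u l + t * v l)" "b = (\<lambda>l. s' * u l + t' * v l)" by (auto simp: W_def)
    hence "a + b = (\<lambda>l. (s + s') * u l + (t + t') * v l)" by (auto simp: algebra_simps)
    thus "a + b \<in> W" using W by simp
  next
    fix k a assume "a \<in> W"
    then obtain s t where "a = (\<lambda>l. s * u l + t * v l)" by (auto simp: W_def)
    hence "cscale k a = (\<lambda>l. (k * s) * u l + (k * t) * v l)" by (auto simp: cscale_def algebra_simps)
    thus "cscale k a \<in> W" using W by simp
  qed
  have uW: "u \<in> W" and vW: "v \<in> W" using W[of 1 0] W[of 0 1] by auto
  have uv: "u \<noteq> v"
  proof
    assume "u = v"
    hence "(\<lambda>l. 1 * u l + (-1) * v l) = 0" by (auto simp: fun_eq_iff)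
    from ind[OF this] show False by simp
  qed
  have indep: "cvec.independent {u, v}"
  proof (subst cvec.dependent_finite)
    show "\<not> (\<exists>g. (\<exists>w\<in>{u, v}. g w \<noteq> 0) \<and> (\<Sum>w\<in>{u, v}. cscale (g w) w) = 0)"
    proof (intro notI, elim exE conjE)
      fix g assume g: "\<exists>w\<in>{u, v}. g w \<noteq> 0" "(\<Sum>w\<in>{u, v}. cscale (g w) w) = 0"
      have "(\<lambda>l. g u * u l + g v * v l) = 0" using g(2) uv by (simp add: cscale_def fun_eq_iff)
      from ind[OF this] g(1) show False by auto
    qed
  qed simp
  have "W \<subseteq> cvec.span {u, v}"
  proof
    fix a assume "a \<in> W"
    then obtain s t where "a = (\<lambda>l. s * u l + t * v l)" by (auto simp: W_def)
    hence "a = cscale s u + cscale t v" by (auto simp: cscale_def)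
    thus "a \<in> cvec.span {u, v}" by (auto intro: cvec.span_add cvec.span_scale cvec.span_base)
  qed
  hence "cvec.dim W = card {u, v}"
    by (intro cvec.dim_unique[of "{u,v}"]) (use uW vW indep in auto)
  hence dim: "cvec.dim W = 2" using uv by simp
  have "W \<subseteq> X" using X by (auto simp: W_def)
  hence "linear_on W f" using wl sub dim unfolding weakly_linear_def by blast
  thus "f (u + v) = f u + f v" "f (cscale c u) = c * f u" using uW vW unfolding linear_on_def by blast+
qed

definition admissible_rank :: "nat \<Rightarrow> nat \<Rightarrow> nat \<Rightarrow> bool" where
  "admissible_rank L D r \<longleftrightarrow> (\<forall>n d P. (\<forall>j<L. hom_form n (d j) (P j) \<and> 2 \<le> d j \<and> d j \<le> D) \<longrightarrow>
     high_rank n {..<L} d P r \<longrightarrow> admissible n (zero_set n L P))"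

theorem high_rank_admissible:
  assumes L: "0 < L"
  shows "\<exists>r. admissible_rank L D r"
proof -
  \<comment> \<open>Additivity of the extension compares \<open>v\<close>, \<open>w\<close> and
    \<open>v + w\<close>, each of which is a sum of three points.\<close>
  define N where "N = (9::nat)"
  define \<rho> where "\<rho> t = solvable_bound (t * N + L * Suc D ^ (N + N)) D" for t
  \<comment> \<open>One place for each Taylor coefficient of order 1 to \<open>D - 1\<close> of each
    equation at each of the \<open>N\<close> points. Orders from \<open>d j\<close> on will receive
    the zero form, so that \<open>M\<close> is the same for all degrees \<open>d\<close>.\<close>
  define pl where "pl = List.product [0..<N] (List.product [0..<L] [1..<D])"
  define M where "M = mset (map (\<lambda>(i,j,k). k) pl)"
  have pl: "set pl = {..<N} \<times> {..<L} \<times> {1..<D}" by (auto simp: pl_def)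
  have MD: "e \<le> D" if "e \<in># M" for e
  proof -
    have "e \<in> (\<lambda>(i,j,k). k) ` set pl" using that by (simp add: M_def)
    thus ?thesis unfolding pl by (elim imageE SigmaE) simp
  qed
  define Q where "Q r1 \<longleftrightarrow> (\<forall>n d P qs. mset (map fst qs) = M \<longrightarrow> (\<forall>(e,F)\<in>set qs. 0 < e \<and> hom_form n e F) \<longrightarrow> high_rank n {..<L} d P r1 \<longrightarrow>
    (\<exists>rs. (\<forall>(e,F)\<in>set rs. 0 < e \<and> e \<le> D \<and> hom_form n e F) \<and> high_rank n (joint_fam rs L) (joint_deg rs d) (joint_fun rs P) (\<rho> (length rs)) \<and>
      (\<forall>x. (\<forall>(e,F)\<in>set rs. F x = 0) \<and> (\<forall>j<L. P j x = 0) \<longrightarrow> (\<forall>(e,F)\<in>set qs. F x = 0))))" for r1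
  have "\<exists>r. Q r" unfolding Q_def by (rule regularize) (rule MD)
  then obtain r1 where "Q r1" by blast
  note r1 = this[unfolded Q_def]
  \<comment> \<open>The summands serve the regularisation, the decomposition into three points and
    the dimension needed for planes.\<close>
  define r where "r = r1 + solvable_bound (L * Suc D ^ 2) D + (L * D + 2)"
  have "admissible_rank L D r" unfolding admissible_rank_def
  proof (intro allI impI)
    fix n d P
    assume Pd: "\<forall>j<L. hom_form n (d j) (P j) \<and> 2 \<le> d j \<and> d j \<le> D" and high_rank: "high_rank n {..<L} d P r"
    have P: "\<And>j. j < L \<Longrightarrow> hom_form n (d j) (P j)" and d: "\<And>j. j < L \<Longrightarrow> 2 \<le> d j \<and> d j \<le> D" using Pd by auto
    have n: "L * D + 2 \<le> n" using high_rank_dim[of n d P L r] P d L high_rank by (force simp: r_def)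
    let ?X = "zero_set n L P"
    show "admissible n ?X" unfolding admissible_def
    proof (intro allI impI)
      fix f assume wl: "weakly_linear ?X f"
      \<comment> \<open>Weak linearity speaks of planes only, so homogeneity along \<open>u\<close>
        requires a plane of the zero set that contains \<open>u\<close>.\<close>
      have hom_nz: "f (cscale c u) = c * f u" if u: "u \<in> ?X" "u \<noteq> 0" for c u
      proof -
        obtain p where p: "u p \<noteq> 0" using u(2) by (auto simp: fun_eq_iff)
        hence pn: "p < n" using u(1) by (auto simp: zero_set_def coord_space_def not_less[symmetric])
        obtain w where w: "w \<in> coord_space n" "w \<noteq> 0" "w p = 0" "\<forall>j<L. \<forall>s t. P j (\<lambda>l. s * u l + t * w l) = 0"
          using plane_exists[of L n d P D u p, OF P d n _ pn] u(1) by (auto simp: zero_set_def)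
        show ?thesis
        proof (rule weakly_linear_plane(2)[OF wl, of u w])
          show "(\<lambda>l. s * u l + t * w l) \<in> ?X" for s t
            using w u(1) by (auto simp: zero_set_def coord_space_def)
          fix s t assume z: "(\<lambda>l. s * u l + t * w l) = 0"
          have "s = 0" using fun_cong[OF z, of p] p w(3) by simp
          moreover obtain l where "w l \<noteq> 0" using w(2) by (auto simp: fun_eq_iff)
          ultimately show "s = 0 \<and> t = 0" using fun_cong[OF z, of l] by simp
        qed
      qed
      have zX: "0 \<in> ?X" using hom_form_zero_at[OF P] d by (force simp: zero_set_def coord_space_def zero_fun_def)
      have f0: "f 0 = 0"
      proof -
        obtain w where w: "w \<in> coord_space n" "w \<noteq> 0" "\<forall>j<L. \<forall>s t. P j (\<lambda>l. s * (0::cvec) l + t * w l) = 0"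
          using plane_exists[of L n d P D "0::cvec" 0, OF P d n] n zX by (auto simp: zero_set_def)
        have "P j w = 0" if "j < L" for j using w(3)[rule_format, OF that, of 0 1] by simp
        hence "w \<in> ?X" using w(1) by (simp add: zero_set_def)
        from hom_nz[OF this w(2), of 0] show ?thesis by (simp add: cscale_def zero_fun_def)
      qed
      have hom: "f (cscale c u) = c * f u" if "u \<in> ?X" for c u
        using hom_nz[OF that] f0 by (cases "u = 0") (auto simp: cscale_def zero_fun_def)
      \<comment> \<open>If \<open>u\<close> and \<open>v\<close> span less than a plane, homogeneity
        and \<open>f 0 = 0\<close> give the claim.\<close>
      have add: "f (\<lambda>l. u l + v l) = f u + f v"
        if uv: "u \<in> coord_space n" "v \<in> coord_space n" "\<And>j s t. j < L \<Longrightarrow> P j (\<lambda>l. s * u l + t * v l) = 0" for u v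
      proof -
        have X: "(\<lambda>l. s * u l + t * v l) \<in> ?X" for s t
          using uv by (auto simp: zero_set_def coord_space_def)
        have uX: "u \<in> ?X" using X[of 1 0] by auto
        show ?thesis
        proof (cases "\<exists>s t. (\<lambda>l. s * u l + t * v l) = 0 \<and> \<not> (s = 0 \<and> t = 0)")
          case False
          have "f (u + v) = f u + f v" by (rule weakly_linear_plane(1)[OF wl X]) (use False in blast)
          thus ?thesis by (simp add: plus_fun_def)
        next
          case True
          then obtain s t where st: "\<And>l. s * u l + t * v l = 0" "\<not> (s = 0 \<and> t = 0)" by (auto simp: fun_eq_iff)
          show ?thesis
          proof (cases "t = 0")
            case True
            hence "u l = 0" for l using st(1)[of l] st(2) by auto
            hence "u = 0" by (auto simp: fun_eq_iff)
            thus ?thesis using f0 by simp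
          next
            case False
            have vc: "v = cscale (- s / t) u"
            proof
              fix l
              have "t * v l = - (s * u l)" using st(1)[of l] by (simp add: eq_neg_iff_add_eq_0 add.commute)
              thus "v l = cscale (- s / t) u l" using False by (simp add: cscale_def field_simps)
            qed
            have "(\<lambda>l. u l + v l) = cscale (1 + - s / t) u" by (auto simp: vc cscale_def algebra_simps)
            hence "f (\<lambda>l. u l + v l) = (1 + - s / t) * f u" using hom[OF uX] by simp
            also have "\<dots> = f u + f v" using hom[OF uX, of "- s / t"] vc by (simp add: algebra_simps)
            finally show ?thesis .
          qed
        qed
      qed
      have sum_span: "f (\<lambda>l. \<Sum>i<N. v i l) = (\<Sum>i<N. f (v i))"
        if v: "\<And>i. v i \<in> coord_space n" "\<And>j s. j < L \<Longrightarrow> P j (\<lambda>l. \<Sum>i<N. s i * v i l) = 0" for v and N :: nat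
      proof -
        have "f (\<lambda>l. \<Sum>i<k. v i l) = (\<Sum>i<k. f (v i))" if "k \<le> N" for k
          using that
        proof (induction k)
          case 0 show ?case using f0 by (simp add: zero_fun_def)
        next
          case (Suc k)
          have "f (\<lambda>l. (\<Sum>i<k. v i l) + v k l) = f (\<lambda>l. \<Sum>i<k. v i l) + f (v k)"
          proof (rule add)
            show "(\<lambda>l. \<Sum>i<k. v i l) \<in> coord_space n" using v(1) by (auto simp: coord_space_def)
            show "v k \<in> coord_space n" by (rule v(1))
            fix j s t assume j: "j < L"
            have "(\<lambda>l. s * (\<Sum>i<k. v i l) + t * v k l) = (\<lambda>l. \<Sum>i<N. (if i < k then s else if i = k then t else 0) * v i l)"
            proof
              fix l
              have "(\<Sum>i<N. (if i < k then s else if i = k then t else 0) * v i l) = (\<Sum>i<Suc k. (if i < k then s else if i = k then t else 0) * v i l)"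
                by (rule sum.mono_neutral_right) (use Suc.prems in auto)
              also have "\<dots> = s * (\<Sum>i<k. v i l) + t * v k l" by (simp add: sum_distrib_left)
              finally show "s * (\<Sum>i<k. v i l) + t * v k l = (\<Sum>i<N. (if i < k then s else if i = k then t else 0) * v i l)" by simp
            qed
            thus "P j (\<lambda>l. s * (\<Sum>i<k. v i l) + t * v k l) = 0" using v(2)[OF j] by simp
          qed
          thus ?case using Suc by simp
        qed
        thus ?thesis by simp
      qed
      have rel: "(\<Sum>i<N. f (x i)) = 0" if x: "\<And>i. i < N \<Longrightarrow> x i \<in> ?X" "\<And>l. (\<Sum>i<N. x i l) = 0" for x
      proof -
        have P': "\<forall>ij\<in>(UNIV::nat set) \<times> {..<L}. hom_form n (d (snd ij)) (P (snd ij))" using P by auto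
        obtain H where HH: "\<forall>ij\<in>UNIV \<times> {..<L}. (\<forall>k. hom_form n k (H ij k)) \<and> (\<forall>k>d (snd ij). H ij k = (\<lambda>v. 0)) \<and> H ij (d (snd ij)) = P (snd ij) \<and>
           (\<forall>t w. P (snd ij) (\<lambda>l. x (fst ij) l + t * w l) = (\<Sum>k\<le>d (snd ij). t ^ k * H ij k w))"
          using hom_form_shift_family[of "UNIV \<times> {..<L}" n "\<lambda>ij. d (snd ij)" "\<lambda>ij. P (snd ij)" "\<lambda>ij. x (fst ij)", OF P'] by (elim exE)
        define H' where "H' i j = H (i, j)" for i j
        have HH': "(\<forall>k. hom_form n k (H' i j k)) \<and> H' i j (d j) = P j \<and>
           (\<forall>t w. P j (\<lambda>l. x i l + t * w l) = (\<Sum>k\<le>d j. t ^ k * H' i j k w))" if "j < L" for i j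
          using bspec[OF HH, of "(i, j)"] that unfolding H'_def by simp
        have H: "\<And>i j k. j < L \<Longrightarrow> hom_form n k (H' i j k)" "\<And>i j. j < L \<Longrightarrow> H' i j (d j) = P j"
          "\<And>i j t w. j < L \<Longrightarrow> P j (\<lambda>l. x i l + t * w l) = (\<Sum>k\<le>d j. t ^ k * H' i j k w)"
          using HH' by simp_all
        define qs where "qs = map (\<lambda>(i,j,k). (k, if k < d j then H' i j k else (\<lambda>v. 0))) pl"
        have q1: "mset (map fst qs) = M" unfolding qs_def M_def map_map by (rule arg_cong[of _ _ mset], rule map_cong) auto
        have q2: "\<forall>(e,F)\<in>set qs. 0 < e \<and> hom_form n e F" using H(1) by (auto simp: qs_def pl hom_form_zero)
        have q3: "high_rank n {..<L} d P r1" by (rule high_rank_mono[OF high_rank]) (simp add: r_def)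
        obtain rs where rs: "\<forall>(e,F)\<in>set rs. 0 < e \<and> e \<le> D \<and> hom_form n e F"
          "high_rank n (joint_fam rs L) (joint_deg rs d) (joint_fun rs P) (\<rho> (length rs))"
          "\<forall>x. (\<forall>(e,F)\<in>set rs. F x = 0) \<and> (\<forall>j<L. P j x = 0) \<longrightarrow> (\<forall>(e,F)\<in>set qs. F x = 0)"
          using r1[THEN spec, THEN spec, THEN spec, THEN spec, THEN mp, OF q1, THEN mp, OF q2, THEN mp, OF q3] by (elim exE conjE)
        have van: "H' i j k w = 0" if w: "\<forall>(e,F)\<in>set rs. F w = 0" "\<forall>j<L. P j w = 0" "i < N" "j < L" "0 < k" "k < d j" for w i j k
        proof -
          have "(i,j,k) \<in> set pl" using that d[OF w(4)] by (auto simp: pl)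
          hence "(k, H' i j k) \<in> set qs" using w(6) by (force simp: qs_def)
          thus ?thesis using rs(3) w(1,2) by blast
        qed
        have xz: "\<And>i j. i < N \<Longrightarrow> j < L \<Longrightarrow> P j (x i) = 0" using x(1) by (simp add: zero_set_def)
        define RC where "RC y z \<longleftrightarrow> (\<forall>i. y i \<in> coord_space n \<and> z i \<in> coord_space n) \<and> (\<forall>j<L.
           (\<forall>i<N. \<forall>s t. P j (\<lambda>l. s * x i l + t * y i l) = 0) \<and>
           (\<forall>s. P j (\<lambda>l. \<Sum>i<N. s i * (x i l + y i l)) = 0) \<and>
           (\<forall>s. P j (\<lambda>l. \<Sum>i<N. s i * z i l) = 0) \<and>
           (\<forall>i<N. \<forall>s t. P j (\<lambda>l. s * y i l + t * z i l) = 0) \<and>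
           (\<forall>s. P j (\<lambda>l. \<Sum>i<N. s i * (y i l + z i l)) = 0) \<and>
           (\<forall>s t. P j (\<lambda>l. s * (\<Sum>i<N. y i l) + t * (\<Sum>i<N. z i l)) = 0))" for y z
        have "\<exists>y z. RC y z" unfolding RC_def
          by (rule relation_config[of L n d P D N x rs H']) (fact P d xz x(2) rs(1) rs(2)[unfolded \<rho>_def] | rule H(1) H(2) H(3) van; assumption)+
        then obtain y z where "RC y z" by blast
        note RC = this[unfolded RC_def]
        have yz: "\<And>i. y i \<in> coord_space n" "\<And>i. z i \<in> coord_space n"
          "\<And>j i s t. j < L \<Longrightarrow> i < N \<Longrightarrow> P j (\<lambda>l. s * x i l + t * y i l) = 0"
          "\<And>j s. j < L \<Longrightarrow> P j (\<lambda>l. \<Sum>i<N. s i * (x i l + y i l)) = 0"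
          "\<And>j s. j < L \<Longrightarrow> P j (\<lambda>l. \<Sum>i<N. s i * z i l) = 0"
          "\<And>j i s t. j < L \<Longrightarrow> i < N \<Longrightarrow> P j (\<lambda>l. s * y i l + t * z i l) = 0"
          "\<And>j s. j < L \<Longrightarrow> P j (\<lambda>l. \<Sum>i<N. s i * (y i l + z i l)) = 0"
          "\<And>j s t. j < L \<Longrightarrow> P j (\<lambda>l. s * (\<Sum>i<N. y i l) + t * (\<Sum>i<N. z i l)) = 0"
          using RC by blast+
        have xc: "x i \<in> coord_space n" if "i < N" for i using x(1)[OF that] by (simp add: zero_set_def)
        \<comment> \<open>Extended by 0, since \<open>sum_span\<close> asks for vectors at every
          index.\<close>
        define x' where "x' i = (if i < N then x i else 0)" for i
        have x'c: "x' i \<in> coord_space n" for i using xc by (auto simp: x'_def coord_space_def)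
        have cadd: "(\<lambda>l. a l + b l) \<in> coord_space n" if "a \<in> coord_space n" "b \<in> coord_space n" for a b
          using that by (auto simp: coord_space_def)
        have csum: "(\<lambda>l. \<Sum>i<N. a i l) \<in> coord_space n" if "\<And>i. a i \<in> coord_space n" for a :: "nat \<Rightarrow> cvec"
          using that by (auto simp: coord_space_def)
        have 1: "(\<Sum>i<N. f (\<lambda>l. x' i l + y i l)) = (\<Sum>i<N. f (x i)) + (\<Sum>i<N. f (y i))"
          unfolding sum.distrib[symmetric]
        proof (intro sum.cong refl)
          fix i assume i: "i \<in> {..<N}"
          have "f (\<lambda>l. x i l + y i l) = f (x i) + f (y i)" by (rule add) (use i xc yz in auto)
          thus "f (\<lambda>l. x' i l + y i l) = f (x i) + f (y i)" using i by (simp add: x'_def)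
        qed
        have "f (\<lambda>l. \<Sum>i<N. (x' i l + y i l)) = (\<Sum>i<N. f (\<lambda>l. x' i l + y i l))"
          by (rule sum_span[of "\<lambda>i l. x' i l + y i l" N]) (use cadd x'c yz(1,4) in \<open>auto simp: x'_def\<close>)
        also have "(\<lambda>l. \<Sum>i<N. (x' i l + y i l)) = (\<lambda>l. \<Sum>i<N. y i l)"
          using x(2) by (simp add: sum.distrib x'_def)
        finally have 2: "f (\<lambda>l. \<Sum>i<N. y i l) = (\<Sum>i<N. f (x i)) + (\<Sum>i<N. f (y i))" using 1 by simp
        have 3: "f (\<lambda>l. \<Sum>i<N. z i l) = (\<Sum>i<N. f (z i))" by (rule sum_span[OF yz(2) yz(5)])
        have 4: "(\<Sum>i<N. f (\<lambda>l. y i l + z i l)) = (\<Sum>i<N. f (y i)) + (\<Sum>i<N. f (z i))"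
          unfolding sum.distrib[symmetric]
          by (intro sum.cong refl add) (use yz in auto)
        have 5: "f (\<lambda>l. \<Sum>i<N. (y i l + z i l)) = (\<Sum>i<N. f (\<lambda>l. y i l + z i l))"
          by (rule sum_span[of "\<lambda>i l. y i l + z i l" N]) (use cadd yz(1,2,7) in auto)
        have 6: "f (\<lambda>l. (\<Sum>i<N. y i l) + (\<Sum>i<N. z i l)) = f (\<lambda>l. \<Sum>i<N. y i l) + f (\<lambda>l. \<Sum>i<N. z i l)"
          by (rule add) (use csum yz(1,2,8) in auto)
        have "f (\<lambda>l. \<Sum>i<N. y i l) = (\<Sum>i<N. f (y i))"
          using 3 4 5 6 by (simp add: sum.distrib)
        thus ?thesis using 2 by simp
      qed
      have rel_list: "(\<Sum>x\<leftarrow>xs. f x) = 0" if xs: "set xs \<subseteq> ?X" "length xs \<le> N" "\<And>l. (\<Sum>x\<leftarrow>xs. x l) = 0" for xs :: "cvec list"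
      proof -
        define x where "x i = (if i < length xs then xs ! i else 0)" for i
        have split: "(\<Sum>i<N. g (x i)) = (\<Sum>y\<leftarrow>xs. g y)" if "g 0 = 0" for g :: "cvec \<Rightarrow> complex"
        proof -
          have "(\<Sum>i<N. g (x i)) = (\<Sum>i<length xs. g (x i))"
            by (rule sum.mono_neutral_right) (use xs(2) that in \<open>auto simp: x_def\<close>)
          also have "\<dots> = (\<Sum>y\<leftarrow>xs. g y)" by (simp add: sum_list_sum_nth atLeast0LessThan x_def)
          finally show ?thesis .
        qed
        have "(\<Sum>i<N. f (x i)) = 0"
        proof (rule rel)
          show "x i \<in> ?X" for i using xs(1) zX by (auto simp: x_def)
          show "(\<Sum>i<N. x i l) = 0" for l using split[of "\<lambda>v. v l"] xs(3) by simp
        qed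
        thus ?thesis using split[of f] f0 by simp
      qed
      have neg: "(\<lambda>l. c * u l) \<in> ?X" if "u \<in> ?X" for c u
        using that hom_form_scale[OF P] by (auto simp: zero_set_def coord_space_def)
      have HR2: "high_rank n {..<L} d P (solvable_bound (L * Suc D ^ 2) D)" by (rule high_rank_mono[OF high_rank]) (simp add: r_def)
      have "\<forall>v\<in>coord_space n. \<exists>a b c. a \<in> ?X \<and> b \<in> ?X \<and> c \<in> ?X \<and> v = a + b + c"
        using sum_of_three[OF P d HR2] by blast
      then obtain a b c where abc: "\<And>v. v \<in> coord_space n \<Longrightarrow> a v \<in> ?X \<and> b v \<in> ?X \<and> c v \<in> ?X \<and> v = a v + b v + c v"
        by metis
      have abcl: "v l = a v l + b v l + c v l" if "v \<in> coord_space n" for v l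
      proof -
        have "v = a v + b v + c v" using abc[OF that] by blast
        from fun_cong[OF this, of l] show ?thesis by simp
      qed
      \<comment> \<open>The arbitrary choice of three points is harmless: linearity of
        \<open>g\<close> and its agreement with \<open>f\<close> are relations between at most
        \<open>N\<close> points, to which \<open>rel_list\<close> applies.\<close>
      define g where "g v = f (a v) + f (b v) + f (c v)" for v
      have homl: "f (\<lambda>l. k * u l) = k * f u" if "u \<in> ?X" for k u using hom[OF that, of k] by (simp add: cscale_def)
      have "linear_on (coord_space n) g" unfolding linear_on_def
      proof (intro conjI ballI allI)
        fix v w assume vw: "v \<in> coord_space n" "w \<in> coord_space n"
        have vwc: "v + w \<in> coord_space n" using vw by (auto simp: coord_space_def)
        note A = abc[OF vw(1)] abc[OF vw(2)] abc[OF vwc]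
        let ?m = "\<lambda>u l. (-1) * u l"
        have "(\<Sum>x\<leftarrow>[a v, b v, c v, a w, b w, c w, ?m (a (v+w)), ?m (b (v+w)), ?m (c (v+w))]. f x) = 0"
        proof (rule rel_list)
          show "set [a v, b v, c v, a w, b w, c w, ?m (a (v+w)), ?m (b (v+w)), ?m (c (v+w))] \<subseteq> ?X"
            using A neg[of _ "-1"] by auto
          show "(\<Sum>x\<leftarrow>[a v, b v, c v, a w, b w, c w, ?m (a (v+w)), ?m (b (v+w)), ?m (c (v+w))]. x l) = 0" for l
            using abcl[OF vw(1), of l] abcl[OF vw(2), of l] abcl[OF vwc, of l] by (simp add: algebra_simps)
        qed (simp add: N_def)
        thus "g (v + w) = g v + g w" using A homl[of _ "-1"] by (simp add: g_def algebra_simps)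
      next
        fix k v assume v: "v \<in> coord_space n"
        have kv: "cscale k v \<in> coord_space n" using v by (auto simp: coord_space_def cscale_def)
        note A = abc[OF v] abc[OF kv]
        let ?m = "\<lambda>k u l. k * u l"
        have "(\<Sum>x\<leftarrow>[?m k (a v), ?m k (b v), ?m k (c v), ?m (-1) (a (cscale k v)), ?m (-1) (b (cscale k v)), ?m (-1) (c (cscale k v))]. f x) = 0"
        proof (rule rel_list)
          show "set [?m k (a v), ?m k (b v), ?m k (c v), ?m (-1) (a (cscale k v)), ?m (-1) (b (cscale k v)), ?m (-1) (c (cscale k v))] \<subseteq> ?X"
            using A neg neg[of _ "-1"] by auto
          show "(\<Sum>x\<leftarrow>[?m k (a v), ?m k (b v), ?m k (c v), ?m (-1) (a (cscale k v)), ?m (-1) (b (cscale k v)), ?m (-1) (c (cscale k v))]. x l) = 0" for l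
          proof -
            have "k * v l = k * (a v l + b v l + c v l)" using abcl[OF v, of l] by simp
            thus ?thesis using abcl[OF kv, of l] by (simp add: algebra_simps cscale_def)
          qed
        qed (simp add: N_def)
        thus "g (cscale k v) = k * g v" using A homl homl[of _ "-1"] by (simp add: g_def algebra_simps)
      qed
      moreover have "f x = g x" if x: "x \<in> ?X" for x
      proof -
        have xc: "x \<in> coord_space n" using x by (simp add: zero_set_def)
        note A = abc[OF xc]
        have "(\<Sum>y\<leftarrow>[\<lambda>l. (-1) * x l, a x, b x, c x]. f y) = 0"
        proof (rule rel_list)
          show "set [\<lambda>l. (-1) * x l, a x, b x, c x] \<subseteq> ?X" using A neg[OF x, of "-1"] by auto
          show "(\<Sum>y\<leftarrow>[\<lambda>l. (-1) * x l, a x, b x, c x]. y l) = 0" for l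
            using abcl[OF xc, of l] by (simp add: algebra_simps)
        qed (simp add: N_def)
        thus ?thesis using homl[OF x, of "-1"] by (simp add: g_def algebra_simps)
      qed
      ultimately show "\<exists>g. linear_on (coord_space n) g \<and> (\<forall>x\<in>?X. f x = g x)" by blast
    qed
  qed
  thus ?thesis by blast
qed

section \<open>Finite projections and the degrees of the equations\<close>

text \<open>The module generated by \<open>G\<close> over the polynomial functions in the first
  \<open>m\<close> coordinates. These form the base; the following ones are coordinates along the
  fibres.\<close>

inductive base_span :: "nat \<Rightarrow> (cvec \<Rightarrow> complex) set \<Rightarrow> (cvec \<Rightarrow> complex) \<Rightarrow> bool" for m G where
  base_span_zero: "base_span m G (\<lambda>x. 0)"
| base_span_step: "g \<in> G \<Longrightarrow> poly_fn m c \<Longrightarrow> base_span m G F \<Longrightarrow> base_span m G (\<lambda>x. c x * g x + F x)"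

lemma base_span_gen: "g \<in> G \<Longrightarrow> base_span m G g"
  using base_span_step[OF _ poly_fn_const base_span_zero, of g G m 1] by simp

lemma base_span_add: "base_span m G F \<Longrightarrow> base_span m G H \<Longrightarrow> base_span m G (\<lambda>x. F x + H x)"
proof (induction rule: base_span.induct)
  case (base_span_step g c F)
  from base_span.base_span_step[OF base_span_step(1,2) base_span_step(4)[OF base_span_step(5)]] show ?case by (simp add: add.assoc)
qed simp

lemma base_span_sum: "(\<And>i. i \<in> I \<Longrightarrow> base_span m G (F i)) \<Longrightarrow> base_span m G (\<lambda>x. \<Sum>i\<in>I. F i x)"
  by (induction I rule: infinite_finite_induct) (auto intro: base_span_zero base_span_add)

lemma base_span_image:
  assumes "base_span m G F" "\<And>g. g \<in> G \<Longrightarrow> base_span m G' (\<lambda>x. h x * g x)"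
  shows "base_span m G' (\<lambda>x. h x * F x)"
  using assms(1)
proof (induction rule: base_span.induct)
  case (base_span_step g c F)
  have "base_span m G' (\<lambda>x. c x * H x)" if "base_span m G' H" for H
    using that
  proof (induction rule: base_span.induct)
    case base_span_zero show ?case using base_span.base_span_zero by simp
  next
    case (base_span_step g' c' F')
    from base_span.base_span_step[OF base_span_step(1) poly_fn_mult[OF \<open>poly_fn m c\<close> base_span_step(2)] base_span_step(4)]
    show ?case by (simp add: algebra_simps)
  qed
  from base_span_add[OF this[OF assms(2)[OF base_span_step(1)]] base_span_step(4)] show ?case by (simp add: algebra_simps)
qed (use base_span_zero in simp)

lemma base_span_cmult:
  assumes "poly_fn m c" "base_span m G F"
  shows "base_span m G (\<lambda>x. c x * F x)"
proof (rule base_span_image[OF assms(2)])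
  fix g assume "g \<in> G"
  from base_span_step[OF this assms(1) base_span_zero] show "base_span m G (\<lambda>x. c x * g x)" by simp
qed

lemma base_span_mono: "base_span m G F \<Longrightarrow> G \<subseteq> G' \<Longrightarrow> base_span m G' F"
  by (induction rule: base_span.induct) (auto intro: base_span.intros)

lemma base_span_minus: "base_span m G F \<Longrightarrow> base_span m G (\<lambda>x. - F x)"
  using base_span_cmult[OF poly_fn_const, of m G F "-1"] by simp

lemma base_span_mult:
  assumes "base_span m A F" "base_span m B H" "\<And>a b. a \<in> A \<Longrightarrow> b \<in> B \<Longrightarrow> (\<lambda>x. a x * b x) \<in> C"
  shows "base_span m C (\<lambda>x. F x * H x)"
proof (rule base_span_image[OF assms(2)])
  fix b assume b: "b \<in> B"
  have "base_span m C (\<lambda>x. b x * F x)"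
    by (rule base_span_image[OF assms(1)]) (use base_span_gen[OF assms(3)[OF _ b]] in \<open>simp add: mult.commute\<close>)
  thus "base_span m C (\<lambda>x. F x * b x)" by (simp add: mult.commute)
qed

lemma base_span_expand:
  assumes "base_span m G F" "finite G"
  shows "\<exists>p. (\<forall>g. poly_fn m (p g)) \<and> (\<forall>x. F x = (\<Sum>g\<in>G. p g x * g x))"
  using assms(1)
proof (induction rule: base_span.induct)
  case base_span_zero
  show ?case by (rule exI[of _ "\<lambda>_ _. 0"]) (auto intro: poly_fn_const)
next
  case (base_span_step g c F)
  then obtain p where p: "\<And>g. poly_fn m (p g)" "\<And>x. F x = (\<Sum>g\<in>G. p g x * g x)" by blast
  have "c x * g x + F x = (\<Sum>h\<in>G. (p h x + (if h = g then c x else 0)) * h x)" for x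
    using assms(2) base_span_step(1) by (simp add: p(2) distrib_right sum.distrib if_distrib[of "\<lambda>c. c * _"] cong: if_cong)
  moreover have "poly_fn m (\<lambda>x. p h x + (if h = g then c x else 0))" for h
    using p(1) base_span_step(2) by (cases "h = g") (auto intro: poly_fn_add)
  ultimately show ?case by (intro exI[of _ "\<lambda>h x. p h x + (if h = g then c x else 0)"]) blast
qed

definition fibre_monos :: "nat \<Rightarrow> nat \<Rightarrow> nat \<Rightarrow> (cvec \<Rightarrow> complex) set" where
  "fibre_monos m L k = {(\<lambda>x. \<Prod>i\<leftarrow>w. x (m + i)) | w. set w \<subseteq> {..<L} \<and> length w \<le> k}"

lemma finite_fibre_monos: "finite (fibre_monos m L k)"
proof -
  have "fibre_monos m L k = (\<lambda>w x. \<Prod>i\<leftarrow>w. x (m + i)) ` {w. set w \<subseteq> {..<L} \<and> length w \<le> k}"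
    unfolding fibre_monos_def by blast
  thus ?thesis using finite_lists_length_le[of "{..<L}" k] by simp
qed

lemma fibre_monos_one: "(\<lambda>x. 1) \<in> fibre_monos m L k"
  unfolding fibre_monos_def by (auto intro!: exI[of _ "[]"])

lemma fibre_monos_mult: "g \<in> fibre_monos m L a \<Longrightarrow> h \<in> fibre_monos m L b \<Longrightarrow> (\<lambda>x. g x * h x) \<in> fibre_monos m L (a + b)"
proof -
  assume "g \<in> fibre_monos m L a" "h \<in> fibre_monos m L b"
  then obtain w v where "g = (\<lambda>x. \<Prod>i\<leftarrow>w. x (m + i))" "set w \<subseteq> {..<L}" "length w \<le> a"
    "h = (\<lambda>x. \<Prod>i\<leftarrow>v. x (m + i))" "set v \<subseteq> {..<L}" "length v \<le> b" unfolding fibre_monos_def by blast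
  thus ?thesis unfolding fibre_monos_def by (intro CollectI exI[of _ "w @ v"]) auto
qed

lemma fibre_monos_var: "i < L \<Longrightarrow> (\<lambda>x. x (m + i)) \<in> fibre_monos m L 1"
  unfolding fibre_monos_def by (auto intro!: exI[of _ "[i]"])

lemma fibre_monos_mono: "a \<le> b \<Longrightarrow> fibre_monos m L a \<subseteq> fibre_monos m L b"
  unfolding fibre_monos_def by auto

lemma base_span_fibre_monos_mult: "base_span m (fibre_monos m L a) F \<Longrightarrow> base_span m (fibre_monos m L b) H \<Longrightarrow> base_span m (fibre_monos m L (a + b)) (\<lambda>x. F x * H x)"
  by (rule base_span_mult[OF _ _ fibre_monos_mult])

text \<open>A monomial of degree \<open>e\<close> that involves a base coordinate has fibre degree
  less than \<open>e\<close>, and setting the base coordinates to 0 removes exactly such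
  monomials.\<close>

lemma hom_form_base_span:
  assumes "hom_form (m + L) e F"
  shows "base_span m (fibre_monos m L e) F \<and> (0 < e \<longrightarrow> base_span m (fibre_monos m L (e - 1)) (\<lambda>x. F x - F (\<lambda>i. if i < m then 0 else x i)))"
  using assms
proof (induction rule: hom_form.induct)
  case (hom_form_const c)
  show ?case using base_span_cmult[OF poly_fn_const base_span_gen[OF fibre_monos_one]] by simp
next
  case (hom_form_zero e)
  show ?case using base_span_zero by simp
next
  case (hom_form_add e F G)
  have "F x + G x - (F y + G y) = (F x - F y) + (G x - G y)" for x y by simp
  note eq = this
  show ?case unfolding eq using hom_form_add base_span_add by blast
next
  case (hom_form_var i e F)
  show ?case
  proof (cases "i < m")
    case True
    have "base_span m (fibre_monos m L e) (\<lambda>x. x i * F x)" using base_span_cmult[OF poly_fn_coord[OF True]] hom_form_var by blast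
    thus ?thesis using base_span_mono[OF _ fibre_monos_mono] True by auto
  next
    case False
    define j where "j = i - m"
    have j: "j < L" "i = m + j" using hom_form_var False by (auto simp: j_def)
    have s: "base_span m (fibre_monos m L (Suc k)) (\<lambda>x. x i * H x)" if "base_span m (fibre_monos m L k) H" for k H
      using base_span_fibre_monos_mult[OF base_span_gen[OF fibre_monos_var[OF j(1)]] that] j(2) by simp
    have "base_span m (fibre_monos m L e) (\<lambda>x. x i * (F x - F (\<lambda>i. if i < m then 0 else x i)))"
    proof (cases "e = 0")
      case True
      then obtain c where "F = (\<lambda>x. c)" using hom_form_0_const[OF hom_form_var(2)] by blast
      thus ?thesis using base_span_zero by simp
    next
      case False
      thus ?thesis using s[of "e - 1"] hom_form_var by simp
    qed
    thus ?thesis using s hom_form_var False by (simp add: right_diff_distrib)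
  qed
qed

lemma prod_list_extract:
  fixes w :: "'a list"
  assumes "M \<le> count (mset w) i"
  shows "\<exists>v. set v \<subseteq> set w \<and> length w = M + length v \<and>
    (\<forall>f :: 'a \<Rightarrow> 'b::comm_monoid_mult. (\<Prod>i\<leftarrow>w. f i) = f i ^ M * (\<Prod>i\<leftarrow>v. f i))"
proof -
  have "replicate_mset M i \<subseteq># mset w" using assms by (simp add: count_le_replicate_mset_subset_eq)
  then obtain r where r: "mset w = replicate_mset M i + r" by (auto simp: subset_mset.le_iff_add)
  obtain v where v: "r = mset v" using ex_mset[of r] by metis
  have "set v \<subseteq> set w" using r v by (metis set_mset_mset set_mset_union Un_upper2)
  moreover have "length w = M + length v" using arg_cong[OF r, of size] v by simp
  moreover have "(\<Prod>i\<leftarrow>w. f i) = f i ^ M * (\<Prod>i\<leftarrow>v. f i)" for f :: "'a \<Rightarrow> 'b::comm_monoid_mult"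
  proof -
    have "(\<Prod>i\<leftarrow>w. f i) = prod_mset (image_mset f (mset w))" by (metis mset_map prod_mset_prod_list)
    also have "\<dots> = f i ^ M * prod_mset (image_mset f (mset v))" by (simp add: r v)
    also have "prod_mset (image_mset f (mset v)) = (\<Prod>i\<leftarrow>v. f i)" by (metis mset_map prod_mset_prod_list)
    finally show ?thesis .
  qed
  ultimately show ?thesis by blast
qed

text \<open>Since the forms \<open>P j\<close> have no common zero on the space of the last \<open>L\<close> coordinates, a high power of such a
  coordinate is, on the common zeros of the \<open>P j\<close>, a combination of monomials of smaller degree in these coordinates.\<close>

theorem finite_module:
  assumes P: "\<And>j. j < L \<Longrightarrow> hom_form (m + L) (d j) (P j)" and d: "\<And>j. j < L \<Longrightarrow> 0 < d j"
    and triv: "\<And>z i. (\<forall>j<L. P j (\<lambda>i. if i < m then 0 else z (i - m)) = 0) \<Longrightarrow> i < L \<Longrightarrow> z i = 0"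
  shows "\<exists>(q::nat) g. (\<exists>a<q. \<forall>x. g a x = 1) \<and> (\<forall>F. poly_fn (m + L) F \<longrightarrow> (\<exists>A. (\<forall>a b. poly_fn m (A a b)) \<and>
    (\<forall>x. (\<forall>j<L. P j x = 0) \<longrightarrow> (\<forall>a<q. F x * g a x = (\<Sum>b<q. A a b x * g b x)))))"
proof -
  define f where "f j z = P j (\<lambda>i. if i < m then 0 else z (i - m))" for j z
  have f: "hom_form L (d j) (f j)" if "j < L" for j
    unfolding f_def
  proof (rule hom_form_comp1[OF P[OF that]])
    fix i assume "i < m + L"
    thus "hom_form L 1 (\<lambda>z. if i < m then 0 else z (i - m))"
      by (cases "i < m") (auto intro: hom_form_zero hom_form_coord[simplified])
  qed
  have "\<exists>M>0. \<forall>i<L. \<exists>a. (\<forall>j\<in>{..<L}. d j \<le> M \<and> hom_form L (M - d j) (a j)) \<and> (\<forall>z. z i ^ M = (\<Sum>j\<in>{..<L}. a j z * f j z))"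
    by (rule graded_nullstellensatz) (use f triv[folded f_def] in auto)
  then obtain M where M: "M > 0" "\<And>i. i < L \<Longrightarrow> \<exists>a. (\<forall>j\<in>{..<L}. d j \<le> M \<and> hom_form L (M - d j) (a j)) \<and> (\<forall>z. z i ^ M = (\<Sum>j\<in>{..<L}. a j z * f j z))"
    by blast
  define X where "X = {x. \<forall>j<L. P j x = 0}"
  \<comment> \<open>By the pigeonhole principle, a monomial of fibre degree \<open>N + 1\<close>
    contains the M-th power of some fibre coordinate.\<close>
  define N where "N = L * M"
  define Sp where "Sp k F \<longleftrightarrow> (\<exists>F'. base_span m (fibre_monos m L k) F' \<and> (\<forall>x\<in>X. F x = F' x))" for k F
  have Sp_add: "Sp k (\<lambda>x. F x + H x)" if "Sp k F" "Sp k H" for k F H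
    using that base_span_add unfolding Sp_def by (metis (no_types, lifting))
  have Sp_cmult: "Sp k (\<lambda>x. c x * F x)" if "Sp k F" "poly_fn m c" for k F c
    using that base_span_cmult unfolding Sp_def by (metis (no_types, lifting))
  \<comment> \<open>The Nullstellensatz on the fibre expresses the power by the \<open>P j\<close>
    with base coordinates set to 0. On \<open>X\<close> these equal minus the part of
    \<open>P j\<close> that involves the base, which has smaller fibre degree.\<close>
  have pw: "Sp (M - 1) (\<lambda>x. x (m + i) ^ M)" if i: "i < L" for i
  proof -
    obtain a where a: "\<And>j. j < L \<Longrightarrow> d j \<le> M" "\<And>j. j < L \<Longrightarrow> hom_form L (M - d j) (a j)" "\<And>z. z i ^ M = (\<Sum>j\<in>{..<L}. a j z * f j z)"
      using M(2)[OF i] by auto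
    define F' where "F' x = (\<Sum>j<L. a j (\<lambda>l. x (m + l)) * - (P j x - P j (\<lambda>i. if i < m then 0 else x i)))" for x
    have "base_span m (fibre_monos m L (M - 1)) F'" unfolding F'_def
    proof (rule base_span_sum)
      fix j assume "j \<in> {..<L}"
      hence j: "j < L" by simp
      have "hom_form (m + L) (M - d j) (\<lambda>x. a j (\<lambda>l. x (m + l)))"
        by (rule hom_form_comp1[OF a(2)[OF j]]) (auto intro: hom_form_coord[simplified])
      hence 1: "base_span m (fibre_monos m L (M - d j)) (\<lambda>x. a j (\<lambda>l. x (m + l)))" using hom_form_base_span by blast
      have 2: "base_span m (fibre_monos m L (d j - 1)) (\<lambda>x. - (P j x - P j (\<lambda>i. if i < m then 0 else x i)))"
        using hom_form_base_span[OF P[OF j]] d[OF j] base_span_minus by blast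
      have "M - d j + (d j - 1) = M - 1" using a(1)[OF j] d[OF j] by simp
      with base_span_fibre_monos_mult[OF 1 2]
      show "base_span m (fibre_monos m L (M - 1)) (\<lambda>x. a j (\<lambda>l. x (m + l)) * - (P j x - P j (\<lambda>i. if i < m then 0 else x i)))" by simp
    qed
    moreover have "x (m + i) ^ M = F' x" if "x \<in> X" for x
    proof -
      have "(\<lambda>i. if i < m then 0 else x (m + (i - m))) = (\<lambda>i. if i < m then 0 else x i)" by auto
      hence "f j (\<lambda>l. x (m + l)) = P j (\<lambda>i. if i < m then 0 else x i)" for j unfolding f_def by simp
      hence "x (m + i) ^ M = (\<Sum>j<L. a j (\<lambda>l. x (m + l)) * P j (\<lambda>i. if i < m then 0 else x i))"
        using a(3)[of "\<lambda>l. x (m + l)"] by simp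
      also have "\<dots> = F' x" unfolding F'_def by (intro sum.cong refl) (use \<open>x \<in> X\<close> in \<open>auto simp: X_def\<close>)
      finally show ?thesis .
    qed
    ultimately show ?thesis unfolding Sp_def by blast
  qed
  have red: "Sp N g" if gz: "g \<in> fibre_monos m L (Suc N)" for g
  proof -
    obtain w where w: "g = (\<lambda>x. \<Prod>i\<leftarrow>w. x (m + i))" "set w \<subseteq> {..<L}" "length w \<le> Suc N"
      using gz unfolding fibre_monos_def by blast
    show ?thesis
    proof (cases "length w \<le> N")
      case True
      hence "g \<in> fibre_monos m L N" using w unfolding fibre_monos_def by blast
      thus ?thesis using base_span_gen unfolding Sp_def by blast
    next
      case False
      have "\<exists>i<L. M \<le> count (mset w) i"
      proof (rule ccontr)
        assume "\<not> ?thesis"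
        hence c: "count (mset w) i \<le> M" if "i < L" for i using that by (auto simp: not_le intro: less_imp_le)
        have "length w = (\<Sum>i\<in>set w. count (mset w) i)" using size_multiset_overloaded_eq[of "mset w"] by simp
        also have "\<dots> \<le> (\<Sum>i\<in>{..<L}. count (mset w) i)" using w(2) by (intro sum_mono2) auto
        also have "\<dots> \<le> (\<Sum>i\<in>{..<L}. M)" by (intro sum_mono) (use c in auto)
        also have "\<dots> = N" by (simp add: N_def)
        finally show False using False by simp
      qed
      then obtain i where i: "i < L" "M \<le> count (mset w) i" by blast
      obtain v where v: "set v \<subseteq> set w" "length w = M + length v"
        "\<And>f :: nat \<Rightarrow> complex. (\<Prod>i\<leftarrow>w. f i) = f i ^ M * (\<Prod>i\<leftarrow>v. f i)" using prod_list_extract[OF i(2)] by blast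
      obtain F' where F': "base_span m (fibre_monos m L (M - 1)) F'" "\<And>x. x \<in> X \<Longrightarrow> x (m + i) ^ M = F' x"
        using pw[OF i(1)] unfolding Sp_def by blast
      have "(\<lambda>x. \<Prod>i\<leftarrow>v. x (m + i)) \<in> fibre_monos m L (length v)" using v(1) w(2) unfolding fibre_monos_def by blast
      from base_span_fibre_monos_mult[OF F'(1) base_span_gen[OF this]]
      have "base_span m (fibre_monos m L N) (\<lambda>x. F' x * (\<Prod>i\<leftarrow>v. x (m + i)))"
        by (rule base_span_mono[OF _ fibre_monos_mono]) (use v(2) w(3) M(1) in simp)
      moreover have "g x = F' x * (\<Prod>i\<leftarrow>v. x (m + i))" if "x \<in> X" for x
        using F'(2)[OF that] v(3)[of "\<lambda>i. x (m + i)"] by (simp add: w(1))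
      ultimately show ?thesis unfolding Sp_def by blast
    qed
  qed
  have Sp_base_span: "Sp N F" if "base_span m G F" "\<And>g. g \<in> G \<Longrightarrow> Sp N g" for G F
    using that(1)
  proof (induction rule: base_span.induct)
    case base_span_zero show ?case using base_span.base_span_zero unfolding Sp_def by blast
  next
    case (base_span_step g c F)
    from Sp_add[OF Sp_cmult[OF that(2)[OF base_span_step(1)] base_span_step(2)] base_span_step(4)] show ?case .
  qed
  have Sp_z: "Sp N (\<lambda>x. x (m + i) * F x)" if "Sp N F" "i < L" for i F
  proof -
    obtain F' where F': "base_span m (fibre_monos m L N) F'" "\<And>x. x \<in> X \<Longrightarrow> F x = F' x" using \<open>Sp N F\<close> unfolding Sp_def by blast
    have "base_span m (fibre_monos m L (1 + N)) (\<lambda>x. x (m + i) * F' x)"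
      by (rule base_span_fibre_monos_mult[OF base_span_gen[OF fibre_monos_var[OF that(2)]] F'(1)])
    from Sp_base_span[OF this] red have "Sp N (\<lambda>x. x (m + i) * F' x)" by simp
    thus ?thesis using F'(2) unfolding Sp_def by auto
  qed
  have Sp_deg_le: "Sp N (\<lambda>x. H x * F x)" if "deg_le (m + L) t H" "Sp N F" for t H F
    using that(1)
  proof (induction rule: deg_le.induct)
    case (deg_le_const t c) show ?case by (rule Sp_cmult[OF that(2) poly_fn_const])
  next
    case (deg_le_add t H H') thus ?case using Sp_add[of N "\<lambda>x. H x * F x" "\<lambda>x. H' x * F x"] by (simp add: distrib_right)
  next
    case (deg_le_var i t H)
    show ?case
    proof (cases "i < m")
      case True
      from Sp_cmult[OF deg_le_var.IH poly_fn_coord[OF True]] show ?thesis by (simp add: mult.assoc)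
    next
      case False
      hence "i - m < L" using deg_le_var(1) by simp
      from Sp_z[OF deg_le_var.IH this] False show ?thesis by (simp add: mult.assoc)
    qed
  qed
  obtain gs where gs: "set gs = fibre_monos m L N" "distinct gs" using finite_distinct_list[OF finite_fibre_monos] by blast
  define q where "q = length gs"
  define g where "g a = gs ! a" for a
  have gz: "g a \<in> fibre_monos m L N" if "a < q" for a
    using nth_mem[of a gs] that unfolding g_def q_def gs(1) by simp
  obtain a1 where a1: "a1 < q" "g a1 = (\<lambda>x. 1)"
    using fibre_monos_one[of m L N] unfolding gs(1)[symmetric] in_set_conv_nth g_def q_def by blast
  have main: "\<exists>A. (\<forall>a b. poly_fn m (A a b)) \<and> (\<forall>x. (\<forall>j<L. P j x = 0) \<longrightarrow> (\<forall>a<q. F x * g a x = (\<Sum>b<q. A a b x * g b x)))"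
    if F: "poly_fn (m + L) F" for F
  proof -
    have "\<exists>p. (\<forall>b. poly_fn m (p b)) \<and> (\<forall>x\<in>X. F x * g a x = (\<Sum>b<q. p b x * g b x))" if "a < q" for a
    proof -
      have "Sp N (g a)" using gz[OF that] base_span_gen unfolding Sp_def by blast
      moreover obtain t where "deg_le (m + L) t F" using F unfolding poly_fn_def by blast
      ultimately have "Sp N (\<lambda>x. F x * g a x)" by (intro Sp_deg_le)
      then obtain F' where F': "base_span m (fibre_monos m L N) F'" "\<forall>x\<in>X. F x * g a x = F' x"
        unfolding Sp_def by (elim exE conjE)
      obtain p where p: "\<And>h. poly_fn m (p h)" "\<And>x. F' x = (\<Sum>h\<in>fibre_monos m L N. p h x * h x)"
        using base_span_expand[OF F'(1) finite_fibre_monos] by blast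
      have "F' x = (\<Sum>b<q. p (g b) x * g b x)" for x
      proof -
        have "F' x = (\<Sum>h\<in>set gs. p h x * h x)" using p(2) gs(1) by simp
        also have "\<dots> = (\<Sum>b<q. p (g b) x * g b x)"
          by (rule sum.reindex_bij_betw[symmetric, of g "{..<q}" "set gs" "\<lambda>h. p h x * h x"])
            (use bij_betw_nth[OF gs(2)] in \<open>auto simp: g_def[abs_def] q_def\<close>)
        finally show ?thesis .
      qed
      thus ?thesis using p(1) F'(2) by (intro exI[of _ "\<lambda>b. p (g b)"]) auto
    qed
    hence "\<forall>a. \<exists>p. a < q \<longrightarrow> (\<forall>b. poly_fn m (p b)) \<and> (\<forall>x\<in>X. F x * g a x = (\<Sum>b<q. p b x * g b x))" by blast
    then obtain A where A: "\<forall>a. a < q \<longrightarrow> (\<forall>b. poly_fn m (A a b)) \<and> (\<forall>x\<in>X. F x * g a x = (\<Sum>b<q. A a b x * g b x))"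
      by (rule choice[THEN exE])
    have "poly_fn m (if a < q then A a b else (\<lambda>x. 0))" for a b using A by (auto intro: poly_fn_const)
    moreover have "\<forall>x. (\<forall>j<L. P j x = 0) \<longrightarrow> (\<forall>a<q. F x * g a x = (\<Sum>b<q. (if a < q then A a b else (\<lambda>x. 0)) x * g b x))"
      using A by (simp add: X_def)
    ultimately show ?thesis by (intro exI[of _ "\<lambda>a b. if a < q then A a b else (\<lambda>x. 0)"]) blast
  qed
  have "\<exists>a<q. \<forall>x. g a x = 1" using a1 by auto
  show ?thesis
  proof (rule exI[of _ q], rule exI[of _ g], rule conjI[OF \<open>\<exists>a<q. \<forall>x. g a x = 1\<close>], intro allI impI)
    fix F assume "poly_fn (m + L) F"
    thus "\<exists>A. (\<forall>a b. poly_fn m (A a b)) \<and> (\<forall>x. (\<forall>j<L. P j x = 0) \<longrightarrow> (\<forall>a<q. F x * g a x = (\<Sum>b<q. A a b x * g b x)))"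
      by (rule main)
  qed
qed

section \<open>Polynomials in one variable over the base\<close>

text \<open>\<open>k\<close> is a formal degree: the coefficient of degree \<open>k\<close> may
  vanish at some or at all points of the base.\<close>

definition upoly_fn :: "nat \<Rightarrow> nat \<Rightarrow> (cvec \<Rightarrow> complex poly) \<Rightarrow> bool" where
  "upoly_fn m k Q \<longleftrightarrow> (\<forall>x. degree (Q x) \<le> k) \<and> (\<forall>l. poly_fn m (\<lambda>x. coeff (Q x) l))"

lemma upoly_fn_mono: "upoly_fn m k Q \<Longrightarrow> k \<le> k' \<Longrightarrow> upoly_fn m k' Q"
  unfolding upoly_fn_def using order_trans by blast

lemma upoly_fn_monom: "poly_fn m c \<Longrightarrow> upoly_fn m k (\<lambda>x. monom (c x) k)"
proof -
  assume "poly_fn m c"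
  hence "poly_fn m (\<lambda>x. coeff (monom (c x) k) l)" for l by (cases "k = l") (auto intro: poly_fn_const)
  thus ?thesis unfolding upoly_fn_def by (simp add: degree_monom_le)
qed

lemma upoly_fn_C: "poly_fn m c \<Longrightarrow> upoly_fn m k (\<lambda>x. [:c x:])"
  using upoly_fn_mono[OF upoly_fn_monom[of m c 0]] by (simp add: monom_0)

lemma upoly_fn_linear: "poly_fn m a \<Longrightarrow> poly_fn m b \<Longrightarrow> upoly_fn m 1 (\<lambda>x. [:a x, b x:])"
proof -
  assume ab: "poly_fn m a" "poly_fn m b"
  have "coeff [:a x, b x:] l = (if l = 0 then a x else if l = 1 then b x else 0)" for x l
    by (cases l; cases "l - 1") auto
  hence "poly_fn m (\<lambda>x. coeff [:a x, b x:] l)" for l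
    using ab poly_fn_const[of m 0] by (cases "l = 0"; cases "l = 1") simp_all
  thus ?thesis unfolding upoly_fn_def by simp
qed

lemma upoly_fn_add: "upoly_fn m k Q \<Longrightarrow> upoly_fn m k R \<Longrightarrow> upoly_fn m k (\<lambda>x. Q x + R x)"
  unfolding upoly_fn_def by (auto intro: poly_fn_add degree_add_le)

lemma upoly_fn_minus: "upoly_fn m k Q \<Longrightarrow> upoly_fn m k (\<lambda>x. - Q x)"
  unfolding upoly_fn_def by (auto intro: poly_fn_uminus)

lemma upoly_fn_diff: "upoly_fn m k Q \<Longrightarrow> upoly_fn m k R \<Longrightarrow> upoly_fn m k (\<lambda>x. Q x - R x)"
  unfolding upoly_fn_def by (auto intro: poly_fn_diff degree_diff_le)

lemma upoly_fn_mult: "upoly_fn m a Q \<Longrightarrow> upoly_fn m b R \<Longrightarrow> upoly_fn m (a + b) (\<lambda>x. Q x * R x)"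
  unfolding upoly_fn_def coeff_mult
  by (auto intro!: poly_fn_sum poly_fn_mult intro: order_trans[OF degree_mult_le add_mono])

lemma upoly_fn_smult: "poly_fn m c \<Longrightarrow> upoly_fn m k Q \<Longrightarrow> upoly_fn m k (\<lambda>x. Polynomial.smult (c x) (Q x))"
  using upoly_fn_mult[OF upoly_fn_C[of m c 0], of k Q] by simp

lemma upoly_fn_sum: "(\<And>i. i \<in> I \<Longrightarrow> upoly_fn m k (Q i)) \<Longrightarrow> upoly_fn m k (\<lambda>x. \<Sum>i\<in>I. Q i x)"
proof (induction I rule: infinite_finite_induct)
  case (insert i I) thus ?case by (auto intro: upoly_fn_add)
qed (use upoly_fn_C[OF poly_fn_const, of m k 0] in auto)

lemma upoly_fn_prod: "finite I \<Longrightarrow> (\<And>i. i \<in> I \<Longrightarrow> upoly_fn m (k i) (Q i)) \<Longrightarrow> upoly_fn m (\<Sum>i\<in>I. k i) (\<lambda>x. \<Prod>i\<in>I. Q i x)"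
proof (induction I rule: finite_induct)
  case empty show ?case using upoly_fn_C[OF poly_fn_const, of m 0 1] by (simp add: one_pCons)
next
  case (insert i I) thus ?case by (auto intro: upoly_fn_mult)
qed

lemma upoly_fn_pderiv: "upoly_fn m k Q \<Longrightarrow> upoly_fn m (k - 1) (\<lambda>x. pderiv (Q x))"
  unfolding upoly_fn_def coeff_pderiv
  by (auto simp: degree_pderiv intro!: poly_fn_mult poly_fn_const diff_le_mono)

lemma upoly_fn_det:
  assumes "\<And>a b. a < q \<Longrightarrow> b < q \<Longrightarrow> upoly_fn m 1 (E a b)"
  shows "upoly_fn m q (\<lambda>x. det (mat q q (\<lambda>(a,b). E a b x)))"
proof -
  have "upoly_fn m q (\<lambda>x. signof p * (\<Prod>i\<in>{0..<q}. E i (p i) x))" if "p permutes {0..<q}" for p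
  proof -
    have "upoly_fn m (\<Sum>i\<in>{0..<q}. 1) (\<lambda>x. \<Prod>i\<in>{0..<q}. E i (p i) x)"
      by (rule upoly_fn_prod) (use assms permutes_in_image[OF that] in auto)
    hence "upoly_fn m q (\<lambda>x. \<Prod>i\<in>{0..<q}. E i (p i) x)" by simp
    from upoly_fn_smult[OF poly_fn_const[of m "signof p"] this] show ?thesis by (auto simp: sign_def upoly_fn_minus)
  qed
  hence "upoly_fn m q (\<lambda>x. \<Sum>p\<in>{p. p permutes {0..<q}}. signof p * (\<Prod>i\<in>{0..<q}. E i (p i) x))"
    by (intro upoly_fn_sum) auto
  moreover have "det (mat q q (\<lambda>(a,b). E a b x)) = (\<Sum>p\<in>{p. p permutes {0..<q}}. signof p * (\<Prod>i\<in>{0..<q}. E i (p i) x))" for x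
    unfolding det_def
    by (auto intro!: sum.cong prod.cong simp: permutes_in_image)
  ultimately show ?thesis by simp
qed

lemma upoly_fn_poly:
  assumes "upoly_fn m k Q" "poly_fn n' (\<lambda>x. z x)" "m \<le> n'"
  shows "poly_fn n' (\<lambda>x. poly (Q x) (z x))"
proof -
  have "poly (Q x) (z x) = (\<Sum>l\<le>k. coeff (Q x) l * z x ^ l)" for x
    unfolding poly_altdef by (rule sum.mono_neutral_left) (use assms(1) in \<open>auto simp: upoly_fn_def coeff_eq_0 not_le\<close>)
  moreover have "poly_fn n' (\<lambda>x. coeff (Q x) l)" for l
    using assms(1,3) deg_le_mono_n unfolding upoly_fn_def poly_fn_def by blast
  ultimately show ?thesis by (auto intro!: poly_fn_sum poly_fn_mult poly_fn_power assms(2))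
qed

lemma upoly_fn_degree_less:
  assumes "upoly_fn m (Suc k) Q" "\<And>x. coeff (Q x) (Suc k) = 0"
  shows "upoly_fn m k Q"
proof -
  have "degree (Q x) \<le> k" for x
  proof (rule degree_le, intro allI impI)
    fix i assume "k < i"
    show "coeff (Q x) i = 0"
    proof (cases "i = Suc k")
      case False
      moreover have "degree (Q x) \<le> Suc k" using assms(1) unfolding upoly_fn_def by blast
      ultimately have "degree (Q x) < i" using \<open>k < i\<close> by linarith
      thus ?thesis by (rule coeff_eq_0)
    qed (use assms(2) in simp)
  qed
  thus ?thesis using assms(1) unfolding upoly_fn_def by blast
qed

text \<open>Division without inverting the formal leading coefficient of \<open>Q\<close>: each step
  that lowers the degree multiplies by it instead.\<close>

lemma upoly_fn_pseudo_div:
  assumes "upoly_fn m b Q" "0 < b" "upoly_fn m k D"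
  shows "\<exists>M \<kappa> \<rho>. upoly_fn m (k - b) \<kappa> \<and> upoly_fn m (b - 1) \<rho> \<and>
    (\<forall>x. Polynomial.smult (coeff (Q x) b ^ M) (D x) = Q x * \<kappa> x + \<rho> x)"
  using assms(3)
proof (induction k arbitrary: D)
  case 0
  show ?case
    by (intro exI[of _ 0] exI[of _ "\<lambda>_. 0"] exI[of _ D]) (use upoly_fn_mono[OF 0] upoly_fn_C[OF poly_fn_const, of m _ 0] in simp)
next
  case (Suc k)
  show ?case
  proof (cases "Suc k < b")
    case True
    show ?thesis
      by (intro exI[of _ 0] exI[of _ "\<lambda>_. 0"] exI[of _ D])
        (use upoly_fn_mono[OF Suc.prems, of "b - 1"] True upoly_fn_C[OF poly_fn_const, of m _ 0] in simp)
  next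
    case False
    define q where "q x = coeff (Q x) b" for x
    define c where "c x = coeff (D x) (Suc k)" for x
    have q: "poly_fn m q" using assms(1) by (simp add: upoly_fn_def q_def[abs_def])
    have c: "poly_fn m c" using Suc.prems by (simp add: upoly_fn_def c_def[abs_def])
    define T where "T x = monom (c x) (Suc k - b)" for x
    have T: "upoly_fn m (Suc k - b) T" unfolding T_def by (rule upoly_fn_monom[OF c])
    define D' where "D' x = Polynomial.smult (q x) (D x) - T x * Q x" for x
    have "upoly_fn m (Suc k - b + b) (\<lambda>x. T x * Q x)" by (rule upoly_fn_mult[OF T assms(1)])
    hence "upoly_fn m (Suc k) D'" unfolding D'_def using False by (intro upoly_fn_diff upoly_fn_smult q Suc.prems) simp
    moreover have "coeff (D' x) (Suc k) = 0" for x
      using False by (simp add: D'_def T_def coeff_monom_mult q_def c_def)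
    ultimately have "upoly_fn m k D'" by (rule upoly_fn_degree_less)
    from Suc.IH[OF this] obtain M \<kappa> \<rho> where IH: "upoly_fn m (k - b) \<kappa>" "upoly_fn m (b - 1) \<rho>"
      "\<And>x. Polynomial.smult (q x ^ M) (D' x) = Q x * \<kappa> x + \<rho> x" unfolding q_def by blast
    have "Polynomial.smult (q x ^ Suc M) (D x) = Q x * (\<kappa> x + Polynomial.smult (q x ^ M) (T x)) + \<rho> x" for x
    proof -
      have "Polynomial.smult (q x ^ Suc M) (D x) = Polynomial.smult (q x ^ M) (D' x + T x * Q x)" by (simp add: D'_def mult.commute)
      also have "\<dots> = Q x * (\<kappa> x + Polynomial.smult (q x ^ M) (T x)) + \<rho> x"
        unfolding smult_add_right IH(3) by (simp add: algebra_simps)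
      finally show ?thesis .
    qed
    moreover have "upoly_fn m (Suc k - b) (\<lambda>x. \<kappa> x + Polynomial.smult (q x ^ M) (T x))"
      by (intro upoly_fn_add upoly_fn_smult poly_fn_power q T upoly_fn_mono[OF IH(1)]) simp
    ultimately show ?thesis using IH(2) unfolding q_def by blast
  qed
qed

text \<open>Along a line in the base the coefficients are polynomials in \<open>t\<close>, which
  makes Gauss's lemma in \<open>complex poly poly\<close> available.\<close>

lemma upoly_fn_line:
  assumes "upoly_fn m k Q"
  shows "\<exists>W :: complex poly poly. \<forall>l t. coeff (Q (\<lambda>i. u i + t * w i)) l = poly (coeff W l) t"
proof -
  have "\<forall>l. \<exists>p :: complex poly. \<forall>t. coeff (Q (\<lambda>i. u i + t * w i)) l = poly p t"
    using assms deg_le_line unfolding upoly_fn_def poly_fn_def by blast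
  then obtain C :: "nat \<Rightarrow> complex poly" where C: "\<And>l t. coeff (Q (\<lambda>i. u i + t * w i)) l = poly (C l) t" by metis
  have "coeff (Q (\<lambda>i. u i + t * w i)) l = poly (coeff (\<Sum>l\<le>k. monom (C l) l) l) t" for l t
  proof (cases "l \<le> k")
    case True thus ?thesis by (simp add: coeff_sum C)
  next
    case False
    hence "coeff (Q (\<lambda>i. u i + t * w i)) l = 0" using assms unfolding upoly_fn_def by (meson coeff_eq_0 le_less_trans not_le)
    thus ?thesis using False by (simp add: coeff_sum)
  qed
  thus ?thesis by blast
qed

text \<open>Gauss's lemma, by comparing contents.\<close>

lemma lead_coeff_dvd_coeff:
  fixes \<mu> \<kappa> \<chi> :: "complex poly poly"
  assumes eq: "Polynomial.smult c \<chi> = \<mu> * \<kappa>" and c: "c \<noteq> 0" and \<chi>: "lead_coeff \<chi> = 1"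
  shows "lead_coeff \<mu> dvd coeff \<mu> l"
proof -
  have "content \<chi> dvd lead_coeff \<chi>" by simp
  hence cont: "content \<chi> = 1" using \<chi> by (metis is_unit_normalize normalize_content)
  define g where "g = content \<mu> * content \<kappa>"
  have g: "g = normalize c" using arg_cong[OF eq, of content] cont by (simp add: content_mult g_def)
  have "c = lead_coeff (Polynomial.smult c \<chi>)" using \<chi> by simp
  also have "\<dots> = lead_coeff \<mu> * lead_coeff \<kappa>" unfolding eq by (rule lead_coeff_mult)
  also have "lead_coeff \<mu> = content \<mu> * lead_coeff (primitive_part \<mu>)"
    by (metis content_times_primitive_part lead_coeff_smult)
  also have "lead_coeff \<kappa> = content \<kappa> * lead_coeff (primitive_part \<kappa>)"
    by (metis content_times_primitive_part lead_coeff_smult)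
  finally have "c = g * (lead_coeff (primitive_part \<mu>) * lead_coeff (primitive_part \<kappa>))" by (simp add: g_def ac_simps)
  moreover have "c = g * unit_factor c" unfolding g by simp
  moreover have "g \<noteq> 0" using c g by simp
  ultimately have "lead_coeff (primitive_part \<mu>) * lead_coeff (primitive_part \<kappa>) = unit_factor c" by (metis mult_left_cancel)
  hence "is_unit (lead_coeff (primitive_part \<mu>))" using c by (metis dvd_triv_left dvd_trans unit_factor_is_unit)
  moreover have "lead_coeff \<mu> = content \<mu> * lead_coeff (primitive_part \<mu>)"
    by (metis content_times_primitive_part lead_coeff_smult)
  ultimately have "lead_coeff \<mu> dvd content \<mu>" by (simp add: mult_unit_dvd_iff)
  thus ?thesis using content_dvd_coeff dvd_trans by blast
qed

text \<open>The homogeneous components at a point of a quotient that is polynomial along the lines through that point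
  are found recursively, as for power series.\<close>

fun quot_comp :: "(nat \<Rightarrow> cvec \<Rightarrow> complex) \<Rightarrow> (nat \<Rightarrow> cvec \<Rightarrow> complex) \<Rightarrow> nat \<Rightarrow> cvec \<Rightarrow> complex" where
  "quot_comp p q j = (\<lambda>w. (p j w - (\<Sum>i<j. q (j - i) w * quot_comp p q i w)) / q 0 w)"

lemma deg_le_line_components:
  assumes "deg_le m K p"
  shows "\<exists>H. (\<forall>k. hom_form m k (H k)) \<and> (\<forall>t w. p (\<lambda>i. u i + t * w i) = (\<Sum>k\<le>K. t ^ k * H k w)) \<and> (\<forall>k>K. H k = (\<lambda>x. 0))"
proof -
  have "deg_le m K (\<lambda>x. p (\<lambda>i. u i + x i))"
    by (rule deg_le_comp1[OF assms]) (auto intro: deg_le_add deg_le_coord deg_le.deg_le_const)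
  then obtain H where H: "\<And>k. hom_form m k (H k)" "\<And>k. k > K \<Longrightarrow> H k = (\<lambda>x. 0)" "(\<lambda>x. p (\<lambda>i. u i + x i)) = (\<lambda>x. \<Sum>k\<le>K. H k x)"
    using deg_le_hom_form_components by blast
  have "p (\<lambda>i. u i + t * w i) = (\<Sum>k\<le>K. t ^ k * H k w)" for t w
    using fun_cong[OF H(3), of "\<lambda>i. t * w i"] by (simp add: hom_form_scale[OF H(1)])
  thus ?thesis using H by blast
qed

lemma poly_fn_translate:
  assumes "poly_fn m F"
  shows "poly_fn m (\<lambda>x. F (\<lambda>i. x i - u i))"
proof -
  obtain t where t: "deg_le m t F" using assms unfolding poly_fn_def by blast
  have "deg_le m t (\<lambda>x. F (\<lambda>i. x i - u i))"
    by (rule deg_le_comp1[OF t]) (intro deg_le_diff deg_le_coord deg_le.deg_le_const)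
  thus ?thesis unfolding poly_fn_def by blast
qed

declare quot_comp.simps [simp del]

text \<open>As \<open>q u\<close> is not 0, the Taylor components at \<open>u\<close> of the
  quotient are polynomial in the direction. On each line the quotient is a polynomial of degree at
  most the bound \<open>K\<close> for \<open>p\<close>, so the components up to \<open>K\<close> add
  up to a global quotient.\<close>

lemma divides_on_lines:
  assumes p: "poly_fn m p" and q: "poly_fn m q" "q u \<noteq> 0"
    and dv: "\<And>w. \<exists>h. \<forall>t. p (\<lambda>i. u i + t * w i) = q (\<lambda>i. u i + t * w i) * poly h t"
  shows "\<exists>b. poly_fn m b \<and> (\<forall>x. p x = q x * b x)"
proof -
  obtain K K' where "deg_le m K p" "deg_le m K' q" using p q unfolding poly_fn_def by blast
  obtain pc where pc0: "(\<forall>k. hom_form m k (pc k)) \<and> (\<forall>t w. p (\<lambda>i. u i + t * w i) = (\<Sum>k\<le>K. t ^ k * pc k w)) \<and> (\<forall>k>K. pc k = (\<lambda>x. 0))"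
    using deg_le_line_components[OF \<open>deg_le m K p\<close>, of u] by (elim exE)
  obtain qc where qc0: "(\<forall>k. hom_form m k (qc k)) \<and> (\<forall>t w. q (\<lambda>i. u i + t * w i) = (\<Sum>k\<le>K'. t ^ k * qc k w)) \<and> (\<forall>k>K'. qc k = (\<lambda>x. 0))"
    using deg_le_line_components[OF \<open>deg_le m K' q\<close>, of u] by (elim exE)
  have pc: "\<And>k. hom_form m k (pc k)" "\<And>t w. p (\<lambda>i. u i + t * w i) = (\<Sum>k\<le>K. t ^ k * pc k w)" "\<And>k. k > K \<Longrightarrow> pc k = (\<lambda>x. 0)"
    and qc: "\<And>k. hom_form m k (qc k)" "\<And>t w. q (\<lambda>i. u i + t * w i) = (\<Sum>k\<le>K'. t ^ k * qc k w)" "\<And>k. k > K' \<Longrightarrow> qc k = (\<lambda>x. 0)"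
    using pc0 qc0 by simp_all
  have q0: "qc 0 w = q u" for w
  proof -
    have "(\<Sum>k\<le>K'. 0 ^ k * qc k w) = (\<Sum>k\<le>K'. if k = 0 then qc 0 w else 0)" by (intro sum.cong refl) auto
    thus ?thesis using qc(2)[of 0 w] by simp
  qed
  have PFh: "poly_fn m (quot_comp pc qc j)" for j
  proof (induction j rule: less_induct)
    case (less j)
    have "poly_fn m (\<lambda>w. (pc j w - (\<Sum>i<j. qc (j - i) w * quot_comp pc qc i w)) * inverse (q u))"
      by (intro poly_fn_mult poly_fn_diff poly_fn_sum poly_fn_const poly_fn_hom_form[OF pc(1)] poly_fn_hom_form[OF qc(1)] less) auto
    thus ?case by (subst quot_comp.simps) (simp add: q0 divide_inverse)
  qed
  define b where "b x = (\<Sum>j\<le>K. quot_comp pc qc j (\<lambda>i. x i - u i))" for x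
  have "poly_fn m (\<lambda>x. quot_comp pc qc j (\<lambda>i. x i - u i))" for j by (rule poly_fn_translate[OF PFh])
  hence "poly_fn m b" unfolding b_def by (intro poly_fn_sum)
  moreover have "p x = q x * b x" for x
  proof -
    define w where "w i = x i - u i" for i
    obtain h where h: "\<And>t. p (\<lambda>i. u i + t * w i) = q (\<lambda>i. u i + t * w i) * poly h t" using dv by blast
    define pw where "pw = (\<Sum>k\<le>K. monom (pc k w) k)"
    define qw where "qw = (\<Sum>k\<le>K'. monom (qc k w) k)"
    have "poly pw t = poly (qw * h) t" for t
      using h[of t] unfolding pc(2) qc(2) by (simp add: pw_def qw_def poly_sum poly_monom mult.commute)
    hence eq: "pw = qw * h" using poly_eq_poly_eq_iff by blast
    have cp: "coeff pw k = pc k w" for k by (cases "k \<le> K") (auto simp: pw_def coeff_sum pc(3))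
    have cq: "coeff qw k = qc k w" for k by (cases "k \<le> K'") (auto simp: qw_def coeff_sum qc(3))
    have "coeff qw 0 \<noteq> 0" using cq q0 q(2) by simp
    hence qw: "qw \<noteq> 0" by auto
    have "degree pw \<le> K" unfolding pw_def by (rule degree_sum_le) (auto intro: order_trans[OF degree_monom_le])
    hence dh: "degree h \<le> K" using eq qw by (cases "h = 0") (auto simp: degree_mult_eq)
    have "coeff h j = quot_comp pc qc j w" for j
    proof (induction j rule: less_induct)
      case (less j)
      have "pc j w = (\<Sum>i\<le>j. coeff h i * qc (j - i) w)"
        unfolding cp[symmetric] eq by (subst mult.commute) (simp add: coeff_mult cq)
      also have "\<dots> = (\<Sum>i<j. qc (j - i) w * quot_comp pc qc i w) + coeff h j * q u"
        unfolding lessThan_Suc_atMost[symmetric] sum.lessThan_Suc by (simp add: q0 less mult.commute)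
      finally show ?case using q(2) by (subst quot_comp.simps) (simp add: q0)
    qed
    note ch = this
    have "poly h 1 = (\<Sum>i\<le>degree h. coeff h i)" by (simp add: poly_altdef)
    also have "\<dots> = (\<Sum>i\<le>K. coeff h i)" by (rule sum.mono_neutral_left) (use dh in \<open>auto simp: coeff_eq_0\<close>)
    also have "\<dots> = b x" by (simp add: ch b_def w_def[abs_def])
    finally have "poly h 1 = b x" .
    moreover have "(\<lambda>i. u i + 1 * w i) = x" by (auto simp: w_def)
    ultimately show ?thesis using h[of 1] by simp
  qed
  ultimately show ?thesis by blast
qed

lemma card_roots_rsquarefree:
  fixes p :: "complex poly"
  assumes "rsquarefree p"
  shows "card {z. poly p z = 0} = degree p"
proof -
  have p: "p \<noteq> 0" using assms by (auto simp: rsquarefree_def)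
  have "degree p = degree (Polynomial.smult (lead_coeff p) (\<Prod>z | poly p z = 0. [:-z, 1:]))"
    using complex_poly_decompose_rsquarefree[OF assms] by simp
  also have "\<dots> = degree (\<Prod>z | poly p z = 0. [:-z, 1:])" using p by simp
  also have "\<dots> = (\<Sum>z | poly p z = 0. degree [:-z, 1:])" by (rule degree_prod_eq_sum_degree) simp
  finally show ?thesis by simp
qed

section \<open>The finite cover and its relations\<close>

text \<open>\<open>triv\<close> says that over the base point 0 the equations have only the zero
  solution, which makes the projection to the base finite; \<open>prime\<close> is the
  irreducibility of \<open>X\<close>. As all functions depend on the first \<open>m + L\<close>
  coordinates, points of \<open>X\<close> may be continued arbitrarily beyond them.\<close>

locale finite_cover =
  fixes m L :: nat and d :: "nat \<Rightarrow> nat" and P :: "nat \<Rightarrow> cvec \<Rightarrow> complex" and X :: "cvec set"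
  defines "X \<equiv> {x. \<forall>j<L. P j x = 0}"
  assumes P: "\<And>j. j < L \<Longrightarrow> hom_form (m + L) (d j) (P j)"
    and d: "\<And>j. j < L \<Longrightarrow> 0 < d j"
    and triv: "\<And>z i. (\<forall>j<L. P j (\<lambda>i. if i < m then 0 else z (i - m)) = 0) \<Longrightarrow> i < L \<Longrightarrow> z i = 0"
    and prime: "\<And>F H. poly_fn (m + L) F \<Longrightarrow> poly_fn (m + L) H \<Longrightarrow> (\<forall>x\<in>X. F x * H x = 0) \<Longrightarrow>
      (\<forall>x\<in>X. F x = 0) \<or> (\<forall>x\<in>X. H x = 0)"
begin

definition vanishes :: "nat \<Rightarrow> (cvec \<Rightarrow> complex poly) \<Rightarrow> bool" where
  "vanishes i Q \<longleftrightarrow> (\<forall>x\<in>X. poly (Q x) (x (m + i)) = 0)"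

text \<open>With a homogenising coordinate \<open>s 0\<close> the fibre is cut out by
  \<open>L\<close> forms in \<open>L + 1\<close> variables. They have a common zero, and
  \<open>triv\<close> keeps it from lying at infinity.\<close>

lemma fibre_nonempty: "\<exists>x\<in>X. \<forall>i<m. x i = y i"
proof -
  define f where "f j s = P j (\<lambda>i. if i < m then s 0 * y i else s (Suc (i - m)))" for j and s :: cvec
  have "\<exists>s. (\<exists>b\<le>L. s b \<noteq> 0) \<and> (\<forall>j<L. f j s = 0)"
  proof (rule forms_common_zero[OF _ d])
    fix j assume "j < L"
    show "hom_form (Suc L) (d j) (f j)" unfolding f_def
    proof (rule hom_form_comp1[OF P[OF \<open>j < L\<close>]])
      fix i assume "i < m + L"
      thus "hom_form (Suc L) 1 (\<lambda>s. if i < m then s 0 * y i else s (Suc (i - m)))"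
        by (cases "i < m") (auto intro!: hom_form_cmult2 hom_form_coord[simplified])
    qed
  qed
  then obtain s b where s: "b \<le> L" "s b \<noteq> 0" "\<And>j. j < L \<Longrightarrow> f j s = 0" by blast
  have s0: "s 0 \<noteq> 0"
  proof
    assume s0: "s 0 = 0"
    have eq: "(\<lambda>i. if i < m then s 0 * y i else s (Suc (i - m))) = (\<lambda>i. if i < m then 0 else s (Suc (i - m)))"
      by (auto simp: s0)
    have "\<forall>j<L. P j (\<lambda>i. if i < m then 0 else s (Suc (i - m))) = 0" using s(3) unfolding f_def eq by blast
    from triv[OF this] have "s (Suc i) = 0" if "i < L" for i using that by blast
    hence "s b = 0" using s0 s(1) by (cases b) auto
    thus False using s(2) by simp
  qed
  define x where "x i = (if i < m then y i else s (Suc (i - m)) / s 0)" for i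
  have "P j x = 0" if "j < L" for j
  proof -
    have "(\<lambda>i. s 0 * x i) = (\<lambda>i. if i < m then s 0 * y i else s (Suc (i - m)))" by (auto simp: x_def s0)
    hence "s 0 ^ d j * P j x = 0" using s(3)[OF that] hom_form_scale[OF P[OF that], of "s 0" x] unfolding f_def by simp
    thus ?thesis using s0 by simp
  qed
  hence "x \<in> X" by (simp add: X_def)
  moreover have "\<forall>i<m. x i = y i" by (simp add: x_def)
  ultimately show ?thesis by blast
qed

text \<open>Every base point lies under a point of \<open>X\<close>.\<close>

lemma poly_fn_base_zero:
  assumes "poly_fn m c" "\<And>x. x \<in> X \<Longrightarrow> c x = 0"
  shows "c y = 0"
proof -
  obtain x where x: "x \<in> X" "\<And>i. i < m \<Longrightarrow> x i = y i" using fibre_nonempty by blast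
  obtain t where "deg_le m t c" using assms(1) by (auto simp: poly_fn_def)
  from deg_le_cong[OF this x(2)] assms(2)[OF x(1)] show ?thesis by simp
qed

lemma vanishes_mult:
  assumes "upoly_fn m k Q" "upoly_fn m k' R" "i < L" "vanishes i (\<lambda>x. Q x * R x)"
  shows "vanishes i Q \<or> vanishes i R"
proof -
  have "poly_fn (m + L) (\<lambda>x. poly (Q x) (x (m + i)))" "poly_fn (m + L) (\<lambda>x. poly (R x) (x (m + i)))"
    by (rule upoly_fn_poly[OF assms(1)] upoly_fn_poly[OF assms(2)]; use assms(3) in \<open>auto intro: poly_fn_coord\<close>)+
  from prime[OF this] assms(4) show ?thesis unfolding vanishes_def by simp
qed

text \<open>The determinant trick of Cayley and Hamilton: \<open>g\<close> will consist of the
  module generators at a point, and the generator 1 makes it a nonzero kernel vector.\<close>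

lemma kernel_det:
  assumes "\<exists>a<q. g a = 1" "\<And>a. a < q \<Longrightarrow> (\<Sum>b<q. B a b * g b) = 0"
  shows "det (mat q q (\<lambda>(a,b). B a b :: complex)) = 0"
proof -
  have "vec q g \<noteq> 0\<^sub>v q" using assms(1) by (metis index_vec index_zero_vec(1) zero_neq_one)
  moreover have "mat q q (\<lambda>(a,b). B a b) *\<^sub>v vec q g = 0\<^sub>v q"
    using assms(2) by (intro eq_vecI) (auto simp: scalar_prod_def lessThan_atLeast0)
  ultimately show ?thesis
    by (subst det_0_iff_vec_prod_zero_field[of _ q]) (auto intro!: exI[of _ "vec q g"])
qed

lemma module_generators:
  "\<exists>(q::nat) g. (\<exists>a<q. \<forall>x. g a x = 1) \<and> (\<forall>F. poly_fn (m + L) F \<longrightarrow> (\<exists>A. (\<forall>a b. poly_fn m (A a b)) \<and>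
    (\<forall>x. (\<forall>j<L. P j x = 0) \<longrightarrow> (\<forall>a<q. F x * g a x = (\<Sum>b<q. A a b x * g b x)))))"
  by (rule finite_module[where d = d]) (fact P d | erule (1) triv)+

text \<open>The characteristic polynomial of multiplication by the coordinate
  \<open>x (m + i)\<close> on the module generators.\<close>

lemma monic_relation:
  assumes i: "i < L"
  shows "\<exists>N \<chi>. upoly_fn m N \<chi> \<and> (\<forall>x. coeff (\<chi> x) N = 1) \<and> vanishes i \<chi>"
proof -
  obtain q :: nat and g where g: "\<exists>a<q. \<forall>x. g a x = 1" and A: "\<And>F. poly_fn (m + L) F \<Longrightarrow> \<exists>A. (\<forall>a b. poly_fn m (A a b)) \<and>
    (\<forall>x. (\<forall>j<L. P j x = 0) \<longrightarrow> (\<forall>a<q. F x * g a x = (\<Sum>b<q. A a b x * g b x)))"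
    using module_generators by blast
  have "poly_fn (m + L) (\<lambda>x. x (m + i))" by (rule poly_fn_coord) (use i in simp)
  from A[OF this] obtain A where A: "\<And>a b. poly_fn m (A a b)"
    "\<And>x a. x \<in> X \<Longrightarrow> a < q \<Longrightarrow> x (m + i) * g a x = (\<Sum>b<q. A a b x * g b x)" unfolding X_def by blast
  define M where "M x = mat q q (\<lambda>(a,b). A a b x)" for x
  have M: "M x \<in> carrier_mat q q" for x by (simp add: M_def)
  define E where "E a b x = [:- A a b x, if a = b then 1 else 0:]" for a b x
  have cpm: "char_poly_matrix (M x) = mat q q (\<lambda>(a,b). E a b x)" for x
    unfolding char_poly_matrix_def by (rule eq_matI) (auto simp: M_def E_def)
  have "upoly_fn m q (\<lambda>x. det (mat q q (\<lambda>(a,b). E a b x)))"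
    by (rule upoly_fn_det) (unfold E_def, intro upoly_fn_linear poly_fn_uminus A poly_fn_const)
  hence "upoly_fn m q (\<lambda>x. char_poly (M x))" unfolding char_poly_def cpm .
  moreover have "\<forall>x. coeff (char_poly (M x)) q = 1" using degree_monic_char_poly[OF M] by blast
  moreover have "vanishes i (\<lambda>x. char_poly (M x))" unfolding vanishes_def
  proof
    fix x assume x: "x \<in> X"
    define B where "B a b = (if a = b then x (m + i) else 0) - A a b x" for a b
    have "poly (char_poly (M x)) (x (m + i)) = det (mat q q (\<lambda>(a,b). B a b))"
      unfolding char_poly_def cpm by (rule poly_det_cong[of _ q]) (auto simp: E_def B_def)
    also have "\<dots> = 0"
    proof (rule kernel_det[of q "\<lambda>a. g a x"])
      show "\<exists>a<q. g a x = 1" using g by blast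
      fix a assume a: "a < q"
      have "(\<Sum>b<q. B a b * g b x) = (\<Sum>b<q. if a = b then x (m + i) * g a x else 0) - (\<Sum>b<q. A a b x * g b x)"
        unfolding sum_subtractf[symmetric] by (intro sum.cong refl) (auto simp: B_def algebra_simps)
      thus "(\<Sum>b<q. B a b * g b x) = 0" using A(2)[OF x a] a by simp
    qed
    finally show "poly (char_poly (M x)) (x (m + i)) = 0" .
  qed
  ultimately show ?thesis by blast
qed

definition minimal_degree :: "nat \<Rightarrow> nat \<Rightarrow> bool" where
  "minimal_degree i e \<longleftrightarrow> 0 < e \<and> (\<forall>R. upoly_fn m (e - 1) R \<longrightarrow> vanishes i R \<longrightarrow> (\<forall>x. R x = 0))"

text \<open>A nonzero relation of least degree. Degree 0 is excluded because \<open>X\<close> maps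
  onto the base.\<close>

lemma minimal_relation:
  assumes i: "i < L"
  shows "\<exists>e \<mu>. minimal_degree i e \<and> upoly_fn m e \<mu> \<and> vanishes i \<mu> \<and> (\<exists>x. coeff (\<mu> x) e \<noteq> 0)"
proof -
  define R where "R k \<longleftrightarrow> (\<exists>\<mu>. upoly_fn m k \<mu> \<and> vanishes i \<mu> \<and> (\<exists>x. \<mu> x \<noteq> 0))" for k
  obtain N \<chi> where \<chi>: "upoly_fn m N \<chi>" "\<forall>x. coeff (\<chi> x) N = 1" "vanishes i \<chi>" using monic_relation[OF i] by blast
  have "\<chi> x \<noteq> 0" for x using \<chi>(2)[rule_format, of x] by auto
  hence RN: "R N" unfolding R_def using \<chi> by blast
  define e where "e = (LEAST k. R k)"
  have Re: "R e" unfolding e_def by (rule LeastI[of R, OF RN])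
  then obtain \<mu> x0 where \<mu>: "upoly_fn m e \<mu>" "vanishes i \<mu>" "\<mu> x0 \<noteq> 0" unfolding R_def by blast
  have e0: "e \<noteq> 0"
  proof
    assume e0: "e = 0"
    have dg: "degree (\<mu> x) = 0" for x using \<mu>(1) e0 unfolding upoly_fn_def by simp
    have c: "\<mu> x = [:coeff (\<mu> x) 0:]" for x using degree_0_id[OF dg[of x]] by simp
    have "coeff (\<mu> x0) 0 = 0"
    proof (rule poly_fn_base_zero[where c = "\<lambda>x. coeff (\<mu> x) 0" and y = x0])
      show "poly_fn m (\<lambda>x. coeff (\<mu> x) 0)" using \<mu>(1) unfolding upoly_fn_def by blast
      fix x assume "x \<in> X"
      hence "poly (\<mu> x) (x (m + i)) = 0" using \<mu>(2) unfolding vanishes_def by blast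
      thus "coeff (\<mu> x) 0 = 0" by (subst (asm) c) simp
    qed
    thus False using c[of x0] \<mu>(3) by simp
  qed
  have less: "\<not> R (e - 1)" using not_less_Least[of "e - 1" R] e0 unfolding e_def[symmetric] by simp
  hence "minimal_degree i e" using e0 unfolding minimal_degree_def R_def by blast
  moreover have "\<exists>x. coeff (\<mu> x) e \<noteq> 0"
  proof (rule ccontr)
    assume "\<not> ?thesis"
    hence "upoly_fn m (e - 1) \<mu>" using upoly_fn_degree_less[of m "e - 1" \<mu>] \<mu>(1) e0 by simp
    thus False using less \<mu>(2,3) unfolding R_def by blast
  qed
  ultimately show ?thesis using \<mu> by blast
qed

text \<open>The remainder of the pseudo-division is again a relation, of degree below the minimum,
  and so it is 0.\<close>

lemma minimal_remainder:
  assumes "minimal_degree i e" "upoly_fn m e \<mu>" "vanishes i \<mu>" "upoly_fn m k D" "vanishes i D"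
  shows "\<exists>M \<kappa>. upoly_fn m (k - e) \<kappa> \<and> (\<forall>x. Polynomial.smult (coeff (\<mu> x) e ^ M) (D x) = \<mu> x * \<kappa> x)"
proof -
  have e: "0 < e" using assms(1) unfolding minimal_degree_def by blast
  from upoly_fn_pseudo_div[OF assms(2) e assms(4)] obtain M \<kappa> \<rho> where
    dv: "upoly_fn m (k - e) \<kappa>" "upoly_fn m (e - 1) \<rho>" "\<And>x. Polynomial.smult (coeff (\<mu> x) e ^ M) (D x) = \<mu> x * \<kappa> x + \<rho> x" by blast
  have "vanishes i \<rho>" unfolding vanishes_def
  proof
    fix x assume x: "x \<in> X"
    have "poly (Polynomial.smult (coeff (\<mu> x) e ^ M) (D x)) (x (m + i)) = poly (\<mu> x * \<kappa> x + \<rho> x) (x (m + i))" by (simp only: dv(3))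
    thus "poly (\<rho> x) (x (m + i)) = 0" using assms(3,5) x unfolding vanishes_def by simp
  qed
  hence "\<rho> x = 0" for x using assms(1) dv(2) unfolding minimal_degree_def by blast
  thus ?thesis using dv by auto
qed

lemma line_lead_coeff:
  assumes "upoly_fn m k Q" "\<And>l t. coeff (Q (\<lambda>i. u i + t * w i)) l = poly (coeff W l) t" "coeff W k \<noteq> 0"
  shows "lead_coeff W = coeff W k"
proof -
  have "coeff W l = 0" if "k < l" for l
  proof -
    have "poly (coeff W l) t = 0" for t
      unfolding assms(2)[symmetric] using assms(1) that unfolding upoly_fn_def by (meson coeff_eq_0 le_less_trans)
    thus ?thesis using poly_all_0_iff_0 by blast
  qed
  hence "degree W \<le> k" by (intro degree_le) auto
  moreover have "k \<le> degree W" by (rule le_degree) (rule assms(3))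
  ultimately show ?thesis by simp
qed

text \<open>The leading coefficient divides the others along the lines through a point where it does not vanish.\<close>

lemma minimal_monic_relation:
  assumes i: "i < L"
  shows "\<exists>e F. minimal_degree i e \<and> upoly_fn m e F \<and> vanishes i F \<and> (\<forall>x. coeff (F x) e = 1)"
proof -
  obtain e \<mu> u where \<mu>: "minimal_degree i e" "upoly_fn m e \<mu>" "vanishes i \<mu>" "coeff (\<mu> u) e \<noteq> 0"
    using minimal_relation[OF i] by blast
  obtain N \<chi> where \<chi>: "upoly_fn m N \<chi>" "\<forall>x. coeff (\<chi> x) N = 1" "vanishes i \<chi>" using monic_relation[OF i] by blast
  define c where "c x = coeff (\<mu> x) e" for x
  obtain M \<kappa> where \<kappa>: "upoly_fn m (N - e) \<kappa>" "\<And>x. Polynomial.smult (c x ^ M) (\<chi> x) = \<mu> x * \<kappa> x"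
    using minimal_remainder[OF \<mu>(1-3) \<chi>(1,3)] unfolding c_def by blast
  have c: "poly_fn m c" using \<mu>(2) unfolding upoly_fn_def c_def by blast
  have "\<exists>b. poly_fn m b \<and> (\<forall>x. coeff (\<mu> x) l = c x * b x)" for l
  proof (rule divides_on_lines[OF _ c])
    show "poly_fn m (\<lambda>x. coeff (\<mu> x) l)" using \<mu>(2) unfolding upoly_fn_def by blast
    show "c u \<noteq> 0" using \<mu>(4) by (simp add: c_def)
    fix w
    obtain W\<mu> W\<chi> W\<kappa> :: "complex poly poly" where
      W: "\<And>l t. coeff (\<mu> (\<lambda>i. u i + t * w i)) l = poly (coeff W\<mu> l) t"
        "\<And>l t. coeff (\<chi> (\<lambda>i. u i + t * w i)) l = poly (coeff W\<chi> l) t"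
        "\<And>l t. coeff (\<kappa> (\<lambda>i. u i + t * w i)) l = poly (coeff W\<kappa> l) t"
      using upoly_fn_line[OF \<mu>(2), of u w] upoly_fn_line[OF \<chi>(1), of u w] upoly_fn_line[OF \<kappa>(1), of u w] by (elim exE) blast
    have cu: "coeff W\<mu> e \<noteq> 0"
    proof
      assume "coeff W\<mu> e = 0"
      thus False using W(1)[where l=e and t=0] \<mu>(4) by simp
    qed
    have "coeff W\<chi> N = 1"
    proof -
      have "poly (coeff W\<chi> N) t = poly 1 t" for t using W(2)[where l=N] \<chi>(2) by simp
      thus ?thesis using poly_eq_poly_eq_iff by blast
    qed
    hence lead: "lead_coeff W\<chi> = 1" using line_lead_coeff[OF \<chi>(1) W(2)] by simp
    have "Polynomial.smult (coeff W\<mu> e ^ M) W\<chi> = W\<mu> * W\<kappa>"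
    proof (rule poly_eqI)
      fix l
      have "poly (coeff (Polynomial.smult (coeff W\<mu> e ^ M) W\<chi>) l) t = poly (coeff (W\<mu> * W\<kappa>) l) t" for t
      proof -
        have "coeff (Polynomial.smult (c (\<lambda>i. u i + t * w i) ^ M) (\<chi> (\<lambda>i. u i + t * w i))) l =
          coeff (\<mu> (\<lambda>i. u i + t * w i) * \<kappa> (\<lambda>i. u i + t * w i)) l" by (simp only: \<kappa>(2))
        thus ?thesis by (simp add: coeff_mult W c_def poly_sum poly_power)
      qed
      thus "coeff (Polynomial.smult (coeff W\<mu> e ^ M) W\<chi>) l = coeff (W\<mu> * W\<kappa>) l" using poly_eq_poly_eq_iff by blast
    qed
    from lead_coeff_dvd_coeff[OF this _ lead] have "lead_coeff W\<mu> dvd coeff W\<mu> l" using cu by simp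
    hence "coeff W\<mu> e dvd coeff W\<mu> l" using line_lead_coeff[OF \<mu>(2) W(1) cu] by simp
    then obtain h where "coeff W\<mu> l = coeff W\<mu> e * h" by (elim dvdE)
    hence "\<forall>t. coeff (\<mu> (\<lambda>i. u i + t * w i)) l = c (\<lambda>i. u i + t * w i) * poly h t"
      by (simp add: W c_def)
    thus "\<exists>h. \<forall>t. coeff (\<mu> (\<lambda>i. u i + t * w i)) l = c (\<lambda>i. u i + t * w i) * poly h t" by blast
  qed
  then obtain b where b: "\<And>l. poly_fn m (b l)" "\<And>l x. coeff (\<mu> x) l = c x * b l x" by metis
  \<comment> \<open>\<open>F\<close> is \<open>\<mu>\<close> divided by its leading coefficient
    \<open>c\<close>. It is a relation as well, since \<open>X\<close> is irreducible and
    \<open>c\<close> does not vanish identically on it.\<close>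
  define F where "F x = (\<Sum>l<e. monom (b l x) l) + monom 1 e" for x
  have PPF: "upoly_fn m e F" unfolding F_def
    by (intro upoly_fn_add upoly_fn_sum upoly_fn_mono[OF upoly_fn_monom] upoly_fn_monom b poly_fn_const) auto
  have ce: "coeff (F x) e = 1" for x by (simp add: F_def coeff_sum)
  have sm: "Polynomial.smult (c x) (F x) = \<mu> x" for x
  proof (rule poly_eqI)
    fix l
    have "coeff (\<mu> x) l = 0" if "e < l" using \<mu>(2) that unfolding upoly_fn_def by (meson coeff_eq_0 le_less_trans)
    thus "coeff (Polynomial.smult (c x) (F x)) l = coeff (\<mu> x) l"
      using b(2)[of x l] by (cases "l < e"; cases "l = e") (auto simp: F_def coeff_sum c_def)
  qed
  have "vanishes i (\<lambda>x. [:c x:] * F x)" using \<mu>(3) by (simp add: sm)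
  hence "vanishes i (\<lambda>x. [:c x:]) \<or> vanishes i F" by (rule vanishes_mult[OF upoly_fn_C[OF c, of 0] PPF i])
  moreover have "\<not> vanishes i (\<lambda>x. [:c x:])"
  proof
    assume "vanishes i (\<lambda>x. [:c x:])"
    hence "c x = 0" if "x \<in> X" for x using that by (simp add: vanishes_def)
    hence "c u = 0" by (rule poly_fn_base_zero[OF c])
    thus False using \<mu>(4) by (simp add: c_def)
  qed
  ultimately have "vanishes i F" by simp
  thus ?thesis by (intro exI[of _ e] exI[of _ F] conjI allI \<mu>(1) PPF ce)
qed

text \<open>Otherwise 1 lies in the ideal generated on X by the functions vanishing at (y, r); multiplication by 1 on module generators
  then yields a determinant that vanishes on X, hence is a multiple of F, but has value 1 at (y, r).\<close>

lemma root_realized: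
  assumes i: "i < L" and F: "minimal_degree i e" "upoly_fn m e F" "vanishes i F" "\<And>x. coeff (F x) e = 1"
    and root: "poly (F y) r = 0"
  shows "\<exists>x\<in>X. (\<forall>b<m. x b = y b) \<and> x (m + i) = r"
proof (rule ccontr)
  assume no: "\<not> ?thesis"
  define I where "I = {..<L} <+> {..m}"
  define f where "f s x = (case s of Inl j \<Rightarrow> P j x | Inr b \<Rightarrow> if b < m then x b - y b else x (m + i) - r)" for s x
  have "\<exists>a. (\<forall>s\<in>I. poly_fn (m + L) (a s)) \<and> (\<forall>x. (\<Sum>s\<in>I. a s x * f s x) = 1)"
  proof (rule weak_nullstellensatz)
    show "finite I" by (simp add: I_def)
    show "poly_fn (m + L) (f s)" if "s \<in> I" for s
    proof (cases s)
      case (Inl j)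
      hence "f s = P j" by (auto simp: f_def)
      thus ?thesis using that poly_fn_hom_form[OF P] Inl by (auto simp: I_def)
    next
      case (Inr b)
      hence "f s = (\<lambda>x. if b < m then x b - y b else x (m + i) - r)" by (auto simp: f_def)
      thus ?thesis using i by (cases "b < m") (auto intro!: poly_fn_diff poly_fn_coord poly_fn_const)
    qed
    fix x
    show "\<exists>s\<in>I. f s x \<noteq> 0"
    proof (rule ccontr)
      assume "\<not> ?thesis"
      hence z: "\<And>s. s \<in> I \<Longrightarrow> f s x = 0" by blast
      have "P j x = 0" if "j < L" for j using z[of "Inl j"] that by (auto simp: f_def I_def)
      hence "x \<in> X" by (simp add: X_def)
      moreover have "x b = y b" if "b < m" for b using z[unfolded I_def, OF InrI[of b "{..m}"]] that by (simp add: f_def)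
      moreover have "x (m + i) = r" using z[unfolded I_def, OF InrI[of m "{..m}"]] by (simp add: f_def)
      ultimately show False using no by blast
    qed
  qed
  then obtain a where a: "\<And>s. s \<in> I \<Longrightarrow> poly_fn (m + L) (a s)" "\<And>x. (\<Sum>s\<in>I. a s x * f s x) = 1" by blast
  have one: "1 = (\<Sum>b<m. (x b - y b) * a (Inr b) x) + (x (m + i) - r) * a (Inr m) x" if "x \<in> X" for x
  proof -
    have "1 = (\<Sum>j<L. a (Inl j) x * P j x) + (\<Sum>b\<le>m. a (Inr b) x * (if b < m then x b - y b else x (m + i) - r))"
      using a(2)[of x] by (simp add: I_def sum.Plus f_def)
    also have "(\<Sum>j<L. a (Inl j) x * P j x) = 0" using that by (simp add: X_def)
    finally show ?thesis by (simp add: lessThan_Suc_atMost[symmetric] mult.commute)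
  qed
  obtain q :: nat and g where g: "\<exists>a<q. \<forall>x. g a x = 1" and A: "\<And>F. poly_fn (m + L) F \<Longrightarrow> \<exists>A. (\<forall>a b. poly_fn m (A a b)) \<and>
    (\<forall>x. (\<forall>j<L. P j x = 0) \<longrightarrow> (\<forall>a<q. F x * g a x = (\<Sum>b<q. A a b x * g b x)))"
    using module_generators by blast
  have "\<forall>s. \<exists>A. s \<le> m \<longrightarrow> (\<forall>c b. poly_fn m (A c b)) \<and> (\<forall>x\<in>X. \<forall>c<q. a (Inr s) x * g c x = (\<Sum>b<q. A c b x * g b x))"
  proof
    fix s
    show "\<exists>A. s \<le> m \<longrightarrow> (\<forall>c b. poly_fn m (A c b)) \<and> (\<forall>x\<in>X. \<forall>c<q. a (Inr s) x * g c x = (\<Sum>b<q. A c b x * g b x))"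
    proof (cases "s \<le> m")
      case True
      hence "poly_fn (m + L) (a (Inr s))" using a(1)[unfolded I_def, OF InrI[of s "{..m}"]] by simp
      from A[OF this] show ?thesis unfolding X_def by blast
    qed simp
  qed
  then obtain A where "\<forall>s. s \<le> m \<longrightarrow> (\<forall>c b. poly_fn m (A s c b)) \<and> (\<forall>x\<in>X. \<forall>c<q. a (Inr s) x * g c x = (\<Sum>b<q. A s c b x * g b x))"
    by (rule choice[THEN exE])
  hence A: "\<And>s c b. s \<le> m \<Longrightarrow> poly_fn m (A s c b)"
    "\<And>s x c. s \<le> m \<Longrightarrow> x \<in> X \<Longrightarrow> c < q \<Longrightarrow> a (Inr s) x * g c x = (\<Sum>b<q. A s c b x * g b x)" by simp_all
  \<comment> \<open>The part free of z in the matrix that represents 1 minus the combination in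
    \<open>one\<close>, with a variable z for \<open>x (m + i)\<close>. On \<open>X\<close> it
    annihilates the generators; at base point \<open>y\<close> and \<open>z = r\<close> it is the
    identity.\<close>
  define E0 where "E0 c b x = (if c = b then 1 else 0) - (\<Sum>s<m. (x s - y s) * A s c b x) + r * A m c b x" for c b x
  define E where "E c b x = [:E0 c b x, - A m c b x:]" for c b x
  define D where "D x = det (mat q q (\<lambda>(c,b). E c b x))" for x
  have PPD: "upoly_fn m q D" unfolding D_def
  proof (rule upoly_fn_det)
    fix c b
    have "poly_fn m (E0 c b)" unfolding E0_def
      by (intro poly_fn_add poly_fn_diff poly_fn_sum poly_fn_mult poly_fn_const A poly_fn_coord) auto
    thus "upoly_fn m 1 (E c b)" unfolding E_def by (intro upoly_fn_linear poly_fn_uminus A) auto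
  qed
  have ev: "poly (D x) z = det (mat q q (\<lambda>(c,b). E0 c b x - z * A m c b x))" for x z
    unfolding D_def by (rule poly_det_cong[of _ q]) (auto simp: E_def)
  have "vanishes i D" unfolding vanishes_def ev
  proof
    fix x assume x: "x \<in> X"
    show "det (mat q q (\<lambda>(c,b). E0 c b x - x (m + i) * A m c b x)) = 0"
    proof (rule kernel_det[of q "\<lambda>a. g a x"])
      show "\<exists>a<q. g a x = 1" using g by blast
      fix c assume c: "c < q"
      have "(\<Sum>b<q. (E0 c b x - x (m + i) * A m c b x) * g b x) =
        (\<Sum>b<q. (if c = b then g c x else 0) - (\<Sum>s<m. (x s - y s) * (A s c b x * g b x)) - (x (m + i) - r) * (A m c b x * g b x))"
        by (intro sum.cong refl) (auto simp: E0_def algebra_simps sum_distrib_left sum_distrib_right)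
      also have "\<dots> = g c x - (\<Sum>b<q. \<Sum>s<m. (x s - y s) * (A s c b x * g b x)) - (\<Sum>b<q. (x (m + i) - r) * (A m c b x * g b x))"
        using c by (simp add: sum_subtractf)
      also have "(\<Sum>b<q. \<Sum>s<m. (x s - y s) * (A s c b x * g b x)) = (\<Sum>s<m. \<Sum>b<q. (x s - y s) * (A s c b x * g b x))"
        by (rule sum.swap)
      also have "\<dots> = (\<Sum>s<m. (x s - y s) * (a (Inr s) x * g c x))"
        unfolding sum_distrib_left[symmetric] by (intro sum.cong refl) (use A(2)[OF _ x c] in simp)
      also have "(\<Sum>b<q. (x (m + i) - r) * (A m c b x * g b x)) = (x (m + i) - r) * (a (Inr m) x * g c x)"
        unfolding sum_distrib_left[symmetric] using A(2)[OF _ x c, of m] by simp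
      also have "g c x - (\<Sum>s<m. (x s - y s) * (a (Inr s) x * g c x)) - (x (m + i) - r) * (a (Inr m) x * g c x) =
        (1 - ((\<Sum>s<m. (x s - y s) * a (Inr s) x) + (x (m + i) - r) * a (Inr m) x)) * g c x"
        by (simp add: algebra_simps sum_distrib_left)
      also have "\<dots> = 0" using one[OF x] by simp
      finally show "(\<Sum>b<q. (E0 c b x - x (m + i) * A m c b x) * g b x) = 0" .
    qed
  qed
  from minimal_remainder[OF F(1-3) PPD this] obtain \<kappa> where "D y = F y * \<kappa> y" using F(4) by auto
  hence "poly (D y) r = 0" using root by simp
  moreover have "mat q q (\<lambda>(c,b). E0 c b y - r * A m c b y) = 1\<^sub>m q"
    by (rule eq_matI) (auto simp: E0_def)
  hence "poly (D y) r = 1" unfolding ev by simp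
  ultimately show False by simp
qed

text \<open>An element of least degree in the ideal of F and F' divides F up to a factor from the base, so by minimality of F
  it does not involve the last variable.\<close>

lemma generically_separable:
  assumes i: "i < L" and F: "minimal_degree i e" "upoly_fn m e F" "vanishes i F" "\<And>x. coeff (F x) e = 1"
  shows "\<exists>\<Delta>. poly_fn m \<Delta> \<and> (\<exists>x. \<Delta> x \<noteq> 0) \<and> (\<forall>x. \<Delta> x \<noteq> 0 \<longrightarrow> card {z. poly (F x) z = 0} = e)"
proof -
  have e: "0 < e" using F(1) unfolding minimal_degree_def by blast
  define J where "J Q \<longleftrightarrow> (\<exists>k A B. upoly_fn m k A \<and> upoly_fn m k B \<and> (\<forall>x. Q x = A x * F x + B x * pderiv (F x)))" for Q
  define R where "R k \<longleftrightarrow> (\<exists>Q. upoly_fn m k Q \<and> J Q \<and> (\<exists>x. Q x \<noteq> 0))" for k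
  have "R (e - 1)" unfolding R_def
  proof (intro exI conjI)
    show "upoly_fn m (e - 1) (\<lambda>x. pderiv (F x))" by (rule upoly_fn_pderiv[OF F(2)])
    show "J (\<lambda>x. pderiv (F x))" unfolding J_def
      by (rule exI[of _ 0], rule exI[of _ "\<lambda>_. 0"], rule exI[of _ "\<lambda>_. 1"])
        (use upoly_fn_C[OF poly_fn_const, of m 0 0] upoly_fn_C[OF poly_fn_const, of m 0 1] in \<open>simp add: one_pCons\<close>)
    have "coeff (pderiv (F (\<lambda>_. 0))) (e - 1) = of_nat e" using e F(4) by (simp add: coeff_pderiv)
    thus "pderiv (F (\<lambda>_. 0)) \<noteq> 0" using e by auto
  qed
  define k where "k = (LEAST k. R k)"
  have Rk: "R k" unfolding k_def by (rule LeastI[of R, OF \<open>R (e - 1)\<close>])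
  have ke: "k \<le> e - 1" unfolding k_def by (rule Least_le[of R, OF \<open>R (e - 1)\<close>])
  obtain Q x0 where Q: "upoly_fn m k Q" "J Q" "Q x0 \<noteq> 0" using Rk unfolding R_def by blast
  obtain kk A B where AB: "upoly_fn m kk A" "upoly_fn m kk B" "\<And>x. Q x = A x * F x + B x * pderiv (F x)" using Q(2) unfolding J_def by blast
  have k0: "k = 0"
  proof (rule ccontr)
    assume k0: "k \<noteq> 0"
    have less: "\<not> R (k - 1)" using not_less_Least[of "k - 1" R] k0 unfolding k_def[symmetric] by simp
    obtain M \<kappa> \<rho> where dv: "upoly_fn m (e - k) \<kappa>" "upoly_fn m (k - 1) \<rho>" "\<And>x. Polynomial.smult (coeff (Q x) k ^ M) (F x) = Q x * \<kappa> x + \<rho> x"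
      using upoly_fn_pseudo_div[OF Q(1) _ F(2)] k0 by blast
    define c where "c x = coeff (Q x) k ^ M" for x
    have c: "poly_fn m c" using Q(1) unfolding upoly_fn_def c_def by (intro poly_fn_power) blast
    have "J \<rho>" unfolding J_def
    proof (intro exI conjI allI)
      show "upoly_fn m (kk + (e - k)) (\<lambda>x. [:c x:] - A x * \<kappa> x)" "upoly_fn m (kk + (e - k)) (\<lambda>x. - (B x * \<kappa> x))"
        by (intro upoly_fn_diff upoly_fn_minus upoly_fn_C upoly_fn_mult c AB dv)+
      fix x
      have "\<rho> x = Polynomial.smult (c x) (F x) - Q x * \<kappa> x" using dv(3)[of x] by (simp add: c_def)
      also have "\<dots> = [:c x:] * F x - (A x * F x + B x * pderiv (F x)) * \<kappa> x" by (simp add: AB(3))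
      also have "\<dots> = ([:c x:] - A x * \<kappa> x) * F x + (- (B x * \<kappa> x)) * pderiv (F x)" by (simp add: algebra_simps)
      finally show "\<rho> x = ([:c x:] - A x * \<kappa> x) * F x + (- (B x * \<kappa> x)) * pderiv (F x)" .
    qed
    hence \<rho>: "\<rho> x = 0" for x using less dv(2) unfolding R_def by blast
    have eq: "Polynomial.smult (c x) (F x) = Q x * \<kappa> x" for x using dv(3)[of x] \<rho>[of x] by (simp add: c_def)
    have "vanishes i (\<lambda>x. Q x * \<kappa> x)" unfolding eq[symmetric] using F(3) by (simp add: vanishes_def)
    \<comment> \<open>One of the factors \<open>Q\<close> and \<open>\<kappa>\<close> is a relation,
      and both have degree below \<open>e\<close>, so it is 0.\<close>
    from vanishes_mult[OF Q(1) dv(1) i this] show False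
    proof
      assume "vanishes i Q"
      moreover have "upoly_fn m (e - 1) Q" by (rule upoly_fn_mono[OF Q(1) ke])
      ultimately show False using F(1) Q(3) unfolding minimal_degree_def by blast
    next
      assume "vanishes i \<kappa>"
      moreover have "upoly_fn m (e - 1) \<kappa>" by (rule upoly_fn_mono[OF dv(1)]) (use k0 in simp)
      ultimately have \<kappa>: "\<kappa> x = 0" for x using F(1) unfolding minimal_degree_def by blast
      have "coeff (Q x) k = 0" for x
      proof -
        have "F x \<noteq> 0" using F(4)[of x] by auto
        thus ?thesis using eq[of x] \<kappa>[of x] by (simp add: c_def)
      qed
      hence "upoly_fn m (k - 1) Q" using upoly_fn_degree_less[of m "k - 1" Q] Q(1) k0 by simp
      thus False using less Q(2,3) unfolding R_def by blast
    qed
  qed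
  define \<Delta> where "\<Delta> x = coeff (Q x) 0" for x
  have Qc: "Q x = [:\<Delta> x:]" for x
    using degree_0_id[of "Q x"] Q(1) k0 unfolding upoly_fn_def \<Delta>_def by simp
  show ?thesis
  proof (rule exI[of _ \<Delta>], intro conjI allI impI)
    show "poly_fn m \<Delta>" using Q(1) unfolding upoly_fn_def \<Delta>_def by blast
    show "\<exists>x. \<Delta> x \<noteq> 0" using Q(3) Qc[of x0] by auto
    fix x assume \<Delta>: "\<Delta> x \<noteq> 0"
    \<comment> \<open>A multiple root of \<open>F x\<close> would be a root of the nonzero constant
      \<open>\<Delta> x\<close>.\<close>
    have "rsquarefree (F x)" unfolding rsquarefree_roots
    proof (intro allI notI)
      fix a assume "poly (F x) a = 0 \<and> poly (pderiv (F x)) a = 0"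
      hence "poly (Q x) a = 0" using AB(3)[of x] by simp
      thus False using \<Delta> Qc[of x] by simp
    qed
    moreover have "degree (F x) = e"
      by (rule antisym) (use F(2) F(4)[of x] in \<open>auto simp: upoly_fn_def intro: le_degree\<close>)
    ultimately show "card {z. poly (F x) z = 0} = e" using card_roots_rsquarefree by blast
  qed
qed

text \<open>If d j0 exceeded D, the remaining equations would have a common zero z on the space y = 0; expressing the monic relation
  for a nonzero coordinate of z by the equations and comparing the powers of t at (0, t z) gives a contradiction.\<close>

theorem degree_bound:
  assumes rad: "\<And>F. poly_fn (m + L) F \<Longrightarrow> (\<forall>x\<in>X. F x = 0) \<Longrightarrow>
      \<exists>Q. (\<forall>j<L. poly_fn (m + L) (Q j)) \<and> (\<forall>x. F x = (\<Sum>j<L. Q j x * P j x))"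
    and G: "poly_fn m G" "G y0 \<noteq> 0"
    and fin: "\<And>y i. G y \<noteq> 0 \<Longrightarrow> i < L \<Longrightarrow>
      finite ((\<lambda>x. x (m + i)) ` {x\<in>X. \<forall>b<m. x b = y b}) \<and> card ((\<lambda>x. x (m + i)) ` {x\<in>X. \<forall>b<m. x b = y b}) \<le> D"
    and j0: "j0 < L"
  shows "d j0 \<le> D"
proof (rule ccontr)
  assume "\<not> d j0 \<le> D"
  hence dD: "D < d j0" by simp
  \<comment> \<open>Enumerates the indices other than \<open>j0\<close>. Without \<open>P j0\<close>
    there remain \<open>L - 1\<close> forms in the \<open>L\<close> fibre coordinates, one too few
    to exclude a nontrivial zero.\<close>
  define \<sigma> where "\<sigma> i = (if i < j0 then i else Suc i)" for i
  have \<sigma>: "\<sigma> i < L" if "i < L - 1" for i using that j0 by (auto simp: \<sigma>_def)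
  have \<sigma>s: "\<exists>i<L - 1. \<sigma> i = j" if "j < L" "j \<noteq> j0" for j
    using that j0 by (intro exI[of _ "if j < j0 then j else j - 1"]) (auto simp: \<sigma>_def)
  have L: "Suc (L - 1) = L" using j0 by simp
  have "\<exists>z. (\<exists>b\<le>L - 1. z b \<noteq> 0) \<and> (\<forall>i<L - 1. P (\<sigma> i) (\<lambda>l. if l < m then 0 else z (l - m)) = 0)"
  proof (rule forms_common_zero)
    fix i assume i: "i < L - 1"
    show "0 < d (\<sigma> i)" by (rule d[OF \<sigma>[OF i]])
    show "hom_form (Suc (L - 1)) (d (\<sigma> i)) (\<lambda>z. P (\<sigma> i) (\<lambda>l. if l < m then 0 else z (l - m)))"
    proof (rule hom_form_comp1[OF P[OF \<sigma>[OF i]]])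
      fix l assume "l < m + L"
      thus "hom_form (Suc (L - 1)) 1 (\<lambda>z. if l < m then 0 else z (l - m))"
        unfolding L by (cases "l < m") (auto intro: hom_form_zero hom_form_coord[simplified])
    qed
  qed
  then obtain z i where z: "i \<le> L - 1" "z i \<noteq> 0" "\<And>k. k < L - 1 \<Longrightarrow> P (\<sigma> k) (\<lambda>l. if l < m then 0 else z (l - m)) = 0" by blast
  define w where "w l = (if l < m then 0 else z (l - m))" for l
  have Pw: "P j w = 0" if "j < L" "j \<noteq> j0" for j using \<sigma>s[OF that] z(3) unfolding w_def by blast
  have i: "i < L" using z(1) j0 by simp
  obtain e F where F: "minimal_degree i e" "upoly_fn m e F" "vanishes i F" "\<And>x. coeff (F x) e = 1"
    using minimal_monic_relation[OF i] by blast
  obtain \<Delta> x0 where \<Delta>: "poly_fn m \<Delta>" "\<Delta> x0 \<noteq> 0" "\<And>x. \<Delta> x \<noteq> 0 \<Longrightarrow> card {z. poly (F x) z = 0} = e"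
    using generically_separable[OF i F] by blast
  \<comment> \<open>A base point over which the fibre is counted by \<open>fin\<close> and
    \<open>F\<close> has \<open>e\<close> distinct roots. All these roots are values of the
    coordinate on the fibre, hence \<open>e \<le> D\<close>.\<close>
  obtain y where y: "G y \<noteq> 0" "\<Delta> y \<noteq> 0"
    using deg_le_no_zero_divisors[of m _ G _ \<Delta> y0 x0] G \<Delta>(1,2) unfolding poly_fn_def by blast
  have "{z. poly (F y) z = 0} \<subseteq> (\<lambda>x. x (m + i)) ` {x\<in>X. \<forall>b<m. x b = y b}"
  proof
    fix r assume "r \<in> {z. poly (F y) z = 0}"
    hence "poly (F y) r = 0" by simp
    from root_realized[OF i F this] obtain x where "x \<in> X" "\<forall>b<m. x b = y b" "x (m + i) = r" by blast
    thus "r \<in> (\<lambda>x. x (m + i)) ` {x\<in>X. \<forall>b<m. x b = y b}" by (auto intro!: image_eqI[of _ _ x])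
  qed
  from card_mono[OF conjunct1[OF fin[OF y(1) i]] this] have eD: "e \<le> D"
    using conjunct2[OF fin[OF y(1) i]] \<Delta>(3)[OF y(2)] by simp
  have "poly_fn (m + L) (\<lambda>x. poly (F x) (x (m + i)))"
    by (rule upoly_fn_poly[OF F(2)]) (use i in \<open>auto intro: poly_fn_coord\<close>)
  from rad[OF this] F(3) obtain Q where Q: "\<And>j. j < L \<Longrightarrow> poly_fn (m + L) (Q j)"
    "\<And>x. poly (F x) (x (m + i)) = (\<Sum>j<L. Q j x * P j x)" unfolding vanishes_def by blast
  obtain tq where "deg_le (m + L) tq (Q j0)" using Q(1)[OF j0] unfolding poly_fn_def by blast
  then obtain r where r: "\<And>t. Q j0 (\<lambda>l. 0 + t * w l) = poly r t" using deg_le_line[of "m + L" tq "Q j0" "\<lambda>_. 0" w] by blast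
  have F0: "F (\<lambda>l. t * w l) = F (\<lambda>_. 0)" for t
  proof (rule poly_eqI)
    fix l
    obtain tl where "deg_le m tl (\<lambda>x. coeff (F x) l)" using F(2) unfolding upoly_fn_def poly_fn_def by blast
    from deg_le_cong[OF this, of "\<lambda>l. t * w l" "\<lambda>_. 0"] show "coeff (F (\<lambda>l. t * w l)) l = coeff (F (\<lambda>_. 0)) l"
      by (simp add: w_def)
  qed
  have "poly (pcompose (F (\<lambda>_. 0)) [:0, z i:]) t = poly (monom (P j0 w) (d j0) * r) t" for t
  proof -
    have "poly (pcompose (F (\<lambda>_. 0)) [:0, z i:]) t = poly (F (\<lambda>l. t * w l)) (t * w (m + i))"
      unfolding F0 by (simp add: poly_pcompose w_def)
    also have "\<dots> = (\<Sum>j<L. Q j (\<lambda>l. t * w l) * P j (\<lambda>l. t * w l))" by (rule Q(2))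
    also have "\<dots> = (\<Sum>j<L. if j = j0 then poly r t * (t ^ d j0 * P j0 w) else 0)"
      by (intro sum.cong refl) (use hom_form_scale[OF P] Pw r[of t] in auto)
    also have "\<dots> = poly (monom (P j0 w) (d j0) * r) t" using j0 by (simp add: poly_monom)
    finally show ?thesis .
  qed
  hence "pcompose (F (\<lambda>_. 0)) [:0, z i:] = monom (P j0 w) (d j0) * r" using poly_eq_poly_eq_iff by blast
  \<comment> \<open>The left side is \<open>z i ^ e\<close>, as \<open>F\<close> is monic; on the
    right only powers from \<open>d j0\<close> on occur, and \<open>e\<close> is smaller.\<close>
  hence "coeff (pcompose (F (\<lambda>_. 0)) [:0, z i:]) e = coeff (monom (P j0 w) (d j0) * r) e" by simp
  thus False using F(4) z(2) dD eD by (simp add: coeff_pcompose_linear coeff_monom_mult)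
qed

end

section \<open>Complete intersections\<close>

lemma total_deg_homogeneous:
  assumes "p \<noteq> 0" "\<And>m. m \<in> Poly_Mapping.keys p \<Longrightarrow> mon_deg m = e"
  shows "total_deg p = e"
proof -
  have "Poly_Mapping.keys p \<noteq> {}" using assms(1) by simp
  then obtain m where "m \<in> Poly_Mapping.keys p" by blast
  hence "mon_deg ` Poly_Mapping.keys p = {e}" using assms(2) by (auto intro!: image_eqI[of _ _ m])
  thus ?thesis by (simp add: total_deg_def)
qed

lemma keys_const_mult: "Poly_Mapping.keys (const c * p) \<subseteq> Poly_Mapping.keys p"
  using keys_mult[of "const c" p] by (auto simp: const_def split: if_splits)

lemma unit_combination: "j < (L::nat) \<Longrightarrow> (\<Sum>i<L. const (if i = j then 1 else 0) * P i) = P j"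
proof (rule peval_inject)
  fix x assume "j < L"
  have "peval x (\<Sum>i<L. const (if i = j then 1 else 0) * P i) = (\<Sum>i<L. if i = j then peval x (P j) else 0)"
    unfolding peval_sum by (intro sum.cong refl) auto
  thus "peval x (\<Sum>i<L. const (if i = j then 1 else 0) * P i) = peval x (P j)" using \<open>j < L\<close> by simp
qed

lemma const_cpolys: "const c \<in> cpolys A"
  by (auto simp: cpolys_def const_def split: if_splits)

lemma family_member_degree:
  assumes "family_has_rank L P" "j < L"
  shows "P j \<noteq> 0" "2 \<le> total_deg (P j)"
proof -
  have "(\<Sum>i<L. const (if i = j then 1 else 0) * P i) \<in> nontrivial_combinations L P"
    unfolding nontrivial_combinations_def using assms(2)
    by (intro CollectI exI[of _ "\<lambda>i. if i = j then 1 else 0"]) auto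
  hence "P j \<in> nontrivial_combinations L P" by (simp only: unit_combination[OF assms(2)])
  thus "P j \<noteq> 0" "2 \<le> total_deg (P j)" using assms(1) unfolding family_has_rank_def by blast+
qed

text \<open>Summands with a zero factor are dropped, because the rank of a polynomial is defined
  with factors of positive degree and 0 counts as degree 0.\<close>

lemma poly_rank_lowrank:
  assumes "lowrank n E B (\<lambda>x. peval x p)" "total_deg p = E"
  shows "poly_rank n p \<le> enat B"
proof -
  obtain r A G where r: "r \<le> B" and AG: "\<And>l. l < r \<Longrightarrow> \<exists>a b. a > 0 \<and> b > 0 \<and> a + b = E \<and> hom_form n a (A l) \<and> hom_form n b (G l)"
    and p: "\<And>x. peval x p = (\<Sum>l<r. A l x * G l x)" using assms(1) unfolding lowrank_def by blast
  have "\<exists>A' G'. (A' \<in> cpolys {..<n} \<and> G' \<in> cpolys {..<n} \<and> (A' \<noteq> 0 \<longrightarrow> G' \<noteq> 0 \<longrightarrow>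
      0 < total_deg A' \<and> 0 < total_deg G' \<and> total_deg A' + total_deg G' \<le> E)) \<and>
      (\<forall>x. peval x A' = A l x \<and> peval x G' = G l x)" if l: "l < r" for l
  proof -
    obtain a b where ab: "a > 0" "b > 0" "a + b = E" "hom_form n a (A l)" "hom_form n b (G l)" using AG[OF l] by blast
    obtain A' where A': "A' \<in> cpolys {..<n}" "\<forall>m\<in>Poly_Mapping.keys A'. mon_deg m = a" "\<forall>x. peval x A' = A l x"
      using hom_form_cpolys[OF ab(4)] by blast
    obtain G' where G': "G' \<in> cpolys {..<n}" "\<forall>m\<in>Poly_Mapping.keys G'. mon_deg m = b" "\<forall>x. peval x G' = G l x"
      using hom_form_cpolys[OF ab(5)] by blast
    show ?thesis
      by (rule exI[of _ A'], rule exI[of _ G'])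
        (use A' G' ab total_deg_homogeneous[of A' a] total_deg_homogeneous[of G' b] in auto)
  qed
  hence "\<forall>l. \<exists>A' G'. l < r \<longrightarrow> (A' \<in> cpolys {..<n} \<and> G' \<in> cpolys {..<n} \<and> (A' \<noteq> 0 \<longrightarrow> G' \<noteq> 0 \<longrightarrow>
      0 < total_deg A' \<and> 0 < total_deg G' \<and> total_deg A' + total_deg G' \<le> E)) \<and>
      (\<forall>x. peval x A' = A l x \<and> peval x G' = G l x)" by blast
  then obtain A' where "\<forall>l. \<exists>G'. l < r \<longrightarrow> (A' l \<in> cpolys {..<n} \<and> G' \<in> cpolys {..<n} \<and> (A' l \<noteq> 0 \<longrightarrow> G' \<noteq> 0 \<longrightarrow>
      0 < total_deg (A' l) \<and> 0 < total_deg G' \<and> total_deg (A' l) + total_deg G' \<le> E)) \<and>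
      (\<forall>x. peval x (A' l) = A l x \<and> peval x G' = G l x)" by (rule choice[THEN exE])
  then obtain G' where "\<forall>l. l < r \<longrightarrow> (A' l \<in> cpolys {..<n} \<and> G' l \<in> cpolys {..<n} \<and> (A' l \<noteq> 0 \<longrightarrow> G' l \<noteq> 0 \<longrightarrow>
      0 < total_deg (A' l) \<and> 0 < total_deg (G' l) \<and> total_deg (A' l) + total_deg (G' l) \<le> E)) \<and>
      (\<forall>x. peval x (A' l) = A l x \<and> peval x (G' l) = G l x)" by (rule choice[THEN exE])
  note AG' = this[rule_format]
  have peq: "p = (\<Sum>l<r. A' l * G' l)"
    by (rule peval_inject) (use AG' in \<open>simp add: p\<close>)
  define I where "I = {l. l < r \<and> A' l \<noteq> 0 \<and> G' l \<noteq> 0}"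
  have I: "finite I" "card I \<le> r" using card_mono[of "{..<r}" I] by (auto simp: I_def)
  obtain h where h: "bij_betw h {..<card I} I" using ex_bij_betw_nat_finite[OF I(1)] by (auto simp: atLeast0LessThan)
  have "p = (\<Sum>l\<in>I. A' l * G' l)" unfolding peq by (rule sum.mono_neutral_right) (auto simp: I_def)
  also have "\<dots> = (\<Sum>k<card I. A' (h k) * G' (h k))" by (rule sum.reindex_bij_betw[OF h, symmetric])
  finally have eq: "p = (\<Sum>k<card I. A' (h k) * G' (h k))" .
  have hI: "h k \<in> I" if "k < card I" for k using h that by (auto simp: bij_betw_def)
  have "enat (card I) \<in> {enat r | r. \<exists>l R. (\<forall>i<r. l i \<in> cpolys {..<n} \<and> R i \<in> cpolys {..<n} \<and>
        total_deg (l i) > 0 \<and> total_deg (R i) > 0 \<and> total_deg (l i) + total_deg (R i) \<le> total_deg p) \<and>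
     p = (\<Sum>i<r. l i * R i)}"
  proof (intro CollectI exI conjI allI impI)
    show "enat (card I) = enat (card I)" ..
    show "p = (\<Sum>k<card I. A' (h k) * G' (h k))" by (rule eq)
  qed (use AG' hI assms(2) in \<open>auto simp: I_def\<close>)
  hence "poly_rank n p \<le> enat (card I)" unfolding poly_rank_def by (rule Inf_lower)
  also have "\<dots> \<le> enat B" using I(2) r by simp
  finally show ?thesis .
qed

text \<open>Giving coefficient 0 to the members of other degrees turns a combination in one degree
  \<open>E\<close> into one of the nontrivial combinations of the family. It is a nonzero form of
  degree \<open>E\<close>, so a decomposition of it bounds the rank of the family.\<close>

lemma family_rank_high_rank:
  assumes P: "\<And>j. j < L \<Longrightarrow> P j \<in> cpolys {..<n}" "\<And>j m. j < L \<Longrightarrow> m \<in> Poly_Mapping.keys (P j) \<Longrightarrow> mon_deg m = d j"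
    and rank: "family_has_rank L P" "family_rank n L P > enat r"
  shows "high_rank n {..<L} d (\<lambda>j x. peval x (P j)) r"
  unfolding high_rank_alt[OF finite_lessThan]
proof (intro allI impI notI)
  fix E and c :: "nat \<Rightarrow> complex"
  assume ex: "\<exists>i\<in>{..<L}. d i = E \<and> c i \<noteq> 0"
    and low: "lowrank n E r (\<lambda>x. \<Sum>i<L. if d i = E then c i * peval x (P i) else 0)"
  define Q where "Q = (\<Sum>i<L. const (if d i = E then c i else 0) * P i)"
  have Q: "Q \<in> nontrivial_combinations L P"
    unfolding nontrivial_combinations_def Q_def using ex
    by (intro CollectI exI[of _ "\<lambda>i. if d i = E then c i else 0"]) auto
  have pQ: "peval x Q = (\<Sum>i<L. if d i = E then c i * peval x (P i) else 0)" for x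
    unfolding Q_def peval_sum by (intro sum.cong refl) auto
  have keysQ: "mon_deg m = E" if "m \<in> Poly_Mapping.keys Q" for m
  proof -
    have "Poly_Mapping.keys Q \<subseteq> (\<Union>i<L. Poly_Mapping.keys (const (if d i = E then c i else 0) * P i))"
      unfolding Q_def by (rule keys_sum)
    with that have "\<exists>i<L. m \<in> Poly_Mapping.keys (const (if d i = E then c i else 0) * P i)" by blast
    then obtain i where i: "i < L" "m \<in> Poly_Mapping.keys (const (if d i = E then c i else 0) * P i)" by blast
    have "d i = E" using i(2) by (auto simp: const_def split: if_splits)
    moreover have "m \<in> Poly_Mapping.keys (P i)" using i(2) keys_const_mult by blast
    ultimately show ?thesis using P(2)[OF i(1)] by simp
  qed
  have "total_deg Q = E" by (rule total_deg_homogeneous) (use rank(1) Q keysQ in \<open>auto simp: family_has_rank_def\<close>)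
  hence "poly_rank n Q \<le> enat r" using low by (intro poly_rank_lowrank[of n E]) (simp_all add: pQ)
  moreover have "family_rank n L P \<le> poly_rank n Q" unfolding family_rank_def using Q by (intro Inf_lower) blast
  ultimately show False using rank(2) by (metis leD order_trans)
qed

lemma generated_ideal_zero: "p \<in> generated_ideal n L P \<Longrightarrow> (\<And>j. j < L \<Longrightarrow> peval x (P j) = 0) \<Longrightarrow> peval x p = 0"
  unfolding generated_ideal_def by auto

text \<open>A closed set is the zero set of its vanishing ideal, which here is generated by the
  \<open>P j\<close>.\<close>

lemma hci_zero_set:
  assumes "homogeneous_complete_intersection n L P X"
  shows "X = zero_set n L (\<lambda>j x. peval x (P j))"
proof -
  have ideal: "vanishing_ideal n X = generated_ideal n L P" and cl: "zariski_closed n X"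
    using assms by (auto simp: homogeneous_complete_intersection_def irreducible_closed_def)
  obtain S where S: "S \<subseteq> cpolys {..<n}" "X = {x\<in>coord_space n. \<forall>p\<in>S. peval x p = 0}" using cl unfolding zariski_closed_def by blast
  show ?thesis
  proof (intro subset_antisym subsetI)
    fix x assume x: "x \<in> X"
    have "peval x (P j) = 0" if "j < L" for j
    proof -
      have "P j \<in> generated_ideal n L P" unfolding generated_ideal_def
        by (rule CollectI, rule exI[of _ "\<lambda>i. const (if i = j then 1 else 0)"])
          (simp add: unit_combination[OF that] const_cpolys)
      hence "P j \<in> vanishing_ideal n X" using ideal by simp
      thus ?thesis using x unfolding vanishing_ideal_def by blast
    qed
    thus "x \<in> zero_set n L (\<lambda>j x. peval x (P j))" using x S by (auto simp: zero_set_def)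
  next
    fix x assume x: "x \<in> zero_set n L (\<lambda>j x. peval x (P j))"
    have "peval x p = 0" if "p \<in> S" for p
    proof (rule generated_ideal_zero)
      have "p \<in> vanishing_ideal n X" using that S unfolding vanishing_ideal_def by blast
      thus "p \<in> generated_ideal n L P" using ideal by simp
    qed (use x in \<open>auto simp: zero_set_def\<close>)
    thus "x \<in> X" using x S(2) by (auto simp: zero_set_def)
  qed
qed

lemma poly_fn_cpolys: "poly_fn n F \<Longrightarrow> \<exists>p\<in>cpolys {..<n}. \<forall>x. peval x p = F x"
  unfolding poly_fn_def using deg_le_cpolys by blast

text \<open>If a product vanishes on X, then X is the union of the two closed subsets on which one
  of the factors vanishes.\<close>

lemma hci_prime:
  assumes "homogeneous_complete_intersection n L P X" "poly_fn n F" "poly_fn n H" "\<And>x. x \<in> X \<Longrightarrow> F x * H x = 0"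
  shows "(\<forall>x\<in>X. F x = 0) \<or> (\<forall>x\<in>X. H x = 0)"
proof -
  have irr: "irreducible_closed n X" using assms(1) by (simp add: homogeneous_complete_intersection_def)
  then obtain S where S: "S \<subseteq> cpolys {..<n}" "X = {x\<in>coord_space n. \<forall>p\<in>S. peval x p = 0}"
    unfolding irreducible_closed_def zariski_closed_def by blast
  obtain f where f: "f \<in> cpolys {..<n}" "\<And>x. peval x f = F x" using poly_fn_cpolys[OF assms(2)] by blast
  obtain h where h: "h \<in> cpolys {..<n}" "\<And>x. peval x h = H x" using poly_fn_cpolys[OF assms(3)] by blast
  define Z where "Z q = {x\<in>coord_space n. \<forall>p\<in>insert q S. peval x p = 0}" for q
  have "zariski_closed n (Z q)" if "q \<in> cpolys {..<n}" for q
    unfolding zariski_closed_def Z_def using S(1) that by (intro exI[of _ "insert q S"]) auto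
  moreover have "X = Z f \<union> Z h" using assms(4) by (auto simp: S(2) Z_def f h)
  ultimately have "X = Z f \<or> X = Z h" using irr f(1) h(1) unfolding irreducible_closed_def by blast
  thus ?thesis using f(2) h(2) by (auto simp: Z_def)
qed

lemma hci_radical:
  assumes "homogeneous_complete_intersection n L P X" "poly_fn n F" "\<And>x. x \<in> X \<Longrightarrow> F x = 0"
  shows "\<exists>Q. (\<forall>j<L. poly_fn n (Q j)) \<and> (\<forall>x. F x = (\<Sum>j<L. Q j x * peval x (P j)))"
proof -
  have ideal: "vanishing_ideal n X = generated_ideal n L P"
    using assms by (auto simp: homogeneous_complete_intersection_def)
  obtain f where f: "f \<in> cpolys {..<n}" "\<And>x. peval x f = F x" using poly_fn_cpolys[OF assms(2)] by blast
  have "f \<in> vanishing_ideal n X" using f assms(3) by (simp add: vanishing_ideal_def)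
  then obtain Q where Q: "f = (\<Sum>j<L. Q j * P j)" "\<And>j. j < L \<Longrightarrow> Q j \<in> cpolys {..<n}"
    unfolding ideal generated_ideal_def by blast
  have "poly_fn n (\<lambda>x. peval x (Q j))" if "j < L" for j using cpolys_deg_le[OF Q(2)[OF that]] by (simp add: poly_fn_def)
  moreover have "F x = (\<Sum>j<L. peval x (Q j) * peval x (P j))" for x using f(2)[of x] Q(1) by simp
  ultimately show ?thesis by (intro exI[of _ "\<lambda>j x. peval x (Q j)"]) blast
qed

lemma poly_fn_peval:
  assumes "G \<in> cpolys A" "\<And>v. v \<in> A \<Longrightarrow> poly_fn n (\<lambda>x. u x v)"
  shows "poly_fn n (\<lambda>x. peval (u x) G)"
  unfolding peval_def
  by (intro poly_fn_sum poly_fn_mult poly_fn_const poly_fn_prod poly_fn_power assms(2)) (use assms(1) in \<open>auto simp: cpolys_def\<close>)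

lemma peval_cong:
  assumes "G \<in> cpolys A" "\<And>v. v \<in> A \<Longrightarrow> x v = y v"
  shows "peval x G = peval y G"
  unfolding peval_def
  by (intro sum.cong prod.cong refl arg_cong2[where f = "(*)"] arg_cong2[where f = "(^)"] assms(2))
    (use assms(1) in \<open>auto simp: cpolys_def\<close>)

section \<open>Coordinates adapted to a linear projection\<close>

text \<open>Independence of an indexed family, so that repetitions count as dependent.\<close>

definition fam_indep :: "nat \<Rightarrow> (nat \<Rightarrow> cvec) \<Rightarrow> bool" where
  "fam_indep k w \<longleftrightarrow> (\<forall>a. (\<forall>i. (\<Sum>j<k. a j * w j i) = 0) \<longrightarrow> (\<forall>j<k. a j = 0))"

lemma fam_indepD: "fam_indep k w \<Longrightarrow> (\<And>i. (\<Sum>j<k. a j * w j i) = 0) \<Longrightarrow> j < k \<Longrightarrow> a j = 0"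
  unfolding fam_indep_def by blast

lemma cvec_sum_apply: "(\<Sum>j\<in>I. f j) i = (\<Sum>j\<in>I. (f j i :: complex))" for f :: "'a \<Rightarrow> cvec"
  by (induction I rule: infinite_finite_induct) auto

lemma fam_indep_iff: "fam_indep k w \<longleftrightarrow> inj_on w {..<k} \<and> cvec.independent (w ` {..<k})"
proof
  assume F: "fam_indep k w"
  have inj: "inj_on w {..<k}"
  proof (rule inj_onI, rule ccontr)
    fix i j assume ij: "i \<in> {..<k}" "j \<in> {..<k}" "w i = w j" "i \<noteq> j"
    define a :: "nat \<Rightarrow> complex" where "a l = (if l = i then 1 else 0) - (if l = j then 1 else 0)" for l
    have "(\<Sum>l<k. a l * w l t) = 0" for t
    proof -
      have "(\<Sum>l<k. a l * w l t) = (\<Sum>l<k. if l = i then w i t else 0) - (\<Sum>l<k. if l = j then w j t else 0)"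
        unfolding sum_subtractf[symmetric] by (intro sum.cong refl) (auto simp: a_def)
      thus ?thesis using ij by simp
    qed
    from fam_indepD[OF F this] ij(1) have "a i = 0" by simp
    thus False using ij(4) by (simp add: a_def)
  qed
  moreover have "cvec.independent (w ` {..<k})"
  proof (subst cvec.dependent_finite)
    show "\<not> (\<exists>u. (\<exists>v\<in>w ` {..<k}. u v \<noteq> 0) \<and> (\<Sum>v\<in>w ` {..<k}. cscale (u v) v) = 0)"
    proof (intro notI, elim exE conjE)
      fix u assume u: "\<exists>v\<in>w ` {..<k}. u v \<noteq> 0" "(\<Sum>v\<in>w ` {..<k}. cscale (u v) v) = 0"
      have "(\<Sum>j<k. u (w j) * w j i) = 0" for i
        using fun_cong[OF u(2), of i] by (simp add: sum.reindex[OF inj] cvec_sum_apply cscale_def)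
      hence "u (w j) = 0" if "j < k" for j by (rule fam_indepD[OF F, of "\<lambda>j. u (w j)"]) (rule that)
      thus False using u(1) by auto
    qed
  qed simp
  ultimately show "inj_on w {..<k} \<and> cvec.independent (w ` {..<k})" by blast
next
  assume *: "inj_on w {..<k} \<and> cvec.independent (w ` {..<k})"
  show "fam_indep k w" unfolding fam_indep_def
  proof (intro allI impI)
    fix a j assume a: "\<forall>i. (\<Sum>j<k. a j * w j i) = 0" and j: "j < k"
    define u where "u v = a (the_inv_into {..<k} w v)" for v
    have u: "u (w j) = a j" if "j < k" for j using that * by (simp add: u_def the_inv_into_f_f)
    have "(\<Sum>v\<in>w ` {..<k}. cscale (u v) v) = 0"
    proof
      fix i
      have "(\<Sum>v\<in>w ` {..<k}. cscale (u v) v) i = (\<Sum>j<k. a j * w j i)"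
        using * u by (simp add: sum.reindex cvec_sum_apply cscale_def)
      thus "(\<Sum>v\<in>w ` {..<k}. cscale (u v) v) i = 0 i" using a by simp
    qed
    hence "u (w j) = 0" using * j cvec.dependent_finite[of "w ` {..<k}"] by blast
    thus "a j = 0" using u[OF j] by simp
  qed
qed

lemma fam_indep_dim:
  assumes "cvec.dim (cvec.span (w ` {..<k})) = k"
  shows "fam_indep k w"
proof -
  obtain B where B: "B \<subseteq> w ` {..<k}" "cvec.independent B" "w ` {..<k} \<subseteq> cvec.span B" "card B = cvec.dim (w ` {..<k})"
    using cvec.basis_exists[of "w ` {..<k}"] by blast
  have "card B = k" using B(4) assms by (simp add: cvec.dim_span)
  moreover have "card (w ` {..<k}) \<le> k" using card_image_le[of "{..<k}" w] by simp
  ultimately have "B = w ` {..<k}" using B(1) by (intro card_seteq) auto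
  hence "card (w ` {..<k}) = card {..<k}" using \<open>card B = k\<close> by simp
  hence "inj_on w {..<k}" by (intro eq_card_imp_inj_on) auto
  thus ?thesis unfolding fam_indep_iff using B(2) \<open>B = w ` {..<k}\<close> by simp
qed

definition std_vec :: "nat \<Rightarrow> cvec" where
  "std_vec i = (\<lambda>l. if l = i then 1 else 0)"

lemma coord_space_expand:
  assumes "x \<in> coord_space n"
  shows "x = (\<Sum>i<n. cscale (x i) (std_vec i))"
proof
  fix l
  have "(\<Sum>i<n. cscale (x i) (std_vec i)) l = (\<Sum>i<n. if i = l then x l else 0)"
    unfolding cvec_sum_apply by (intro sum.cong refl) (auto simp: cscale_def std_vec_def)
  thus "x l = (\<Sum>i<n. cscale (x i) (std_vec i)) l" using assms by (auto simp: coord_space_def)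
qed

lemma coord_space_sum: "(\<And>j. j \<in> I \<Longrightarrow> w j \<in> coord_space n) \<Longrightarrow> (\<lambda>i. \<Sum>j\<in>I. a j * w j i) \<in> coord_space n"
  by (auto simp: coord_space_def intro!: sum.neutral)

text \<open>\<open>b\<close> extends the family to a basis and \<open>\<kappa> l\<close> is the l-th
  dual coordinate functional. Both inverse relations are written as sums, which makes the change of
  coordinates a polynomial substitution in either direction.\<close>

lemma basis_coordinates:
  assumes w: "\<And>j. j < k \<Longrightarrow> w j \<in> coord_space n" and indep: "fam_indep k w"
  shows "\<exists>b \<kappa>. k \<le> n \<and> (\<forall>l<n. b l \<in> coord_space n) \<and> (\<forall>j<k. b j = w j) \<and>
    (\<forall>x\<in>coord_space n. \<forall>i. x i = (\<Sum>l<n. (\<Sum>i<n. x i * \<kappa> l i) * b l i)) \<and>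
    (\<forall>y. \<forall>l<n. (\<Sum>i<n. (\<Sum>l<n. y l * b l i) * \<kappa> l i) = y l)"
proof -
  define S where "S = w ` {..<k}"
  define E where "E = std_vec ` {..<n}"
  have S: "S \<subseteq> coord_space n" "cvec.independent S" "inj_on w {..<k}" using w indep by (auto simp: S_def fam_indep_iff)
  have E: "E \<subseteq> coord_space n" "finite E" by (auto simp: E_def coord_space_def std_vec_def)
  have VE: "coord_space n \<subseteq> cvec.span E"
  proof
    fix x assume "x \<in> coord_space n"
    from coord_space_expand[OF this] show "x \<in> cvec.span E"
      by (metis (no_types, lifting) E_def cvec.span_base cvec.span_scale cvec.span_sum image_eqI)
  qed
  have iE: "fam_indep n std_vec" unfolding fam_indep_def
  proof (intro allI impI)
    fix a j assume a: "\<forall>i. (\<Sum>j<n. a j * std_vec j i) = 0" and j: "j < n"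
    have "(\<Sum>l<n. a l * std_vec l j) = (\<Sum>l<n. if l = j then a j else 0)" by (intro sum.cong refl) (auto simp: std_vec_def)
    thus "a j = 0" using a j by simp
  qed
  obtain B where B: "S \<subseteq> B" "B \<subseteq> coord_space n" "cvec.independent B" "coord_space n \<subseteq> cvec.span B"
    using cvec.maximal_independent_subset_extend[OF S(1,2)] by blast
  have fB: "finite B" using cvec.independent_span_bound[OF E(2) B(3)] B(2) VE by blast
  have cB: "card B = n"
  proof -
    have "card B = cvec.dim (coord_space n)" by (rule cvec.basis_card_eq_dim[OF B(2,4,3)])
    also have "\<dots> = card E" by (rule cvec.basis_card_eq_dim[OF E(1) VE, symmetric]) (use iE in \<open>simp add: E_def fam_indep_iff\<close>)
    also have "\<dots> = n" using iE by (simp add: E_def fam_indep_iff card_image)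
    finally show ?thesis .
  qed
  have cS: "card S = k" using S(3) by (simp add: S_def card_image)
  have kn: "k \<le> n" using card_mono[OF fB B(1)] cS cB by simp
  have "card {k..<n} = card (B - S)" using card_Diff_subset[OF _ B(1)] finite_subset[OF B(1) fB] cS cB by simp
  then obtain h where h: "bij_betw h {k..<n} (B - S)" using finite_same_card_bij[of "{k..<n}" "B - S"] fB by auto
  define b where "b l = (if l < k then w l else h l)" for l
  have bS: "bij_betw b {..<k} S" unfolding bij_betw_def S_def using S(3) by (auto simp: b_def inj_on_def)
  have bh: "bij_betw b {k..<n} (B - S)" using h by (subst bij_betw_cong[of _ _ h]) (auto simp: b_def)
  have "bij_betw b ({..<k} \<union> {k..<n}) (S \<union> (B - S))" by (rule bij_betw_combine[OF bS bh]) auto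
  moreover have "{..<k} \<union> {k..<n} = {..<n}" using kn by auto
  moreover have "S \<union> (B - S) = B" using B(1) by blast
  ultimately have bB: "bij_betw b {..<n} B" by simp
  have bind: "fam_indep n b" unfolding fam_indep_iff using bB B(3) by (auto simp: bij_betw_def)
  have bc: "b l \<in> coord_space n" if "l < n" for l using bB B(2) that by (auto simp: bij_betw_def)
  define \<kappa> where "\<kappa> l i = cvec.representation B (std_vec i) (b l)" for l i
  have usp: "std_vec i \<in> cvec.span B" if "i < n" for i using that E(1) B(4) by (auto simp: E_def)
  have rep: "cvec.representation B x (b l) = (\<Sum>i<n. x i * \<kappa> l i)" if "x \<in> coord_space n" for x l
  proof -
    have "cvec.representation B x (b l) = cvec.representation B (\<Sum>i<n. cscale (x i) (std_vec i)) (b l)"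
      using coord_space_expand[OF that] by simp
    also have "\<dots> = (\<Sum>i<n. cvec.representation B (cscale (x i) (std_vec i)) (b l))"
      by (subst cvec.representation_sum[OF B(3)]) (auto intro!: cvec.span_scale usp)
    also have "\<dots> = (\<Sum>i<n. x i * \<kappa> l i)"
      by (intro sum.cong refl) (use usp in \<open>auto simp: cvec.representation_scale[OF B(3)] \<kappa>_def\<close>)
    finally show ?thesis .
  qed
  have 1: "x i = (\<Sum>l<n. (\<Sum>i<n. x i * \<kappa> l i) * b l i)" if x: "x \<in> coord_space n" for x i
  proof -
    have "x = (\<Sum>v\<in>B. cscale (cvec.representation B x v) v)"
      by (rule cvec.sum_representation_eq[symmetric, OF B(3) _ fB]) (use x B(4) in auto)
    also have "\<dots> = (\<Sum>l<n. cscale (cvec.representation B x (b l)) (b l))"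
      by (rule sum.reindex_bij_betw[OF bB, symmetric])
    finally have "x = (\<Sum>l<n. cscale (\<Sum>i<n. x i * \<kappa> l i) (b l))" unfolding rep[OF x] .
    from fun_cong[OF this, of i] show ?thesis by (simp add: cvec_sum_apply cscale_def)
  qed
  have 2: "(\<Sum>i<n. (\<Sum>l<n. y l * b l i) * \<kappa> l i) = y l" if "l < n" for y l
  proof -
    define x where "x = (\<lambda>i. \<Sum>l<n. y l * b l i)"
    have x: "x \<in> coord_space n" unfolding x_def by (rule coord_space_sum) (use bc in auto)
    have "(\<Sum>l<n. ((\<Sum>i<n. x i * \<kappa> l i) - y l) * b l i) = 0" for i
      using 1[OF x, of i] by (simp add: left_diff_distrib sum_subtractf) (simp add: x_def)
    from fam_indepD[OF bind this that] have "(\<Sum>i<n. x i * \<kappa> l i) - y l = 0" .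
    thus ?thesis by (simp add: x_def)
  qed
  show ?thesis
    by (rule exI[of _ b], rule exI[of _ \<kappa>]) (use kn bc 1 2 in \<open>auto simp: b_def\<close>)
qed

lemma lincomb_span: "(\<lambda>i. \<Sum>j<k. c j * w j i) \<in> cvec.span (w ` {..<k})"
proof -
  have "(\<lambda>i. \<Sum>j<k. c j * w j i) = (\<Sum>j<k. cscale (c j) (w j))" by (rule ext) (simp add: cvec_sum_apply cscale_def)
  moreover have "(\<Sum>j<k. cscale (c j) (w j)) \<in> cvec.span (w ` {..<k})"
    by (intro cvec.span_sum cvec.span_scale cvec.span_base imageI)
  ultimately show ?thesis by simp
qed

lemma span_lincomb:
  assumes "x \<in> cvec.span (w ` {..<k})"
  shows "\<exists>c. x = (\<lambda>i. \<Sum>j<(k::nat). c j * w j i)"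
proof -
  define V where "V = {(\<lambda>i. \<Sum>j<k. c j * w j i) | c. True}"
  have V: "(\<lambda>i. \<Sum>j<k. c j * w j i) \<in> V" for c unfolding V_def by blast
  have "cvec.span (w ` {..<k}) \<subseteq> V"
  proof (rule cvec.span_minimal)
    show "w ` {..<k} \<subseteq> V"
    proof
      fix y assume "y \<in> w ` {..<k}"
      then obtain l where l: "l < k" "y = w l" by auto
      have "(\<Sum>j<k. (if j = l then 1 else 0) * w j i) = (\<Sum>j<k. if j = l then w l i else 0)" for i
        by (intro sum.cong refl) auto
      hence "y = (\<lambda>i. \<Sum>j<k. (if j = l then 1 else 0) * w j i)" using l by (intro ext) simp
      thus "y \<in> V" using V by simp
    qed
    show "cvec.subspace V" unfolding cvec.subspace_def
    proof (intro conjI ballI allI)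
      show "0 \<in> V" using V[of "\<lambda>_. 0"] by (simp add: zero_fun_def)
    next
      fix x y assume "x \<in> V" "y \<in> V"
      then obtain a b where "x = (\<lambda>i. \<Sum>j<k. a j * w j i)" "y = (\<lambda>i. \<Sum>j<k. b j * w j i)" unfolding V_def by blast
      hence "x + y = (\<lambda>i. \<Sum>j<k. (a j + b j) * w j i)" by (intro ext) (simp add: distrib_right sum.distrib)
      thus "x + y \<in> V" using V by simp
    next
      fix c x assume "x \<in> V"
      then obtain a where "x = (\<lambda>i. \<Sum>j<k. a j * w j i)" unfolding V_def by blast
      hence "cscale c x = (\<lambda>i. \<Sum>j<k. (c * a j) * w j i)" by (simp add: cscale_def sum_distrib_left mult.assoc)
      thus "cscale c x \<in> V" using V by simp
    qed
  qed
  thus ?thesis using assms unfolding V_def by blast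
qed

lemma span_single: "cvec.span {x} = {cscale c x | c. True}"
  by (auto simp: cvec.span_singleton)

lemma projective_pointI:
  assumes "x \<noteq> 0" "\<And>c. cscale c x \<in> Y"
  shows "cvec.span {x} \<in> projective_points Y"
proof -
  have "cvec.independent {x}" using assms(1) cvec.dependent_single by blast
  hence "cvec.dim (cvec.span {x}) = 1" using cvec.dim_eq_card_independent by (simp add: cvec.dim_span)
  moreover have "cvec.span {x} \<subseteq> Y" using assms(2) by (auto simp: span_single)
  ultimately show ?thesis unfolding projective_points_def by (simp add: cvec.subspace_span)
qed

lemma projective_point_nonzero:
  assumes "l \<in> projective_points Y"
  shows "\<exists>x\<in>l. x \<noteq> 0"
proof (rule ccontr)
  assume "\<not> ?thesis"
  hence "l \<subseteq> cvec.span {}" by auto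
  hence "cvec.dim l \<le> card ({} :: cvec set)" by (intro cvec.dim_le_card) auto
  thus False using assms by (simp add: projective_points_def)
qed

lemma poly_fn_common_nonzero:
  assumes "finite I" "\<And>i. i \<in> I \<Longrightarrow> poly_fn n (F i)" "\<And>i. i \<in> I \<Longrightarrow> \<exists>x. F i x \<noteq> 0"
  shows "\<exists>x. \<forall>i\<in>I. F i x \<noteq> 0"
proof -
  have "\<exists>x. (\<Prod>i\<in>I. F i x) \<noteq> 0" using assms
  proof (induction I rule: finite_induct)
    case (insert i I)
    have "poly_fn n (F i)" "poly_fn n (\<lambda>x. \<Prod>i\<in>I. F i x)" "\<exists>x. F i x \<noteq> 0" "\<exists>x. (\<Prod>i\<in>I. F i x) \<noteq> 0"
      using insert by (auto intro: poly_fn_prod)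
    hence "\<exists>x. F i x \<noteq> 0 \<and> (\<Prod>i\<in>I. F i x) \<noteq> 0" unfolding poly_fn_def using deg_le_no_zero_divisors by blast
    thus ?case using insert by simp
  qed simp
  thus ?thesis using assms(1) by simp
qed

lemma poly_fn_linear_comp:
  assumes "poly_fn n F"
  shows "poly_fn n (\<lambda>x. F (\<lambda>l. \<Sum>i<n. x i * M l i))"
proof -
  obtain t where t: "deg_le n t F" using assms unfolding poly_fn_def by blast
  have "deg_le n t (\<lambda>x. F (\<lambda>l. \<Sum>i<n. x i * M l i))"
    by (rule deg_le_comp1[OF t]) (intro deg_le_sum deg_le_cmult2 deg_le_coord, simp)
  thus ?thesis unfolding poly_fn_def by blast
qed

text \<open>A generic hyperplane avoids the finitely many lines.\<close>

lemma shift_subspace: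
  assumes indep: "fam_indep (Suc L) v" and G: "G \<in> cpolys ({..<L + 1} \<times> {..<n})"
    "peval (\<lambda>(j, i). v j i) G \<noteq> 0"
    and cone: "\<And>x c. x \<in> X \<Longrightarrow> cscale c x \<in> X"
    and fin: "finite (projective_points (X \<inter> cvec.span (v ` {..<Suc L})))"
  shows "\<exists>\<beta>. peval (\<lambda>(j, i). if j = 0 then v 0 i else v j i + \<beta> (j - 1) * v 0 i) G \<noteq> 0 \<and>
    (\<forall>z. (\<lambda>i. \<Sum>j<L. z j * (v (Suc j) i + \<beta> j * v 0 i)) \<in> X \<longrightarrow> (\<forall>j<L. z j = 0))"
proof -
  let ?W = "cvec.span (v ` {..<Suc L})"
  define LL where "LL = projective_points (X \<inter> ?W)"
  have "\<exists>a. (\<exists>j<Suc L. a j \<noteq> 0) \<and> (\<lambda>i. \<Sum>j<Suc L. a j * v j i) \<in> l" if l: "l \<in> LL" for l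
  proof -
    obtain x where x: "x \<in> l" "x \<noteq> 0" using projective_point_nonzero l unfolding LL_def by blast
    have "x \<in> ?W" using x(1) l unfolding LL_def projective_points_def by blast
    then obtain a where a: "x = (\<lambda>i. \<Sum>j<Suc L. a j * v j i)" using span_lincomb by blast
    have "\<exists>j<Suc L. a j \<noteq> 0"
    proof (rule ccontr)
      assume "\<not> ?thesis"
      hence "x = (\<lambda>i. 0)" unfolding a by (intro ext sum.neutral) auto
      thus False using x(2) by (simp add: zero_fun_def)
    qed
    thus ?thesis using x(1) a by blast
  qed
  then obtain a where a: "\<And>l. l \<in> LL \<Longrightarrow> \<exists>j<Suc L. a l j \<noteq> 0" "\<And>l. l \<in> LL \<Longrightarrow> (\<lambda>i. \<Sum>j<Suc L. a l j * v j i) \<in> l"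
    by metis
  \<comment> \<open>\<open>q l\<close> vanishes if the line \<open>l\<close>, represented by the
    coordinates \<open>a l\<close>, lies in the hyperplane spanned by the vectors
    \<open>v (Suc j) + \<beta> j v 0\<close>. The function \<open>g\<close> defined next ensures
    that the modified tuple remains generic.\<close>
  define q where "q l \<beta> = a l 0 - (\<Sum>j<L. \<beta> j * a l (Suc j))" for l and \<beta> :: cvec
  define g where "g \<beta> = peval (\<lambda>(j, i). if j = 0 then v 0 i else v j i + \<beta> (j - 1) * v 0 i) G" for \<beta> :: cvec
  have "poly_fn L g" unfolding g_def
  proof (rule poly_fn_peval[OF G(1)])
    fix ji :: "nat \<times> nat" assume "ji \<in> {..<L + 1} \<times> {..<n}"
    then obtain j i where ji: "ji = (j, i)" "j < L + 1" by auto
    show "poly_fn L (\<lambda>\<beta>. case ji of (j, i) \<Rightarrow> if j = 0 then v 0 i else v j i + \<beta> (j - 1) * v 0 i)"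
      using ji by (cases "j = 0") (auto intro!: poly_fn_const poly_fn_add poly_fn_mult poly_fn_coord)
  qed
  moreover have "g (\<lambda>_. 0) \<noteq> 0"
  proof -
    have "(\<lambda>(j, i). if j = 0 then v 0 i else v j i + 0 * v 0 i) = (\<lambda>(j, i). v j i)" by (auto simp: fun_eq_iff)
    thus ?thesis using G(2) by (simp add: g_def)
  qed
  moreover have qPF: "poly_fn L (q l)" for l unfolding q_def by (intro poly_fn_diff poly_fn_const poly_fn_sum poly_fn_mult poly_fn_coord) auto
  moreover have qnz: "\<exists>\<beta>. q l \<beta> \<noteq> 0" if l: "l \<in> LL" for l
  proof (cases "\<exists>j<L. a l (Suc j) \<noteq> 0")
    case True
    then obtain j where j: "j < L" "a l (Suc j) \<noteq> 0" by blast
    define \<beta> where "\<beta> k = (if k = j then (a l 0 - 1) / a l (Suc j) else 0)" for k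
    have "(\<Sum>k<L. \<beta> k * a l (Suc k)) = (\<Sum>k<L. if k = j then a l 0 - 1 else 0)"
      by (intro sum.cong refl) (use j(2) in \<open>auto simp: \<beta>_def\<close>)
    hence "q l \<beta> = 1" using j(1) by (simp add: q_def)
    thus ?thesis by (intro exI[of _ \<beta>]) simp
  next
    case False
    have "a l 0 \<noteq> 0" using a(1)[OF l] False by (metis Suc_less_eq not0_implies_Suc)
    thus ?thesis by (intro exI[of _ "\<lambda>_. 0"]) (simp add: q_def)
  qed
  ultimately have "\<exists>\<beta>. \<forall>o'\<in>insert None (Some ` LL). (case o' of None \<Rightarrow> g | Some l \<Rightarrow> q l) \<beta> \<noteq> 0"
    using fin by (intro poly_fn_common_nonzero) (auto simp: LL_def)
  then obtain \<beta> where \<beta>: "g \<beta> \<noteq> 0" "\<And>l. l \<in> LL \<Longrightarrow> q l \<beta> \<noteq> 0" by force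
  have "z j = 0" if z: "(\<lambda>i. \<Sum>j<L. z j * (v (Suc j) i + \<beta> j * v 0 i)) \<in> X" and j: "j < L" for z j
  proof (rule ccontr)
    assume nz: "z j \<noteq> 0"
    define c where "c k = (if k = 0 then (\<Sum>j<L. z j * \<beta> j) else z (k - 1))" for k
    define x where "x = (\<lambda>i. \<Sum>j<Suc L. c j * v j i)"
    have "x = (\<lambda>i. \<Sum>j<L. z j * (v (Suc j) i + \<beta> j * v 0 i))"
      unfolding x_def sum.lessThan_Suc_shift by (rule ext) (simp add: c_def distrib_left sum.distrib sum_distrib_right mult.assoc)
    hence xX: "x \<in> X" using z by simp
    have xW: "x \<in> ?W" unfolding x_def by (rule lincomb_span)
    have x0: "x \<noteq> 0"
    proof
      assume "x = 0"
      hence "(\<Sum>j<Suc L. c j * v j i) = 0" for i unfolding x_def by (simp add: fun_eq_iff)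
      from fam_indepD[OF indep this, of "Suc j"] j nz show False by (simp add: c_def)
    qed
    have l: "cvec.span {x} \<in> LL" unfolding LL_def
      by (rule projective_pointI[OF x0]) (use cone[OF xX] cvec.span_scale[OF xW] in auto)
    then obtain t where t: "(\<lambda>i. \<Sum>j<Suc L. a (cvec.span {x}) j * v j i) = cscale t x"
      using a(2)[OF l] unfolding span_single by blast
    have at: "a (cvec.span {x}) k = t * c k" if "k < Suc L" for k
    proof -
      have "(\<Sum>j<Suc L. (a (cvec.span {x}) j - t * c j) * v j i) = 0" for i
        using fun_cong[OF t, of i] unfolding left_diff_distrib sum_subtractf
        by (simp add: x_def cscale_def sum_distrib_left mult.assoc distrib_left)
      from fam_indepD[OF indep this that] show ?thesis by simp
    qed
    have "q (cvec.span {x}) \<beta> = t * c 0 - (\<Sum>j<L. \<beta> j * (t * c (Suc j)))"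
      unfolding q_def by (intro arg_cong2[where f = "(-)"] sum.cong refl) (use at in auto)
    also have "\<dots> = 0" by (simp add: c_def sum_distrib_left algebra_simps)
    finally show False using \<beta>(2)[OF l] by simp
  qed
  thus ?thesis using \<beta>(1) unfolding g_def by blast
qed

text \<open>The fibre directions form a linear space of dimension \<open>L\<close> that meets X only
  in 0. The fibre over a base point other than 0 lies in a subspace of dimension
  \<open>L + 1\<close>, in which its points on X span distinct lines through 0; if the subspace is
  generic, there are at most \<open>D\<close> such lines.\<close>

lemma hci_degree_bound:
  assumes hci: "homogeneous_complete_intersection n L P X" and deg: "projective_degree n L X D"
    and P: "\<And>j. j < L \<Longrightarrow> hom_form n (dd j) (\<lambda>x. peval x (P j))" and dd: "\<And>j. j < L \<Longrightarrow> 0 < dd j" and j0: "j0 < L"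
  shows "dd j0 \<le> D"
proof -
  have Xiff: "x \<in> X \<longleftrightarrow> x \<in> coord_space n \<and> (\<forall>j<L. peval x (P j) = 0)" for x
    using hci_zero_set[OF hci] by (auto simp: zero_set_def)
  have cone: "cscale c x \<in> X" if "x \<in> X" for x c
    using that hom_form_scale[OF P, of _ c x] by (auto simp: Xiff cscale_def coord_space_def)
  obtain G where G: "G \<in> cpolys ({..<L + 1} \<times> {..<n})" "G \<noteq> 0"
    and gen: "\<And>v. (\<forall>j<L+1. v j \<in> coord_space n) \<Longrightarrow> peval (\<lambda>(j, i). v j i) G \<noteq> 0 \<Longrightarrow>
      cvec.dim (cvec.span (v ` {..<L+1})) = L + 1 \<and> finite (projective_points (X \<inter> cvec.span (v ` {..<L+1}))) \<and>
      card (projective_points (X \<inter> cvec.span (v ` {..<L+1}))) = D"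
    using deg unfolding projective_degree_def generic_subspace_def by blast
  obtain x0 where x0: "peval x0 G \<noteq> 0" using peval_nonzero[OF G(2)] by blast
  define v where "v j i = (if i < n then x0 (j, i) else 0)" for j i
  have vc: "v j \<in> coord_space n" for j by (simp add: v_def coord_space_def)
  have "peval (\<lambda>(j, i). v j i) G = peval x0 G" by (rule peval_cong[OF G(1)]) (auto simp: v_def)
  hence vG: "peval (\<lambda>(j, i). v j i) G \<noteq> 0" using x0 by simp
  have indep: "fam_indep (Suc L) v" using gen[OF _ vG] vc by (intro fam_indep_dim) simp
  have fin: "finite (projective_points (X \<inter> cvec.span (v ` {..<Suc L})))" using gen[OF _ vG] vc by simp
  obtain \<beta> where \<beta>: "peval (\<lambda>(j, i). if j = 0 then v 0 i else v j i + \<beta> (j - 1) * v 0 i) G \<noteq> 0"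
    "\<And>z j. (\<lambda>i. \<Sum>j<L. z j * (v (Suc j) i + \<beta> j * v 0 i)) \<in> X \<Longrightarrow> j < L \<Longrightarrow> z j = 0"
    using shift_subspace[OF indep G(1) vG cone fin] by blast
  \<comment> \<open>The first \<open>L\<close> vectors become the fibre directions;
    \<open>v 0\<close> completes them to the subspace from which they were obtained and becomes a
    base direction.\<close>
  define w where "w j = (if j < L then (\<lambda>i. v (Suc j) i + \<beta> j * v 0 i) else v 0)" for j
  have wc: "w j \<in> coord_space n" for j using vc by (auto simp: w_def coord_space_def)
  have windep: "fam_indep (Suc L) w" unfolding fam_indep_def
  proof (intro allI impI)
    fix a j assume a: "\<forall>i. (\<Sum>j<Suc L. a j * w j i) = 0" and j: "j < Suc L"
    define c where "c k = (if k = 0 then a L + (\<Sum>j<L. a j * \<beta> j) else a (k - 1))" for k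
    have "(\<Sum>j<Suc L. c j * v j i) = (\<Sum>j<Suc L. a j * w j i)" for i
      unfolding sum.lessThan_Suc_shift[of "\<lambda>j. c j * v j i"] sum.lessThan_Suc[of "\<lambda>j. a j * w j i"]
      by (simp add: c_def w_def distrib_left distrib_right sum.distrib sum_distrib_right mult.assoc)
    hence z: "(\<Sum>j<Suc L. c j * v j i) = 0" for i using a by simp
    have c: "c k = 0" if "k < Suc L" for k by (rule fam_indepD[OF indep z that])
    have aj: "a k = 0" if "k < L" for k using c[of "Suc k"] that by (simp add: c_def)
    have "a L = 0" using c[of 0] aj by (simp add: c_def)
    thus "a j = 0" using aj j less_Suc_eq by blast
  qed
  obtain b \<kappa> where bk: "Suc L \<le> n \<and> (\<forall>l<n. b l \<in> coord_space n) \<and> (\<forall>j<Suc L. b j = w j) \<and>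
    (\<forall>x\<in>coord_space n. \<forall>i. x i = (\<Sum>l<n. (\<Sum>i<n. x i * \<kappa> l i) * b l i)) \<and>
    (\<forall>y. \<forall>l<n. (\<Sum>i<n. (\<Sum>l<n. y l * b l i) * \<kappa> l i) = y l)"
    using basis_coordinates[OF wc windep] by blast
  have b\<kappa>: "(\<Sum>i<n. (\<Sum>l<n. y l * b l i) * \<kappa> l i) = y l" if "l < n" for y l using bk that by simp
  define m where "m = n - L"
  have m: "0 < m" "m + L = n" using bk by (auto simp: m_def)
  \<comment> \<open>The basis begins with the \<open>L\<close> fibre directions, whereas the cover
    expects them after the \<open>m\<close> base coordinates.\<close>
  define \<pi> where "\<pi> l = (if l < m then L + l else l - m)" for l
  define \<pi>' where "\<pi>' l = (if l < L then l + m else l - L)" for l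
  have \<pi>: "\<pi> l < n" "\<pi>' (\<pi> l) = l" if "l < n" for l using that m by (auto simp: \<pi>_def \<pi>'_def)
  have \<pi>': "\<pi>' l < n" "\<pi> (\<pi>' l) = l" if "l < n" for l using that m by (auto simp: \<pi>_def \<pi>'_def)
  have bij: "bij_betw \<pi>' {..<n} {..<n}"
    by (rule bij_betw_byWitness[of _ \<pi>]) (use \<pi> \<pi>' in auto)
  define \<Phi> where "\<Phi> x = (\<lambda>i. \<Sum>l<n. x l * b (\<pi> l) i)" for x
  define \<psi> where "\<psi> x = (\<lambda>l. \<Sum>i<n. x i * \<kappa> (\<pi> l) i)" for x
  have \<Phi>_alt: "\<Phi> x = (\<lambda>i. \<Sum>l<n. x (\<pi>' l) * b l i)" for x
  proof
    fix i
    have "(\<Sum>l<n. x (\<pi>' l) * b l i) = (\<Sum>l<n. x (\<pi>' l) * b (\<pi> (\<pi>' l)) i)" by (intro sum.cong refl) (simp add: \<pi>')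
    also have "\<dots> = \<Phi> x i" unfolding \<Phi>_def by (rule sum.reindex_bij_betw[OF bij])
    finally show "\<Phi> x i = (\<Sum>l<n. x (\<pi>' l) * b l i)" by simp
  qed
  have \<Phi>c: "\<Phi> x \<in> coord_space n" for x unfolding \<Phi>_alt by (rule coord_space_sum) (use bk in auto)
  have \<psi>\<Phi>: "\<psi> (\<Phi> x) l = x l" if "l < n" for x l
  proof -
    have "\<psi> (\<Phi> x) l = (\<Sum>i<n. (\<Sum>l<n. x (\<pi>' l) * b l i) * \<kappa> (\<pi> l) i)" unfolding \<psi>_def \<Phi>_alt ..
    also have "\<dots> = x (\<pi>' (\<pi> l))" by (rule b\<kappa>[OF \<pi>(1)[OF that]])
    finally show ?thesis using \<pi>(2)[OF that] by simp
  qed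
  have \<Phi>\<psi>: "\<Phi> (\<psi> x) = x" if "x \<in> coord_space n" for x
  proof
    fix i
    have "\<Phi> (\<psi> x) i = (\<Sum>l<n. (\<Sum>i<n. x i * \<kappa> l i) * b l i)"
      unfolding \<Phi>_alt \<psi>_def by (intro sum.cong refl) (simp add: \<pi>')
    also have "\<dots> = x i" using bk that by metis
    finally show "\<Phi> (\<psi> x) i = x i" .
  qed
  have \<Phi>_split: "\<Phi> x = (\<lambda>i. (\<Sum>l<m. x l * b (\<pi> l) i) + (\<Sum>j<L. x (m + j) * w j i))" for x
  proof
    fix i
    have "(\<Sum>l<m + L. x l * b (\<pi> l) i) = (\<Sum>l<m. x l * b (\<pi> l) i) + (\<Sum>j<L. x (m + j) * b (\<pi> (m + j)) i)"
      by (rule sum_lessThan_add)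
    also have "(\<Sum>j<L. x (m + j) * b (\<pi> (m + j)) i) = (\<Sum>j<L. x (m + j) * w j i)"
      by (intro sum.cong refl) (use bk in \<open>auto simp: \<pi>_def\<close>)
    finally show "\<Phi> x i = (\<Sum>l<m. x l * b (\<pi> l) i) + (\<Sum>j<L. x (m + j) * w j i)" unfolding \<Phi>_def m(2) .
  qed
  have poly_fn\<Phi>: "poly_fn n (\<lambda>x. F (\<Phi> x))" if "poly_fn n F" for F
    using poly_fn_linear_comp[OF that, of "\<lambda>i l. b (\<pi> l) i"] by (simp add: \<Phi>_def)
  have poly_fn\<psi>: "poly_fn n (\<lambda>x. F (\<psi> x))" if "poly_fn n F" for F
    using poly_fn_linear_comp[OF that, of "\<lambda>l i. \<kappa> (\<pi> l) i"] by (simp add: \<psi>_def)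
  have F\<psi>\<Phi>: "F (\<psi> (\<Phi> x)) = F x" if "poly_fn n F" for F x
    using that \<psi>\<Phi> unfolding poly_fn_def by (auto intro: deg_le_cong)
  define X' where "X' = {x. \<forall>j<L. peval (\<Phi> x) (P j) = 0}"
  have X': "x \<in> X' \<longleftrightarrow> \<Phi> x \<in> X" for x using \<Phi>c by (simp add: X'_def Xiff)
  have \<psi>X: "\<psi> x \<in> X'" if "x \<in> X" for x using that \<Phi>\<psi>[of x] by (simp add: X' Xiff)
  have fc: "finite_cover m L dd (\<lambda>j x. peval (\<Phi> x) (P j))"
  proof (unfold_locales, unfold m(2) X'_def[symmetric])
    fix j assume j: "j < L"
    show "hom_form n (dd j) (\<lambda>x. peval (\<Phi> x) (P j))"
      unfolding \<Phi>_def by (rule hom_form_comp1[OF P[OF j]]) (intro hom_form_sum hom_form_cmult2 hom_form_coord, simp)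
    show "0 < dd j" by (rule dd[OF j])
  next
    fix z :: cvec and i
    assume z: "\<forall>j<L. peval (\<Phi> (\<lambda>i. if i < m then 0 else z (i - m))) (P j) = 0" and i: "i < L"
    hence "\<Phi> (\<lambda>i. if i < m then 0 else z (i - m)) \<in> X" by (simp add: Xiff \<Phi>c)
    moreover have "\<Phi> (\<lambda>i. if i < m then 0 else z (i - m)) = (\<lambda>i. \<Sum>j<L. z j * (v (Suc j) i + \<beta> j * v 0 i))"
      unfolding \<Phi>_split by (rule ext) (simp add: w_def)
    ultimately show "z i = 0" using \<beta>(2)[OF _ i, of z] by simp
  next
    fix F H assume FH: "poly_fn n F" "poly_fn n H" "\<forall>x\<in>X'. F x * H x = 0"
    have "(\<forall>x\<in>X. F (\<psi> x) = 0) \<or> (\<forall>x\<in>X. H (\<psi> x) = 0)"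
      by (rule hci_prime[OF hci poly_fn\<psi>[OF FH(1)] poly_fn\<psi>[OF FH(2)]]) (use FH(3) \<psi>X in blast)
    thus "(\<forall>x\<in>X'. F x = 0) \<or> (\<forall>x\<in>X'. H x = 0)"
      using X' F\<psi>\<Phi>[OF FH(1)] F\<psi>\<Phi>[OF FH(2)] by metis
  qed
  interpret fc: finite_cover m L dd "\<lambda>j x. peval (\<Phi> x) (P j)" X'
    by (rule fc) (simp add: X'_def)
  \<comment> \<open>A spanning tuple for the linear hull of the fibre over \<open>y\<close>: a base
    vector, then the fibre directions.\<close>
  define V where "V y j = (if j = 0 then (\<lambda>i. \<Sum>l<m. y l * b (\<pi> l) i) else w (j - 1))" for y j
  define G' where "G' y = peval (\<lambda>(j, i). V y j i) G" for y
  have Vc: "V y j \<in> coord_space n" for y j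
    unfolding V_def using wc \<pi>(1) bk m(2) by (auto intro!: coord_space_sum)
  have "poly_fn m G'" unfolding G'_def
  proof (rule poly_fn_peval[OF G(1)])
    fix ji :: "nat \<times> nat" assume "ji \<in> {..<L + 1} \<times> {..<n}"
    show "poly_fn m (\<lambda>y. case ji of (j, i) \<Rightarrow> V y j i)"
      unfolding V_def by (cases ji; cases "fst ji = 0") (auto intro!: poly_fn_const poly_fn_sum poly_fn_mult poly_fn_coord)
  qed
  \<comment> \<open>At the first unit vector the tuple is the modified generic tuple obtained from
    \<open>shift_subspace\<close>, so \<open>G'\<close> is not identically 0.\<close>
  moreover have "G' (\<lambda>l. if l = 0 then 1 else 0) \<noteq> 0"
  proof -
    have "V (\<lambda>l. if l = 0 then 1 else 0) j i = (if j = 0 then v 0 i else v j i + \<beta> (j - 1) * v 0 i)" if "j < L + 1" for i j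
    proof (cases "j = 0")
      case True
      have "(\<Sum>l<m. (if l = 0 then 1 else 0) * b (\<pi> l) i) = (\<Sum>l<m. if l = 0 then b (\<pi> 0) i else 0)"
        by (intro sum.cong refl) auto
      also have "\<dots> = v 0 i" using m(1) bk by (simp add: \<pi>_def w_def)
      finally show ?thesis using True by (simp add: V_def)
    next
      case False
      thus ?thesis using that by (auto simp: V_def w_def)
    qed
    hence "G' (\<lambda>l. if l = 0 then 1 else 0) = peval (\<lambda>(j, i). if j = 0 then v 0 i else v j i + \<beta> (j - 1) * v 0 i) G"
      unfolding G'_def by (intro peval_cong[OF G(1)]) auto
    thus ?thesis using \<beta>(1) by simp
  qed
  moreover have "finite ((\<lambda>x. x (m + i)) ` {x\<in>X'. \<forall>b<m. x b = y b}) \<and> card ((\<lambda>x. x (m + i)) ` {x\<in>X'. \<forall>b<m. x b = y b}) \<le> D"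
    if y: "G' y \<noteq> 0" and i: "i < L" for y i
  proof -
    let ?W = "cvec.span (V y ` {..<L + 1})"
    have g: "cvec.dim ?W = L + 1" "finite (projective_points (X \<inter> ?W))" "card (projective_points (X \<inter> ?W)) = D"
      using gen[of "V y"] Vc y unfolding G'_def by auto
    have Vind: "fam_indep (L + 1) (V y)" by (rule fam_indep_dim[OF g(1)])
    have "\<exists>l<m. y l \<noteq> 0"
    proof (rule ccontr)
      assume "\<not> ?thesis"
      hence "V y 0 k = 0" for k by (auto simp: V_def intro!: sum.neutral)
      hence "(\<Sum>j<L + 1. (if j = 0 then 1 else 0) * V y j k) = 0" for k by (intro sum.neutral) auto
      from fam_indepD[OF Vind this, of 0] show False by simp
    qed
    then obtain l0 where l0: "l0 < m" "y l0 \<noteq> 0" by blast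
    \<comment> \<open>As \<open>y\<close> is not 0, a line through 0 contains at most one point of
      the form \<open>\<Phi> x\<close> with \<open>x\<close> over \<open>y\<close>; \<open>h\<close>
      reads off its fibre coordinate, and takes an arbitrary value on lines without such a
      point.\<close>
    define h where "h l = \<psi> (SOME p. p \<in> l \<and> (\<forall>k<m. \<psi> p k = y k)) (m + i)" for l
    have sub: "(\<lambda>x. x (m + i)) ` {x\<in>X'. \<forall>b<m. x b = y b} \<subseteq> h ` projective_points (X \<inter> ?W)"
    proof
      fix s assume "s \<in> (\<lambda>x. x (m + i)) ` {x\<in>X'. \<forall>b<m. x b = y b}"
      then obtain x where x: "x \<in> X'" "\<And>k. k < m \<Longrightarrow> x k = y k" "s = x (m + i)" by blast
      have "\<Phi> x = (\<lambda>i. \<Sum>j<Suc L. (if j = 0 then 1 else x (m + (j - 1))) * V y j i)"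
        unfolding \<Phi>_split sum.lessThan_Suc_shift by (rule ext) (simp add: V_def x(2))
      hence xW: "\<Phi> x \<in> ?W" using lincomb_span[of "\<lambda>j. if j = 0 then 1 else x (m + (j - 1))" "V y" "Suc L"] by simp
      have xX: "\<Phi> x \<in> X" using x(1) X' by simp
      have \<psi>x: "\<psi> (\<Phi> x) k = y k" if "k < m" for k using \<psi>\<Phi>[of k x] x(2)[OF that] that m(2) by simp
      have nz: "\<Phi> x \<noteq> 0"
      proof
        assume "\<Phi> x = 0"
        hence "\<psi> (\<Phi> x) l0 = 0" by (simp add: \<psi>_def)
        thus False using \<psi>x[OF l0(1)] l0(2) by simp
      qed
      have l: "cvec.span {\<Phi> x} \<in> projective_points (X \<inter> ?W)"
        by (rule projective_pointI[OF nz]) (use cone[OF xX] cvec.span_scale[OF xW] in auto)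
      have "\<exists>p. p \<in> cvec.span {\<Phi> x} \<and> (\<forall>k<m. \<psi> p k = y k)"
        by (rule exI[of _ "\<Phi> x"]) (use \<psi>x in \<open>auto intro: cvec.span_base\<close>)
      note some = someI_ex[OF this]
      define p where "p = (SOME p. p \<in> cvec.span {\<Phi> x} \<and> (\<forall>k<m. \<psi> p k = y k))"
      have p: "p \<in> cvec.span {\<Phi> x}" "\<forall>k<m. \<psi> p k = y k" using some unfolding p_def by auto
      obtain c where c: "p = cscale c (\<Phi> x)" using p(1) unfolding span_single by blast
      have sc: "\<psi> (cscale c (\<Phi> x)) k = c * \<psi> (\<Phi> x) k" for k by (simp add: \<psi>_def cscale_def sum_distrib_left mult.assoc)
      have "c * y l0 = y l0" using p(2) c l0(1) sc[of l0] \<psi>x[OF l0(1)] by simp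
      hence "c = 1" using l0(2) by simp
      hence "h (cvec.span {\<Phi> x}) = \<psi> (\<Phi> x) (m + i)" unfolding h_def p_def[symmetric] c sc by simp
      also have "\<dots> = s" using \<psi>\<Phi>[of "m + i" x] i m(2) x(3) by simp
      finally show "s \<in> h ` projective_points (X \<inter> ?W)" using l by blast
    qed
    from surj_card_le[OF g(2) sub] finite_subset[OF sub finite_imageI[OF g(2)]] g(3) show ?thesis by simp
  qed
  moreover have "\<exists>Q. (\<forall>j<L. poly_fn (m + L) (Q j)) \<and> (\<forall>x. F x = (\<Sum>j<L. Q j x * peval (\<Phi> x) (P j)))"
    if F: "poly_fn (m + L) F" "\<forall>x\<in>X'. F x = 0" for F
  proof -
    have Fn: "poly_fn n F" using F(1) m(2) by simp
    obtain Q where Q: "\<forall>j<L. poly_fn n (Q j)" "\<forall>x. F (\<psi> x) = (\<Sum>j<L. Q j x * peval x (P j))"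
      using hci_radical[OF hci poly_fn\<psi>[OF Fn]] F(2) \<psi>X by blast
    show ?thesis
    proof (intro exI conjI allI impI)
      show "poly_fn (m + L) (\<lambda>x. Q j (\<Phi> x))" if "j < L" for j using poly_fn\<Phi> Q(1) that m(2) by simp
      show "F x = (\<Sum>j<L. Q j (\<Phi> x) * peval (\<Phi> x) (P j))" for x
        using Q(2)[rule_format, of "\<Phi> x"] F\<psi>\<Phi>[OF Fn, of x] by simp
    qed
  qed
  ultimately show ?thesis by (intro fc.degree_bound[OF _ _ _ _ j0])
qed

theorem theorem1p5:
  fixes d L :: nat
  assumes "d \<ge> 1" and "L \<ge> 1"
  shows "\<exists>r::nat. \<forall>(n::nat) (X :: (nat \<Rightarrow> complex) set) (P :: nat \<Rightarrow> nat cpoly).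
           homogeneous_complete_intersection n L P X \<and>
           projective_degree n L X d \<and>
           family_has_rank L P \<and> family_rank n L P > enat r
           \<longrightarrow> admissible n X"
proof -
  \<comment> \<open>The degree of X serves as the bound for the degrees of the equations, which is
    what lets the rank bound depend on \<open>d\<close> and \<open>L\<close> alone.\<close>
  obtain r where r: "admissible_rank L d r" using high_rank_admissible[of L d] assms(2) by auto
  have "admissible n X" if hci: "homogeneous_complete_intersection n L P X" and deg: "projective_degree n L X d"
    and rank: "family_has_rank L P" "family_rank n L P > enat r" for n X P
  proof -
    have P: "P j \<in> cpolys {..<n}" "homogeneous (P j)" if "j < L" for j
      using hci that unfolding homogeneous_complete_intersection_def by blast+
    have mdeg: "mon_deg m = total_deg (P j)" if j: "j < L" and m: "m \<in> Poly_Mapping.keys (P j)" for j m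
    proof -
      obtain e where e: "\<forall>m\<in>Poly_Mapping.keys (P j). mon_deg m = e" using P(2)[OF j] unfolding homogeneous_def by blast
      have "total_deg (P j) = e" by (rule total_deg_homogeneous[OF family_member_degree(1)[OF rank(1) j]]) (use e in blast)
      thus ?thesis using e m by blast
    qed
    have hfP: "hom_form n (total_deg (P j)) (\<lambda>x. peval x (P j))" if "j < L" for j
      by (rule cpolys_hom_form[OF P(1)[OF that] mdeg[OF that]])
    have deg2: "2 \<le> total_deg (P j)" if "j < L" for j by (rule family_member_degree(2)[OF rank(1) that])
    have "total_deg (P j) \<le> d" if "j < L" for j
      by (rule hci_degree_bound[OF hci deg hfP less_le_trans[OF _ deg2] that]) simp_all
    moreover have "high_rank n {..<L} (\<lambda>j. total_deg (P j)) (\<lambda>j x. peval x (P j)) r"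
      by (rule family_rank_high_rank[OF P(1) mdeg rank])
    moreover have "\<forall>j<L. hom_form n (total_deg (P j)) (\<lambda>x. peval x (P j)) \<and> 2 \<le> total_deg (P j) \<and> total_deg (P j) \<le> d"
      using hfP deg2 calculation(1) by simp
    ultimately have "admissible n (zero_set n L (\<lambda>j x. peval x (P j)))"
      by (rule_tac r[unfolded admissible_rank_def, THEN spec, THEN spec, THEN spec, THEN mp, THEN mp])
    thus ?thesis using hci_zero_set[OF hci] by simp
  qed
  thus ?thesis by blast
qed

end
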